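(* Let $D=\{(x_1,x_2):x_2>0\}$ and $U=B_1(0)\subset\mathbb R^2$. Let $u\in W^{1,2}(D\cap U,\mathcal A_Q(\mathbb R^n))$ be Dir-minimizing with $u|_{\partial D\cap U}=Q[\![0]\!]$, and assume $u$ is $I$-homogeneous for some $I>0$, i.e. $u(\lambda x)=\sum_i[\![\lambda^Iu_i(x)]\!]$ whenever $u(x)=\sum_i[\![u_i(x)]\!]$ and $\lambda>0$ with $x,\lambda x\in D\cap U$. Then either $u=Q[\![\boldsymbol\eta\circ u]\!]$ (i.e. $u$ is $Q$ copies of a single classical harmonic function) or $I=1$.
   Context: $\mathcal A_Q(\mathbb R^n)$ is Almgren's space of $Q$-tuples of points of $\mathbb R^n$ (unordered, with multiplicity), $\mathcal A_Q(\mathbb R^n)=\{\sum_{i=1}^Q[\![P_i]\!]\}$, with the metric $\mathcal G$; $W^{1,2}$ and $|Du|$ are in Almgren's sense. $\boldsymbol\eta(\sum_i[\![P_i]\!])=\frac1Q\sum_iP_i$. $u$ is Dir-minimizing if for every compact $K\subset U$ and every $v\in W^{1,2}(D\cap U,\mathcal A_Q(\mathbb R^n))$ with $v=u$ on $(U\setminus K)\cap D$ and $v|_{\partial D\cap U}=Q[\![0]\!]$ one has $\int_{D\cap U}|Du|^2\le\int_{D\cap U}|Dv|^2$. *)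

theory Defs
  imports "HOL-Analysis.Analysis" "HOL-Library.Multiset"
begin

definition AQ :: "nat \<Rightarrow> (real^'n) multiset set" where
  "AQ Q = {T. size T = Q}"

definition Gdist :: "(real^'n) multiset \<Rightarrow> (real^'n) multiset \<Rightarrow> real" where
  "Gdist T S = Min {sqrt (\<Sum>i<size T. (norm (xs ! i - ys ! i))\<^sup>2) | xs ys.
                      mset xs = T \<and> mset ys = S}"

definition AQ_eta :: "nat \<Rightarrow> (real^'n) multiset \<Rightarrow> real^'n" where
  "AQ_eta Q T = (1 / real Q) *\<^sub>R sum_mset T"

definition D_half :: "(real^2) set" where
  "D_half = {x. x $ 2 > 0}"

definition U_disk :: "(real^2) set" where
  "U_disk = ball 0 1"

definition Omega :: "(real^2) set" where
  "Omega = D_half \<inter> U_disk"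

definition C1c :: "(real^2) set \<Rightarrow> (real^2 \<Rightarrow> real) set" where
  "C1c S = {\<phi>. (\<forall>x. \<phi> differentiable (at x))
               \<and> (\<forall>v. continuous_on UNIV (\<lambda>x. frechet_derivative \<phi> (at x) v))
               \<and> compact (closure {x. \<phi> x \<noteq> 0}) \<and> closure {x. \<phi> x \<noteq> 0} \<subseteq> S}"

definition pd :: "2 \<Rightarrow> (real^2 \<Rightarrow> real) \<Rightarrow> real^2 \<Rightarrow> real" where
  "pd j \<phi> x = frechet_derivative \<phi> (at x) (axis j 1)"

definition L2 :: "(real^2) set \<Rightarrow> (real^2 \<Rightarrow> real) \<Rightarrow> bool" where
  "L2 S f \<longleftrightarrow> f \<in> borel_measurable (lebesgue_on S)
              \<and> integrable (lebesgue_on S) (\<lambda>x. (f x)\<^sup>2)"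

definition weak_deriv :: "(real^2) set \<Rightarrow> 2 \<Rightarrow> (real^2 \<Rightarrow> real) \<Rightarrow> (real^2 \<Rightarrow> real) \<Rightarrow> bool" where
  "weak_deriv S j f g \<longleftrightarrow>
     (\<forall>\<phi>\<in>C1c S. set_integrable lebesgue S (\<lambda>x. f x * pd j \<phi> x)
              \<and> set_integrable lebesgue S (\<lambda>x. g x * \<phi> x)
              \<and> set_lebesgue_integral lebesgue S (\<lambda>x. f x * pd j \<phi> x)
                  = - set_lebesgue_integral lebesgue S (\<lambda>x. g x * \<phi> x))"

definition W12 :: "(real^2) set \<Rightarrow> (real^2 \<Rightarrow> real) \<Rightarrow> bool" where
  "W12 S f \<longleftrightarrow> L2 S f \<and> (\<forall>j. \<exists>g. L2 S g \<and> weak_deriv S j f g)"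

definition AQ_adm :: "nat \<Rightarrow> (real^2) set \<Rightarrow> (real^2 \<Rightarrow> (real^'n) multiset) \<Rightarrow> 2
                      \<Rightarrow> (real^2 \<Rightarrow> real) \<Rightarrow> bool" where
  "AQ_adm Q S u j \<psi> \<longleftrightarrow> L2 S \<psi> \<and>
     (\<forall>T\<in>AQ Q. \<exists>g. weak_deriv S j (\<lambda>x. Gdist (u x) T) g
                    \<and> (AE x in lebesgue_on S. \<bar>g x\<bar> \<le> \<psi> x))"

definition AQ_W12 :: "nat \<Rightarrow> (real^2) set \<Rightarrow> (real^2 \<Rightarrow> (real^'n) multiset) \<Rightarrow> bool" where
  "AQ_W12 Q S u \<longleftrightarrow> (\<forall>x\<in>S. u x \<in> AQ Q)
      \<and> (\<forall>T\<in>AQ Q. W12 S (\<lambda>x. Gdist (u x) T))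
      \<and> (\<forall>j. \<exists>\<psi>. AQ_adm Q S u j \<psi>)"

text \<open>Dirichlet energy: sum over j of the integral of |D_j u|^2, where |D_j u| is the
  minimal admissible bound; equivalently the infimum of the integrals of psi^2.\<close>
definition Dir :: "nat \<Rightarrow> (real^2) set \<Rightarrow> (real^2 \<Rightarrow> (real^'n) multiset) \<Rightarrow> real" where
  "Dir Q S u = (\<Sum>j\<in>UNIV. Inf {set_lebesgue_integral lebesgue S (\<lambda>x. (\<psi> x)\<^sup>2) | \<psi>. AQ_adm Q S u j \<psi>})"

section \<open>Traces on the flat boundary part {x_2 = 0} \<inter> U (Gauss-Green characterisation)\<close>

definition flat_trace :: "(real^2 \<Rightarrow> real) \<Rightarrow> (real^2 \<Rightarrow> real) \<Rightarrow> bool" where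
  "flat_trace f h \<longleftrightarrow> (\<exists>g. weak_deriv Omega 2 f g \<and>
     (\<forall>\<phi>\<in>C1c U_disk.
        set_lebesgue_integral lebesgue Omega (\<lambda>x. f x * pd 2 \<phi> x)
        + set_lebesgue_integral lebesgue Omega (\<lambda>x. g x * \<phi> x)
        = - set_lebesgue_integral lborel {-1<..<1::real}
              (\<lambda>t. h (vector [t, 0]) * \<phi> (vector [t, 0]))))"

definition AQ_trace_zero :: "nat \<Rightarrow> (real^2 \<Rightarrow> (real^'n) multiset) \<Rightarrow> bool" where
  "AQ_trace_zero Q u \<longleftrightarrow>
     (\<forall>T\<in>AQ Q. flat_trace (\<lambda>x. Gdist (u x) T) (\<lambda>x. Gdist (replicate_mset Q 0) T))"

definition Dir_minimizing :: "nat \<Rightarrow> (real^2 \<Rightarrow> (real^'n) multiset) \<Rightarrow> bool" where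
  "Dir_minimizing Q u \<longleftrightarrow> AQ_W12 Q Omega u \<and>
     (\<forall>K v. compact K \<and> K \<subseteq> U_disk \<and> AQ_W12 Q Omega v
            \<and> (AE x in lebesgue_on Omega. x \<notin> K \<longrightarrow> v x = u x)
            \<and> AQ_trace_zero Q v
        \<longrightarrow> Dir Q Omega u \<le> Dir Q Omega v)"

definition homogeneous :: "real \<Rightarrow> (real^2 \<Rightarrow> (real^'n) multiset) \<Rightarrow> bool" where
  "homogeneous I u \<longleftrightarrow> (\<forall>x l. l > 0 \<and> x \<in> Omega \<and> l *\<^sub>R x \<in> Omega \<longrightarrow>
      u (l *\<^sub>R x) = image_mset (\<lambda>P. (l powr I) *\<^sub>R P) (u x))"

end

theory Submission
  imports Defs "HOL-Combinatorics.Permutations"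
begin

text \<open>
  Write \<open>u = y\<^sup>I h(x/y)\<close> in the half disk. The slope profile \<open>h\<close> is a continuous curve of \<open>Q\<close>-points, so it splits
  into \<open>Q\<close> continuous sheets. Moving one component of one sheet by a test function does not change the
  Dirichlet energy beyond what the sheets see, hence minimality gives the weak Laplace equation for every
  sheet of every continuous splitting. By homogeneity this is an ordinary differential equation in the
  slope, and each sheet is \<open>r\<^sup>I (a cos (I \<theta>) + b sin (I \<theta>))\<close>. The zero trace forces \<open>a = 0\<close> and
  \<open>b sin (I \<pi>) = 0\<close>. If two sheets differ, then \<open>I\<close> is an integer; if moreover \<open>I \<ge> 2\<close>, then the two sheets
  meet on the ray \<open>\<theta> = \<pi> / I\<close>, and exchanging them on one side of that ray yields another continuous
  splitting, whose sheets are not of the required form.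
\<close>

section \<open>Cutoff functions\<close>

text \<open>The Sobolev class is given only through weak derivatives of the scalar functions
  \<open>Gdist (u x) T\<close>, and \<open>Dir\<close> is an infimum over admissible bounds. Both
  become usable on lines: with countably many \<open>T\<close> dense in \<open>AQ Q\<close>, a bound
  \<psi> controls the \<open>Gdist\<close>-increments of \<open>u\<close> along almost every line of
  its direction. A continuous splitting inherits this control in labelled distance, because both
  distances agree locally; hence the squares of its partial derivatives in that direction sum to at
  most \<psi>^2. The variation compares a lower bound for \<open>Dir\<close> at \<open>u\<close>
  with an upper bound at the competitor, two values of one quadratic polynomial in \<tau>. A
  continuous splitting exists since homogeneity leaves one variable, the slope; over a planar domain
  it can fail around branch points. Continuity is all that is asked of a splitting, which is why an
  exchange of sheets is covered again. The exchange ray \<theta> = \<pi> / I lies inside the half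
  plane exactly when I > 1; for I = 1 it is a boundary ray.\<close>

lemma max0_power_has_real_derivative:
  "((\<lambda>x::real. (max 0 x) ^ Suc (Suc n)) has_real_derivative real (Suc (Suc n)) * (max 0 x) ^ Suc n) (at x)"
proof -
  consider "x < 0" | "x = 0" | "x > 0" by linarith
  then show ?thesis
  proof cases
    case 1
    have "((\<lambda>x::real. 0) has_real_derivative 0) (at x)" by simp
    then have "((\<lambda>x::real. (max 0 x) ^ Suc (Suc n)) has_real_derivative 0) (at x)"
      by (rule has_field_derivative_transform_within_open[where S="{..<0}"]) (use 1 in auto)
    then show ?thesis using 1 by simp
  next
    case 2
    have lim: "((\<lambda>h::real. \<bar>h\<bar> ^ Suc n) \<longlongrightarrow> 0) (at 0)"
      by (rule tendsto_eq_intros refl | simp)+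
    have "((\<lambda>h::real. ((max 0 (0 + h)) ^ Suc (Suc n) - (max 0 0) ^ Suc (Suc n)) / h) \<longlongrightarrow> 0) (at 0)"
    proof (rule Lim_null_comparison[OF _ lim])
      show "\<forall>\<^sub>F h::real in at 0. norm (((max 0 (0 + h)) ^ Suc (Suc n) - (max 0 0) ^ Suc (Suc n)) / h) \<le> \<bar>h\<bar> ^ Suc n"
        by (rule always_eventually) (auto simp: max_def abs_mult power_abs mult_nonpos_nonneg)
    qed
    then show ?thesis using 2 by (simp add: DERIV_def)
  next
    case 3
    have "((\<lambda>x::real. x ^ Suc (Suc n)) has_real_derivative real (Suc (Suc n)) * x ^ Suc n) (at x)"
      using DERIV_pow[of "Suc (Suc n)" x UNIV] by simp
    then have "((\<lambda>x::real. (max 0 x) ^ Suc (Suc n)) has_real_derivative real (Suc (Suc n)) * x ^ Suc n) (at x)"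
      by (rule has_field_derivative_transform_within_open[where S="{0<..}"]) (use 3 in auto)
    then show ?thesis using 3 by simp
  qed
qed

lemma max0_power2_has_real_derivative:
  "((\<lambda>x::real. (max 0 x)\<^sup>2) has_real_derivative 2 * max 0 x) (at x)"
  using max0_power_has_real_derivative[of 0 x] by (simp add: numeral_2_eq_2)

lemma max0_power3_has_real_derivative:
  "((\<lambda>x::real. (max 0 x) ^ 3) has_real_derivative 3 * (max 0 x)\<^sup>2) (at x)"
  using max0_power_has_real_derivative[of 1 x] by (simp add: numeral_3_eq_3 numeral_2_eq_2)

text \<open>A C^1 step from 0 to 1 on [0, 1], written as a second difference of truncated squares:
  the weights 1, -2, 1 cancel the terms in x^2 and x beyond 1. C^1 is the regularity that
  \<open>C1c\<close> asks of test functions. \<open>shat\<close> is the derivative, a hat of mass 1,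
  and \<open>sramp\<close> a primitive.\<close>

definition sstep :: "real \<Rightarrow> real" where
  "sstep x = 2 * ((max 0 x)\<^sup>2 - 2 * (max 0 (x - 1/2))\<^sup>2 + (max 0 (x - 1))\<^sup>2)"

definition shat :: "real \<Rightarrow> real" where
  "shat x = 4 * (max 0 x - 2 * max 0 (x - 1/2) + max 0 (x - 1))"

definition sramp :: "real \<Rightarrow> real" where
  "sramp x = 2 / 3 * ((max 0 x) ^ 3 - 2 * (max 0 (x - 1/2)) ^ 3 + (max 0 (x - 1)) ^ 3)"

lemma sstep_has_real_derivative: "(sstep has_real_derivative shat x) (at x)"
proof -
  have d: "((\<lambda>x. (max 0 (x - c))\<^sup>2) has_real_derivative 2 * max 0 (x - c)) (at x)" for c
    using DERIV_chain2[OF max0_power2_has_real_derivative, of "\<lambda>x. x - c" 1 x UNIV]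
    by (simp add: DERIV_diff[OF DERIV_ident DERIV_const, simplified])
  show ?thesis unfolding sstep_def[abs_def] shat_def
    by (rule DERIV_cong[OF DERIV_cmult[OF DERIV_add[OF DERIV_diff[OF max0_power2_has_real_derivative
          DERIV_cmult[OF d[of "1/2"], of 2]] d[of 1]]]]) simp
qed

lemma sramp_has_real_derivative: "(sramp has_real_derivative sstep x) (at x)"
proof -
  have d: "((\<lambda>x. (max 0 (x - c)) ^ 3) has_real_derivative 3 * (max 0 (x - c))\<^sup>2) (at x)" for c
    using DERIV_chain2[OF max0_power3_has_real_derivative, of "\<lambda>x. x - c" 1 x UNIV]
    by (simp add: DERIV_diff[OF DERIV_ident DERIV_const, simplified])
  show ?thesis unfolding sramp_def[abs_def] sstep_def
    by (rule DERIV_cong[OF DERIV_cmult[OF DERIV_add[OF DERIV_diff[OF max0_power3_has_real_derivative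
          DERIV_cmult[OF d[of "1/2"], of 2]] d[of 1]]]]) simp
qed

lemma sstep_le0: "x \<le> 0 \<Longrightarrow> sstep x = 0" by (simp add: sstep_def)
lemma sstep_ge1: "x \<ge> 1 \<Longrightarrow> sstep x = 1" by (simp add: sstep_def power2_eq_square algebra_simps)
lemma shat_le0: "x \<le> 0 \<Longrightarrow> shat x = 0" by (simp add: shat_def)
lemma shat_ge1: "x \<ge> 1 \<Longrightarrow> shat x = 0" by (simp add: shat_def)
lemma shat_nonneg: "shat x \<ge> 0" by (auto simp: shat_def max_def)
lemma sramp_le0: "x \<le> 0 \<Longrightarrow> sramp x = 0" by (simp add: sramp_def)
lemma sramp_ge1: "x \<ge> 1 \<Longrightarrow> sramp x = x - 1/2"
  by (simp add: sramp_def power3_eq_cube algebra_simps)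

lemma continuous_on_shat [continuous_intros]:
  "continuous_on S f \<Longrightarrow> continuous_on S (\<lambda>x. shat (f x))"
  unfolding shat_def by (intro continuous_intros)

lemma continuous_on_sstep [continuous_intros]:
  "continuous_on S f \<Longrightarrow> continuous_on S (\<lambda>x. sstep (f x))"
  unfolding sstep_def by (intro continuous_intros)

lemma continuous_on_sramp [continuous_intros]:
  "continuous_on S f \<Longrightarrow> continuous_on S (\<lambda>x. sramp (f x))"
  unfolding sramp_def by (intro continuous_intros)

lemma sstep_mono: "x \<le> y \<Longrightarrow> sstep x \<le> sstep y"
  by (rule DERIV_nonneg_imp_nondecreasing) (use sstep_has_real_derivative shat_nonneg in blast)+

lemma sstep_nonneg: "0 \<le> sstep x"
  using sstep_mono[of "min x 0" x] sstep_le0[of "min x 0"] by simp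

lemma sstep_le1: "sstep x \<le> 1"
  using sstep_mono[of x "max x 1"] sstep_ge1[of "max x 1"] by simp

lemma sramp_diff: assumes "x \<le> y" shows "0 \<le> sramp y - sramp x" "sramp y - sramp x \<le> y - x"
proof -
  show "0 \<le> sramp y - sramp x"
    using DERIV_nonneg_imp_nondecreasing[OF assms, of sramp] sramp_has_real_derivative sstep_nonneg by force
  have "y - sramp y \<ge> x - sramp x"
  proof (rule DERIV_nonneg_imp_nondecreasing[OF assms])
    fix t show "\<exists>z. ((\<lambda>t. t - sramp t) has_real_derivative z) (at t) \<and> 0 \<le> z"
      by (rule exI[of _ "1 - sstep t"])
        (auto intro!: derivative_eq_intros sramp_has_real_derivative simp: sstep_le1)
  qed
  then show "sramp y - sramp x \<le> y - x" by simp
qed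

lemma shat_le2: "shat x \<le> 2" by (auto simp: shat_def max_def)

lemma sstep_scale_tendsto:
  "(\<lambda>n. sstep (real (Suc n) * x)) \<longlonglongrightarrow> (if x > 0 then 1 else 0)"
proof (cases "x > 0")
  case True
  obtain N where N: "real N > 1 / x" using reals_Archimedean2 by blast
  have "\<forall>n\<ge>N. sstep (real (Suc n) * x) = 1"
  proof (intro allI impI sstep_ge1)
    fix n assume "N \<le> n"
    then have "1 / x < real (Suc n)" using N by linarith
    then show "1 \<le> real (Suc n) * x" using True by (simp add: field_simps)
  qed
  then show ?thesis using True by (auto intro!: tendsto_eventually eventually_sequentiallyI[of N])
next
  case False
  then have "sstep (real (Suc n) * x) = 0" for n
    by (intro sstep_le0) (simp add: mult_nonneg_nonpos)
  then show ?thesis using False by simp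
qed

lemma sramp_scale_tendsto:
  "(\<lambda>n. sramp (real (Suc n) * x) / real (Suc n)) \<longlonglongrightarrow> max 0 x"
proof (cases "x > 0")
  case True
  obtain N where N: "real N > 1 / x" using reals_Archimedean2 by blast
  have ev: "\<forall>\<^sub>F n in sequentially. x - (1/2) / real (Suc n) = sramp (real (Suc n) * x) / real (Suc n)"
  proof (rule eventually_sequentiallyI[of N])
    fix n assume "N \<le> n"
    then have "1 / x < real (Suc n)" using N by linarith
    then have "1 \<le> real (Suc n) * x" using True by (simp add: field_simps)
    then show "x - (1/2) / real (Suc n) = sramp (real (Suc n) * x) / real (Suc n)"
      by (subst sramp_ge1) (auto simp: field_simps simp del: of_nat_Suc)
  qed
  have "(\<lambda>n. x - (1/2) / real (Suc n)) \<longlonglongrightarrow> x - 0"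
    using LIMSEQ_Suc[OF lim_const_over_n[of "1/2::real"]] by (intro tendsto_diff tendsto_const)
  then show ?thesis using True Lim_transform_eventually[OF _ ev] by simp
next
  case False
  then have "sramp (real (Suc n) * x) = 0" for n
    by (intro sramp_le0) (simp add: mult_nonneg_nonpos)
  then show ?thesis using False by (simp add: max_def)
qed

text \<open>A trapezoid with flanks [a, a+d] and [b, b+d] whose corners are rounded at scale 1/m;
  \<open>trap'\<close> is its derivative. Sharpening the corners gives \<open>ramp\<close>, and
  \<open>box2\<close> for the derivative; shrinking d afterwards gives an indicator. Four numbers
  describe such a function, so a countable family can serve in the du Bois-Reymond lemma.\<close>

definition trap :: "real \<Rightarrow> real \<Rightarrow> real \<Rightarrow> real \<Rightarrow> real \<Rightarrow> real" where
  "trap m a b d x = (sramp (m * (x - a)) - sramp (m * (x - a - d))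
                      - sramp (m * (x - b)) + sramp (m * (x - b - d))) / (m * d)"

definition trap' :: "real \<Rightarrow> real \<Rightarrow> real \<Rightarrow> real \<Rightarrow> real \<Rightarrow> real" where
  "trap' m a b d x = (sstep (m * (x - a)) - sstep (m * (x - a - d))
                      - sstep (m * (x - b)) + sstep (m * (x - b - d))) / d"

lemma trap_has_real_derivative:
  assumes "m > 0" shows "(trap m a b d has_real_derivative trap' m a b d x) (at x)"
proof -
  have D: "((\<lambda>x. sramp (m * (x - c))) has_real_derivative sstep (m * (x - c)) * m) (at x)" for c
    by (rule DERIV_chain2[OF sramp_has_real_derivative]) (auto intro!: derivative_eq_intros)
  have "(trap m a b d has_real_derivative (sstep (m * (x - a)) * m - sstep (m * (x - (a + d))) * m
       - sstep (m * (x - b)) * m + sstep (m * (x - (b + d))) * m) / (m * d)) (at x)"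
    unfolding trap_def[abs_def] diff_diff_eq
    by (intro DERIV_cdivide DERIV_add DERIV_diff D)
  then show ?thesis
    by (rule DERIV_cong) (use assms in \<open>simp add: trap'_def divide_simps diff_diff_eq\<close>, simp add: algebra_simps)
qed

lemma continuous_on_trap: "continuous_on S (trap m a b d)" "continuous_on S (trap' m a b d)"
  unfolding trap_def[abs_def] trap'_def[abs_def] divide_inverse by (intro continuous_intros)+

lemma trap_outside:
  assumes "m > 0" "d > 0" "a \<le> b" "x \<le> a \<or> x \<ge> b + d + 1/m"
  shows "trap m a b d x = 0" "trap' m a b d x = 0"
proof -
  have "trap m a b d x = 0 \<and> trap' m a b d x = 0"
    using assms(4)
  proof
    assume "x \<le> a"
    then show ?thesis using assms unfolding trap_def trap'_def
      by (auto simp: sramp_le0 sstep_le0 mult_nonneg_nonpos)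
  next
    assume x: "x \<ge> b + d + 1/m"
    have *: "m * (x - c) \<ge> 1" if "c \<le> b + d" for c
      using mult_left_mono[of "1/m" "x - c" m] x that assms(1-3) by auto
    have 1: "m * (x - a) \<ge> 1" "m * (x - (a + d)) \<ge> 1" "m * (x - b) \<ge> 1" "m * (x - (b + d)) \<ge> 1"
      using assms(2,3) by (auto intro!: *)
    show ?thesis unfolding trap_def trap'_def diff_diff_eq
      by (simp only: sramp_ge1[OF 1(1)] sramp_ge1[OF 1(2)] sramp_ge1[OF 1(3)] sramp_ge1[OF 1(4)]
        sstep_ge1[OF 1(1)] sstep_ge1[OF 1(2)] sstep_ge1[OF 1(3)] sstep_ge1[OF 1(4)]) (simp add: algebra_simps)
  qed
  then show "trap m a b d x = 0" "trap' m a b d x = 0" by auto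
qed

lemma trap_abs_le1:
  assumes "m > 0" "d > 0" shows "\<bar>trap m a b d x\<bar> \<le> 1"
proof -
  have *: "0 \<le> (sramp (m * (x - c)) - sramp (m * (x - c - d))) / (m * d) \<and>
    (sramp (m * (x - c)) - sramp (m * (x - c - d))) / (m * d) \<le> 1" for c
  proof -
    have "m * (x - c - d) \<le> m * (x - c)" using assms by simp
    from sramp_diff[OF this] show ?thesis using assms by (simp add: divide_simps algebra_simps)
  qed
  have "trap m a b d x = (sramp (m * (x - a)) - sramp (m * (x - a - d))) / (m * d)
     - (sramp (m * (x - b)) - sramp (m * (x - b - d))) / (m * d)"
    unfolding trap_def by (simp add: diff_divide_distrib add_divide_distrib)
  then show ?thesis using *[of a] *[of b] by linarith
qed

lemma trap'_abs_le:
  assumes "d > 0" shows "\<bar>trap' m a b d x\<bar> \<le> 2 / d"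
proof -
  have "\<bar>sstep (m * (x - a)) - sstep (m * (x - a - d)) - sstep (m * (x - b)) + sstep (m * (x - b - d))\<bar> \<le> 2"
    using sstep_nonneg[of "m * (x - a)"] sstep_nonneg[of "m * (x - a - d)"] sstep_nonneg[of "m * (x - b)"]
      sstep_nonneg[of "m * (x - b - d)"] sstep_le1[of "m * (x - a)"] sstep_le1[of "m * (x - a - d)"]
      sstep_le1[of "m * (x - b)"] sstep_le1[of "m * (x - b - d)"] by linarith
  then show ?thesis using assms by (simp add: trap'_def divide_right_mono)
qed

lemma trap'_tendsto:
  "(\<lambda>n. trap' (real (Suc n)) a b d x) \<longlonglongrightarrow>
     (indicator {a<..} x - indicator {a+d<..} x - indicator {b<..} x + indicator {b+d<..} x) / d"
proof -
  have e: "indicator {c<..} x = (if x - c > 0 then 1 else 0 :: real)" for c by simp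
  show ?thesis unfolding trap'_def e diff_diff_eq divide_inverse
    by (intro tendsto_intros sstep_scale_tendsto)
qed

definition ramp :: "real \<Rightarrow> real \<Rightarrow> real \<Rightarrow> real \<Rightarrow> real" where
  "ramp a b d x = (max 0 (x - a) - max 0 (x - a - d) - max 0 (x - b) + max 0 (x - b - d)) / d"

lemma trap_tendsto:
  "(\<lambda>n. trap (real (Suc n)) a b d x) \<longlonglongrightarrow> ramp a b d x"
proof -
  have e: "trap m a b d x = (sramp (m * (x - a)) / m - sramp (m * (x - a - d)) / m
      - sramp (m * (x - b)) / m + sramp (m * (x - b - d)) / m) * inverse d" for m
    unfolding trap_def by (simp add: divide_simps)
  show ?thesis unfolding e ramp_def diff_diff_eq unfolding divide_inverse[of _ d]
    by (intro tendsto_intros sramp_scale_tendsto)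
qed

lemma ramp_abs_le1: "d > 0 \<Longrightarrow> \<bar>ramp a b d x\<bar> \<le> 1"
proof -
  assume "d > 0"
  then have "\<bar>max 0 (x - a) - max 0 (x - a - d) - max 0 (x - b) + max 0 (x - b - d)\<bar> \<le> d"
    by (auto simp: max_def abs_if)
  with \<open>d > 0\<close> show ?thesis by (simp add: ramp_def)
qed

text \<open>Each truncated quotient is 0 at its own corner, hence the half-open interval in the
  limit.\<close>

lemma ramp_tendsto:
  assumes "a < b"
  shows "((\<lambda>n. ramp a b (1 / real (Suc n)) x) \<longlonglongrightarrow> indicator {a<..b} x)"
proof -
  have e: "(\<lambda>n. (max 0 (x - c) - max 0 (x - c - 1 / real (Suc n))) / (1 / real (Suc n))) \<longlonglongrightarrow> (if x > c then 1 else 0)" for c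
  proof (cases "x > c")
    case True
    obtain N where N: "real N > 1 / (x - c)" using reals_Archimedean2 by blast
    have "(max 0 (x - c) - max 0 (x - c - 1 / real (Suc n))) / (1 / real (Suc n)) = 1" if "n \<ge> N" for n
    proof -
      have "1 / (x - c) < real (Suc n)" using N that by linarith
      then have "1 / real (Suc n) < x - c" using True by (simp add: field_simps)
      then show ?thesis using True by (simp add: field_simps)
    qed
    then show ?thesis using True
      by (auto intro!: tendsto_eventually eventually_sequentiallyI[of N] simp del: of_nat_Suc)
  next
    case False
    then have "(max 0 (x - c) - max 0 (x - c - 1 / real (Suc n))) / (1 / real (Suc n)) = 0" for n
    proof -
      have "x - c - 1 / real (Suc n) \<le> 0" "x - c \<le> 0"
        using False by (auto intro: order_trans[of _ 0] simp del: of_nat_Suc)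
      then show ?thesis by simp
    qed
    then show ?thesis using False by simp
  qed
  have "(\<lambda>n. (max 0 (x - a) - max 0 (x - a - 1 / real (Suc n))) / (1 / real (Suc n))
      - (max 0 (x - b) - max 0 (x - b - 1 / real (Suc n))) / (1 / real (Suc n)))
     \<longlonglongrightarrow> (if x > a then 1 else 0) - (if x > b then 1 else 0)"
    by (intro tendsto_diff e)
  moreover have "(if x > a then 1 else 0) - (if x > b then 1 else 0) = (indicator {a<..b} x :: real)"
    using assms by (auto simp: indicator_def)
  ultimately show ?thesis unfolding ramp_def
    by (simp add: diff_divide_distrib add_divide_distrib algebra_simps)
qed

section \<open>Absolutely continuous functions of one variable\<close>

lemma indicator_Ioc_split:
  "c \<le> d \<Longrightarrow> indicator {c<..} (x::real) - indicator {d<..} x = (indicator {c<..d} x :: real)"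
  by (auto simp: indicator_def)

lemma lborel_integral_Ioc_eq_integral:
  fixes f :: "real \<Rightarrow> real"
  assumes "integrable lborel f"
  shows "(LINT x|lborel. indicator {a<..b} x * f x) = integral {a..b} f"
proof -
  have "(LINT x|lborel. indicator {a<..b} x * f x) = (LINT x:{a..b}|lborel. f x)"
    unfolding set_lebesgue_integral_def
  proof (rule integral_cong_AE)
    have [measurable]: "f \<in> borel_measurable borel" using borel_measurable_integrable[OF assms] by simp
    show "(\<lambda>x. indicator {a<..b} x * f x) \<in> borel_measurable lborel"
      "(\<lambda>x. indicator {a..b} x *\<^sub>R f x) \<in> borel_measurable lborel" by measurable
    show "AE x in lborel. indicator {a<..b} x * f x = indicator {a..b} x *\<^sub>R f x"
      using AE_lborel_singleton[of a] by (rule eventually_mono) (auto simp: indicator_def)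
  qed
  also have "\<dots> = integral {a..b} f"
    using assms integrable_mult_indicator[of "{a..b}" lborel f]
    by (intro set_borel_integral_eq_integral) (simp add: set_integrable_def)
  finally show ?thesis .
qed

lemma integrable_lborel_imp_integrable_on:
  fixes f :: "'a::euclidean_space \<Rightarrow> real"
  assumes "integrable lborel f" "S \<in> sets borel"
  shows "f integrable_on S"
  using set_borel_integral_eq_integral(1)[of S f] assms integrable_mult_indicator[of S lborel f]
  by (simp add: set_integrable_def)

text \<open>\<open>integrable_ccontinuous_explicit\<close> takes cubes with x as lower corner, which
  in one dimension means averages to the right. Averages to the left follow by reflection.\<close>

lemma AE_lborel_averages:
  fixes f :: "real \<Rightarrow> real"
  assumes "integrable lborel f"
  shows "AE x in lborel. ((\<lambda>h. integral {x..x+h} f / h) \<longlongrightarrow> f x) (at_right 0)"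
proof -
  have "f integrable_on cbox a b" for a b
    by (rule integrable_lborel_imp_integrable_on[OF assms]) simp
  then obtain N where N: "negligible N"
    and k: "\<And>x e. x \<notin> N \<Longrightarrow> 0 < e \<Longrightarrow> \<exists>d>0. \<forall>h. 0 < h \<and> h < d \<longrightarrow>
       norm (integral (cbox x (x + h *\<^sub>R One)) f /\<^sub>R h ^ DIM(real) - f x) < e"
    using integrable_ccontinuous_explicit[of f] by metis
  have *: "((\<lambda>h. integral {x..x+h} f / h) \<longlongrightarrow> f x) (at_right 0)" if "x \<notin> N" for x
    unfolding tendsto_iff eventually_at_right_field dist_norm
  proof (intro allI impI)
    fix e :: real assume "0 < e"
    from k[OF that this] obtain d where "d > 0" and d: "\<And>h. 0 < h \<Longrightarrow> h < d \<Longrightarrow>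
       norm (integral (cbox x (x + h *\<^sub>R One)) f /\<^sub>R h ^ DIM(real) - f x) < e" by blast
    show "\<exists>b>0. \<forall>y>0. y < b \<longrightarrow> norm (integral {x..x + y} f / y - f x) < e"
      using \<open>d > 0\<close> d by (intro exI[of _ d]) (simp add: divide_inverse mult.commute)
  qed
  have "AE x in lebesgue. x \<notin> N" using N by (simp add: negligible_iff_null_sets AE_not_in)
  then have "AE x in lebesgue. ((\<lambda>h. integral {x..x+h} f / h) \<longlongrightarrow> f x) (at_right 0)"
    by (rule eventually_mono) (use * in auto)
  then show ?thesis by (simp add: AE_completion_iff)
qed

lemma AE_lborel_averages_left:
  fixes f :: "real \<Rightarrow> real"
  assumes "integrable lborel f"
  shows "AE x in lborel. ((\<lambda>h. integral {x-h..x} f / h) \<longlongrightarrow> f x) (at_right 0)"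
proof -
  have i: "integrable lborel (\<lambda>x. f (- x))"
    using lborel_integrable_real_affine[OF assms, of "-1" 0] by simp
  have d: "distr lborel borel uminus = (lborel :: real measure)"
    using lborel_distr_uminus by simp
  have "AE x in lborel. ((\<lambda>h. integral {x..x+h} (\<lambda>x. f (- x)) / h) \<longlongrightarrow> f (- x)) (at_right 0)"
    by (rule AE_lborel_averages[OF i])
  then have "AE x in distr lborel borel uminus. ((\<lambda>h. integral {x..x+h} (\<lambda>x. f (- x)) / h) \<longlongrightarrow> f (- x)) (at_right 0)"
    unfolding d .
  then have "AE x in lborel. ((\<lambda>h. integral {-x..-x+h} (\<lambda>x. f (- x)) / h) \<longlongrightarrow> f (- (- x))) (at_right 0)"
    by (rule AE_distrD[rotated]) simp
  moreover have "integral {-x..-x+h} (\<lambda>x. f (- x)) = integral {x-h..x} f" for x h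
    using Henstock_Kurzweil_Integration.integral_reflect_real[of "x" "x-h" f] by simp
  ultimately show ?thesis by simp
qed

text \<open>Averages from the right and from the left give the two one-sided difference quotients.
  The exceptional set depends on \<open>p\<close> alone, for which reason \<open>f\<close> is
  quantified inside \<open>AE\<close>.\<close>

lemma AE_has_real_derivative_indefinite:
  fixes p :: "real \<Rightarrow> real"
  assumes "integrable lborel p"
  shows "AE x in lborel. \<forall>f. (\<forall>s t. s \<le> t \<longrightarrow> f t - f s = integral {s..t} p) \<longrightarrow> (f has_real_derivative p x) (at x)"
  using AE_lborel_averages[OF assms] AE_lborel_averages_left[OF assms]
proof eventually_elim
  fix x assume r: "((\<lambda>h. integral {x..x+h} p / h) \<longlongrightarrow> p x) (at_right 0)"
    and l: "((\<lambda>h. integral {x-h..x} p / h) \<longlongrightarrow> p x) (at_right 0)"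
  show "\<forall>f. (\<forall>s t. s \<le> t \<longrightarrow> f t - f s = integral {s..t} p) \<longrightarrow> (f has_real_derivative p x) (at x)"
  proof (intro allI impI)
    fix f assume f: "\<forall>s t. s \<le> t \<longrightarrow> f t - f s = integral {s..t} p"
    have "((\<lambda>h. (f (x + h) - f x) / h) \<longlongrightarrow> p x) (at_right 0)"
      by (rule Lim_transform_eventually[OF r])
        (auto simp: eventually_at_right_field f intro!: exI[of _ 1])
    moreover have "((\<lambda>h. (f (x + h) - f x) / h) \<longlongrightarrow> p x) (at_left 0)"
      unfolding at_left_minus filterlim_filtermap minus_zero
    proof (rule Lim_transform_eventually[OF l])
      have "integral {x-h..x} p / h = (f (x + - h) - f x) / - h" if "h > 0" for h
        using f[rule_format, of "x-h" x] that by (simp add: divide_simps)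
      then show "\<forall>\<^sub>F h in at_right 0. integral {x-h..x} p / h = (f (x + - h) - f x) / - h"
        by (auto simp: eventually_at_right_field intro!: exI[of _ 1])
    qed
    ultimately show "(f has_real_derivative p x) (at x)"
      unfolding DERIV_def by (simp add: filterlim_split_at)
  qed
qed

text \<open>The bound makes both \<open>W + f\<close> and \<open>W - f\<close> nondecreasing. Their
  interval measures add up to the measure with density \<open>2 * w\<close>, so the first is
  absolutely continuous, and its Radon-Nikodym density \<open>D\<close> gives
  \<open>p = D - w\<close>.\<close>

lemma absolutely_continuous_density:
  fixes f w :: "real \<Rightarrow> real"
  assumes w: "integrable lborel w" and w0: "\<And>x. 0 \<le> w x"
    and bd: "\<And>s t. s \<le> t \<Longrightarrow> \<bar>f t - f s\<bar> \<le> integral {s..t} w"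
  obtains p where "integrable lborel p" "\<And>s t. s \<le> t \<Longrightarrow> f t - f s = integral {s..t} p"
    "AE x in lborel. (f has_real_derivative p x) (at x)" "AE x in lborel. \<bar>p x\<bar> \<le> w x"
proof -
  have wb[measurable]: "w \<in> borel_measurable borel" using w borel_measurable_integrable by force
  define W where "W t = (LINT x|lborel. indicator {..t} x * w x)" for t
  have wi: "integrable lborel (\<lambda>x. indicator A x * w x)" if "A \<in> sets borel" for A
    using integrable_mult_indicator[OF _ w, of A] that by simp
  have Wd: "W t - W s = integral {s..t} w" if "s \<le> t" for s t
  proof -
    have "W t - W s = (LINT x|lborel. indicator {..t} x * w x - indicator {..s} x * w x)"
      unfolding W_def by (rule Bochner_Integration.integral_diff[symmetric]) (auto intro!: wi)
    also have "\<dots> = (LINT x|lborel. indicator {s<..t} x * w x)"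
      by (rule Bochner_Integration.integral_cong) (use that in \<open>auto simp: indicator_def\<close>)
    finally show ?thesis using lborel_integral_Ioc_eq_integral[OF w] by simp
  qed
  have Wlim: "continuous (at_right a) W" for a
  proof -
    have wio: "w integrable_on {a-1..a+1}" by (rule integrable_lborel_imp_integrable_on[OF w]) simp
    have c: "continuous_on {a-1..a+1} (\<lambda>t. integral {a-1..t} w)"
      by (rule indefinite_integral_continuous_1[OF wio])
    have "continuous_on {a-1..a+1} (\<lambda>t. W (a-1) + integral {a-1..t} w)"
      by (intro continuous_intros c)
    then have "continuous_on {a-1..a+1} W"
      by (rule continuous_on_eq) (use Wd[of "a-1"] in \<open>auto simp: algebra_simps simp flip: Wd\<close>)
    then have "isCont W a"
      by (rule continuous_on_interior) (simp add: interior_atLeastAtMost_real)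
    then show ?thesis by (rule continuous_within_subset) auto
  qed
  have fc: "continuous (at_right a) f" for a
    unfolding continuous_within
  proof (rule LIM_zero_cancel, rule Lim_null_comparison)
    show "\<forall>\<^sub>F x in at_right a. norm (f x - f a) \<le> W x - W a"
      using bd[of a] Wd[of a] by (auto simp: eventually_at_right_field intro!: exI[of _ "a+1"])
    show "((\<lambda>x. W x - W a) \<longlongrightarrow> 0) (at_right a)"
      using Wlim[of a] unfolding continuous_within by (rule LIM_zero)
  qed
  define F1 where "F1 t = W t + f t" for t
  define F2 where "F2 t = W t - f t" for t
  have m1: "x \<le> y \<Longrightarrow> F1 x \<le> F1 y" and m2: "x \<le> y \<Longrightarrow> F2 x \<le> F2 y" for x y
    using bd[of x y] Wd[of x y] by (auto simp: F1_def F2_def)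
  have c1: "continuous (at_right a) F1" and c2: "continuous (at_right a) F2" for a
    unfolding F1_def[abs_def] F2_def[abs_def] by (intro continuous_intros Wlim fc)+
  define M1 where "M1 = interval_measure F1"
  define M2 where "M2 = interval_measure F2"
  \<comment> \<open>On half-open intervals the increments of \<open>F1\<close> and \<open>F2\<close>
    add up to twice that of \<open>W\<close>. Comparing the sum measure with the density on this
    generating pi-system settles all Borel sets.\<close>
  define \<nu> where "\<nu> = measure_of UNIV (sets borel) (\<lambda>A. emeasure M1 A + emeasure M2 A)"
  have s\<nu>: "sets \<nu> = sets borel"
    unfolding \<nu>_def using sets.sigma_sets_eq[of "borel::real measure"] by (simp add: sets_measure_of_conv)
  have sM: "sets M1 = sets borel" "sets M2 = sets borel" by (simp_all add: M1_def M2_def)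
  have e\<nu>: "emeasure \<nu> A = emeasure M1 A + emeasure M2 A" if "A \<in> sets borel" for A
    unfolding \<nu>_def
  proof (rule emeasure_measure_of_sigma)
    show "sigma_algebra UNIV (sets (borel::real measure))"
      using sets.sigma_algebra_axioms[of "borel::real measure"] by simp
    show "positive (sets borel) (\<lambda>A. emeasure M1 A + emeasure M2 A)" by (simp add: positive_def)
    show "countably_additive (sets borel) (\<lambda>A. emeasure M1 A + emeasure M2 A)"
    proof (rule countably_additiveI)
      fix A :: "nat \<Rightarrow> real set" assume A: "range A \<subseteq> sets borel" "disjoint_family A"
      have "(\<Sum>i. emeasure M1 (A i) + emeasure M2 (A i)) = (\<Sum>i. emeasure M1 (A i)) + (\<Sum>i. emeasure M2 (A i))"
        by (rule suminf_add[symmetric]) auto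
      then show "(\<Sum>i. emeasure M1 (A i) + emeasure M2 (A i)) = emeasure M1 (\<Union> (range A)) + emeasure M2 (\<Union> (range A))"
        using suminf_emeasure[of A M1] suminf_emeasure[of A M2] A sM by simp
    qed
  qed fact
  let ?D = "density lborel (\<lambda>x. ennreal (2 * w x))"
  have "\<nu> = ?D"
  proof (rule measure_eqI_generator_eq[where E="range (\<lambda>(a,b). {a<..b::real})" and \<Omega>=UNIV and A="\<lambda>n. {- real n<..real n}"])
    show "Int_stable (range (\<lambda>(a,b). {a<..b::real}))"
    proof (rule Int_stableI)
      fix A B assume "A \<in> range (\<lambda>(a,b). {a<..b::real})" "B \<in> range (\<lambda>(a,b). {a<..b::real})"
      then obtain a b c d where "A = {a<..b}" "B = {c<..d}" by auto
      then have "A \<inter> B = (\<lambda>(a,b). {a<..b}) (max a c, min b d)" by auto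
      then show "A \<inter> B \<in> range (\<lambda>(a,b). {a<..b::real})" by blast
    qed
    show "range (\<lambda>(a,b). {a<..b::real}) \<subseteq> Pow UNIV" by simp
    have sb: "sets (borel::real measure) = sigma_sets UNIV (range (\<lambda>(a,b). {a<..b}))"
      using arg_cong[OF borel_sigma_sets_Ioc, of sets] by simp
    show "sets \<nu> = sigma_sets UNIV (range (\<lambda>(a,b). {a<..b}))" using s\<nu> sb by simp
    show "sets ?D = sigma_sets UNIV (range (\<lambda>(a,b). {a<..b}))" using sb by simp
    show "range (\<lambda>n. {- real n<..real n}) \<subseteq> range (\<lambda>(a,b). {a<..b})" by auto
    show "(\<Union>n. {- real n<..real n}) = UNIV"
    proof -
      have "\<exists>n. - real n < x \<and> x \<le> real n" for x
      proof -
        obtain n where "\<bar>x\<bar> < real n" using reals_Archimedean2 by blast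
        then show ?thesis by (intro exI[of _ n]) auto
      qed
      then show ?thesis by auto
    qed
    show "emeasure \<nu> {- real n<..real n} \<noteq> \<infinity>" for n
      by (subst e\<nu>) (auto simp: M1_def M2_def emeasure_interval_measure_Ioc m1 m2 c1 c2)
    fix X assume "X \<in> range (\<lambda>(a,b). {a<..b::real})"
    then obtain a b where X: "X = {a<..b}" by auto
    show "emeasure \<nu> X = emeasure ?D X"
    proof (cases "a \<le> b")
      case True
      have "emeasure \<nu> X = ennreal (F1 b - F1 a) + ennreal (F2 b - F2 a)"
        using True by (simp add: e\<nu> X M1_def M2_def emeasure_interval_measure_Ioc m1 m2 c1 c2)
      also have "\<dots> = ennreal (2 * (W b - W a))"
        using m1[OF True] m2[OF True] by (subst ennreal_plus[symmetric]) (auto simp: F1_def F2_def)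
      also have "\<dots> = ennreal (LINT x|lborel. indicator {a<..b} x * (2 * w x))"
        using lborel_integral_Ioc_eq_integral[of "\<lambda>x. 2 * w x" a b] w Wd[OF True] by simp
      also have "\<dots> = (\<integral>\<^sup>+x. ennreal (indicator {a<..b} x * (2 * w x)) \<partial>lborel)"
        using wi[of "{a<..b}"] w0
        by (intro nn_integral_eq_integral[symmetric]) (auto simp: mult.left_commute)
      also have "\<dots> = emeasure ?D X"
        by (subst emeasure_density) (auto simp: X indicator_def intro!: nn_integral_cong)
      finally show ?thesis .
    qed (simp add: X)
  qed
  have ac: "absolutely_continuous lborel M1"
    unfolding absolutely_continuous_def
  proof
    fix A assume A: "A \<in> null_sets (lborel :: real measure)"
    then have "A \<in> null_sets ?D"
      using absolutely_continuousI_density[of "\<lambda>x. ennreal (2 * w x)" lborel] by (auto simp: absolutely_continuous_def)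
    then have "emeasure \<nu> A = 0" using \<open>\<nu> = ?D\<close> by auto
    then show "A \<in> null_sets M1" using A by (auto simp: null_sets_def sM e\<nu>)
  qed
  have fin: "emeasure M1 UNIV < \<infinity>"
  proof -
    have "emeasure M1 UNIV \<le> emeasure \<nu> UNIV" by (simp add: e\<nu>)
    also have "\<dots> = (\<integral>\<^sup>+x. ennreal (2 * w x) \<partial>lborel)" unfolding \<open>\<nu> = ?D\<close> by (simp add: emeasure_density)
    also have "\<dots> < \<infinity>" using w w0 by (subst nn_integral_eq_integral) auto
    finally show ?thesis .
  qed
  have "finite_measure M1" by (rule finite_measureI) (use fin in \<open>simp add: M1_def\<close>)
  then obtain D where D: "D \<in> borel_measurable lborel" "AE x in lborel. RN_deriv lborel M1 x = ennreal (D x)" "\<And>x. 0 \<le> D x"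
    using sigma_finite_measure.real_RN_deriv[OF lborel.sigma_finite_measure_axioms _ ac] sM by (metis sets_lborel)
  have dM: "density lborel (\<lambda>x. ennreal (D x)) = M1"
  proof -
    have "density lborel (\<lambda>x. ennreal (D x)) = density lborel (RN_deriv lborel M1)"
      by (rule density_cong) (use D in auto)
    then show ?thesis using sigma_finite_measure.density_RN_deriv[OF lborel.sigma_finite_measure_axioms ac] sM by simp
  qed
  have Di: "integrable lborel D"
  proof (rule integrableI_nonneg)
    have "(\<integral>\<^sup>+x. ennreal (D x) \<partial>lborel) = emeasure M1 UNIV"
      unfolding dM[symmetric] using D by (simp add: emeasure_density)
    then show "(\<integral>\<^sup>+x. ennreal (D x) \<partial>lborel) < \<infinity>" using fin by simp
  qed (use D in auto)
  have Dd: "F1 t - F1 s = integral {s..t} D" if "s \<le> t" for s t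
  proof -
    have "ennreal (F1 t - F1 s) = emeasure M1 {s<..t}"
      using that by (simp add: M1_def emeasure_interval_measure_Ioc m1 c1)
    also have "\<dots> = (\<integral>\<^sup>+x. ennreal (indicator {s<..t} x * D x) \<partial>lborel)"
      unfolding dM[symmetric] using D by (subst emeasure_density) (auto simp: indicator_def intro!: nn_integral_cong)
    also have "\<dots> = ennreal (LINT x|lborel. indicator {s<..t} x * D x)"
      using integrable_mult_indicator[OF _ Di, of "{s<..t}"] D(3) by (intro nn_integral_eq_integral) auto
    also have "\<dots> = ennreal (integral {s..t} D)" by (simp add: lborel_integral_Ioc_eq_integral[OF Di])
    finally have "ennreal (F1 t - F1 s) = ennreal (integral {s..t} D)" .
    moreover have "0 \<le> integral {s..t} D"
      by (rule integral_nonneg) (use D integrable_lborel_imp_integrable_on[OF Di] in auto)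
    ultimately show ?thesis using m1[OF that] by simp
  qed
  define p where "p x = D x - w x" for x
  have pi: "integrable lborel p" unfolding p_def using Di w by auto
  have pd: "f t - f s = integral {s..t} p" if "s \<le> t" for s t
  proof -
    have "integral {s..t} p = integral {s..t} D - integral {s..t} w"
      unfolding p_def by (rule Henstock_Kurzweil_Integration.integral_diff)
        (auto intro!: integrable_lborel_imp_integrable_on Di w)
    then show ?thesis using Dd[OF that] Wd[OF that] by (simp add: F1_def)
  qed
  have dp: "AE x in lborel. (f has_real_derivative p x) (at x)"
    using AE_has_real_derivative_indefinite[OF pi] by (rule eventually_mono) (use pd in auto)
  have "AE x in lborel. \<bar>p x\<bar> \<le> w x"
    using AE_lborel_averages[OF pi] AE_lborel_averages[OF w]
  proof eventually_elim
    case (elim x)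
    have "((\<lambda>h. \<bar>integral {x..x+h} p / h\<bar>) \<longlongrightarrow> \<bar>p x\<bar>) (at_right 0)"
      using elim(1) by (rule tendsto_rabs)
    then show ?case
    proof (rule tendsto_le[OF trivial_limit_at_right_real elim(2)])
      have "\<bar>integral {x..x+h} p / h\<bar> \<le> integral {x..x+h} w / h" if "h > 0" for h
        using bd[of x "x+h"] pd[of x "x+h"] that by (simp add: divide_right_mono)
      then show "\<forall>\<^sub>F h in at_right 0. \<bar>integral {x..x+h} p / h\<bar> \<le> integral {x..x+h} w / h"
        by (auto simp: eventually_at_right_field intro!: exI[of _ 1])
    qed
  qed
  with pi pd dp show ?thesis by (rule that)
qed

section \<open>The du Bois-Reymond lemma\<close>

lemma AE_lborel_zero_if_interval_integrals_zero:
  fixes f :: "real \<Rightarrow> real"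
  assumes f: "integrable lborel f"
    and z: "\<And>a b. l < a \<Longrightarrow> a < b \<Longrightarrow> b < r \<Longrightarrow> integral {a..b} f = 0"
  shows "AE x in lborel. l < x \<longrightarrow> x < r \<longrightarrow> f x = 0"
  using AE_lborel_averages[OF f]
proof eventually_elim
  case (elim x)
  show ?case
  proof (intro impI)
    assume x: "l < x" "x < r"
    have "\<forall>\<^sub>F h in at_right 0. integral {x..x+h} f / h = 0"
      unfolding eventually_at_right_field
    proof (intro exI[of _ "r - x"] conjI allI impI)
      fix h assume "0 < h" "h < r - x"
      then have "integral {x..x+h} f = 0" by (intro z) (use x in auto)
      then show "integral {x..x+h} f / h = 0" by simp
    qed (use x in auto)
    then have "((\<lambda>h. integral {x..x+h} f / h) \<longlongrightarrow> 0) (at_right 0)"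
      by (rule tendsto_eventually)
    then show "f x = 0" using tendsto_unique[OF trivial_limit_at_right_real elim] by simp
  qed
qed

text \<open>The pointwise limit of \<open>trap'\<close> as m grows: height 1/d on (a, a+d] minus
  height 1/d on (b, b+d]. Integrated against a function it is a difference of two averages.\<close>

definition box2 :: "real \<Rightarrow> real \<Rightarrow> real \<Rightarrow> real \<Rightarrow> real" where
  "box2 a b d x = (indicator {a<..} x - indicator {a+d<..} x - indicator {b<..} x + indicator {b+d<..} x) / d"

lemma box2_measurable [measurable]: "box2 a b d \<in> borel_measurable borel"
  unfolding box2_def by measurable

lemma ramp_measurable [measurable]: "ramp a b d \<in> borel_measurable borel"
  unfolding ramp_def by measurable

lemma trap_measurable [measurable]:
  "trap m a b d \<in> borel_measurable borel" "trap' m a b d \<in> borel_measurable borel"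
  using continuous_on_trap by (auto intro!: borel_measurable_continuous_onI)

lemma box2_abs_le: "d > 0 \<Longrightarrow> \<bar>box2 a b d x\<bar> \<le> 2 / d"
  unfolding box2_def by (auto simp: divide_right_mono indicator_def)

lemma integral_box2:
  fixes f :: "real \<Rightarrow> real"
  assumes f: "integrable lborel f" and d: "d > 0"
  shows "(LINT x|lborel. f x * box2 a b d x) = (integral {a..a+d} f - integral {b..b+d} f) / d"
proof -
  have i: "integrable lborel (\<lambda>x. indicator A x * f x)" if "A \<in> sets borel" for A
    using integrable_mult_indicator[OF _ f, of A] that by simp
  have "f x * box2 a b d x = (indicator {a<..a+d} x * f x - indicator {b<..b+d} x * f x) / d" for x
    unfolding box2_def using indicator_Ioc_split[of a "a+d" x] indicator_Ioc_split[of b "b+d" x] d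
    by (simp add: algebra_simps)
  then have "(LINT x|lborel. f x * box2 a b d x)
     = (LINT x|lborel. (indicator {a<..a+d} x * f x - indicator {b<..b+d} x * f x) / d)" by simp
  also have "\<dots> = (LINT x|lborel. indicator {a<..a+d} x * f x - indicator {b<..b+d} x * f x) / d"
    by simp
  also have "\<dots> = (integral {a..a+d} f - integral {b..b+d} f) / d"
    by (subst Bochner_Integration.integral_diff) (auto intro!: i simp: lborel_integral_Ioc_eq_integral[OF f])
  finally show ?thesis .
qed

lemma integrable_mult_bounded:
  fixes f h :: "'a \<Rightarrow> real"
  assumes "integrable M f" "h \<in> borel_measurable M" "\<And>x. \<bar>h x\<bar> \<le> C"
  shows "integrable M (\<lambda>x. f x * h x)"
proof (rule Bochner_Integration.integrable_bound[of M "\<lambda>x. C * f x"])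
  show "integrable M (\<lambda>x. C * f x)" using assms by simp
  show "(\<lambda>x. f x * h x) \<in> borel_measurable M" using assms borel_measurable_integrable by measurable
  show "AE x in M. norm (f x * h x) \<le> norm (C * f x)"
  proof (rule AE_I2)
    fix x
    have "\<bar>h x\<bar> * \<bar>f x\<bar> \<le> \<bar>C\<bar> * \<bar>f x\<bar>"
      by (rule mult_right_mono) (use assms(3)[of x] in auto)
    then show "norm (f x * h x) \<le> norm (C * f x)" by (simp add: abs_mult mult.commute)
  qed
qed

lemma integral_mult_bounded_tendsto:
  fixes f :: "'a \<Rightarrow> real" and h :: "nat \<Rightarrow> 'a \<Rightarrow> real"
  assumes "integrable M f" "\<And>n. h n \<in> borel_measurable M" "h' \<in> borel_measurable M" "\<And>n x. \<bar>h n x\<bar> \<le> C"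
    "AE x in M. (\<lambda>n. h n x) \<longlonglongrightarrow> h' x"
  shows "(\<lambda>n. LINT x|M. f x * h n x) \<longlonglongrightarrow> (LINT x|M. f x * h' x)"
proof (rule integral_dominated_convergence[where w="\<lambda>x. C * norm (f x)"])
  have [measurable]: "f \<in> borel_measurable M" using assms(1) by auto
  note [measurable] = assms(2,3)
  show "(\<lambda>x. f x * h' x) \<in> borel_measurable M" "\<And>n. (\<lambda>x. f x * h n x) \<in> borel_measurable M" by measurable
  show "integrable M (\<lambda>x. C * norm (f x))" using assms(1) by simp
  show "AE x in M. (\<lambda>n. f x * h n x) \<longlonglongrightarrow> f x * h' x"
    using assms(5) by eventually_elim (intro tendsto_intros)
  show "\<And>n. AE x in M. norm (f x * h n x) \<le> C * norm (f x)"
    using assms(4) by (auto simp: abs_mult mult.commute[of C] intro!: AE_I2 mult_left_mono)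
qed

lemma rational_sequence_tendsto:
  obtains q :: "nat \<Rightarrow> real" where "\<And>n. q n \<in> \<rat>" "q \<longlonglongrightarrow> a"
proof -
  have "\<exists>q\<in>\<rat>. a < q \<and> q < a + 1 / real (Suc n)" for n
    by (rule Rats_dense_in_real) simp
  then obtain q where q: "\<And>n. q n \<in> \<rat> \<and> a < q n \<and> q n < a + 1 / real (Suc n)" by metis
  have "q \<longlonglongrightarrow> a"
  proof (rule tendsto_sandwich[of "\<lambda>n. a" _ _ "\<lambda>n. a + 1 / real (Suc n)"])
    show "(\<lambda>n. a + 1 / real (Suc n)) \<longlonglongrightarrow> a"
      using tendsto_add[OF tendsto_const[of a] LIMSEQ_Suc[OF lim_const_over_n[of 1]]] by simp
  qed (use q in \<open>auto intro!: always_eventually less_imp_le simp del: of_nat_Suc\<close>)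
  then show ?thesis using q that by blast
qed

lemma indicator_greaterThan_tendsto:
  fixes x :: real
  assumes "q \<longlonglongrightarrow> c" "x \<noteq> c"
  shows "(\<lambda>n. indicator {q n<..} x :: real) \<longlonglongrightarrow> indicator {c<..} x"
proof (cases "c < x")
  case True
  then have "\<forall>\<^sub>F n in sequentially. q n < x" using assms(1) by (simp add: order_tendsto_iff)
  then have "\<forall>\<^sub>F n in sequentially. indicator {q n<..} x = (indicator {c<..} x :: real)"
    by eventually_elim (use True in auto)
  then show ?thesis by (rule tendsto_eventually)
next
  case False
  then have "\<forall>\<^sub>F n in sequentially. q n > x" using assms by (simp add: order_tendsto_iff)
  then have "\<forall>\<^sub>F n in sequentially. indicator {q n<..} x = (indicator {c<..} x :: real)"
    by eventually_elim (use False in auto)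
  then show ?thesis by (rule tendsto_eventually)
qed

text \<open>Only test functions with rational parameters are used: this lets the lemma be applied
  simultaneously on almost all lines.\<close>

lemma du_Bois_Reymond:
  fixes f g :: "real \<Rightarrow> real"
  assumes f: "integrable lborel f" and g: "integrable lborel g"
    and H: "\<And>a b d n. a \<in> \<rat> \<Longrightarrow> b \<in> \<rat> \<Longrightarrow> d \<in> \<rat> \<Longrightarrow> 0 < d \<Longrightarrow> l < a \<Longrightarrow> a < b \<Longrightarrow> b + d + 1 / real (Suc n) < r \<Longrightarrow>
       (LINT x|lborel. f x * trap' (real (Suc n)) a b d x) = - (LINT x|lborel. g x * trap (real (Suc n)) a b d x)"
  obtains N where "N \<in> null_sets lborel"
    "\<And>s t. s < t \<Longrightarrow> s \<notin> N \<Longrightarrow> t \<notin> N \<Longrightarrow> l < s \<Longrightarrow> t < r \<Longrightarrow> f t - f s = integral {s..t} g"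
proof -
  have [measurable]: "f \<in> borel_measurable borel" "g \<in> borel_measurable borel"
    using f g borel_measurable_integrable by auto
  \<comment> \<open>The corners are sharpened with rational a, b, d fixed; the support condition
    holds once 1/(n+1) is small enough.\<close>
  have 1: "(LINT x|lborel. f x * box2 a b d x) = - (LINT x|lborel. g x * ramp a b d x)"
    if q: "a \<in> \<rat>" "b \<in> \<rat>" "d \<in> \<rat>" "0 < d" "l < a" "a < b" "b + d < r" for a b d
  proof -
    have L: "(\<lambda>n. LINT x|lborel. f x * trap' (real (Suc n)) a b d x) \<longlonglongrightarrow> (LINT x|lborel. f x * box2 a b d x)"
      by (rule integral_mult_bounded_tendsto[OF f, where C="2/d"])
        (use q trap'_tendsto trap'_abs_le in \<open>auto simp: box2_def[abs_def] simp del: of_nat_Suc\<close>)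
    have R: "(\<lambda>n. LINT x|lborel. g x * trap (real (Suc n)) a b d x) \<longlonglongrightarrow> (LINT x|lborel. g x * ramp a b d x)"
      by (rule integral_mult_bounded_tendsto[OF g, where C="1"])
        (use q trap_tendsto trap_abs_le1 in \<open>auto simp del: of_nat_Suc\<close>)
    have "(\<lambda>n. b + d + 1 / real (Suc n)) \<longlonglongrightarrow> b + d + 0"
      using LIMSEQ_Suc[OF lim_const_over_n[of "1::real"]] by (intro tendsto_intros)
    then have "\<forall>\<^sub>F n in sequentially. b + d + 1 / real (Suc n) < r"
      using q(7) by (simp add: order_tendsto_iff del: of_nat_Suc)
    then have "\<forall>\<^sub>F n in sequentially. - (LINT x|lborel. g x * trap (real (Suc n)) a b d x)
        = (LINT x|lborel. f x * trap' (real (Suc n)) a b d x)"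
      by eventually_elim (use H q in simp)
    from Lim_transform_eventually[OF tendsto_minus[OF R] this]
    show ?thesis using LIMSEQ_unique[OF L] by simp
  qed
  \<comment> \<open>Real a and b are reached by rational approximation. \<open>box2\<close> jumps at
    four points, so its convergence holds only almost everywhere. The width d stays rational, as it
    will be 1/(n+1).\<close>
  have 2: "(LINT x|lborel. f x * box2 a b d x) = - (LINT x|lborel. g x * ramp a b d x)"
    if q: "d \<in> \<rat>" "0 < d" "l < a" "a < b" "b + d < r" for a b d
  proof -
    obtain qa where qa: "\<And>n. qa n \<in> \<rat>" "qa \<longlonglongrightarrow> a" using rational_sequence_tendsto[of a] by blast
    obtain qb where qb: "\<And>n. qb n \<in> \<rat>" "qb \<longlonglongrightarrow> b" using rational_sequence_tendsto[of b] by blast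
    have L: "(\<lambda>n. LINT x|lborel. f x * box2 (qa n) (qb n) d x) \<longlonglongrightarrow> (LINT x|lborel. f x * box2 a b d x)"
    proof (rule integral_mult_bounded_tendsto[OF f, where C="2/d"])
      have "AE x in lborel. x \<noteq> a \<and> x \<noteq> a + d \<and> x \<noteq> b \<and> x \<noteq> b + d"
        using AE_lborel_singleton[of a] AE_lborel_singleton[of "a+d"] AE_lborel_singleton[of b]
          AE_lborel_singleton[of "b+d"] by eventually_elim auto
      then show "AE x in lborel. (\<lambda>n. box2 (qa n) (qb n) d x) \<longlonglongrightarrow> box2 a b d x"
        unfolding box2_def divide_inverse
        by eventually_elim (intro tendsto_intros indicator_greaterThan_tendsto qa qb; simp)
    qed (use box2_abs_le q in auto)
    have R: "(\<lambda>n. LINT x|lborel. g x * ramp (qa n) (qb n) d x) \<longlonglongrightarrow> (LINT x|lborel. g x * ramp a b d x)"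
    proof (rule integral_mult_bounded_tendsto[OF g, where C=1])
      show "AE x in lborel. (\<lambda>n. ramp (qa n) (qb n) d x) \<longlonglongrightarrow> ramp a b d x"
        unfolding ramp_def divide_inverse
        by (intro AE_I2 tendsto_intros qa qb)
    qed (use ramp_abs_le1 q in auto)
    have "\<forall>\<^sub>F n in sequentially. l < qa n" using order_tendstoD(1)[OF qa(2) q(3)] .
    moreover have "\<forall>\<^sub>F n in sequentially. qa n < (a + b) / 2"
      by (rule order_tendstoD(2)[OF qa(2)]) (use q in simp)
    moreover have "\<forall>\<^sub>F n in sequentially. qb n > (a + b) / 2"
      by (rule order_tendstoD(1)[OF qb(2)]) (use q in simp)
    moreover have "\<forall>\<^sub>F n in sequentially. qb n < r - d"
      by (rule order_tendstoD(2)[OF qb(2)]) (use q in simp)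
    ultimately have "\<forall>\<^sub>F n in sequentially. - (LINT x|lborel. g x * ramp (qa n) (qb n) d x)
        = (LINT x|lborel. f x * box2 (qa n) (qb n) d x)"
      by eventually_elim (subst 1, use qa qb q in auto)
    from Lim_transform_eventually[OF tendsto_minus[OF R] this]
    show ?thesis using LIMSEQ_unique[OF L] by simp
  qed
  \<comment> \<open>The exceptional points are those where the right averages of \<open>f\<close>
    fail to converge to \<open>f\<close>. Elsewhere the width 1/(n+1) turns the test with
    \<open>box2\<close> into f s - f t.\<close>
  obtain N where N: "N \<in> null_sets lborel"
    "\<And>x. x \<notin> N \<Longrightarrow> ((\<lambda>h. integral {x..x+h} f / h) \<longlongrightarrow> f x) (at_right 0)"
    using AE_E3[OF AE_lborel_averages[OF f]] by (auto simp: space_lborel)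
  have avg: "(\<lambda>n. integral {x..x+1 / real (Suc n)} f / (1 / real (Suc n))) \<longlonglongrightarrow> f x" if "x \<notin> N" for x
  proof (rule filterlim_compose[OF N(2)[OF that]])
    show "filterlim (\<lambda>n. 1 / real (Suc n)) (at_right 0) sequentially"
      using LIMSEQ_Suc[OF lim_const_over_n[of "1::real"]] by (auto simp: filterlim_at intro!: always_eventually)
  qed
  show ?thesis
  proof (rule that[OF N(1)])
    fix s t assume st: "s < t" "s \<notin> N" "t \<notin> N" "l < s" "t < r"
    have L: "(\<lambda>n. LINT x|lborel. f x * box2 s t (1 / real (Suc n)) x) \<longlonglongrightarrow> f s - f t"
      by (subst integral_box2[OF f]) (use tendsto_diff[OF avg[OF st(2)] avg[OF st(3)]] in \<open>auto simp: diff_divide_distrib left_diff_distrib\<close>)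
    have R: "(\<lambda>n. LINT x|lborel. g x * ramp s t (1 / real (Suc n)) x) \<longlonglongrightarrow> (LINT x|lborel. g x * indicator {s<..t} x)"
      by (rule integral_mult_bounded_tendsto[OF g, where C=1])
        (use ramp_tendsto[OF st(1)] ramp_abs_le1 in auto)
    have "(\<lambda>n. t + 1 / real (Suc n)) \<longlonglongrightarrow> t + 0"
      using LIMSEQ_Suc[OF lim_const_over_n[of "1::real"]] by (intro tendsto_intros)
    then have "\<forall>\<^sub>F n in sequentially. t + 1 / real (Suc n) < r"
      using st(5) by (simp add: order_tendsto_iff del: of_nat_Suc)
    then have "\<forall>\<^sub>F n in sequentially. - (LINT x|lborel. g x * ramp s t (1 / real (Suc n)) x)
        = (LINT x|lborel. f x * box2 s t (1 / real (Suc n)) x)"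
      by eventually_elim (subst 2, use st in auto)
    from Lim_transform_eventually[OF tendsto_minus[OF R] this]
    have "f s - f t = - (LINT x|lborel. g x * indicator {s<..t} x)" using LIMSEQ_unique[OF L] by simp
    then show "f t - f s = integral {s..t} g"
      using lborel_integral_Ioc_eq_integral[OF g, of s t] by (simp add: mult.commute)
  qed
qed

section \<open>Weak derivatives on lines\<close>

definition oth :: "2 \<Rightarrow> 2" where "oth j = (if j = 1 then 2 else 1)"

lemma oth_neq [simp]: "oth j \<noteq> j" "j \<noteq> oth j"
  using exhaust_2[of j] by (auto simp: oth_def)

lemma UNIV_2_oth: "(UNIV :: 2 set) = {j, oth j}"
  using exhaust_2[of j] by (auto simp: oth_def UNIV_2)

lemma not_eq_iff_oth: "i \<noteq> j \<longleftrightarrow> i = oth j"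
  using UNIV_2_oth[of j] by auto

lemma sum_2_oth: "(\<Sum>i\<in>UNIV. f i) = f j + f (oth j)" for f :: "2 \<Rightarrow> 'a::comm_monoid_add"
  by (simp add: UNIV_2_oth[of j])

definition pt :: "2 \<Rightarrow> real \<Rightarrow> real \<Rightarrow> real^2" where
  "pt j t y = (\<chi> i. if i = j then t else y)"

lemma pt_nth [simp]: "pt j t y $ j = t" "pt j t y $ oth j = y"
  by (simp_all add: pt_def)

lemma pt_nth_1 [simp]: "pt 1 t y $ 2 = y" "pt 2 t y $ 1 = y"
  by (simp_all add: pt_def)

lemma pt_eq [simp]: "pt j (x $ j) (x $ oth j) = x"
  by (auto simp: pt_def vec_eq_iff not_eq_iff_oth)

lemma pt_add: "pt j (t + h) y = pt j t y + h *\<^sub>R axis j 1"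
  by (auto simp: pt_def vec_eq_iff axis_def)

lemma continuous_on_pt [continuous_intros]:
  assumes "continuous_on S f" "continuous_on S g"
  shows "continuous_on S (\<lambda>x. pt j (f x) (g x))"
  unfolding pt_def
proof (intro continuous_on_vec_lambda)
  show "continuous_on S (\<lambda>x. if i = j then f x else g x)" for i
    using assms by (cases "i = j") auto
qed

lemma pt_measurable [measurable]:
  "(\<lambda>(y, t). pt j t y) \<in> borel_measurable (lborel \<Otimes>\<^sub>M lborel)"
proof -
  have "continuous_on UNIV (\<lambda>z. pt j (snd z) (fst z))" by (intro continuous_intros)
  then have "(\<lambda>z. pt j (snd z) (fst z)) \<in> borel_measurable borel"
    by (rule borel_measurable_continuous_onI)
  then show ?thesis by (simp add: case_prod_unfold lborel_prod)
qed

lemma pt_measurable2 [measurable (raw)]: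
  assumes [measurable]: "f \<in> borel_measurable M" "g \<in> borel_measurable M"
  shows "(\<lambda>x. pt j (f x) (g x)) \<in> borel_measurable M"
proof -
  have "continuous_on UNIV (\<lambda>z. pt j (fst z) (snd z))" by (intro continuous_intros)
  from borel_measurable_continuous_on[OF this borel_measurable_Pair[OF assms]] show ?thesis by simp
qed

lemma dist_pt: "dist (pt j t y) (pt j t' y') \<le> \<bar>t - t'\<bar> + \<bar>y - y'\<bar>"
proof -
  have "norm (pt j t y - pt j t' y') \<le> (\<Sum>i\<in>UNIV. \<bar>(pt j t y - pt j t' y') $ i\<bar>)"
    by (rule norm_le_l1_cart)
  then show ?thesis by (simp add: sum_2_oth[of _ j] dist_norm)
qed

text \<open>The source of Fubini in both coordinate directions at once. In the pair (y, t) the outer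
  variable selects the line and the inner one runs along it.\<close>

lemma lborel_eq_distr_pt:
  "lborel = distr (lborel \<Otimes>\<^sub>M lborel) borel (\<lambda>(y, t). pt j t y)"
proof (rule lborel_eqI)
  fix l u :: "real^2" assume le: "\<And>b. b \<in> Basis \<Longrightarrow> l \<bullet> b \<le> u \<bullet> b"
  have le': "l $ i \<le> u $ i" for i
    using le[of "axis i 1"] by (simp add: inner_axis axis_in_Basis_iff)
  have mem: "x \<in> box l u \<longleftrightarrow> l $ j < x $ j \<and> x $ j < u $ j \<and> l $ oth j < x $ oth j \<and> x $ oth j < u $ oth j" for x
    using UNIV_2_oth[of j] by (auto simp: mem_box_cart)
  have "emeasure (distr (lborel \<Otimes>\<^sub>M lborel) borel (\<lambda>(y, t). pt j t y)) (box l u)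
     = emeasure (lborel \<Otimes>\<^sub>M lborel) ({l $ oth j<..<u $ oth j} \<times> {l $ j<..<u $ j})"
    by (subst emeasure_distr) (auto simp: space_pair_measure mem intro!: arg_cong[where f="emeasure _"])
  also have "\<dots> = ennreal (u $ oth j - l $ oth j) * ennreal (u $ j - l $ j)"
    using le' by (subst lborel.emeasure_pair_measure_Times) auto
  also have "\<dots> = ennreal (\<Prod>i\<in>UNIV. u $ i - l $ i)"
    using le' by (simp add: UNIV_2_oth[of j] ennreal_mult mult.commute)
  also have "(\<Prod>i\<in>UNIV. u $ i - l $ i) = (\<Prod>b\<in>Basis. (u - l) \<bullet> b)"
  proof -
    have B: "(Basis :: (real^2) set) = (\<lambda>i. axis i 1) ` UNIV" by (auto simp: Basis_vec_def)
    have "inj (\<lambda>i::2. axis i (1::real))" by (auto simp: inj_on_def axis_eq_axis)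
    then show ?thesis unfolding B by (subst prod.reindex) (auto simp: inner_axis)
  qed
  finally show "emeasure (distr (lborel \<Otimes>\<^sub>M lborel) borel (\<lambda>(y, t). pt j t y)) (box l u) = ennreal (\<Prod>b\<in>Basis. (u - l) \<bullet> b)" .
qed simp

lemma AE_lborel_pt:
  assumes "AE x in lborel. R x"
  shows "AE y in lborel. AE t in lborel. R (pt j t y)"
proof -
  have "AE z in lborel \<Otimes>\<^sub>M lborel. R ((\<lambda>(y, t). pt j t y) z)"
    using AE_distrD[OF pt_measurable[of j], of R] assms lborel_eq_distr_pt[of j] by metis
  then show ?thesis by (rule lborel_pair.AE_pair[where Q="\<lambda>z. R ((\<lambda>(y, t). pt j t y) z)", simplified])
qed

lemma AE_lborel_ptI:
  assumes [measurable]: "Measurable.pred borel R"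
    and ae: "AE y in lborel. AE t in lborel. R (pt j t y)"
  shows "AE x in lborel. R x"
proof -
  have "AE z in lborel \<Otimes>\<^sub>M lborel. R ((\<lambda>(y, t). pt j t y) z)"
  proof (rule lborel_pair.AE_pair_measure)
    have "(\<lambda>z. (\<lambda>(y, t). pt j t y) z) -` {x. R x} \<inter> space (lborel \<Otimes>\<^sub>M lborel) \<in> sets (lborel \<Otimes>\<^sub>M lborel)"
      by (rule measurable_sets[OF pt_measurable]) simp
    moreover have "{z \<in> space (lborel \<Otimes>\<^sub>M lborel). R ((\<lambda>(y, t). pt j t y) z)}
      = (\<lambda>z. (\<lambda>(y, t). pt j t y) z) -` {x. R x} \<inter> space (lborel \<Otimes>\<^sub>M lborel)" by auto
    ultimately show "{z \<in> space (lborel \<Otimes>\<^sub>M lborel). R ((\<lambda>(y, t). pt j t y) z)} \<in> sets (lborel \<Otimes>\<^sub>M lborel)" by simp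
  qed (use ae in auto)
  then have "AE x in distr (lborel \<Otimes>\<^sub>M lborel) borel (\<lambda>(y, t). pt j t y). R x"
    by (subst AE_distr_iff) auto
  then show ?thesis unfolding lborel_eq_distr_pt[of j, symmetric] .
qed

lemma integrable_lborel_pt:
  fixes f :: "real^2 \<Rightarrow> real"
  assumes f: "integrable lborel f"
  shows "AE y in lborel. integrable lborel (\<lambda>t. f (pt j t y))"
    "integrable lborel (\<lambda>y. LINT t|lborel. f (pt j t y))"
    "(LINT x|lborel. f x) = (LINT y|lborel. LINT t|lborel. f (pt j t y))"
proof -
  have [measurable]: "f \<in> borel_measurable borel" using f borel_measurable_integrable by force
  have i: "integrable (lborel \<Otimes>\<^sub>M lborel) (\<lambda>(y, t). f (pt j t y))"
    using f unfolding lborel_eq_distr_pt[of j] by (subst (asm) integrable_distr_eq) (auto simp: case_prod_unfold)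
  show "AE y in lborel. integrable lborel (\<lambda>t. f (pt j t y))"
    using lborel_pair.AE_integrable_fst'[OF i] by simp
  show "integrable lborel (\<lambda>y. LINT t|lborel. f (pt j t y))"
    using lborel_pair.integrable_fst'[OF i] by simp
  have "(LINT x|lborel. f x) = integral\<^sup>L (lborel \<Otimes>\<^sub>M lborel) (\<lambda>(y, t). f (pt j t y))"
    by (subst lborel_eq_distr_pt[of j], subst integral_distr) (auto simp: case_prod_unfold)
  also have "\<dots> = (LINT y|lborel. LINT t|lborel. f (pt j t y))"
    using lborel_pair.integral_fst'[OF i] by simp
  finally show "(LINT x|lborel. f x) = (LINT y|lborel. LINT t|lborel. f (pt j t y))" .
qed

section \<open>Test functions in the plane\<close>

lemma C1cI:
  fixes \<phi> :: "real^2 \<Rightarrow> real"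
  assumes D: "\<And>x. (\<phi> has_derivative (\<lambda>v. \<Sum>j\<in>UNIV. v $ j * A j x)) (at x)"
    and c: "\<And>j. continuous_on UNIV (A j)"
    and K: "compact K" "K \<subseteq> S" "\<And>x. x \<notin> K \<Longrightarrow> \<phi> x = 0"
  shows "\<phi> \<in> C1c S" and "pd j \<phi> x = A j x"
proof -
  have fd: "frechet_derivative \<phi> (at x) = (\<lambda>v. \<Sum>j\<in>UNIV. v $ j * A j x)" for x
    using frechet_derivative_at[OF D] by simp
  have cl: "closure {x. \<phi> x \<noteq> 0} \<subseteq> K"
    by (rule closure_minimal) (use K compact_imp_closed in auto)
  then have "compact (closure {x. \<phi> x \<noteq> 0})"
    using K(1) by (metis closed_closure compact_Int_closed inf.absorb_iff2)
  then show "\<phi> \<in> C1c S"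
    using cl K differentiableI[OF D] by (auto simp: C1c_def fd intro!: continuous_intros c)
  show "pd j \<phi> x = A j x"
    by (simp add: pd_def fd sum_2_oth[of _ j] axis_def)
qed

lemma C1cD:
  fixes \<phi> :: "real^2 \<Rightarrow> real"
  assumes "\<phi> \<in> C1c S"
  shows "(\<phi> has_derivative (\<lambda>v. \<Sum>j\<in>UNIV. v $ j * pd j \<phi> x)) (at x)"
    "continuous_on UNIV (pd j \<phi>)" "continuous_on UNIV \<phi>"
    "compact (closure {x. \<phi> x \<noteq> 0})" "closure {x. \<phi> x \<noteq> 0} \<subseteq> S"
    "x \<notin> closure {x. \<phi> x \<noteq> 0} \<Longrightarrow> \<phi> x = 0" "x \<notin> closure {x. \<phi> x \<noteq> 0} \<Longrightarrow> pd j \<phi> x = 0"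
proof -
  have d: "\<phi> differentiable (at x)" for x using assms by (simp add: C1c_def)
  then have hd: "(\<phi> has_derivative frechet_derivative \<phi> (at x)) (at x)" for x
    by (simp add: frechet_derivative_works)
  have "frechet_derivative \<phi> (at x) v = (\<Sum>j\<in>UNIV. v $ j * pd j \<phi> x)" for x v
  proof -
    have l: "linear (frechet_derivative \<phi> (at x))" using hd has_derivative_linear by blast
    have "v = (\<Sum>j\<in>UNIV. (v $ j) *\<^sub>R axis j 1)"
      by (auto simp: vec_eq_iff axis_def if_distrib[of "\<lambda>x. _ * x"] sum.delta' cong: if_cong)
    then have "frechet_derivative \<phi> (at x) v = frechet_derivative \<phi> (at x) (\<Sum>j\<in>UNIV. (v $ j) *\<^sub>R axis j 1)" by simp
    also have "\<dots> = (\<Sum>j\<in>UNIV. v $ j * pd j \<phi> x)"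
      by (simp add: linear_sum[OF l] linear_scale[OF l] pd_def)
    finally show ?thesis .
  qed
  then show "(\<phi> has_derivative (\<lambda>v. \<Sum>j\<in>UNIV. v $ j * pd j \<phi> x)) (at x)"
    using hd[of x] by (metis (no_types, lifting) ext)
  show "continuous_on UNIV (pd j \<phi>)" unfolding pd_def[abs_def] using assms by (simp add: C1c_def)
  show "continuous_on UNIV \<phi>"
    using d by (intro differentiable_imp_continuous_on) (simp add: differentiable_on_def)
  show "compact (closure {x. \<phi> x \<noteq> 0})" "closure {x. \<phi> x \<noteq> 0} \<subseteq> S" using assms by (auto simp: C1c_def)
  show "x \<notin> closure {x. \<phi> x \<noteq> 0} \<Longrightarrow> \<phi> x = 0" using closure_subset[of "{x. \<phi> x \<noteq> 0}"] by auto
  assume x: "x \<notin> closure {x. \<phi> x \<noteq> 0}"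
  have "((\<lambda>x. 0) has_derivative (\<lambda>v. 0)) (at x)" by simp
  then have "(\<phi> has_derivative (\<lambda>v. 0)) (at x)"
    by (rule has_derivative_transform_within_open[where s="- closure {x. \<phi> x \<noteq> 0}"])
      (use x closure_subset[of "{x. \<phi> x \<noteq> 0}"] in auto)
  then show "pd j \<phi> x = 0" using frechet_derivative_at[of \<phi> "\<lambda>v. 0" x] by (simp add: pd_def fun_eq_iff)
qed

lemma C1c_line_derivative:
  assumes "\<phi> \<in> C1c S"
  shows "((\<lambda>t. \<phi> (pt j t y)) has_real_derivative pd j \<phi> (pt j t y)) (at t)"
proof -
  have "((\<lambda>t. pt j t y) has_derivative (\<lambda>h. h *\<^sub>R axis j 1)) (at t)"
  proof -
    have "((\<lambda>t. pt j 0 y + t *\<^sub>R axis j 1) has_derivative (\<lambda>h. h *\<^sub>R axis j 1)) (at t)"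
      by (auto intro!: derivative_eq_intros)
    then show ?thesis by (simp flip: pt_add)
  qed
  from diff_chain_at[OF this C1cD(1)[OF assms]]
  have "(\<phi> \<circ> (\<lambda>t. pt j t y) has_derivative (\<lambda>v. \<Sum>i\<in>UNIV. v $ i * pd i \<phi> (pt j t y)) \<circ> (\<lambda>h. h *\<^sub>R axis j 1)) (at t)" .
  moreover have "(\<lambda>v. \<Sum>i\<in>UNIV. v $ i * pd i \<phi> (pt j t y)) \<circ> (\<lambda>h. h *\<^sub>R axis j 1) = (*) (pd j \<phi> (pt j t y))"
    by (rule ext) (simp add: sum_2_oth[of _ j] axis_def)
  ultimately show ?thesis
    unfolding has_field_derivative_def by (simp only: o_def)
qed

lemma C1c_bounded:
  assumes "\<phi> \<in> C1c S"
  obtains C where "\<And>x. \<bar>\<phi> x\<bar> \<le> C" "\<And>x j. \<bar>pd j \<phi> x\<bar> \<le> C" "C \<ge> 0"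
proof -
  let ?K = "closure {x. \<phi> x \<noteq> 0}"
  have *: "\<exists>C. \<forall>x. \<bar>f x\<bar> \<le> C" if "continuous_on UNIV f" "\<And>x. x \<notin> ?K \<Longrightarrow> f x = 0" for f :: "real^2 \<Rightarrow> real"
  proof -
    have "bounded (f ` ?K)"
      by (intro compact_imp_bounded compact_continuous_image C1cD(4)[OF assms] continuous_on_subset[OF that(1)]) auto
    then obtain C where "\<And>x. x \<in> ?K \<Longrightarrow> \<bar>f x\<bar> \<le> C" by (auto simp: bounded_iff)
    then have "\<bar>f x\<bar> \<le> max C 0" for x using that(2)[of x] by (cases "x \<in> ?K") (auto simp: le_max_iff_disj)
    then show ?thesis by blast
  qed
  obtain C0 where 0: "\<And>x. \<bar>\<phi> x\<bar> \<le> C0" using *[OF C1cD(3)[OF assms] C1cD(6)[OF assms]] by blast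
  have "\<forall>j. \<exists>C. \<forall>x. \<bar>pd j \<phi> x\<bar> \<le> C" using *[OF C1cD(2)[OF assms] C1cD(7)[OF assms]] by blast
  then obtain C1 where 1: "\<And>j x. \<bar>pd j \<phi> x\<bar> \<le> C1 j" by metis
  have 1: "\<bar>pd j \<phi> x\<bar> \<le> \<bar>C1 1\<bar> + \<bar>C1 2\<bar>" for j x
    using 1[of j x] exhaust_2[of j] by auto
  show ?thesis
  proof (rule that[of "\<bar>C0\<bar> + (\<bar>C1 1\<bar> + \<bar>C1 2\<bar>)"])
    show "\<bar>\<phi> x\<bar> \<le> \<bar>C0\<bar> + (\<bar>C1 1\<bar> + \<bar>C1 2\<bar>)" for x using 0[of x] by linarith
    show "\<bar>pd j \<phi> x\<bar> \<le> \<bar>C0\<bar> + (\<bar>C1 1\<bar> + \<bar>C1 2\<bar>)" for x j using 1[of j x] by linarith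
  qed simp
qed

lemma C1c_tensor:
  fixes \<alpha> \<beta> :: "real \<Rightarrow> real"
  assumes a: "\<And>x. (\<alpha> has_real_derivative \<alpha>' x) (at x)" "continuous_on UNIV \<alpha>'" "\<And>x. x \<notin> {a..b} \<Longrightarrow> \<alpha> x = 0"
    and b: "\<And>x. (\<beta> has_real_derivative \<beta>' x) (at x)" "continuous_on UNIV \<beta>'" "\<And>x. x \<notin> {c..d} \<Longrightarrow> \<beta> x = 0"
    and S: "\<And>t y. t \<in> {a..b} \<Longrightarrow> y \<in> {c..d} \<Longrightarrow> pt j t y \<in> S"
  shows "(\<lambda>x. \<alpha> (x $ j) * \<beta> (x $ oth j)) \<in> C1c S"
    "pd j (\<lambda>x. \<alpha> (x $ j) * \<beta> (x $ oth j)) x = \<alpha>' (x $ j) * \<beta> (x $ oth j)"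
    "pd (oth j) (\<lambda>x. \<alpha> (x $ j) * \<beta> (x $ oth j)) x = \<alpha> (x $ j) * \<beta>' (x $ oth j)"
proof -
  define A where "A i x = (if i = j then \<alpha>' (x $ j) * \<beta> (x $ oth j) else \<alpha> (x $ j) * \<beta>' (x $ oth j))" for i and x :: "real^2"
  define K where "K = (\<lambda>(t,y). pt j t y) ` ({a..b} \<times> {c..d})"
  have ca: "continuous_on UNIV \<alpha>" and cb: "continuous_on UNIV \<beta>"
    using DERIV_isCont[OF a(1)] DERIV_isCont[OF b(1)] by (auto simp: continuous_on_eq_continuous_at)
  have cv: "continuous_on UNIV (\<lambda>x::real^2. f (x $ i))" if "continuous_on UNIV f" for f :: "real \<Rightarrow> real" and i
    by (rule continuous_on_compose2[OF that]) (auto intro!: continuous_intros)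
  have D: "((\<lambda>x. \<alpha> (x $ j) * \<beta> (x $ oth j)) has_derivative (\<lambda>v. \<Sum>i\<in>UNIV. v $ i * A i x)) (at x)" for x
  proof -
    have pr: "((\<lambda>x::real^2. x $ i) has_derivative (\<lambda>v. v $ i)) (at x)" for i
      by (rule bounded_linear.has_derivative[OF bounded_linear_vec_nth]) simp
    have 1: "((\<lambda>x. \<alpha> (x $ j)) has_derivative (\<lambda>v. \<alpha>' (x $ j) * v $ j)) (at x)"
      using diff_chain_at[OF pr a(1)[THEN has_field_derivative_imp_has_derivative]] by (simp add: o_def)
    have 2: "((\<lambda>x. \<beta> (x $ oth j)) has_derivative (\<lambda>v. \<beta>' (x $ oth j) * v $ oth j)) (at x)"
      using diff_chain_at[OF pr b(1)[THEN has_field_derivative_imp_has_derivative]] by (simp add: o_def)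
    show ?thesis
      by (rule has_derivative_eq_rhs[OF has_derivative_mult[OF 1 2]])
        (auto simp: sum_2_oth[of _ j] A_def algebra_simps)
  qed
  have c: "continuous_on UNIV (A i)" for i
    unfolding A_def by (cases "i = j") (auto intro!: continuous_intros cv ca cb a b)
  have K: "compact K" "K \<subseteq> S"
    unfolding K_def case_prod_unfold using S
    by (auto intro!: compact_continuous_image compact_Times continuous_intros)
  have z: "\<alpha> (x $ j) * \<beta> (x $ oth j) = 0" if "x \<notin> K" for x
  proof (rule ccontr)
    assume "\<not> ?thesis"
    then have "x $ j \<in> {a..b}" "x $ oth j \<in> {c..d}" using a(3) b(3) by force+
    then have "(\<lambda>(t,y). pt j t y) (x $ j, x $ oth j) \<in> K" unfolding K_def by blast
    with that show False by simp
  qed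
  show "(\<lambda>x. \<alpha> (x $ j) * \<beta> (x $ oth j)) \<in> C1c S"
    by (rule C1cI(1)[OF D c K z])
  show "pd j (\<lambda>x. \<alpha> (x $ j) * \<beta> (x $ oth j)) x = \<alpha>' (x $ j) * \<beta> (x $ oth j)"
    "pd (oth j) (\<lambda>x. \<alpha> (x $ j) * \<beta> (x $ oth j)) x = \<alpha> (x $ j) * \<beta>' (x $ oth j)"
    using C1cI(2)[OF D c K z] by (auto simp: A_def)
qed

lemma C1c_mult:
  assumes "\<phi> \<in> C1c S" and D: "\<And>x. (\<rho> has_derivative (\<lambda>v. \<Sum>j\<in>UNIV. v $ j * A j x)) (at x)"
    and c: "\<And>j. continuous_on UNIV (A j)"
  shows "(\<lambda>x. \<rho> x * \<phi> x) \<in> C1c S" "pd j (\<lambda>x. \<rho> x * \<phi> x) x = A j x * \<phi> x + \<rho> x * pd j \<phi> x"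
proof -
  note \<phi> = C1cD[OF assms(1)]
  have cr: "continuous_on UNIV \<rho>"
    using D by (intro differentiable_imp_continuous_on) (auto simp: differentiable_on_def differentiable_def)
  have D': "((\<lambda>x. \<rho> x * \<phi> x) has_derivative (\<lambda>v. \<Sum>j\<in>UNIV. v $ j * (A j x * \<phi> x + \<rho> x * pd j \<phi> x))) (at x)" for x
    by (rule has_derivative_eq_rhs[OF has_derivative_mult[OF D \<phi>(1)]])
      (auto simp: sum_2_oth[of _ 1] algebra_simps)
  have c': "continuous_on UNIV (\<lambda>x. A j x * \<phi> x + \<rho> x * pd j \<phi> x)" for j
    by (intro continuous_intros c cr \<phi>)
  have z: "\<rho> x * \<phi> x = 0" if "x \<notin> closure {x. \<phi> x \<noteq> 0}" for x using \<phi>(6)[OF that] by simp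
  show "(\<lambda>x. \<rho> x * \<phi> x) \<in> C1c S" "pd j (\<lambda>x. \<rho> x * \<phi> x) x = A j x * \<phi> x + \<rho> x * pd j \<phi> x"
    by (rule C1cI[OF D' c' \<phi>(4,5) z], assumption)+
qed

text \<open>The definitions integrate over \<open>lebesgue\<close>, but a Lebesgue measurable
  function may fail to be measurable on a line. A Borel representative is therefore taken before
  lines are considered; the last claim keeps all integrals against Borel factors.\<close>

lemma integrable_lebesgue_borel_rep:
  fixes f :: "'a::euclidean_space \<Rightarrow> real"
  assumes "integrable lebesgue f"
  obtains f' where "integrable lborel f'" "AE x in lborel. f x = f' x"
    "\<And>h. h \<in> borel_measurable borel \<Longrightarrow> (LINT x|lebesgue. f x * h x) = (LINT x|lborel. f' x * h x)"
proof -
  have "f \<in> borel_measurable (completion lborel)" using assms borel_measurable_integrable by blast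
  then obtain f' where m: "f' \<in> borel_measurable lborel" and ae: "AE x in lborel. f x = f' x"
    using completion_ex_borel_measurable_real by blast
  have m'[measurable]: "f' \<in> borel_measurable lebesgue" "f \<in> borel_measurable lebesgue"
    using m assms measurable_completion by blast+
  have ae': "AE x in lebesgue. f x = f' x" using ae by (simp add: AE_completion_iff)
  have "integrable lebesgue f'"
    using assms integrable_cong_AE[of f lebesgue f'] ae' m' by blast
  then have i: "integrable lborel f'" using m integrable_completion[of f' lborel] by simp
  have "(LINT x|lebesgue. f x * h x) = (LINT x|lborel. f' x * h x)" if h: "h \<in> borel_measurable borel" for h
  proof -
    have [measurable]: "h \<in> borel_measurable lebesgue" using measurable_completion[of h lborel borel] h by simp
    have "(LINT x|lebesgue. f x * h x) = (LINT x|lebesgue. f' x * h x)"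
    proof (rule integral_cong_AE)
      show "AE x in lebesgue. f x * h x = f' x * h x" using ae' by eventually_elim simp
    qed measurable
    also have "\<dots> = (LINT x|lborel. f' x * h x)"
      by (rule integral_completion) (use m h in simp)
    finally show ?thesis .
  qed
  with i ae that show ?thesis by blast
qed

text \<open>A plateau, 1 on [a, b] and 0 off [a - e, b + e]. Products of two such functions localise
  to a box, and multiplying by them leaves alone whatever is supported in the box.\<close>

definition plat :: "real \<Rightarrow> real \<Rightarrow> real \<Rightarrow> real \<Rightarrow> real" where
  "plat e a b x = sstep ((x - a) / e + 1) * sstep ((b - x) / e + 1)"

definition plat' :: "real \<Rightarrow> real \<Rightarrow> real \<Rightarrow> real \<Rightarrow> real" where
  "plat' e a b x = shat ((x - a) / e + 1) / e * sstep ((b - x) / e + 1) - sstep ((x - a) / e + 1) * (shat ((b - x) / e + 1) / e)"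

lemma plat_has_real_derivative: "e > 0 \<Longrightarrow> (plat e a b has_real_derivative plat' e a b x) (at x)"
proof -
  assume e: "e > 0"
  have 1: "((\<lambda>x. sstep ((x - a) / e + 1)) has_real_derivative shat ((x - a) / e + 1) * (1 / e)) (at x)"
    by (rule DERIV_chain2[OF sstep_has_real_derivative]) (use e in \<open>auto intro!: derivative_eq_intros\<close>)
  have 2: "((\<lambda>x. sstep ((b - x) / e + 1)) has_real_derivative shat ((b - x) / e + 1) * (- 1 / e)) (at x)"
    by (rule DERIV_chain2[OF sstep_has_real_derivative]) (use e in \<open>auto intro!: derivative_eq_intros\<close>)
  show ?thesis unfolding plat_def[abs_def] plat'_def
    by (rule DERIV_cong[OF DERIV_mult[OF 1 2]]) (simp add: algebra_simps)
qed

lemma continuous_on_plat: "continuous_on UNIV (plat e a b)" "continuous_on UNIV (plat' e a b)"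
  unfolding plat_def[abs_def] plat'_def[abs_def] divide_inverse by (intro continuous_intros)+

lemma plat_eq1: "e > 0 \<Longrightarrow> x \<in> {a..b} \<Longrightarrow> plat e a b x = 1"
  by (simp add: plat_def sstep_ge1)

lemma plat_eq0: "e > 0 \<Longrightarrow> x \<notin> {a-e..b+e} \<Longrightarrow> plat e a b x = 0"
proof -
  assume e: "e > 0" "x \<notin> {a-e..b+e}"
  then have "(x - a) / e + 1 \<le> 0 \<or> (b - x) / e + 1 \<le> 0" by (auto simp: field_simps)
  then show ?thesis by (auto simp: plat_def sstep_le0)
qed

lemma plat_abs_le1: "\<bar>plat e a b x\<bar> \<le> 1"
  unfolding plat_def using sstep_nonneg sstep_le1 by (auto simp: abs_mult intro!: mult_le_one)

text \<open>A C^1 approximation of the indicator of (a, b]. It exceeds the interval by up to 1/(n+1)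
  on the right, so that in test functions it comes with a plateau as a factor.\<close>

definition sind :: "nat \<Rightarrow> real \<Rightarrow> real \<Rightarrow> real \<Rightarrow> real" where
  "sind n a b x = sstep (real (Suc n) * (x - a)) - sstep (real (Suc n) * (x - b))"

definition sind' :: "nat \<Rightarrow> real \<Rightarrow> real \<Rightarrow> real \<Rightarrow> real" where
  "sind' n a b x = real (Suc n) * shat (real (Suc n) * (x - a)) - real (Suc n) * shat (real (Suc n) * (x - b))"

lemma sind_has_real_derivative: "(sind n a b has_real_derivative sind' n a b x) (at x)"
proof -
  have 1: "((\<lambda>x. sstep (real (Suc n) * (x - c))) has_real_derivative shat (real (Suc n) * (x - c)) * real (Suc n)) (at x)" for c
    by (rule DERIV_chain2[OF sstep_has_real_derivative]) (auto intro!: derivative_eq_intros)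
  show ?thesis unfolding sind_def[abs_def] sind'_def
    by (rule DERIV_cong[OF DERIV_diff[OF 1 1]]) (simp only: mult.commute)
qed

lemma continuous_on_sind: "continuous_on UNIV (sind n a b)" "continuous_on UNIV (sind' n a b)"
  unfolding sind_def[abs_def] sind'_def[abs_def] by (intro continuous_intros)+

lemma sind_abs_le1: "\<bar>sind n a b x\<bar> \<le> 1"
  unfolding sind_def using sstep_nonneg[of "real (Suc n) * (x - a)"] sstep_nonneg[of "real (Suc n) * (x - b)"]
    sstep_le1[of "real (Suc n) * (x - a)"] sstep_le1[of "real (Suc n) * (x - b)"] by linarith

lemma sind_tendsto: assumes "a \<le> b" shows "(\<lambda>n. sind n a b x) \<longlonglongrightarrow> indicator {a<..b} x"
proof -
  have "(\<lambda>n. sind n a b x) \<longlonglongrightarrow> (if x - a > 0 then 1 else 0) - (if x - b > 0 then 1 else 0)"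
    unfolding sind_def by (intro tendsto_diff sstep_scale_tendsto)
  also have "(if x - a > 0 then 1 else 0) - (if x - b > 0 then 1 else 0) = (indicator {a<..b} x :: real)"
    using assms by (auto simp: indicator_def)
  finally show ?thesis .
qed

section \<open>The fundamental lemma and uniqueness of weak derivatives\<close>

lemma borel_measurable_cont_nth:
  fixes f :: "real \<Rightarrow> real"
  assumes "continuous_on UNIV f" shows "(\<lambda>x::real^2. f (x $ i)) \<in> borel_measurable borel"
  by (rule borel_measurable_continuous_onI)
    (auto intro!: continuous_on_compose2[OF assms] continuous_intros)

text \<open>The margin of width e around the box is where the plateau functions fall to 0.\<close>

definition boxin :: "2 \<Rightarrow> (real^2) set \<Rightarrow> real \<Rightarrow> real \<Rightarrow> real \<Rightarrow> real \<Rightarrow> real \<Rightarrow> bool" where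
  "boxin j S a b c d e \<longleftrightarrow> 0 < e \<and> (\<forall>t\<in>{a-e..b+e}. \<forall>y\<in>{c-e..d+e}. pt j t y \<in> S)"

text \<open>Rational boxes are countable in number, so an exceptional set for each box yields one
  for all of \<open>S\<close>. Compactness of the segment leaves room for the box and its
  margin.\<close>

lemma rational_box_around_segment:
  assumes "open S" "s \<le> t" "\<And>\<tau>. \<tau> \<in> {s..t} \<Longrightarrow> pt j \<tau> y \<in> S"
  obtains a b c d e :: rat where "boxin j S (of_rat a) (of_rat b) (of_rat c) (of_rat d) (of_rat e)"
    "of_rat a < s" "t < of_rat b" "of_rat c < y" "y < of_rat d"
proof -
  have "compact ((\<lambda>\<tau>. pt j \<tau> y) ` {s..t})" by (intro compact_continuous_image continuous_intros) auto
  moreover have "(\<lambda>\<tau>. pt j \<tau> y) ` {s..t} \<subseteq> S" using assms(3) by auto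
  ultimately obtain r where r: "r > 0" "(\<Union>x\<in>(\<lambda>\<tau>. pt j \<tau> y) ` {s..t}. ball x r) \<subseteq> S"
    using compact_subset_open_imp_ball_epsilon_subset[OF _ assms(1)] by metis
  have in_S: "pt j t' y' \<in> S" if "t' \<in> {s - r/3..t + r/3}" "\<bar>y' - y\<bar> \<le> r/3" for t' y'
  proof -
    \<comment> \<open>The point of [s, t] nearest to t'. Corner and margin use r/6 each, so both
      coordinates are off by at most r/3 and the distance stays below r.\<close>
    define \<tau> where "\<tau> = max s (min t t')"
    have \<tau>: "\<tau> \<in> {s..t}" "\<bar>\<tau> - t'\<bar> \<le> r/3" using that assms(2) r(1) by (auto simp: \<tau>_def max_def min_def)
    have "dist (pt j \<tau> y) (pt j t' y') \<le> \<bar>\<tau> - t'\<bar> + \<bar>y - y'\<bar>" by (rule dist_pt)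
    also have "\<dots> < r" using \<tau> that r(1) by (simp add: abs_minus_commute)
    finally have "pt j t' y' \<in> ball (pt j \<tau> y) r" by simp
    then show ?thesis using r(2) \<tau>(1) by blast
  qed
  have q: "\<exists>q::rat. x < of_rat q \<and> of_rat q < x'" if "x < x'" for x x' :: real
    using of_rat_dense[OF that] by blast
  obtain a b c d e :: rat where "s - r/6 < of_rat a" "of_rat a < s" "t < of_rat b" "of_rat b < t + r/6"
    "y - r/6 < of_rat c" "of_rat c < y" "y < of_rat d" "of_rat d < y + r/6" "0 < (of_rat e::real)" "of_rat e < r/6"
    using q[of "s - r/6" s] q[of t "t + r/6"] q[of "y - r/6" y] q[of y "y + r/6"] q[of 0 "r/6"] r(1) by auto
  note h = this
  have "boxin j S (of_rat a) (of_rat b) (of_rat c) (of_rat d) (of_rat e)"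
    unfolding boxin_def
  proof (intro conjI ballI in_S)
    fix t' y' :: real
    assume t': "t' \<in> {of_rat a - of_rat e..of_rat b + of_rat e}" and y': "y' \<in> {of_rat c - of_rat e..of_rat d + of_rat e}"
    show "t' \<in> {s - r/3..t + r/3}" using t' h by simp
    have "of_rat c - of_rat e \<le> y'" "y' \<le> of_rat d + of_rat e" using y' by auto
    then show "\<bar>y' - y\<bar> \<le> r/3" using h by linarith
  qed (use h in simp)
  then show ?thesis using that h by blast
qed

text \<open>\<open>q\<close> is integrable only against test functions; its product with the plateau
  function \<theta> is integrable on the plane and agrees with \<open>q\<close> on the box. The
  integrals of this product over all rectangles vanish as limits of tests with \<open>sind\<close>,
  and Lebesgue differentiation on cubes finishes.\<close>

lemma fundamental_lemma_box:
  fixes q :: "real^2 \<Rightarrow> real"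
  assumes q: "\<And>\<phi>. \<phi> \<in> C1c S \<Longrightarrow> set_integrable lebesgue S (\<lambda>x. q x * \<phi> x) \<and> (LINT x:S|lebesgue. q x * \<phi> x) = 0"
    and B: "boxin j S a b c d e"
  shows "AE x in lborel. x $ j \<in> {a..b} \<and> x $ oth j \<in> {c..d} \<longrightarrow> q x = 0"
proof -
  have e: "e > 0" using B by (simp add: boxin_def)
  define \<theta> where "\<theta> x = plat e a b (x $ j) * plat e c d (x $ oth j)" for x :: "real^2"
  have "\<theta> \<in> C1c S" unfolding \<theta>_def[abs_def]
    by (rule C1c_tensor(1)[OF plat_has_real_derivative[OF e] continuous_on_plat(2) plat_eq0[OF e]
          plat_has_real_derivative[OF e] continuous_on_plat(2) plat_eq0[OF e]])
      (use B in \<open>auto simp: boxin_def\<close>)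
  then have "integrable lebesgue (\<lambda>x. indicator S x * (q x * \<theta> x))"
    using q[of \<theta>] by (simp add: set_integrable_def)
  then obtain q' where q': "integrable lborel q'" "AE x in lborel. indicator S x * (q x * \<theta> x) = q' x"
    "\<And>h. h \<in> borel_measurable borel \<Longrightarrow> (LINT x|lebesgue. indicator S x * (q x * \<theta> x) * h x) = (LINT x|lborel. q' x * h x)"
    by (rule integrable_lebesgue_borel_rep) blast
  have z: "(LINT x|lborel. q' x * (sind n l u (x $ j) * sind n l' u' (x $ oth j))) = 0" for n l u l' u'
  proof -
    have d: "((\<lambda>x. plat e a b x * sind n l u x) has_real_derivative plat' e a b x * sind n l u x + sind' n l u x * plat e a b x) (at x)" for x a b l u
      by (rule DERIV_mult[OF plat_has_real_derivative[OF e] sind_has_real_derivative])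
    have cc: "continuous_on UNIV (\<lambda>x. plat' e a b x * sind n l u x + sind' n l u x * plat e a b x)" for a b l u
      by (intro continuous_intros continuous_on_plat continuous_on_sind)
    have "(\<lambda>x. plat e a b (x $ j) * sind n l u (x $ j) * (plat e c d (x $ oth j) * sind n l' u' (x $ oth j))) \<in> C1c S"
      by (rule C1c_tensor(1)[OF d cc _ d cc]) (use B plat_eq0[OF e] in \<open>auto simp: boxin_def\<close>)
    from q[OF this] have "(LINT x|lebesgue. indicator S x * (q x * \<theta> x) * (sind n l u (x $ j) * sind n l' u' (x $ oth j))) = 0"
      by (simp add: set_lebesgue_integral_def \<theta>_def mult_ac)
    then show ?thesis
      by (subst (asm) q'(3)) (auto intro!: borel_measurable_times borel_measurable_cont_nth continuous_on_sind)
  qed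
  have z2: "(LINT x|lborel. q' x * (indicator {l<..u} (x $ j) * indicator {l'<..u'} (x $ oth j))) = 0"
    if "l \<le> u" "l' \<le> u'" for l u l' u'
  proof -
    have "(\<lambda>n. LINT x|lborel. q' x * (sind n l u (x $ j) * sind n l' u' (x $ oth j)))
       \<longlonglongrightarrow> (LINT x|lborel. q' x * (indicator {l<..u} (x $ j) * indicator {l'<..u'} (x $ oth j)))"
    proof (rule integral_mult_bounded_tendsto[OF q'(1), where C=1])
      show "AE x in lborel. (\<lambda>n. sind n l u (x $ j) * sind n l' u' (x $ oth j)) \<longlonglongrightarrow> indicator {l<..u} (x $ j) * indicator {l'<..u'} (x $ oth j)"
        by (intro AE_I2 tendsto_mult sind_tendsto that)
      show "\<bar>sind n l u (x $ j) * sind n l' u' (x $ oth j)\<bar> \<le> 1" for n x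
        using sind_abs_le1 by (auto simp: abs_mult intro!: mult_le_one)
    qed (auto intro!: borel_measurable_times borel_measurable_cont_nth continuous_on_sind)
    then show ?thesis unfolding z using LIMSEQ_unique tendsto_const by blast
  qed
  have nul: "AE x in lborel. (x::real^2) $ i \<noteq> r" for i r
  proof (rule AE_lborel_ptI[where j=i])
    show "AE y in lborel. AE t in lborel. pt i t y $ i \<noteq> r"
      using AE_lborel_singleton[of r] by (auto intro!: AE_I2)
  qed simp
  have z3: "integral (cbox l u) q' = 0" if "\<And>i. l $ i \<le> u $ i" for l u
  proof -
    have "set_integrable lborel (cbox l u) q'"
      using integrable_mult_indicator[of "cbox l u" lborel q'] q'(1) by (simp add: set_integrable_def)
    then have "integral (cbox l u) q' = (LINT x:cbox l u|lborel. q' x)"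
      by (rule set_borel_integral_eq_integral(2)[symmetric])
    also have "\<dots> = (LINT x|lborel. q' x * (indicator {l $ j<..u $ j} (x $ j) * indicator {l $ oth j<..u $ oth j} (x $ oth j)))"
      unfolding set_lebesgue_integral_def
    proof (rule integral_cong_AE)
      have [measurable]: "q' \<in> borel_measurable borel" using q'(1) borel_measurable_integrable by force
      show "(\<lambda>x. indicator (cbox l u) x *\<^sub>R q' x) \<in> borel_measurable lborel"
       "(\<lambda>x. q' x * (indicator {l $ j<..u $ j} (x $ j) * indicator {l $ oth j<..u $ oth j} (x $ oth j))) \<in> borel_measurable lborel"
        by measurable
      show "AE x in lborel. indicator (cbox l u) x *\<^sub>R q' x = q' x * (indicator {l $ j<..u $ j} (x $ j) * indicator {l $ oth j<..u $ oth j} (x $ oth j))"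
        using nul[of j "l $ j"] nul[of "oth j" "l $ oth j"]
      proof eventually_elim
        case (elim x)
        have "x \<in> cbox l u \<longleftrightarrow> l $ j \<le> x $ j \<and> x $ j \<le> u $ j \<and> l $ oth j \<le> x $ oth j \<and> x $ oth j \<le> u $ oth j"
          using UNIV_2_oth[of j] by (auto simp: mem_box_cart)
        then show ?case using elim by (auto simp: indicator_def)
      qed
    qed
    finally show ?thesis using z2 that by simp
  qed
  have "q' integrable_on cbox a b" for a b
    by (rule integrable_lborel_imp_integrable_on[OF q'(1)]) simp
  then obtain N where N: "negligible N"
    and k: "\<And>x e. x \<notin> N \<Longrightarrow> 0 < e \<Longrightarrow> \<exists>d>0. \<forall>h. 0 < h \<and> h < d \<longrightarrow>
       norm (integral (cbox x (x + h *\<^sub>R One)) q' /\<^sub>R h ^ DIM(real^2) - q' x) < e"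
    using integrable_ccontinuous_explicit[of q'] by metis
  have q0: "q' x = 0" if "x \<notin> N" for x
  proof (rule ccontr)
    assume "q' x \<noteq> 0"
    then have "0 < norm (q' x)" by simp
    from k[OF that this] obtain d where d: "d > 0" "\<And>h. 0 < h \<Longrightarrow> h < d \<Longrightarrow>
       norm (integral (cbox x (x + h *\<^sub>R One)) q' /\<^sub>R h ^ DIM(real^2) - q' x) < norm (q' x)"
      by blast
    have "integral (cbox x (x + (d/2) *\<^sub>R One)) q' = 0"
    proof (rule z3)
      fix i
      have "(One::real^2) $ i = 1"
        using inner_sum_left_Basis[of "axis i 1 :: real^2" "\<lambda>_. 1"] by (simp add: inner_axis axis_in_Basis_iff)
      then show "x $ i \<le> (x + (d/2) *\<^sub>R One) $ i" using d by simp
    qed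
    with d(2)[of "d/2"] d(1) show False by simp
  qed
  have "AE x in lebesgue. x \<notin> N" using N by (simp add: negligible_iff_null_sets AE_not_in)
  then have "AE x in lborel. x \<notin> N" by (simp add: AE_completion_iff)
  then show ?thesis using q'(2)
  proof eventually_elim
    case (elim x)
    show ?case
    proof
      assume x: "x $ j \<in> {a..b} \<and> x $ oth j \<in> {c..d}"
      have "pt j (x $ j) (x $ oth j) \<in> S" using B x unfolding boxin_def by (auto simp del: pt_eq)
      moreover have "\<theta> x = 1" using x plat_eq1[OF e] by (simp add: \<theta>_def)
      ultimately show "q x = 0" using elim q0[of x] by simp
    qed
  qed
qed

lemma fundamental_lemma:
  fixes q :: "real^2 \<Rightarrow> real"
  assumes S: "open S"
    and q: "\<And>\<phi>. \<phi> \<in> C1c S \<Longrightarrow> set_integrable lebesgue S (\<lambda>x. q x * \<phi> x) \<and> (LINT x:S|lebesgue. q x * \<phi> x) = 0"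
  shows "AE x in lborel. x \<in> S \<longrightarrow> q x = 0"
proof -
  have "AE x in lborel. \<forall>a b c d e::rat. boxin 1 S (of_rat a) (of_rat b) (of_rat c) (of_rat d) (of_rat e) \<longrightarrow>
      x $ 1 \<in> {of_rat a..of_rat b} \<and> x $ oth 1 \<in> {of_rat c..of_rat d} \<longrightarrow> q x = 0"
    unfolding AE_all_countable using fundamental_lemma_box[of S q, OF q] by (auto intro!: AE_I2 AE_impI)
  then show ?thesis
  proof eventually_elim
    case (elim x)
    show ?case
    proof
      assume "x \<in> S"
      then have i: "\<And>\<tau>. \<tau> \<in> {x $ 1..x $ 1} \<Longrightarrow> pt 1 \<tau> (x $ oth 1) \<in> S" by simp
      obtain a b c d e :: rat where "boxin 1 S (of_rat a) (of_rat b) (of_rat c) (of_rat d) (of_rat e)"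
        "of_rat a < x $ 1" "x $ 1 < of_rat b" "of_rat c < x $ oth 1" "x $ oth 1 < of_rat d"
        by (rule rational_box_around_segment[OF S order_refl i])
      then show "q x = 0" using elim[rule_format, of a b c d e] by auto
    qed
  qed
qed

text \<open>\<open>weak_deriv\<close> makes g and g' integrable against each test function, which is
  the form of integrability that \<open>fundamental_lemma\<close> takes.\<close>

lemma weak_deriv_unique:
  assumes "open S" "weak_deriv S j f g" "weak_deriv S j f g'"
  shows "AE x in lborel. x \<in> S \<longrightarrow> g x = g' x"
proof -
  have "AE x in lborel. x \<in> S \<longrightarrow> g x - g' x = 0"
  proof (rule fundamental_lemma[OF assms(1)])
    fix \<phi> assume \<phi>: "\<phi> \<in> C1c S"
    have 1: "set_integrable lebesgue S (\<lambda>x. g x * \<phi> x)" "set_integrable lebesgue S (\<lambda>x. g' x * \<phi> x)"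
      "(LINT x:S|lebesgue. g x * \<phi> x) = (LINT x:S|lebesgue. g' x * \<phi> x)"
      using assms(2,3) \<phi> by (auto simp: weak_deriv_def)
    show "set_integrable lebesgue S (\<lambda>x. (g x - g' x) * \<phi> x) \<and> (LINT x:S|lebesgue. (g x - g' x) * \<phi> x) = 0"
      using set_integral_diff[OF 1(1,2)] 1(3) by (simp add: left_diff_distrib)
  qed
  then show ?thesis by eventually_elim auto
qed

section \<open>Absolute continuity on almost every line\<close>

lemma integral_abs_le_AE:
  fixes f h :: "real \<Rightarrow> real"
  assumes f: "integrable lborel f" and h: "integrable lborel h" and le: "AE x in lborel. \<bar>f x\<bar> \<le> h x"
  shows "\<bar>integral {s..t} f\<bar> \<le> integral {s..t} h"
proof -
  have i: "integrable lborel (\<lambda>x. indicator {s<..t} x * k x)" if "integrable lborel k" for k :: "real \<Rightarrow> real"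
    using integrable_mult_indicator[OF _ that, of "{s<..t}"] by simp
  have "\<bar>LINT x|lborel. indicator {s<..t} x * f x\<bar> \<le> (LINT x|lborel. indicator {s<..t} x * h x)"
  proof (rule integral_norm_bound[THEN order_trans, of lborel "\<lambda>x. indicator {s<..t} x * f x", simplified])
    show "(LINT x|lborel. \<bar>indicator {s<..t} x * f x\<bar>) \<le> (LINT x|lborel. indicator {s<..t} x * h x)"
    proof (rule integral_mono_AE)
      show "AE x in lborel. \<bar>indicator {s<..t} x * f x\<bar> \<le> indicator {s<..t} x * h x"
        using le by eventually_elim (auto simp: indicator_def)
    qed (use i[OF f] i[OF h] in auto)
  qed
  then show ?thesis by (simp add: lborel_integral_Ioc_eq_integral[OF f] lborel_integral_Ioc_eq_integral[OF h])
qed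

text \<open>Test functions are products of a function of the position on the line and a function of
  the line. The second factor is arbitrary, so the one-dimensional identity holds on almost every
  line, for each first factor separately. Rational parameters make the first factors countably many,
  and the du Bois-Reymond lemma applies line by line.\<close>

lemma weak_deriv_box_lines:
  fixes F g \<psi> :: "real^2 \<Rightarrow> real"
  assumes wd: "weak_deriv S j F g" and F: "set_integrable lebesgue S F"
    and gb: "AE x in lborel. x \<in> S \<longrightarrow> \<bar>g x\<bar> \<le> \<psi> x" and \<psi>: "integrable lborel \<psi>" "\<And>x. 0 \<le> \<psi> x"
    and B: "boxin j S a b c d e"
  shows "AE y in lborel. c < y \<and> y < d \<longrightarrow> (\<exists>N\<in>null_sets lborel. \<forall>s t. s < t \<longrightarrow> s \<notin> N \<longrightarrow> t \<notin> N \<longrightarrow> a < s \<longrightarrow> t < b \<longrightarrow>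
     \<bar>F (pt j t y) - F (pt j s y)\<bar> \<le> integral {s..t} (\<lambda>\<tau>. \<psi> (pt j \<tau> y)))"
proof -
  have e: "e > 0" using B by (simp add: boxin_def)
  define \<theta> where "\<theta> x = plat e a b (x $ j) * plat e c d (x $ oth j)" for x :: "real^2"
  have "\<theta> \<in> C1c S" unfolding \<theta>_def[abs_def]
    by (rule C1c_tensor(1)[OF plat_has_real_derivative[OF e] continuous_on_plat(2) plat_eq0[OF e]
          plat_has_real_derivative[OF e] continuous_on_plat(2) plat_eq0[OF e]])
      (use B in \<open>auto simp: boxin_def\<close>)
  then have "integrable lebesgue (\<lambda>x. indicator S x * (g x * \<theta> x))"
    using wd by (simp add: weak_deriv_def set_integrable_def)
  then obtain g1 where g1: "integrable lborel g1" "AE x in lborel. indicator S x * (g x * \<theta> x) = g1 x"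
    "\<And>h. h \<in> borel_measurable borel \<Longrightarrow> (LINT x|lebesgue. indicator S x * (g x * \<theta> x) * h x) = (LINT x|lborel. g1 x * h x)"
    by (rule integrable_lebesgue_borel_rep) blast
  have "integrable lebesgue (\<lambda>x. indicator S x * F x)" using F by (simp add: set_integrable_def)
  then obtain F1 where F1: "integrable lborel F1" "AE x in lborel. indicator S x * F x = F1 x"
    "\<And>h. h \<in> borel_measurable borel \<Longrightarrow> (LINT x|lebesgue. indicator S x * F x * h x) = (LINT x|lborel. F1 x * h x)"
    by (rule integrable_lebesgue_borel_rep) blast
  have g1b: "AE x in lborel. \<bar>g1 x\<bar> \<le> \<psi> x"
    using gb g1(2)
  proof eventually_elim
    case (elim x)
    have t1: "\<bar>\<theta> x\<bar> \<le> 1" unfolding \<theta>_def abs_mult using plat_abs_le1 by (auto intro!: mult_le_one)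
    show ?case
    proof (cases "x \<in> S")
      case True
      then have "\<bar>g1 x\<bar> = \<bar>g x\<bar> * \<bar>\<theta> x\<bar>" using elim by (simp flip: elim(2) add: abs_mult)
      also have "\<dots> \<le> \<psi> x * 1" using elim True t1 by (intro mult_mono) auto
      finally show ?thesis by simp
    next
      case False
      then have "g1 x = 0" using elim by (simp flip: elim(2))
      then show ?thesis using \<psi> by simp
    qed
  qed
  \<comment> \<open>Here the exceptional set of lines still depends on the trapezoid.\<close>
  have key: "AE y in lborel. c < y \<longrightarrow> y < d \<longrightarrow>
     (LINT t|lborel. F1 (pt j t y) * trap' (real (Suc n)) p q r t) + (LINT t|lborel. g1 (pt j t y) * trap (real (Suc n)) p q r t) = 0"
    if pq: "0 < r" "a < p" "p < q" "q + r + 1 / real (Suc n) < b" for p q r n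
  proof -
    let ?A = "trap (real (Suc n)) p q r" and ?A' = "trap' (real (Suc n)) p q r"
    define G where "G x = F1 x * ?A' (x $ j) + g1 x * ?A (x $ j)" for x
    have iF: "integrable lborel (\<lambda>x. F1 x * ?A' (x $ j))"
      by (rule integrable_mult_bounded[OF F1(1) _ trap'_abs_le[OF pq(1)]])
        (auto intro!: borel_measurable_cont_nth continuous_on_trap)
    have ig: "integrable lborel (\<lambda>x. g1 x * ?A (x $ j))"
      by (rule integrable_mult_bounded[OF g1(1) _ trap_abs_le1])
        (use pq in \<open>auto intro!: borel_measurable_cont_nth continuous_on_trap\<close>)
    have iG: "integrable lborel G" unfolding G_def[abs_def] by (intro Bochner_Integration.integrable_add iF ig)
    have sup: "?A x = 0" if "x \<notin> {a..b}" for x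
      by (rule trap_outside(1)) (use that pq in \<open>auto simp del: of_nat_Suc\<close>)
    \<comment> \<open>The trapezoid lives where the plateau is 1. Inserting the plateau replaces
      \<open>g\<close> by the globally integrable \<open>g1\<close>.\<close>
    have Apl: "?A x * plat e a b x = ?A x" for x
      using sup[of x] plat_eq1[OF e, of x a b] by (cases "x \<in> {a..b}") auto
    \<comment> \<open>The defect of the one-dimensional identity on the line at y. Testing in the y
      variable shows that its integrals over intervals vanish.\<close>
    define w where "w y = (LINT t|lborel. G (pt j t y))" for y
    have iq: "integrable lborel w" unfolding w_def[abs_def] by (rule integrable_lborel_pt(2)[OF iG])
    have "integral {c1..d1} w = 0" if cd: "c < c1" "c1 < d1" "d1 < d" for c1 d1
    proof -
      have ts: "(LINT x|lborel. (F1 x * ?A' (x $ j)) * (plat e c d (x $ oth j) * sind m c1 d1 (x $ oth j)))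
         + (LINT x|lborel. (g1 x * ?A (x $ j)) * sind m c1 d1 (x $ oth j)) = 0" for m
      proof -
        let ?\<beta> = "\<lambda>x. plat e c d x * sind m c1 d1 x"
        let ?\<phi> = "\<lambda>x. ?A (x $ j) * ?\<beta> (x $ oth j)"
        have d2: "(?\<beta> has_real_derivative plat' e c d x * sind m c1 d1 x + sind' m c1 d1 x * plat e c d x) (at x)" for x
          by (rule DERIV_mult[OF plat_has_real_derivative[OF e] sind_has_real_derivative])
        have c2: "continuous_on UNIV (\<lambda>x. plat' e c d x * sind m c1 d1 x + sind' m c1 d1 x * plat e c d x)"
          by (intro continuous_intros continuous_on_plat continuous_on_sind)
        have s2: "?\<beta> x = 0" if "x \<notin> {c-e..d+e}" for x using plat_eq0[OF e that] by simp
        have m0: "real (Suc n) > 0" by simp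
        have inS: "pt j t y \<in> S" if "t \<in> {a..b}" "y \<in> {c-e..d+e}" for t y
          using B that e by (auto simp: boxin_def)
        note T = C1c_tensor[OF trap_has_real_derivative[OF m0] continuous_on_trap(2) sup d2 c2 s2 inS]
        have \<phi>: "?\<phi> \<in> C1c S" by (rule T(1))
        have pdp: "pd j ?\<phi> x = ?A' (x $ j) * ?\<beta> (x $ oth j)" for x by (rule T(2))
        have "(LINT x:S|lebesgue. F x * pd j ?\<phi> x) = - (LINT x:S|lebesgue. g x * ?\<phi> x)"
          using wd \<phi> by (auto simp: weak_deriv_def)
        moreover have "(LINT x:S|lebesgue. F x * pd j ?\<phi> x) = (LINT x|lebesgue. indicator S x * F x * (?A' (x $ j) * ?\<beta> (x $ oth j)))"
          unfolding set_lebesgue_integral_def pdp by (simp add: mult_ac)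
        moreover have "(LINT x:S|lebesgue. g x * ?\<phi> x) = (LINT x|lebesgue. indicator S x * (g x * \<theta> x) * (?A (x $ j) * sind m c1 d1 (x $ oth j)))"
          unfolding set_lebesgue_integral_def \<theta>_def
        proof (rule Bochner_Integration.integral_cong[OF refl])
          fix x
          have "g x * ?\<phi> x = g x * ((?A (x $ j) * plat e a b (x $ j)) * ?\<beta> (x $ oth j))" by (simp only: Apl)
          then show "indicator S x *\<^sub>R (g x * ?\<phi> x) = indicator S x * (g x * (plat e a b (x $ j) * plat e c d (x $ oth j))) * (?A (x $ j) * sind m c1 d1 (x $ oth j))"
            by (auto simp: mult_ac)
        qed
        moreover have "(LINT x|lebesgue. indicator S x * F x * (?A' (x $ j) * ?\<beta> (x $ oth j))) = (LINT x|lborel. F1 x * (?A' (x $ j) * ?\<beta> (x $ oth j)))"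
          by (rule F1(3)) (auto intro!: borel_measurable_times borel_measurable_cont_nth continuous_on_mult continuous_on_trap continuous_on_plat continuous_on_sind)
        moreover have "(LINT x|lebesgue. indicator S x * (g x * \<theta> x) * (?A (x $ j) * sind m c1 d1 (x $ oth j))) = (LINT x|lborel. g1 x * (?A (x $ j) * sind m c1 d1 (x $ oth j)))"
          by (rule g1(3)) (auto intro!: borel_measurable_times borel_measurable_cont_nth continuous_on_mult continuous_on_trap continuous_on_plat continuous_on_sind)
        ultimately show ?thesis by (simp add: mult.assoc)
      qed
      have l1: "(\<lambda>m. LINT x|lborel. (F1 x * ?A' (x $ j)) * (plat e c d (x $ oth j) * sind m c1 d1 (x $ oth j)))
        \<longlonglongrightarrow> (LINT x|lborel. (F1 x * ?A' (x $ j)) * indicator {c1<..d1} (x $ oth j))"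
      proof (rule integral_mult_bounded_tendsto[OF iF, where C=1])
        show "AE x in lborel. (\<lambda>m. plat e c d (x $ oth j) * sind m c1 d1 (x $ oth j)) \<longlonglongrightarrow> indicator {c1<..d1} (x $ oth j)"
        proof (rule AE_I2)
          fix x :: "real^2"
          have "(\<lambda>m. plat e c d (x $ oth j) * sind m c1 d1 (x $ oth j)) \<longlonglongrightarrow> plat e c d (x $ oth j) * indicator {c1<..d1} (x $ oth j)"
            by (intro tendsto_mult tendsto_const sind_tendsto) (use cd in simp)
          moreover have "plat e c d (x $ oth j) * indicator {c1<..d1} (x $ oth j) = indicator {c1<..d1} (x $ oth j)"
            using plat_eq1[OF e, of "x $ oth j" c d] cd by (auto simp: indicator_def)
          ultimately show "(\<lambda>m. plat e c d (x $ oth j) * sind m c1 d1 (x $ oth j)) \<longlonglongrightarrow> indicator {c1<..d1} (x $ oth j)" by simp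
        qed
        show "\<bar>plat e c d (x $ oth j) * sind m c1 d1 (x $ oth j)\<bar> \<le> 1" for m x
          using sind_abs_le1 plat_abs_le1 by (auto simp: abs_mult intro!: mult_le_one)
      qed (auto intro!: borel_measurable_times borel_measurable_cont_nth continuous_on_mult continuous_on_sind continuous_on_plat)
      have l2: "(\<lambda>m. LINT x|lborel. (g1 x * ?A (x $ j)) * sind m c1 d1 (x $ oth j))
        \<longlonglongrightarrow> (LINT x|lborel. (g1 x * ?A (x $ j)) * indicator {c1<..d1} (x $ oth j))"
        by (rule integral_mult_bounded_tendsto[OF ig, where C=1])
          (use cd sind_abs_le1 in \<open>auto intro!: borel_measurable_cont_nth continuous_on_sind sind_tendsto AE_I2\<close>)
      have "(LINT x|lborel. (F1 x * ?A' (x $ j)) * indicator {c1<..d1} (x $ oth j))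
        + (LINT x|lborel. (g1 x * ?A (x $ j)) * indicator {c1<..d1} (x $ oth j)) = 0"
        using tendsto_add[OF l1 l2] unfolding ts using LIMSEQ_unique tendsto_const by blast
      moreover have "(LINT x|lborel. (F1 x * ?A' (x $ j)) * indicator {c1<..d1} (x $ oth j))
        + (LINT x|lborel. (g1 x * ?A (x $ j)) * indicator {c1<..d1} (x $ oth j)) = (LINT x|lborel. G x * indicator {c1<..d1} (x $ oth j))"
      proof (subst Bochner_Integration.integral_add[symmetric])
        show "integrable lborel (\<lambda>x. F1 x * ?A' (x $ j) * indicator {c1<..d1} (x $ oth j))"
          by (rule integrable_mult_bounded[OF iF, where C=1]) auto
        show "integrable lborel (\<lambda>x. g1 x * ?A (x $ j) * indicator {c1<..d1} (x $ oth j))"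
          by (rule integrable_mult_bounded[OF ig, where C=1]) auto
      qed (simp add: G_def distrib_right)
      moreover have "(LINT x|lborel. G x * indicator {c1<..d1} (x $ oth j)) = (LINT y|lborel. indicator {c1<..d1} y * w y)"
      proof -
        have iGi: "integrable lborel (\<lambda>x. G x * indicator {c1<..d1} (x $ oth j))"
          by (rule integrable_mult_bounded[OF iG, where C=1]) auto
        show ?thesis unfolding integrable_lborel_pt(3)[OF iGi, of j] w_def by (simp add: mult.commute)
      qed
      ultimately show ?thesis by (simp add: lborel_integral_Ioc_eq_integral[OF iq])
    qed
    then have "AE y in lborel. c < y \<longrightarrow> y < d \<longrightarrow> w y = 0"
      by (rule AE_lborel_zero_if_interval_integrals_zero[OF iq])
    then show ?thesis
      using integrable_lborel_pt(1)[OF iF, of j] integrable_lborel_pt(1)[OF ig, of j]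
      by eventually_elim (auto simp: w_def G_def)
  qed
  \<comment> \<open>Only countably many trapezoids remain, so one exceptional set of lines serves
    them all.\<close>
  have key2: "AE y in lborel. \<forall>(p::rat) (q::rat) (r::rat) n. 0 < (of_rat r::real) \<longrightarrow> a < of_rat p \<longrightarrow> (of_rat p::real) < of_rat q \<longrightarrow> of_rat q + of_rat r + 1 / real (Suc n) < b
     \<longrightarrow> c < y \<longrightarrow> y < d \<longrightarrow>
     (LINT t|lborel. F1 (pt j t y) * trap' (real (Suc n)) (of_rat p) (of_rat q) (of_rat r) t) + (LINT t|lborel. g1 (pt j t y) * trap (real (Suc n)) (of_rat p) (of_rat q) (of_rat r) t) = 0"
    unfolding AE_all_countable by (intro allI AE_impI key)
  show ?thesis
    using key2 integrable_lborel_pt(1)[OF F1(1), of j] integrable_lborel_pt(1)[OF g1(1), of j]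
      integrable_lborel_pt(1)[OF \<psi>(1), of j] AE_lborel_pt[OF g1b, of j] AE_lborel_pt[OF F1(2), of j]
  proof eventually_elim
    case (elim y)
    show ?case
    proof
      assume y: "c < y \<and> y < d"
      have H: "(LINT x|lborel. F1 (pt j x y) * trap' (real (Suc n)) p q r x) = - (LINT x|lborel. g1 (pt j x y) * trap (real (Suc n)) p q r x)"
        if "p \<in> \<rat>" "q \<in> \<rat>" "r \<in> \<rat>" "0 < r" "a < p" "p < q" "q + r + 1 / real (Suc n) < b" for p q r n
      proof -
        obtain p' q' r' where "p = of_rat p'" "q = of_rat q'" "r = of_rat r'"
          using \<open>p \<in> \<rat>\<close> \<open>q \<in> \<rat>\<close> \<open>r \<in> \<rat>\<close> by (auto elim!: Rats_cases)
        with elim(1)[rule_format, of r' p' q' n] that(4-) y show ?thesis by (simp add: eq_neg_iff_add_eq_0)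
      qed
      have "\<exists>N1\<in>null_sets lborel. \<forall>s t. s < t \<longrightarrow> s \<notin> N1 \<longrightarrow> t \<notin> N1 \<longrightarrow> a < s \<longrightarrow> t < b \<longrightarrow>
        F1 (pt j t y) - F1 (pt j s y) = integral {s..t} (\<lambda>\<tau>. g1 (pt j \<tau> y))"
      proof (rule du_Bois_Reymond[where l=a and r=b, OF elim(2,3)], goal_cases)
        case (1 p q r n)
        then show ?case by (rule H)
      next
        case (2 N)
        then show ?case by (intro bexI[of _ N] allI impI) auto
      qed
      then obtain N1 where N1: "N1 \<in> null_sets lborel"
        "\<And>s t. s < t \<Longrightarrow> s \<notin> N1 \<Longrightarrow> t \<notin> N1 \<Longrightarrow> a < s \<Longrightarrow> t < b \<Longrightarrow> F1 (pt j t y) - F1 (pt j s y) = integral {s..t} (\<lambda>\<tau>. g1 (pt j \<tau> y))"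
        by blast
      obtain N2 where N2: "N2 \<in> null_sets lborel" "\<And>t. t \<notin> N2 \<Longrightarrow> indicator S (pt j t y) * F (pt j t y) = F1 (pt j t y)"
        using AE_E3[OF elim(6)] by (auto simp: space_lborel)
      show "\<exists>N\<in>null_sets lborel. \<forall>s t. s < t \<longrightarrow> s \<notin> N \<longrightarrow> t \<notin> N \<longrightarrow> a < s \<longrightarrow> t < b \<longrightarrow>
         \<bar>F (pt j t y) - F (pt j s y)\<bar> \<le> integral {s..t} (\<lambda>\<tau>. \<psi> (pt j \<tau> y))"
      proof (intro bexI[of _ "N1 \<union> N2"] allI impI)
        show "N1 \<union> N2 \<in> null_sets lborel" using N1 N2 by auto
        fix s t assume st: "s < t" "s \<notin> N1 \<union> N2" "t \<notin> N1 \<union> N2" "a < s" "t < b"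
        have "pt j s y \<in> S" "pt j t y \<in> S" using B st y by (auto simp: boxin_def)
        then have "F (pt j t y) - F (pt j s y) = F1 (pt j t y) - F1 (pt j s y)"
          using N2(2)[of s] N2(2)[of t] st by simp
        also have "\<dots> = integral {s..t} (\<lambda>\<tau>. g1 (pt j \<tau> y))" using N1(2) st by auto
        finally show "\<bar>F (pt j t y) - F (pt j s y)\<bar> \<le> integral {s..t} (\<lambda>\<tau>. \<psi> (pt j \<tau> y))"
          using integral_abs_le_AE[OF elim(3,4,5)] by simp
      qed
    qed
  qed
qed

text \<open>A segment inside \<open>S\<close> lies in one rational box. The exceptional set on a
  line is the union over the countably many boxes that belong to this line.\<close>

lemma weak_deriv_lines:
  fixes F g \<psi> :: "real^2 \<Rightarrow> real"
  assumes S: "open S" and wd: "weak_deriv S j F g" and F: "set_integrable lebesgue S F"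
    and gb: "AE x in lborel. x \<in> S \<longrightarrow> \<bar>g x\<bar> \<le> \<psi> x" and \<psi>: "integrable lborel \<psi>" "\<And>x. 0 \<le> \<psi> x"
  shows "AE y in lborel. \<exists>N\<in>null_sets lborel. \<forall>s t. s < t \<longrightarrow> s \<notin> N \<longrightarrow> t \<notin> N \<longrightarrow> (\<forall>\<tau>\<in>{s..t}. pt j \<tau> y \<in> S) \<longrightarrow>
     \<bar>F (pt j t y) - F (pt j s y)\<bar> \<le> integral {s..t} (\<lambda>\<tau>. \<psi> (pt j \<tau> y))"
proof -
  have "AE y in lborel. \<forall>i::rat\<times>rat\<times>rat\<times>rat\<times>rat. (\<lambda>(a,b,c,d,e). boxin j S (of_rat a) (of_rat b) (of_rat c) (of_rat d) (of_rat e) \<longrightarrow>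
     of_rat c < y \<and> y < of_rat d \<longrightarrow> (\<exists>N\<in>null_sets lborel. \<forall>s t. s < t \<longrightarrow> s \<notin> N \<longrightarrow> t \<notin> N \<longrightarrow> of_rat a < s \<longrightarrow> t < of_rat b \<longrightarrow>
     \<bar>F (pt j t y) - F (pt j s y)\<bar> \<le> integral {s..t} (\<lambda>\<tau>. \<psi> (pt j \<tau> y)))) i"
    unfolding AE_all_countable
  proof (intro allI, clarify)
    fix a b c d e :: rat
    show "AE y in lborel. boxin j S (of_rat a) (of_rat b) (of_rat c) (of_rat d) (of_rat e) \<longrightarrow>
     of_rat c < y \<and> y < of_rat d \<longrightarrow> (\<exists>N\<in>null_sets lborel. \<forall>s t. s < t \<longrightarrow> s \<notin> N \<longrightarrow> t \<notin> N \<longrightarrow> of_rat a < s \<longrightarrow> t < of_rat b \<longrightarrow>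
     \<bar>F (pt j t y) - F (pt j s y)\<bar> \<le> integral {s..t} (\<lambda>\<tau>. \<psi> (pt j \<tau> y)))"
      by (intro AE_impI weak_deriv_box_lines[OF wd F gb \<psi>])
  qed
  then show ?thesis
  proof eventually_elim
    case (elim y)
    define G where "G i \<longleftrightarrow> (\<lambda>(a,b,c,d,e). boxin j S (of_rat a) (of_rat b) (of_rat c) (of_rat d) (of_rat e) \<and> of_rat c < y \<and> y < of_rat d) i" for i :: "rat\<times>rat\<times>rat\<times>rat\<times>rat"
    have "\<forall>i\<in>Collect G. \<exists>N\<in>null_sets lborel. \<forall>s t. s < t \<longrightarrow> s \<notin> N \<longrightarrow> t \<notin> N \<longrightarrow> of_rat (fst i) < s \<longrightarrow> t < of_rat (fst (snd i)) \<longrightarrow>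
     \<bar>F (pt j t y) - F (pt j s y)\<bar> \<le> integral {s..t} (\<lambda>\<tau>. \<psi> (pt j \<tau> y))"
    proof
      fix i assume "i \<in> Collect G"
      moreover obtain a b c d e where "i = (a,b,c,d,e)" by (cases i) auto
      ultimately show "\<exists>N\<in>null_sets lborel. \<forall>s t. s < t \<longrightarrow> s \<notin> N \<longrightarrow> t \<notin> N \<longrightarrow> of_rat (fst i) < s \<longrightarrow> t < of_rat (fst (snd i)) \<longrightarrow>
     \<bar>F (pt j t y) - F (pt j s y)\<bar> \<le> integral {s..t} (\<lambda>\<tau>. \<psi> (pt j \<tau> y))"
        using elim[rule_format, of "(a,b,c,d,e)"] by (simp add: G_def)
    qed
    then obtain NN where NN: "\<And>i. G i \<Longrightarrow> NN i \<in> null_sets lborel"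
      "\<And>i s t. G i \<Longrightarrow> s < t \<Longrightarrow> s \<notin> NN i \<Longrightarrow> t \<notin> NN i \<Longrightarrow> of_rat (fst i) < s \<Longrightarrow> t < of_rat (fst (snd i)) \<Longrightarrow>
        \<bar>F (pt j t y) - F (pt j s y)\<bar> \<le> integral {s..t} (\<lambda>\<tau>. \<psi> (pt j \<tau> y))"
      unfolding bchoice_iff by (metis mem_Collect_eq)
    show ?case
    proof (intro bexI[of _ "\<Union>i\<in>Collect G. NN i"] allI impI)
      show "(\<Union>i\<in>Collect G. NN i) \<in> null_sets lborel"
        by (rule null_sets_UN') (use NN in auto)
      fix s t assume st: "s < t" "s \<notin> (\<Union>i\<in>Collect G. NN i)" "t \<notin> (\<Union>i\<in>Collect G. NN i)" "\<forall>\<tau>\<in>{s..t}. pt j \<tau> y \<in> S"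
      have inS: "\<And>\<tau>. \<tau> \<in> {s..t} \<Longrightarrow> pt j \<tau> y \<in> S" using st(4) by blast
      obtain a b c d e :: rat where h: "boxin j S (of_rat a) (of_rat b) (of_rat c) (of_rat d) (of_rat e)"
        "of_rat a < s" "t < of_rat b" "of_rat c < y" "y < of_rat d"
        by (rule rational_box_around_segment[OF S less_imp_le[OF st(1)] inS])
      then have "G (a,b,c,d,e)" by (simp add: G_def)
      from NN(2)[OF this st(1)] st(2,3) h this
      show "\<bar>F (pt j t y) - F (pt j s y)\<bar> \<le> integral {s..t} (\<lambda>\<tau>. \<psi> (pt j \<tau> y))" by auto
    qed
  qed
qed

lemma absolutely_continuous_interval:
  fixes f w :: "real \<Rightarrow> real"
  assumes ab: "a \<le> b" and w: "integrable lborel w" and w0: "\<And>x. 0 \<le> w x"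
    and bd: "\<And>s t. a \<le> s \<Longrightarrow> s < t \<Longrightarrow> t \<le> b \<Longrightarrow> \<bar>f t - f s\<bar> \<le> integral {s..t} w"
  shows "\<exists>p. integrable lborel p \<and> (\<forall>s t. a \<le> s \<longrightarrow> s \<le> t \<longrightarrow> t \<le> b \<longrightarrow> f t - f s = integral {s..t} p) \<and>
    (AE x in lborel. a < x \<longrightarrow> x < b \<longrightarrow> (f has_real_derivative p x) (at x) \<and> \<bar>p x\<bar> \<le> w x)"
proof -
  define c where "c x = max a (min b x)" for x
  define f' where "f' x = f (c x)" for x
  have c: "a \<le> c x" "c x \<le> b" for x using ab by (auto simp: c_def)
  have io: "w integrable_on {s..t}" for s t by (rule integrable_lborel_imp_integrable_on[OF w]) simp
  have cm: "s \<le> t \<Longrightarrow> c s \<le> c t" for s t by (auto simp: c_def)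
  have bd': "\<bar>f' t - f' s\<bar> \<le> integral {s..t} w" if "s \<le> t" for s t
  proof (cases "c s = c t")
    case True
    then show ?thesis using integral_nonneg[OF io] w0 by (simp add: f'_def)
  next
    case False
    then have "\<bar>f' t - f' s\<bar> \<le> integral {c s..c t} w"
      unfolding f'_def using cm[OF that] c by (intro bd) auto
    also have "\<dots> \<le> integral {s..t} w"
    proof (rule integral_subset_le[OF _ io io])
      show "{c s..c t} \<subseteq> {s..t}" using False that unfolding c_def by (auto simp: max_def min_def split: if_splits)
    qed (use w0 in auto)
    finally show ?thesis .
  qed
  have "\<exists>p. integrable lborel p \<and> (\<forall>s t. s \<le> t \<longrightarrow> f' t - f' s = integral {s..t} p) \<and>
    (AE x in lborel. (f' has_real_derivative p x) (at x)) \<and> (AE x in lborel. \<bar>p x\<bar> \<le> w x)"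
  proof (rule absolutely_continuous_density[OF w w0, of f'], goal_cases)
    case (1 s t)
    then show ?case by (rule bd')
  next
    case (2 p)
    then show ?case by (intro exI[of _ p]) simp
  qed
  then obtain p where p: "integrable lborel p" "\<And>s t. s \<le> t \<Longrightarrow> f' t - f' s = integral {s..t} p"
    "AE x in lborel. (f' has_real_derivative p x) (at x)" "AE x in lborel. \<bar>p x\<bar> \<le> w x" by blast
  have "f t - f s = integral {s..t} p" if "a \<le> s" "s \<le> t" "t \<le> b" for s t
    using p(2)[OF that(2)] that by (simp add: f'_def c_def)
  moreover have "AE x in lborel. a < x \<longrightarrow> x < b \<longrightarrow> (f has_real_derivative p x) (at x) \<and> \<bar>p x\<bar> \<le> w x"
    using p(3,4)
  proof eventually_elim
    case (elim x)
    show ?case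
    proof (intro impI conjI elim(2))
      assume x: "a < x" "x < b"
      show "(f has_real_derivative p x) (at x)"
        by (rule has_field_derivative_transform_within_open[OF elim(1), of "{a<..<b}"])
          (use x in \<open>auto simp: f'_def c_def\<close>)
    qed
  qed
  ultimately show ?thesis using p(1) by blast
qed

text \<open>This is the preceding lemma applied to the product of \<open>f\<close> and \<open>\<phi>\<close>.\<close>

lemma absolutely_continuous_by_parts:
  fixes f w \<phi> :: "real \<Rightarrow> real"
  assumes ab: "a \<le> b" and w: "integrable lborel w" and w0: "\<And>x. 0 \<le> w x"
    and bd: "\<And>s t. a \<le> s \<Longrightarrow> s < t \<Longrightarrow> t \<le> b \<Longrightarrow> \<bar>f t - f s\<bar> \<le> integral {s..t} w"
    and \<phi>: "\<And>x. (\<phi> has_real_derivative \<phi>' x) (at x)" "\<And>x. \<bar>\<phi> x\<bar> \<le> C" "\<And>x. \<bar>\<phi>' x\<bar> \<le> C" "\<phi> a = 0" "\<phi> b = 0"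
    and g: "AE x in lborel. a < x \<longrightarrow> x < b \<longrightarrow> (f has_real_derivative g x) (at x)"
  shows "(LINT x|lborel. indicator {a<..b} x * (g x * \<phi> x + f x * \<phi>' x)) = 0"
proof -
  have C0: "C \<ge> 0" using \<phi>(2)[of 0] by linarith
  have io: "w integrable_on {s..t}" for s t by (rule integrable_lborel_imp_integrable_on[OF w]) simp
  define M where "M = \<bar>f a\<bar> + integral {a..b} w"
  have M: "\<bar>f x\<bar> \<le> M" if "a \<le> x" "x \<le> b" for x
  proof (cases "x = a")
    case True
    then show ?thesis using integral_nonneg[OF io] w0 by (simp add: M_def)
  next
    case False
    then have "\<bar>f x - f a\<bar> \<le> integral {a..x} w" using bd[of a x] that by auto
    also have "\<dots> \<le> integral {a..b} w" by (rule integral_subset_le[OF _ io io]) (use that w0 in auto)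
    finally show ?thesis unfolding M_def by linarith
  qed
  have M0: "M \<ge> 0" using M[of a] ab by linarith
  \<comment> \<open>From \<Delta>(f \<phi>) = \<Delta>f \<phi>(t) + f(s) \<Delta>\<phi>: the first
    term costs C w, the second the bound M of |f| times the Lipschitz constant C of \<phi>.\<close>
  define w2 where "w2 x = C * w x + (M * C) * indicator {a..b} x" for x
  have w2: "integrable lborel w2" unfolding w2_def[abs_def]
    by (intro Bochner_Integration.integrable_add Bochner_Integration.integrable_mult_right w)
      (simp add: integrable_indicator_iff ab)
  have w20: "0 \<le> w2 x" for x unfolding w2_def using C0 M0 w0 by simp
  have bd2: "\<bar>f t * \<phi> t - f s * \<phi> s\<bar> \<le> integral {s..t} w2" if st: "a \<le> s" "s < t" "t \<le> b" for s t
  proof -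
    have "\<exists>z>s. z < t \<and> \<phi> t - \<phi> s = (t - s) * \<phi>' z"
      using MVT2[OF st(2), of \<phi> \<phi>'] \<phi>(1) by blast
    then obtain z where z: "\<phi> t - \<phi> s = (t - s) * \<phi>' z" by blast
    have 1: "\<bar>\<phi> t - \<phi> s\<bar> \<le> C * (t - s)" unfolding z abs_mult using \<phi>(3)[of z] st by (simp add: mult.commute mult_right_mono)
    have "f t * \<phi> t - f s * \<phi> s = (f t - f s) * \<phi> t + f s * (\<phi> t - \<phi> s)" by (simp add: algebra_simps)
    then have "\<bar>f t * \<phi> t - f s * \<phi> s\<bar> \<le> \<bar>f t - f s\<bar> * \<bar>\<phi> t\<bar> + \<bar>f s\<bar> * \<bar>\<phi> t - \<phi> s\<bar>"
      by (metis abs_mult abs_triangle_ineq)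
    also have "\<dots> \<le> integral {s..t} w * C + M * (C * (t - s))"
      using bd[OF st] \<phi>(2)[of t] M[of s] 1 st C0 M0 by (intro add_mono mult_mono) auto
    also have "\<dots> = integral {s..t} (\<lambda>x. C * w x + M * C)"
    proof (subst Henstock_Kurzweil_Integration.integral_add)
      show "(\<lambda>x. C * w x) integrable_on {s..t}"
        by (rule integrable_lborel_imp_integrable_on) (use w in auto)
    qed (use st in \<open>auto simp: mult_ac\<close>)
    also have "\<dots> = integral {s..t} w2"
      by (rule Henstock_Kurzweil_Integration.integral_cong) (use st in \<open>auto simp: w2_def\<close>)
    finally show ?thesis .
  qed
  have "\<exists>p. integrable lborel p \<and> (\<forall>s t. a \<le> s \<longrightarrow> s \<le> t \<longrightarrow> t \<le> b \<longrightarrow> f t * \<phi> t - f s * \<phi> s = integral {s..t} p) \<and>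
    (AE x in lborel. a < x \<longrightarrow> x < b \<longrightarrow> ((\<lambda>x. f x * \<phi> x) has_real_derivative p x) (at x) \<and> \<bar>p x\<bar> \<le> w2 x)"
    by (rule absolutely_continuous_interval[OF ab w2 w20, of "\<lambda>x. f x * \<phi> x"]) (rule bd2)
  then obtain p where p: "integrable lborel p" "\<And>s t. a \<le> s \<Longrightarrow> s \<le> t \<Longrightarrow> t \<le> b \<Longrightarrow> f t * \<phi> t - f s * \<phi> s = integral {s..t} p"
    "AE x in lborel. a < x \<longrightarrow> x < b \<longrightarrow> ((\<lambda>x. f x * \<phi> x) has_real_derivative p x) (at x) \<and> \<bar>p x\<bar> \<le> w2 x"
    by blast
  have "AE x in lborel. indicator {a<..b} x * (g x * \<phi> x + f x * \<phi>' x) = indicator {a<..b} x * p x"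
    using p(3) g AE_lborel_singleton[of b]
  proof eventually_elim
    case (elim x)
    show ?case
    proof (cases "a < x \<and> x < b")
      case True
      then have "((\<lambda>x. f x * \<phi> x) has_real_derivative g x * \<phi> x + \<phi>' x * f x) (at x)"
        using elim by (intro DERIV_mult \<phi>) auto
      then have "p x = g x * \<phi> x + f x * \<phi>' x" using elim(1) True DERIV_unique by fastforce
      then show ?thesis by simp
    next
      case False
      then show ?thesis using elim by (auto simp: indicator_def)
    qed
  qed
  then have ae: "AE x in lborel. indicator {a<..b} x * p x = indicator {a<..b} x * (g x * \<phi> x + f x * \<phi>' x)" by eventually_elim auto
  have [measurable]: "p \<in> borel_measurable borel" using p(1) borel_measurable_integrable by force
  have z: "(LINT x|lborel. indicator {a<..b} x * p x) = 0"
    using lborel_integral_Ioc_eq_integral[OF p(1)] p(2)[of a b] \<phi> ab by simp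
  \<comment> \<open>\<open>g\<close> is prescribed only almost everywhere, so Borel measurability of
    the integrand is not given. If it fails, the integral has the default value 0, which is the
    claim.\<close>
  show ?thesis
  proof (cases "(\<lambda>x. indicator {a<..b} x * (g x * \<phi> x + f x * \<phi>' x)) \<in> borel_measurable lborel")
    case True
    have "(LINT x|lborel. indicator {a<..b} x * p x) = (LINT x|lborel. indicator {a<..b} x * (g x * \<phi> x + f x * \<phi>' x))"
      by (rule integral_cong_AE[OF _ True ae]) measurable
    then show ?thesis using z by simp
  next
    case False
    then show ?thesis by (meson borel_measurable_integrable not_integrable_integral_eq)
  qed
qed

section \<open>Classical partial derivatives as weak derivatives\<close>

definition ldq :: "2 \<Rightarrow> (real^2 \<Rightarrow> real) \<Rightarrow> nat \<Rightarrow> real^2 \<Rightarrow> real" where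
  "ldq j F n x = (F (x + (1 / real (Suc n)) *\<^sub>R axis j 1) - F x) * real (Suc n)"

text \<open>A limit along the steps 1/(n+1) instead of a derivative: it is Borel on the whole plane
  whenever \<open>F\<close> is, with an unspecified value where the sequence diverges.\<close>

definition ldiff :: "2 \<Rightarrow> (real^2 \<Rightarrow> real) \<Rightarrow> real^2 \<Rightarrow> real" where
  "ldiff j F x = lim (\<lambda>n. ldq j F n x)"

lemma ldq_measurable: assumes [measurable]: "F \<in> borel_measurable borel" shows "ldq j F n \<in> borel_measurable borel"
  unfolding ldq_def[abs_def] by measurable

lemma ldiff_measurable: assumes "F \<in> borel_measurable borel" shows "ldiff j F \<in> borel_measurable borel"
  unfolding ldiff_def[abs_def] by (rule borel_measurable_lim_metric) (rule ldq_measurable[OF assms])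

lemma ldq_tendsto:
  assumes "((\<lambda>\<tau>. F (pt j \<tau> y)) has_real_derivative D) (at t)"
  shows "(\<lambda>n. ldq j F n (pt j t y)) \<longlonglongrightarrow> D" "ldiff j F (pt j t y) = D"
proof -
  have "((\<lambda>h. (F (pt j (t + h) y) - F (pt j t y)) / h) \<longlongrightarrow> D) (at 0)"
    using assms by (simp add: DERIV_def)
  moreover have "filterlim (\<lambda>n. 1 / real (Suc n)) (at 0) sequentially"
    using LIMSEQ_Suc[OF lim_const_over_n[of "1::real"]] by (auto simp: filterlim_at)
  ultimately have "(\<lambda>n. (F (pt j (t + 1 / real (Suc n)) y) - F (pt j t y)) / (1 / real (Suc n))) \<longlonglongrightarrow> D"
    by (rule filterlim_compose)
  then show 1: "(\<lambda>n. ldq j F n (pt j t y)) \<longlonglongrightarrow> D" unfolding ldq_def by (simp add: pt_add)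
  show "ldiff j F (pt j t y) = D" unfolding ldiff_def using limI[OF 1] .
qed

text \<open>In contrast to \<open>weak_deriv_lines\<close>, the bound holds at all positions on a
  good line, as is to be expected of continuous functions. Only the end points are required in
  \<open>S\<close>; the set is convex wherever the bound is exploited.\<close>

definition line_bounded :: "2 \<Rightarrow> (real^2) set \<Rightarrow> (real^2 \<Rightarrow> real) \<Rightarrow> (real^2 \<Rightarrow> real) \<Rightarrow> bool" where
  "line_bounded j S F w \<longleftrightarrow> integrable lborel w \<and> (\<forall>x. 0 \<le> w x) \<and>
     (AE y in lborel. \<forall>s t. s < t \<longrightarrow> pt j s y \<in> S \<longrightarrow> pt j t y \<in> S \<longrightarrow>
       \<bar>F (pt j t y) - F (pt j s y)\<bar> \<le> integral {s..t} (\<lambda>\<tau>. w (pt j \<tau> y)))"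

lemma convex_pt:
  assumes "convex S" "pt j s y \<in> S" "pt j t y \<in> S" "s \<le> \<tau>" "\<tau> \<le> t"
  shows "pt j \<tau> y \<in> S"
proof (cases "s = t")
  case False
  define u where "u = (\<tau> - s) / (t - s)"
  have u: "0 \<le> u" "u \<le> 1" using assms False by (auto simp: u_def field_simps)
  have "\<tau> = s + u * (t - s)" using False by (simp add: u_def)
  then have "pt j \<tau> y = (1 - u) *\<^sub>R pt j s y + u *\<^sub>R pt j t y"
    by (auto simp: vec_eq_iff pt_def algebra_simps)
  then show ?thesis using convexD[OF assms(1-3), of "1 - u" u] u by simp
qed (use assms in auto)

lemma boxin_pt:
  "boxin j S a b c d e \<Longrightarrow> a \<le> t \<Longrightarrow> t \<le> b \<Longrightarrow> c \<le> y \<Longrightarrow> y \<le> d \<Longrightarrow> pt j t y \<in> S"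
  unfolding boxin_def by auto

text \<open>The density from \<open>absolutely_continuous_interval\<close> depends on the interval,
  but almost everywhere it is the derivative and hence equals \<open>ldiff\<close>. Rational
  intervals with both ends in \<open>S\<close> cover the part of each line in
  \<open>S\<close>.\<close>

lemma line_bounded_derivative:
  assumes S: "open S" "convex S" and lb: "line_bounded j S F w"
  shows "AE y in lborel. AE t in lborel. pt j t y \<in> S \<longrightarrow>
     ((\<lambda>\<tau>. indicator S (pt j \<tau> y) * F (pt j \<tau> y)) has_real_derivative ldiff j (\<lambda>x. indicator S x * F x) (pt j t y)) (at t)
     \<and> \<bar>ldiff j (\<lambda>x. indicator S x * F x) (pt j t y)\<bar> \<le> w (pt j t y)"
proof -
  let ?F = "\<lambda>x. indicator S x * F x"
  have w: "integrable lborel w" "\<And>x. 0 \<le> w x"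
    and bd: "AE y in lborel. \<forall>s t. s < t \<longrightarrow> pt j s y \<in> S \<longrightarrow> pt j t y \<in> S \<longrightarrow>
       \<bar>F (pt j t y) - F (pt j s y)\<bar> \<le> integral {s..t} (\<lambda>\<tau>. w (pt j \<tau> y))"
    using lb by (auto simp: line_bounded_def)
  show ?thesis using bd integrable_lborel_pt(1)[OF w(1), of j]
  proof eventually_elim
    case (elim y)
    have "AE t in lborel. \<forall>(a::rat) (b::rat). (of_rat a::real) \<le> of_rat b \<longrightarrow> pt j (of_rat a) y \<in> S \<longrightarrow> pt j (of_rat b) y \<in> S \<longrightarrow>
       (of_rat a < t \<longrightarrow> t < of_rat b \<longrightarrow> ((\<lambda>\<tau>. ?F (pt j \<tau> y)) has_real_derivative ldiff j ?F (pt j t y)) (at t)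
        \<and> \<bar>ldiff j ?F (pt j t y)\<bar> \<le> w (pt j t y))"
      unfolding AE_all_countable
    proof (intro allI AE_impI)
      fix a b :: rat assume ab: "(of_rat a::real) \<le> of_rat b" "pt j (of_rat a) y \<in> S" "pt j (of_rat b) y \<in> S"
      have inS: "pt j \<tau> y \<in> S" if "of_rat a \<le> \<tau>" "\<tau> \<le> of_rat b" for \<tau>
        using convex_pt[OF S(2) ab(2,3)] that by auto
      have b: "\<bar>?F (pt j t y) - ?F (pt j s y)\<bar> \<le> integral {s..t} (\<lambda>\<tau>. w (pt j \<tau> y))"
        if "of_rat a \<le> s" "s < t" "t \<le> of_rat b" for s t
        using elim(1) inS[of s] inS[of t] that by auto
      have "\<exists>p. integrable lborel p \<and> (\<forall>s t. of_rat a \<le> s \<longrightarrow> s \<le> t \<longrightarrow> t \<le> of_rat b \<longrightarrow> ?F (pt j t y) - ?F (pt j s y) = integral {s..t} p) \<and>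
        (AE t in lborel. of_rat a < t \<longrightarrow> t < of_rat b \<longrightarrow> ((\<lambda>\<tau>. ?F (pt j \<tau> y)) has_real_derivative p t) (at t) \<and> \<bar>p t\<bar> \<le> w (pt j t y))"
        by (rule absolutely_continuous_interval[OF ab(1) elim(2), of "\<lambda>t. ?F (pt j t y)"]) (use w(2) b in auto)
      then obtain p where p: "AE t in lborel. of_rat a < t \<longrightarrow> t < of_rat b \<longrightarrow> ((\<lambda>\<tau>. ?F (pt j \<tau> y)) has_real_derivative p t) (at t) \<and> \<bar>p t\<bar> \<le> w (pt j t y)"
        by blast
      then show "AE t in lborel. of_rat a < t \<longrightarrow> t < of_rat b \<longrightarrow> ((\<lambda>\<tau>. ?F (pt j \<tau> y)) has_real_derivative ldiff j ?F (pt j t y)) (at t)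
        \<and> \<bar>ldiff j ?F (pt j t y)\<bar> \<le> w (pt j t y)"
      proof eventually_elim
        case (elim t)
        then show ?case using ldq_tendsto(2)[of ?F j y "p t" t] by auto
      qed
    qed
    then show ?case
    proof eventually_elim
      case (elim t)
      show ?case
      proof
        assume "pt j t y \<in> S"
        then have i: "\<And>\<tau>. \<tau> \<in> {t..t} \<Longrightarrow> pt j \<tau> y \<in> S" by simp
        obtain a b c d e :: rat where h: "boxin j S (of_rat a) (of_rat b) (of_rat c) (of_rat d) (of_rat e)"
          "of_rat a < t" "t < of_rat b" "of_rat c < y" "y < of_rat d"
          by (rule rational_box_around_segment[OF S(1) order_refl i])
        have "pt j (of_rat a) y \<in> S" "pt j (of_rat b) y \<in> S" by (rule boxin_pt[OF h(1)]; use h in linarith)+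
        then show "((\<lambda>\<tau>. ?F (pt j \<tau> y)) has_real_derivative ldiff j ?F (pt j t y)) (at t) \<and> \<bar>ldiff j ?F (pt j t y)\<bar> \<le> w (pt j t y)"
          using elim[rule_format, of a b] h by auto
      qed
    qed
  qed
qed

lemma continuous_on_open_borel_indicator:
  fixes F :: "real^2 \<Rightarrow> real"
  assumes "open S" "continuous_on S F"
  shows "(\<lambda>x. indicator S x * F x) \<in> borel_measurable borel"
  using borel_measurable_continuous_on_indicator[of S F] assms by simp

lemma pred_LIMSEQ:
  fixes f :: "nat \<Rightarrow> 'a \<Rightarrow> real"
  assumes [measurable]: "\<And>n. f n \<in> borel_measurable M" "g \<in> borel_measurable M"
  shows "Measurable.pred M (\<lambda>x. (\<lambda>n. f n x) \<longlonglongrightarrow> g x)"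
proof -
  have "((\<lambda>n. f n x) \<longlonglongrightarrow> g x) \<longleftrightarrow> (\<forall>k::nat. \<exists>N. \<forall>n. N \<le> n \<longrightarrow> \<bar>f n x - g x\<bar> < 1 / real (Suc k))" for x
  proof
    assume "(\<lambda>n. f n x) \<longlonglongrightarrow> g x"
    then show "\<forall>k::nat. \<exists>N. \<forall>n. N \<le> n \<longrightarrow> \<bar>f n x - g x\<bar> < 1 / real (Suc k)"
      unfolding LIMSEQ_iff by (auto simp del: of_nat_Suc)
  next
    assume *: "\<forall>k::nat. \<exists>N. \<forall>n. N \<le> n \<longrightarrow> \<bar>f n x - g x\<bar> < 1 / real (Suc k)"
    show "(\<lambda>n. f n x) \<longlonglongrightarrow> g x" unfolding LIMSEQ_iff
    proof (intro allI impI)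
      fix r :: real assume "r > 0"
      then obtain k where k: "1 / real (Suc k) < r" using nat_approx_posE by blast
      obtain N where "\<forall>n\<ge>N. \<bar>f n x - g x\<bar> < 1 / real (Suc k)" using * by blast
      then show "\<exists>no. \<forall>n\<ge>no. norm (f n x - g x) < r" using k by (intro exI[of _ N]) fastforce
    qed
  qed
  then show ?thesis by simp
qed

text \<open>Almost everywhere on almost every line becomes almost everywhere in the plane for
  measurable sets; \<open>pred_LIMSEQ\<close> supplies the measurability of the set of
  convergence.\<close>

lemma line_bounded_AE:
  assumes S: "open S" "convex S" and F: "continuous_on S F" and lb: "line_bounded j S F w"
  shows "AE x in lborel. x \<in> S \<longrightarrow> (\<lambda>n. ldq j (\<lambda>x. indicator S x * F x) n x) \<longlonglongrightarrow> ldiff j (\<lambda>x. indicator S x * F x) x"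
    "AE x in lborel. x \<in> S \<longrightarrow> \<bar>ldiff j (\<lambda>x. indicator S x * F x) x\<bar> \<le> w x"
proof -
  let ?F = "\<lambda>x. indicator S x * F x"
  have [measurable]: "?F \<in> borel_measurable borel" by (rule continuous_on_open_borel_indicator[OF S(1) F])
  have [measurable]: "ldq j ?F n \<in> borel_measurable borel" "ldiff j ?F \<in> borel_measurable borel" for n
    by (intro ldq_measurable ldiff_measurable; measurable)+
  have [measurable]: "S \<in> sets borel" using S by simp
  have [measurable]: "w \<in> borel_measurable borel" using lb borel_measurable_integrable by (force simp: line_bounded_def)
  have m[measurable]: "Measurable.pred borel (\<lambda>x. (\<lambda>n. ldq j ?F n x) \<longlonglongrightarrow> ldiff j ?F x)"
    by (rule pred_LIMSEQ) measurable
  show "AE x in lborel. x \<in> S \<longrightarrow> (\<lambda>n. ldq j ?F n x) \<longlonglongrightarrow> ldiff j ?F x"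
  proof (rule AE_lborel_ptI[where j=j])
    show "AE y in lborel. AE t in lborel. pt j t y \<in> S \<longrightarrow> (\<lambda>n. ldq j ?F n (pt j t y)) \<longlonglongrightarrow> ldiff j ?F (pt j t y)"
      using line_bounded_derivative[OF S lb]
      by eventually_elim (erule eventually_mono, use ldq_tendsto(1)[of ?F] in auto)
  qed measurable
  show "AE x in lborel. x \<in> S \<longrightarrow> \<bar>ldiff j ?F x\<bar> \<le> w x"
  proof (rule AE_lborel_ptI[where j=j])
    show "AE y in lborel. AE t in lborel. pt j t y \<in> S \<longrightarrow> \<bar>ldiff j ?F (pt j t y)\<bar> \<le> w (pt j t y)"
      using line_bounded_derivative[OF S lb]
      by eventually_elim (erule eventually_mono, auto)
  qed measurable
qed

lemma integrable_continuous_times_C1c: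
  assumes S: "open S" and F: "continuous_on S F" and h: "continuous_on UNIV h"
    and K: "compact K" "K \<subseteq> S" "\<And>x. x \<notin> K \<Longrightarrow> h x = 0"
  shows "integrable lborel (\<lambda>x::real^2. indicator S x * (F x * h x) :: real)"
proof -
  have "bounded ((\<lambda>x. F x * h x) ` K)"
    by (intro compact_imp_bounded compact_continuous_image K continuous_on_mult
        continuous_on_subset[OF F] continuous_on_subset[OF h]) (use K in auto)
  then obtain C where C: "\<And>x. x \<in> K \<Longrightarrow> \<bar>F x * h x\<bar> \<le> C" by (auto simp: bounded_iff)
  show ?thesis
  proof (rule Bochner_Integration.integrable_bound[of lborel "\<lambda>x. C * indicator K x"])
    have "emeasure lborel K < \<infinity>" using emeasure_bounded_finite[OF compact_imp_bounded[OF K(1)]] by simp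
    then show "integrable lborel (\<lambda>x. C * indicator K x)"
      using compact_imp_closed[OF K(1)] by (intro Bochner_Integration.integrable_mult_right) (auto simp: integrable_indicator_iff)
    have "(\<lambda>x. indicator S x * F x) \<in> borel_measurable borel" by (rule continuous_on_open_borel_indicator[OF S F])
    moreover have "h \<in> borel_measurable borel" by (rule borel_measurable_continuous_onI[OF h])
    ultimately have "(\<lambda>x. indicator S x * F x * h x) \<in> borel_measurable borel" by (rule borel_measurable_times)
    then show "(\<lambda>x. indicator S x * (F x * h x)) \<in> borel_measurable lborel" by (simp add: mult.assoc)
    show "AE x in lborel. norm (indicator S x * (F x * h x)) \<le> norm (C * indicator K x)"
    proof (rule AE_I2)
      fix x show "norm (indicator S x * (F x * h x)) \<le> norm (C * indicator K x)"
        using C[of x] K(2) K(3)[of x] by (cases "x \<in> K") (auto simp: indicator_def abs_mult)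
    qed
  qed
qed

lemma set_lebesgue_borel:
  fixes f :: "real^2 \<Rightarrow> real"
  assumes "integrable lborel (\<lambda>x. indicator S x * f x)"
  shows "set_integrable lebesgue S f" "(LINT x:S|lebesgue. f x) = (LINT x|lborel. indicator S x * f x)"
proof -
  have m: "(\<lambda>x. indicator S x * f x) \<in> borel_measurable lborel" using assms by auto
  show "set_integrable lebesgue S f"
    unfolding set_integrable_def using integrable_completion[OF m] assms by simp
  show "(LINT x:S|lebesgue. f x) = (LINT x|lborel. indicator S x * f x)"
    unfolding set_lebesgue_integral_def using integral_completion[OF m] by simp
qed

text \<open>The converse of \<open>weak_deriv_lines\<close> for continuous functions on convex sets:
  integration by parts on almost every line, then Fubini.\<close>

lemma line_bounded_weak_deriv:
  assumes S: "open S" "convex S" and F: "continuous_on S F" and lb: "line_bounded j S F w"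
  shows "weak_deriv S j F (ldiff j (\<lambda>x. indicator S x * F x))"
  unfolding weak_deriv_def
proof
  fix \<phi> assume \<phi>: "\<phi> \<in> C1c S"
  let ?F = "\<lambda>x. indicator S x * F x" and ?g = "ldiff j (\<lambda>x. indicator S x * F x)"
  let ?K = "closure {x. \<phi> x \<noteq> 0}"
  note D = C1cD[OF \<phi>]
  obtain C where C: "\<And>x. \<bar>\<phi> x\<bar> \<le> C" "\<And>x j. \<bar>pd j \<phi> x\<bar> \<le> C" "C \<ge> 0" by (rule C1c_bounded[OF \<phi>]) blast
  have w: "integrable lborel w" "\<And>x. 0 \<le> w x"
    and bd: "AE y in lborel. \<forall>s t. s < t \<longrightarrow> pt j s y \<in> S \<longrightarrow> pt j t y \<in> S \<longrightarrow>
       \<bar>F (pt j t y) - F (pt j s y)\<bar> \<le> integral {s..t} (\<lambda>\<tau>. w (pt j \<tau> y))"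
    using lb by (auto simp: line_bounded_def)
  have Fm: "?F \<in> borel_measurable borel" by (rule continuous_on_open_borel_indicator[OF S(1) F])
  have gm[measurable]: "?g \<in> borel_measurable borel" by (rule ldiff_measurable[OF Fm])
  have \<phi>m[measurable]: "\<phi> \<in> borel_measurable borel" by (rule borel_measurable_continuous_onI[OF D(3)])
  have [measurable]: "S \<in> sets borel" using S by simp
  have iF: "integrable lborel (\<lambda>x. indicator S x * (F x * pd j \<phi> x))"
    by (rule integrable_continuous_times_C1c[OF S(1) F D(2) D(4,5)]) (rule D(7))
  have ig: "integrable lborel (\<lambda>x. indicator S x * (?g x * \<phi> x))"
  proof (rule Bochner_Integration.integrable_bound[of lborel "\<lambda>x. C * w x"])
    show "integrable lborel (\<lambda>x. C * w x)" using w by simp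
    show "AE x in lborel. norm (indicator S x * (?g x * \<phi> x)) \<le> norm (C * w x)"
      using line_bounded_AE(2)[OF S F lb]
    proof eventually_elim
      case (elim x)
      show ?case
      proof (cases "x \<in> S")
        case True
        then have "\<bar>?g x\<bar> * \<bar>\<phi> x\<bar> \<le> w x * C" using elim C w by (intro mult_mono) auto
        then show ?thesis using True C(3) w(2)[of x] by (simp add: abs_mult mult.commute)
      qed simp
    qed
  qed measurable
  have "AE y in lborel. (LINT t|lborel. indicator S (pt j t y) * (F (pt j t y) * pd j \<phi> (pt j t y)) + indicator S (pt j t y) * (?g (pt j t y) * \<phi> (pt j t y))) = 0"
    using bd integrable_lborel_pt(1)[OF w(1), of j] line_bounded_derivative[OF S lb]
  proof eventually_elim
    case (elim y)
    define T where "T = {t. pt j t y \<in> ?K}"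
    show ?case
    proof (cases "T = {}")
      case True
      then have n: "pt j t y \<notin> ?K" for t by (auto simp: T_def)
      have "\<phi> (pt j t y) = 0" "pd j \<phi> (pt j t y) = 0" for t using D(6)[OF n] D(7)[OF n] .
      then show ?thesis by simp
    next
      case False
      have "T = (\<lambda>t. pt j t y) -` ?K" by (auto simp: T_def)
      then have "closed T" using closed_vimage[of ?K "\<lambda>t. pt j t y"]
        by (simp add: continuous_on_pt continuous_on_const continuous_on_id)
      moreover have "bounded T"
      proof -
        have "T \<subseteq> (\<lambda>x. x $ j) ` ?K" unfolding T_def by force
        moreover have "bounded ((\<lambda>x. x $ j) ` ?K)"
          by (intro compact_imp_bounded compact_continuous_image D(4)) (auto intro!: continuous_intros)
        ultimately show ?thesis using bounded_subset by blast
      qed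
      ultimately have cT: "compact T" by (simp add: compact_eq_bounded_closed)
      obtain t0 where t0: "t0 \<in> T" "\<And>t. t \<in> T \<Longrightarrow> t0 \<le> t" using compact_attains_inf[OF cT False] by blast
      obtain t1 where t1: "t1 \<in> T" "\<And>t. t \<in> T \<Longrightarrow> t \<le> t1" using compact_attains_sup[OF cT False] by blast
      \<comment> \<open>Convexity enters here: on the line the support of \<phi> may have gaps, but
        its hull [t0, t1] stays in \<open>S\<close>.\<close>
      have inS: "pt j \<tau> y \<in> S" if "\<tau> \<in> {t0..t1}" for \<tau>
        using convex_pt[OF S(2), of j t0 y t1] that t0(1) t1(1) D(5) by (auto simp: T_def)
      have "t0 \<le> t1" using t0(2)[OF t1(1)] .
      then obtain a' b' c d e :: rat where h: "boxin j S (of_rat a') (of_rat b') (of_rat c) (of_rat d) (of_rat e)"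
        "of_rat a' < t0" "t1 < of_rat b'" "of_rat c < y" "y < of_rat d"
        by (rule rational_box_around_segment[OF S(1) _ inS])
      define a b where "a = (of_rat a'::real)" and "b = (of_rat b'::real)"
      have ab: "a \<le> b" "a < t0" "t1 < b" "pt j a y \<in> S" "pt j b y \<in> S"
        using h(2-) \<open>t0 \<le> t1\<close> boxin_pt[OF h(1), of a y] boxin_pt[OF h(1), of b y] by (auto simp: a_def b_def)
      have inS': "pt j \<tau> y \<in> S" if "a \<le> \<tau>" "\<tau> \<le> b" for \<tau>
        using convex_pt[OF S(2) ab(4,5)] that by auto
      have out: "\<phi> (pt j t y) = 0" "pd j \<phi> (pt j t y) = 0" if "t < t0 \<or> t > t1" for t
      proof -
        have "pt j t y \<notin> ?K" using that t0(2)[of t] t1(2)[of t] by (auto simp: T_def)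
        from D(6)[OF this] D(7)[OF this] show "\<phi> (pt j t y) = 0" "pd j \<phi> (pt j t y) = 0" .
      qed
      have "(LINT t|lborel. indicator {a<..b} t * (?g (pt j t y) * \<phi> (pt j t y) + ?F (pt j t y) * pd j \<phi> (pt j t y))) = 0"
      proof (rule absolutely_continuous_by_parts[OF ab(1) elim(2)])
        show "\<bar>?F (pt j t y) - ?F (pt j s y)\<bar> \<le> integral {s..t} (\<lambda>\<tau>. w (pt j \<tau> y))" if "a \<le> s" "s < t" "t \<le> b" for s t
          using elim(1) inS'[of s] inS'[of t] that by auto
        show "((\<lambda>t. \<phi> (pt j t y)) has_real_derivative pd j \<phi> (pt j t y)) (at t)" for t
          by (rule C1c_line_derivative[OF \<phi>])
        show "AE t in lborel. a < t \<longrightarrow> t < b \<longrightarrow> ((\<lambda>t. ?F (pt j t y)) has_real_derivative ?g (pt j t y)) (at t)"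
          using elim(3) by eventually_elim (use inS' in auto)
      qed (use C w out ab in auto)
      moreover have "indicator {a<..b} t * (?g (pt j t y) * \<phi> (pt j t y) + ?F (pt j t y) * pd j \<phi> (pt j t y))
        = indicator S (pt j t y) * (F (pt j t y) * pd j \<phi> (pt j t y)) + indicator S (pt j t y) * (?g (pt j t y) * \<phi> (pt j t y))" for t
      proof (cases "t0 \<le> t \<and> t \<le> t1")
        case True
        then show ?thesis using inS'[of t] ab by (simp add: indicator_def)
      next
        case False
        then show ?thesis using out[of t] by auto
      qed
      ultimately show ?thesis by simp
    qed
  qed
  then have "(LINT y|lborel. LINT t|lborel. indicator S (pt j t y) * (F (pt j t y) * pd j \<phi> (pt j t y)) + indicator S (pt j t y) * (?g (pt j t y) * \<phi> (pt j t y))) = 0"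
    by (rule integral_eq_zero_AE)
  then have "(LINT x|lborel. indicator S x * (F x * pd j \<phi> x) + indicator S x * (?g x * \<phi> x)) = 0"
    using integrable_lborel_pt(3)[OF Bochner_Integration.integrable_add[OF iF ig], of j] by simp
  then have "(LINT x|lborel. indicator S x * (F x * pd j \<phi> x)) = - (LINT x|lborel. indicator S x * (?g x * \<phi> x))"
    by (simp add: Bochner_Integration.integral_add[OF iF ig])
  then show "set_integrable lebesgue S (\<lambda>x. F x * pd j \<phi> x) \<and> set_integrable lebesgue S (\<lambda>x. ?g x * \<phi> x) \<and>
     (LINT x:S|lebesgue. F x * pd j \<phi> x) = - (LINT x:S|lebesgue. ?g x * \<phi> x)"
    using set_lebesgue_borel[OF iF] set_lebesgue_borel[OF ig] by simp
qed

section \<open>\<open>Q\<close>-points and continuous selections\<close>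

text \<open>Labellings are functions rather than lists so that permutations act on them by
  composition.\<close>

definition ms :: "nat \<Rightarrow> (nat \<Rightarrow> 'a) \<Rightarrow> 'a multiset" where
  "ms Q V = image_mset V (mset_set {..<Q})"

definition l2d :: "nat \<Rightarrow> (nat \<Rightarrow> real^'n) \<Rightarrow> (nat \<Rightarrow> real^'n) \<Rightarrow> real" where
  "l2d Q V W = L2_set (\<lambda>i. norm (V i - W i)) {..<Q}"

lemma ms_eq_mset: "ms Q V = mset (map V [0..<Q])"
  by (simp add: ms_def lessThan_atLeast0)

lemma ms_in_AQ: "ms Q V \<in> AQ Q" by (simp add: ms_def AQ_def)

lemma ms_cong: "(\<And>i. i < Q \<Longrightarrow> V i = W i) \<Longrightarrow> ms Q V = ms Q W"
  unfolding ms_def by (rule image_mset_cong) auto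

lemma ms_nth: "length xs = Q \<Longrightarrow> ms Q ((!) xs) = mset xs"
  unfolding ms_eq_mset by (metis map_nth)

lemma AQ_imp_ms: assumes "T \<in> AQ Q" obtains V where "T = ms Q V"
proof -
  obtain xs where xs: "mset xs = T" using ex_mset by blast
  then have "length xs = Q" using assms by (auto simp: AQ_def)
  from ms_nth[OF this] show ?thesis using xs that by metis
qed

lemma ms_permute: assumes "p permutes {..<Q}" shows "ms Q (V \<circ> p) = ms Q V"
proof -
  have "ms Q (V \<circ> p) = image_mset V (image_mset p (mset_set {..<Q}))"
    by (simp add: ms_def image_mset.compositionality)
  also have "image_mset p (mset_set {..<Q}) = mset_set {..<Q}"
    using assms by (simp add: image_mset_mset_set permutes_inj_on permutes_image)
  finally show ?thesis by (simp only: ms_def)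
qed

lemma ms_eq_imp_permutes:
  assumes "ms Q V = ms Q W"
  obtains p where "p permutes {..<Q}" "\<And>i. i < Q \<Longrightarrow> V i = W (p i)"
proof -
  have "mset (map V [0..<Q]) = mset (map W [0..<Q])" using assms by (simp add: ms_eq_mset)
  from mset_eq_permutation[OF this] obtain p where p: "p permutes {..<length (map W [0..<Q])}" "permute_list p (map W [0..<Q]) = map V [0..<Q]" .
  then have p': "p permutes {..<Q}" by simp
  have "V i = W (p i)" if "i < Q" for i
  proof -
    have "p i < Q" using permutes_in_image[OF p'] that by auto
    have "V i = permute_list p (map W [0..<Q]) ! i" using p(2) that by simp
    also have "\<dots> = W (p i)" using permute_list_nth[OF p(1)] that \<open>p i < Q\<close> by simp
    finally show ?thesis .
  qed
  with p' that show ?thesis by blast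
qed

section \<open>Labelled and unlabelled distance\<close>

lemma l2d_nonneg: "0 \<le> l2d Q V W" by (simp add: l2d_def)
lemma l2d_self [simp]: "l2d Q V V = 0" by (simp add: l2d_def L2_set_def)

lemma l2d_cong: "(\<And>i. i < Q \<Longrightarrow> V i = V' i) \<Longrightarrow> (\<And>i. i < Q \<Longrightarrow> W i = W' i) \<Longrightarrow> l2d Q V W = l2d Q V' W'"
  unfolding l2d_def by (rule L2_set_cong) auto

lemma l2d_sym: "l2d Q V W = l2d Q W V" by (simp add: l2d_def norm_minus_commute)

lemma l2d_triangle: "l2d Q V X \<le> l2d Q V W + l2d Q W X"
proof -
  have "l2d Q V X \<le> L2_set (\<lambda>i. norm (V i - W i) + norm (W i - X i)) {..<Q}"
    unfolding l2d_def by (rule L2_set_mono) (auto intro: order_trans[OF _ norm_triangle_ineq])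
  also have "\<dots> \<le> l2d Q V W + l2d Q W X" unfolding l2d_def by (rule L2_set_triangle_ineq)
  finally show ?thesis .
qed

lemma l2d_permute: assumes "p permutes {..<Q}" shows "l2d Q (V \<circ> p) (W \<circ> p) = l2d Q V W"
proof -
  have "(\<Sum>i<Q. (norm (V (p i) - W (p i)))\<^sup>2) = (\<Sum>i<Q. (norm (V i - W i))\<^sup>2)"
    using sum.permute[OF assms, of "\<lambda>i. (norm (V i - W i))\<^sup>2"] by (simp add: o_def)
  then show ?thesis by (simp add: l2d_def L2_set_def)
qed

lemma norm_le_l2d: "i < Q \<Longrightarrow> norm (V i - W i) \<le> l2d Q V W"
  unfolding l2d_def using member_le_L2_set[of "{..<Q}" i "\<lambda>i. norm (V i - W i)"] by simp

text \<open>The lists in \<open>Gdist\<close> are rearrangements of fixed labellings. The set is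
  therefore finite, and its \<open>Min\<close> is attained.\<close>

lemma Gdist_set_eq:
  "{sqrt (\<Sum>i<size (ms Q V). (norm (xs ! i - ys ! i))\<^sup>2) | xs ys. mset xs = ms Q V \<and> mset ys = ms Q W}
     = {l2d Q (V \<circ> p) (W \<circ> q) | p q. p permutes {..<Q} \<and> q permutes {..<Q}}" (is "?A = ?B")
proof
  have sz: "size (ms Q V) = Q" by (simp add: ms_def)
  show "?A \<subseteq> ?B"
  proof
    fix r assume "r \<in> ?A"
    then obtain xs ys where r: "r = sqrt (\<Sum>i<Q. (norm (xs ! i - ys ! i))\<^sup>2)" "mset xs = ms Q V" "mset ys = ms Q W"
      using sz by auto
    have "length xs = Q" "length ys = Q" using r(2,3) by (metis ms_def size_image_mset size_mset size_mset_set card_lessThan)+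
    then have "ms Q ((!) xs) = ms Q V" "ms Q ((!) ys) = ms Q W" using r ms_nth by metis+
    then obtain p q where p: "p permutes {..<Q}" "\<And>i. i < Q \<Longrightarrow> xs ! i = V (p i)"
      and q: "q permutes {..<Q}" "\<And>i. i < Q \<Longrightarrow> ys ! i = W (q i)"
      using ms_eq_imp_permutes by metis
    have "r = l2d Q (V \<circ> p) (W \<circ> q)"
      unfolding r(1) l2d_def L2_set_def using p q by (auto intro!: arg_cong[where f=sqrt] sum.cong)
    then show "r \<in> ?B" using p q by blast
  qed
  show "?B \<subseteq> ?A"
  proof
    fix r assume "r \<in> ?B"
    then obtain p q where r: "r = l2d Q (V \<circ> p) (W \<circ> q)" "p permutes {..<Q}" "q permutes {..<Q}" by blast
    have "r = sqrt (\<Sum>i<size (ms Q V). (norm (map (V \<circ> p) [0..<Q] ! i - map (W \<circ> q) [0..<Q] ! i))\<^sup>2)"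
      unfolding sz r(1) l2d_def L2_set_def by (auto intro!: arg_cong[where f=sqrt] sum.cong)
    moreover have "mset (map (V \<circ> p) [0..<Q]) = ms Q V" "mset (map (W \<circ> q) [0..<Q]) = ms Q W"
      using ms_permute r by (metis ms_eq_mset)+
    ultimately show "r \<in> ?A" by blast
  qed
qed

lemma finite_Gdist_set: "finite {l2d Q (V \<circ> p) (W \<circ> q) | p q. p permutes {..<Q} \<and> q permutes {..<Q}}"
proof -
  have "finite ({p. p permutes {..<Q}} \<times> {q. q permutes {..<Q}})" using finite_permutations by blast
  then have "finite ((\<lambda>(p,q). l2d Q (V \<circ> p) (W \<circ> q)) ` ({p. p permutes {..<Q}} \<times> {q. q permutes {..<Q}}))" by blast
  then show ?thesis by (rule rev_finite_subset) auto
qed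

lemma Gdist_le_l2d: "Gdist (ms Q V) (ms Q W) \<le> l2d Q V W"
proof -
  have "l2d Q V W \<in> {l2d Q (V \<circ> p) (W \<circ> q) | p q. p permutes {..<Q} \<and> q permutes {..<Q}}"
    by (rule CollectI, rule exI[of _ id], rule exI[of _ id]) (simp add: permutes_id)
  then show ?thesis unfolding Gdist_def Gdist_set_eq using Min_le[OF finite_Gdist_set] by blast
qed

text \<open>Permuting both labellings simultaneously preserves the labelled distance, so the first
  one can be kept fixed.\<close>

lemma Gdist_attained:
  obtains p where "p permutes {..<Q}" "Gdist (ms Q V) (ms Q W) = l2d Q V (W \<circ> p)"
proof -
  let ?B = "{l2d Q (V \<circ> p) (W \<circ> q) | p q. p permutes {..<Q} \<and> q permutes {..<Q}}"
  have "?B \<noteq> {}" using permutes_id by blast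
  then have "Gdist (ms Q V) (ms Q W) \<in> ?B" unfolding Gdist_def Gdist_set_eq using Min_in[OF finite_Gdist_set] by blast
  then obtain p q where pq: "Gdist (ms Q V) (ms Q W) = l2d Q (V \<circ> p) (W \<circ> q)" "p permutes {..<Q}" "q permutes {..<Q}" by blast
  have "l2d Q (V \<circ> p) (W \<circ> q) = l2d Q (V \<circ> p \<circ> inv p) (W \<circ> q \<circ> inv p)"
    using l2d_permute[OF permutes_inv[OF pq(2)]] by metis
  also have "V \<circ> p \<circ> inv p = V" using permutes_inv_o(1)[OF pq(2)] by (metis comp_assoc comp_id)
  finally have "Gdist (ms Q V) (ms Q W) = l2d Q V (W \<circ> (q \<circ> inv p))" using pq(1) by (simp only: comp_assoc)
  moreover have "(q \<circ> inv p) permutes {..<Q}" using permutes_compose[OF permutes_inv[OF pq(2)] pq(3)] .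
  ultimately show ?thesis using that by blast
qed

lemma Gdist_nonneg: "0 \<le> Gdist (ms Q V) (ms Q W)"
  by (metis Gdist_attained l2d_nonneg)

lemma Gdist_self: "Gdist (ms Q V) (ms Q V) = 0"
  using Gdist_le_l2d[of Q V V] Gdist_nonneg[of Q V V] by simp

lemma Gdist_sym: "Gdist (ms Q V) (ms Q W) = Gdist (ms Q W) (ms Q V)"
proof -
  have "Gdist (ms Q W) (ms Q V) \<le> Gdist (ms Q V) (ms Q W)" for V W :: "nat \<Rightarrow> real^'n"
  proof -
    obtain p where p: "p permutes {..<Q}" "Gdist (ms Q V) (ms Q W) = l2d Q V (W \<circ> p)" by (rule Gdist_attained)
    have "Gdist (ms Q W) (ms Q V) = Gdist (ms Q (W \<circ> p)) (ms Q V)" by (simp add: ms_permute[OF p(1)])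
    also have "\<dots> \<le> l2d Q (W \<circ> p) V" by (rule Gdist_le_l2d)
    finally show ?thesis using p(2) l2d_sym by metis
  qed
  from this[of V W] this[of W V] show ?thesis by (rule order_antisym)
qed

text \<open>The second optimal matching is taken after the middle tuple has been relabelled by the
  first, so that the labelled triangle inequality applies.\<close>

lemma Gdist_triangle: "Gdist (ms Q V) (ms Q X) \<le> Gdist (ms Q V) (ms Q W) + Gdist (ms Q W) (ms Q X)"
proof -
  obtain p where p: "p permutes {..<Q}" "Gdist (ms Q V) (ms Q W) = l2d Q V (W \<circ> p)" by (rule Gdist_attained)
  obtain q where q: "q permutes {..<Q}" "Gdist (ms Q (W \<circ> p)) (ms Q X) = l2d Q (W \<circ> p) (X \<circ> q)" by (rule Gdist_attained)
  have "Gdist (ms Q V) (ms Q X) = Gdist (ms Q V) (ms Q (X \<circ> q))" by (simp add: ms_permute[OF q(1)])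
  also have "\<dots> \<le> l2d Q V (X \<circ> q)" by (rule Gdist_le_l2d)
  also have "\<dots> \<le> l2d Q V (W \<circ> p) + l2d Q (W \<circ> p) (X \<circ> q)" by (rule l2d_triangle)
  finally show ?thesis using p(2) q(2) by (simp add: ms_permute[OF p(1)])
qed

lemma Gdist_diff_le: "\<bar>Gdist (ms Q V) (ms Q X) - Gdist (ms Q W) (ms Q X)\<bar> \<le> l2d Q V W"
  using Gdist_triangle[of Q V X W] Gdist_triangle[of Q W X V] Gdist_le_l2d[of Q V W] Gdist_sym[of Q V W] by linarith

text \<open>Tuples are taken from a countable dense set of points. Countability allows the distances
  to all of them to be controlled off one null set.\<close>

lemma countable_dense_AQ:
  obtains D :: "(real^'n) multiset set" where "countable D" "D \<subseteq> AQ Q"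
    "\<And>V e. 0 < e \<Longrightarrow> \<exists>W. ms Q W \<in> D \<and> Gdist (ms Q V) (ms Q W) < e"
proof -
  obtain B :: "(real^'n) set" where B: "countable B" "\<And>X. open X \<Longrightarrow> X \<noteq> {} \<Longrightarrow> \<exists>d\<in>B. d \<in> X"
    using countable_dense_exists by blast
  define D where "D = (\<lambda>xs. ms Q ((!) xs)) ` lists B"
  have "countable D" unfolding D_def using B(1) by (intro countable_image countable_lists)
  moreover have "D \<subseteq> AQ Q" unfolding D_def using ms_in_AQ by auto
  moreover have "\<exists>W. ms Q W \<in> D \<and> Gdist (ms Q V) (ms Q W) < e" if e: "0 < e" for V :: "nat \<Rightarrow> real^'n" and e
  proof -
    \<comment> \<open>The labelled distance is at most a sum of Q errors; the summand 1 also covers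
      Q = 0.\<close>
    define d where "d = e / (real Q + 1)"
    have d: "d > 0" using e by (simp add: d_def)
    have "\<exists>b\<in>B. b \<in> ball (V i) d" for i by (rule B(2)) (use d in auto)
    then obtain b where b: "\<And>i. b i \<in> B" "\<And>i. dist (V i) (b i) < d" by (metis mem_ball)
    let ?xs = "map b [0..<Q]"
    have "?xs \<in> lists B" using b(1) by auto
    then have "ms Q ((!) ?xs) \<in> D" unfolding D_def by blast
    moreover have "ms Q ((!) ?xs) = ms Q b" by (rule ms_cong) simp
    moreover have "l2d Q V b < e"
    proof -
      have "l2d Q V b \<le> (\<Sum>i<Q. norm (V i - b i))" unfolding l2d_def by (rule L2_set_le_sum) simp
      also have "\<dots> \<le> (\<Sum>i<Q. d)" by (rule sum_mono) (use b(2) in \<open>auto simp: dist_norm less_imp_le\<close>)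
      also have "\<dots> = real Q * d" by simp
      also have "\<dots> < e" using e by (simp add: d_def field_simps)
      finally show ?thesis .
    qed
    ultimately show ?thesis using Gdist_le_l2d[of Q V b] by (metis order_le_less_trans)
  qed
  ultimately show ?thesis using that by blast
qed

text \<open>A reference point \<open>T\<close> near the second argument makes the difference of
  distances almost the distance itself. This is the passage from the scalar functions in the Sobolev
  definition to \<open>u\<close>.\<close>

lemma Gdist_le_if_dense:
  assumes dense: "\<And>V e. 0 < e \<Longrightarrow> \<exists>W. ms Q W \<in> D \<and> Gdist (ms Q V) (ms Q W) < e"
    and le: "\<And>T. T \<in> D \<Longrightarrow> \<bar>Gdist (ms Q V) T - Gdist (ms Q W) T\<bar> \<le> c"
  shows "Gdist (ms Q V) (ms Q W) \<le> c"
proof (rule field_le_epsilon)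
  fix e :: real assume "0 < e"
  then obtain X where X: "ms Q X \<in> D" "Gdist (ms Q W) (ms Q X) < e/2" using dense[of "e/2"] by auto
  have "Gdist (ms Q V) (ms Q W) \<le> Gdist (ms Q V) (ms Q X) + Gdist (ms Q W) (ms Q X)"
    using Gdist_triangle[of Q V W X] Gdist_sym[of Q X W] by linarith
  then show "Gdist (ms Q V) (ms Q W) \<le> c + e" using le[OF X(1)] X(2) by linarith
qed

text \<open>If \<open>W\<close> is close to \<open>V\<close>, an optimal matching can only permute indices with equal values of \<open>V\<close>.\<close>

lemma Gdist_eq_l2d_local:
  obtains e where "e > 0" "\<And>W. l2d Q V W < e \<Longrightarrow> Gdist (ms Q V) (ms Q W) = l2d Q V W"
proof -
  \<comment> \<open>The gaps between distinct values; the element 1 keeps the set nonempty when all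
    values agree.\<close>
  define A where "A = insert 1 ((\<lambda>(i,k). norm (V i - V k)) ` {(i,k). i < Q \<and> k < Q \<and> V i \<noteq> V k})"
  have "finite {(i,k). i < Q \<and> k < Q \<and> V i \<noteq> V k}" by (rule finite_subset[of _ "{..<Q} \<times> {..<Q}"]) auto
  then have A: "finite A" "A \<noteq> {}" "\<And>a. a \<in> A \<Longrightarrow> a > 0" by (auto simp: A_def)
  define e where "e = Min A / 2"
  have e: "e > 0" using A Min_in[of A] by (auto simp: e_def)
  have sep: "V i = V k" if "i < Q" "k < Q" "norm (V i - V k) < 2 * e" for i k
  proof (rule ccontr)
    assume "V i \<noteq> V k"
    then have "norm (V i - V k) \<in> A" using that unfolding A_def by auto
    then show False using Min_le[OF A(1)] that(3) by (fastforce simp: e_def)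
  qed
  have "Gdist (ms Q V) (ms Q W) = l2d Q V W" if W: "l2d Q V W < e" for W
  proof -
    obtain p where p: "p permutes {..<Q}" "Gdist (ms Q V) (ms Q W) = l2d Q V (W \<circ> p)" by (rule Gdist_attained)
    have "V i = V (p i)" if i: "i < Q" for i
    proof (rule sep[OF i])
      show pi: "p i < Q" using permutes_in_image[OF p(1), of i] i by auto
      have "norm (V i - V (p i)) \<le> norm (V i - W (p i)) + norm (V (p i) - W (p i))"
        by (metis norm_minus_commute norm_triangle_sub diff_add_cancel norm_diff_triangle_ineq norm_triangle_ineq4 diff_diff_eq2 add_diff_cancel)
      also have "\<dots> \<le> l2d Q V (W \<circ> p) + l2d Q V W"
        using norm_le_l2d[OF i, of V "W \<circ> p"] norm_le_l2d[OF pi, of V W] by simp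
      also have "\<dots> < 2 * e" using W p(2) Gdist_le_l2d[of Q V W] by linarith
      finally show "norm (V i - V (p i)) < 2 * e" .
    qed
    then have "l2d Q V (W \<circ> p) = l2d Q (V \<circ> p) (W \<circ> p)" by (intro l2d_cong) auto
    then show ?thesis using p l2d_permute by metis
  qed
  with e that show ?thesis by blast
qed

section \<open>Selections with a controlled modulus of continuity\<close>

lemma image_mset_ms: "image_mset f (ms Q V) = ms Q (\<lambda>i. f (V i))"
  by (simp add: ms_def image_mset.compositionality o_def)

lemma l2d_scaleR: "0 \<le> c \<Longrightarrow> l2d Q (\<lambda>i. c *\<^sub>R V i) (\<lambda>i. c *\<^sub>R W i) = c * l2d Q V W"
  unfolding l2d_def by (simp flip: scaleR_diff_right add: L2_set_right_distrib)

lemma Gdist_scaleR: "0 \<le> c \<Longrightarrow> Gdist (ms Q (\<lambda>i. c *\<^sub>R V i)) (ms Q (\<lambda>i. c *\<^sub>R W i)) \<le> c * Gdist (ms Q V) (ms Q W)"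
proof -
  assume c: "0 \<le> c"
  obtain p where p: "p permutes {..<Q}" "Gdist (ms Q V) (ms Q W) = l2d Q V (W \<circ> p)" by (rule Gdist_attained)
  have "ms Q (\<lambda>i. c *\<^sub>R W i) = ms Q (\<lambda>i. c *\<^sub>R (W \<circ> p) i)" using ms_permute[OF p(1), of "\<lambda>i. c *\<^sub>R W i"] by (simp add: o_def)
  then have "Gdist (ms Q (\<lambda>i. c *\<^sub>R V i)) (ms Q (\<lambda>i. c *\<^sub>R W i)) \<le> l2d Q (\<lambda>i. c *\<^sub>R V i) (\<lambda>i. c *\<^sub>R (W \<circ> p) i)"
    using Gdist_le_l2d by metis
  then show ?thesis using p(2) l2d_scaleR[OF c] by metis
qed

text \<open>A new largest point \<open>b\<close> is matched optimally with its predecessor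
  \<open>m\<close> alone. Superadditivity of \<open>c\<close> absorbs the triangle inequality, so
  the bound extends to all earlier points without a growing constant.\<close>

lemma finite_chain_matching:
  fixes V :: "real \<Rightarrow> nat \<Rightarrow> real^'n"
  assumes G: "\<And>s t. s \<in> D \<Longrightarrow> t \<in> D \<Longrightarrow> s < t \<Longrightarrow> Gdist (ms Q (V s)) (ms Q (V t)) \<le> c s t"
    and sup: "\<And>s r t. s \<in> D \<Longrightarrow> r \<in> D \<Longrightarrow> t \<in> D \<Longrightarrow> s < r \<Longrightarrow> r < t \<Longrightarrow> c s r + c r t \<le> c s t"
    and A: "finite A" "A \<subseteq> D"
  shows "\<exists>\<sigma>. (\<forall>s\<in>A. \<sigma> s permutes {..<Q}) \<and> (\<forall>s\<in>A. \<forall>t\<in>A. s < t \<longrightarrow> l2d Q (V s \<circ> \<sigma> s) (V t \<circ> \<sigma> t) \<le> c s t)"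
  using A
proof (induction A rule: finite_linorder_max_induct)
  case empty
  then show ?case by simp
next
  case (insert b A)
  have "A \<subseteq> D" using insert.prems by auto
  from insert.IH[OF this] obtain \<sigma> where \<sigma>: "\<And>s. s \<in> A \<Longrightarrow> \<sigma> s permutes {..<Q}"
    "\<And>s t. s \<in> A \<Longrightarrow> t \<in> A \<Longrightarrow> s < t \<Longrightarrow> l2d Q (V s \<circ> \<sigma> s) (V t \<circ> \<sigma> t) \<le> c s t" by blast
  have bA: "b \<notin> A" using insert by blast
  show ?case
  proof (cases "A = {}")
    case True
    then show ?thesis by (intro exI[of _ "\<lambda>_. id"]) (simp add: permutes_id[unfolded id_def] id_def)
  next
    case False
    define m where "m = Max A"
    have m: "m \<in> A" "\<And>s. s \<in> A \<Longrightarrow> s \<le> m" using insert(1) False by (auto simp: m_def)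
    have mb: "m < b" using insert(2) m(1) by blast
    have inD: "m \<in> D" "b \<in> D" using insert.prems m(1) by auto
    obtain p where p: "p permutes {..<Q}" "Gdist (ms Q (V m \<circ> \<sigma> m)) (ms Q (V b)) = l2d Q (V m \<circ> \<sigma> m) (V b \<circ> p)"
      by (rule Gdist_attained)
    have pm: "l2d Q (V m \<circ> \<sigma> m) (V b \<circ> p) \<le> c m b"
      using G[OF inD mb] p(2) ms_permute[OF \<sigma>(1)[OF m(1)], of "V m"] by simp
    have pb: "l2d Q (V s \<circ> \<sigma> s) (V b \<circ> p) \<le> c s b" if "s \<in> A" for s
    proof (cases "s = m")
      case False
      then have sm: "s < m" using m(2)[OF that] by simp
      have "l2d Q (V s \<circ> \<sigma> s) (V b \<circ> p) \<le> l2d Q (V s \<circ> \<sigma> s) (V m \<circ> \<sigma> m) + l2d Q (V m \<circ> \<sigma> m) (V b \<circ> p)"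
        by (rule l2d_triangle)
      also have "\<dots> \<le> c s m + c m b" using \<sigma>(2)[OF that m(1) sm] pm by simp
      also have "\<dots> \<le> c s b" using sup[of s m b] that insert.prems sm mb inD by auto
      finally show ?thesis .
    qed (use pm in simp)
    show ?thesis
    proof (intro exI[of _ "\<sigma>(b := p)"] conjI ballI impI)
      fix s assume "s \<in> insert b A"
      then show "(\<sigma>(b := p)) s permutes {..<Q}" using p \<sigma>(1) by auto
    next
      fix s t assume "s \<in> insert b A" "t \<in> insert b A" "s < t"
      moreover have "\<not> b < t" if "t \<in> insert b A" for t using insert(2) that by auto
      ultimately show "l2d Q (V s \<circ> (\<sigma>(b := p)) s) (V t \<circ> (\<sigma>(b := p)) t) \<le> c s t"
        using \<sigma>(2) pb bA by (auto split: if_splits)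
    qed
  qed
qed

text \<open>Finite subsets of \<open>D\<close> are handled by matching successive values; Tychonoff's theorem for the finite
  sets of orderings of the values gives all of \<open>D\<close>.\<close>

lemma controlled_selection:
  fixes h :: "real \<Rightarrow> (real^'n) multiset"
  assumes h: "\<And>s. s \<in> D \<Longrightarrow> h s \<in> AQ Q"
    and G: "\<And>s t. s \<in> D \<Longrightarrow> t \<in> D \<Longrightarrow> s < t \<Longrightarrow> Gdist (h s) (h t) \<le> c s t"
    and sup: "\<And>s r t. s \<in> D \<Longrightarrow> r \<in> D \<Longrightarrow> t \<in> D \<Longrightarrow> s < r \<Longrightarrow> r < t \<Longrightarrow> c s r + c r t \<le> c s t"
  obtains X where "\<And>s. s \<in> D \<Longrightarrow> ms Q (X s) = h s"
    "\<And>s t. s \<in> D \<Longrightarrow> t \<in> D \<Longrightarrow> s < t \<Longrightarrow> l2d Q (X s) (X t) \<le> c s t"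
proof -
  have "\<forall>s\<in>D. \<exists>V. h s = ms Q V" using h AQ_imp_ms by metis
  then obtain V where V: "\<And>s. s \<in> D \<Longrightarrow> h s = ms Q (V s)" by metis
  define P where "P = {p::nat\<Rightarrow>nat. p permutes {..<Q}}"
  have P: "finite P" unfolding P_def by (simp add: finite_permutations)
  define X where "X = product_topology (\<lambda>s::real. discrete_topology P) D"
  have "compact_space X"
    unfolding X_def compact_space_product_topology using P by (simp add: compact_space_discrete_topology)
  have tX: "topspace X = (\<Pi>\<^sub>E s\<in>D. P)" by (simp add: X_def)
  \<comment> \<open>Each requirement involves two coordinates in a product of finite discrete spaces
    and is therefore a closed condition.\<close>
  define C where "C s t = {\<sigma> \<in> topspace X. l2d Q (V s \<circ> \<sigma> s) (V t \<circ> \<sigma> t) \<le> c s t}" for s t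
  have clo: "closedin X (C s t)" if st: "s \<in> D" "t \<in> D" for s t
  proof -
    define R where "R = {(p,q) \<in> P \<times> P. l2d Q (V s \<circ> p) (V t \<circ> q) \<le> c s t}"
    have "finite R" unfolding R_def by (rule finite_subset[of _ "P \<times> P"]) (use P in auto)
    have e: "C s t = (\<Union>(p,q)\<in>R. {\<sigma> \<in> topspace X. \<sigma> s \<in> {p}} \<inter> {\<sigma> \<in> topspace X. \<sigma> t \<in> {q}})"
      using st by (auto simp: C_def R_def tX PiE_iff)
    have cc: "closedin X {\<sigma> \<in> topspace X. \<sigma> r \<in> {p}}" if "r \<in> D" "p \<in> P" for r p
      by (rule closedin_continuous_map_preimage[where Y="discrete_topology P"])
        (use that in \<open>auto simp: X_def intro!: continuous_map_product_projection\<close>)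
    show ?thesis unfolding e
      by (rule closedin_Union) (use \<open>finite R\<close> st cc in \<open>auto simp: R_def intro!: closedin_Int\<close>)
  qed
  define U where "U = {C s t | s t. s \<in> D \<and> t \<in> D \<and> s < t}"
  have fip: "\<Inter> F \<noteq> {}" if F: "finite F" "F \<subseteq> U" "F \<noteq> {}" for F
  proof -
    have "\<forall>S\<in>F. \<exists>st. fst st \<in> D \<and> snd st \<in> D \<and> fst st < snd st \<and> S = C (fst st) (snd st)"
      using F(2) unfolding U_def by fastforce
    then obtain g where g: "\<And>S. S \<in> F \<Longrightarrow> fst (g S) \<in> D \<and> snd (g S) \<in> D \<and> fst (g S) < snd (g S) \<and> S = C (fst (g S)) (snd (g S))"
      by metis
    define A where "A = (\<lambda>S. fst (g S)) ` F \<union> (\<lambda>S. snd (g S)) ` F"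
    have A: "finite A" "A \<subseteq> D" using F g by (auto simp: A_def)
    have G': "Gdist (ms Q (V s)) (ms Q (V t)) \<le> c s t" if "s \<in> D" "t \<in> D" "s < t" for s t
      using G[OF that] V that by simp
    from finite_chain_matching[where D=D and V=V and c=c and Q=Q, OF G' sup A]
    obtain \<sigma> where \<sigma>: "\<And>s. s \<in> A \<Longrightarrow> \<sigma> s permutes {..<Q}" "\<And>s t. s \<in> A \<Longrightarrow> t \<in> A \<Longrightarrow> s < t \<Longrightarrow> l2d Q (V s \<circ> \<sigma> s) (V t \<circ> \<sigma> t) \<le> c s t"
      by blast
    define \<tau> where "\<tau> = (\<lambda>s\<in>D. if s \<in> A then \<sigma> s else id)"
    have "\<tau> \<in> topspace X" unfolding tX \<tau>_def P_def using \<sigma>(1) by (auto simp: permutes_id)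
    moreover have "\<tau> \<in> S" if S: "S \<in> F" for S
    proof -
      have a: "fst (g S) \<in> A" "snd (g S) \<in> A" using S by (auto simp: A_def)
      then have "\<tau> (fst (g S)) = \<sigma> (fst (g S))" "\<tau> (snd (g S)) = \<sigma> (snd (g S))" using A(2) by (auto simp: \<tau>_def)
      then have "\<tau> \<in> C (fst (g S)) (snd (g S))" unfolding C_def using \<sigma>(2)[OF a] g[OF S] \<open>\<tau> \<in> topspace X\<close> by simp
      then show ?thesis using g[OF S] by simp
    qed
    ultimately show ?thesis by blast
  qed
  have "(\<lambda>s\<in>D. id) \<in> topspace X" unfolding tX P_def by (auto simp: permutes_id)
  then have ne: "topspace X \<noteq> {}" by blast
  obtain \<sigma> where \<sigma>: "\<sigma> \<in> topspace X" "\<And>S. S \<in> U \<Longrightarrow> \<sigma> \<in> S"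
  proof (cases "U = {}")
    case True
    then show ?thesis using ne that by blast
  next
    case False
    have "\<Inter> U \<noteq> {}"
    proof -
      have "\<forall>F. finite F \<longrightarrow> F \<subseteq> U \<longrightarrow> \<Inter> F \<noteq> {}"
      proof (intro allI impI)
        fix F assume "finite F" "F \<subseteq> U"
        then show "\<Inter> F \<noteq> {}" using fip[of F] by (cases "F = {}") auto
      qed
      moreover have "\<forall>C\<in>U. closedin X C" using clo by (auto simp: U_def)
      ultimately show ?thesis
        using \<open>compact_space X\<close>[unfolded compact_space_fip, THEN spec[of _ U]] by simp
    qed
    then obtain \<sigma> where s: "\<And>S. S \<in> U \<Longrightarrow> \<sigma> \<in> S" by blast
    obtain S where "S \<in> U" using False by blast
    then have "\<sigma> \<in> topspace X" using s[of S] by (auto simp: U_def C_def)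
    with s that show ?thesis by blast
  qed
  show ?thesis
  proof (rule that[of "\<lambda>s. V s \<circ> \<sigma> s"])
    fix s assume s: "s \<in> D"
    then have "\<sigma> s permutes {..<Q}" using \<sigma>(1) by (auto simp: tX P_def PiE_iff)
    then show "ms Q (V s \<circ> \<sigma> s) = h s" using ms_permute V[OF s] by metis
  next
    fix s t assume "s \<in> D" "t \<in> D" "s < t"
    then have "C s t \<in> U" by (auto simp: U_def)
    then show "l2d Q (V s \<circ> \<sigma> s) (V t \<circ> \<sigma> t) \<le> c s t" using \<sigma>(2) by (auto simp: C_def)
  qed
qed

text \<open>The modulus of continuity may depend on the bounded window. The extensions from
  different windows are continuous and agree on the dense set, hence on overlaps.\<close>

lemma continuous_extension_real:
  fixes f :: "real \<Rightarrow> 'a::banach"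
  assumes dense: "closure D = UNIV"
    and uc: "\<And>m::nat. uniformly_continuous_on (D \<inter> {- real m<..<real m}) f"
  obtains g where "continuous_on UNIV g" "\<And>x. x \<in> D \<Longrightarrow> g x = f x"
proof -
  let ?D = "\<lambda>m::nat. D \<inter> {- real m<..<real m}"
  have cl: "{- real m<..<real m} \<subseteq> closure (?D m)" for m
    using open_Int_closure_subset[of "{- real m<..<real m}" D] dense by (simp add: Int_commute)
  have "\<exists>g. uniformly_continuous_on (closure (?D m)) g \<and> (\<forall>x\<in>?D m. f x = g x)" for m
    using uniformly_continuous_on_extension_on_closure[OF uc[of m]] by metis
  then obtain g where g: "\<And>m. uniformly_continuous_on (closure (?D m)) (g m)" "\<And>m x. x \<in> ?D m \<Longrightarrow> f x = g m x" by metis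
  have gc: "continuous_on {- real m<..<real m} (g m)" for m
    using continuous_on_subset[OF uniformly_continuous_imp_continuous[OF g(1)[of m]] cl] .
  have eq: "g m x = g k x" if "x \<in> {- real m<..<real m}" "m \<le> k" for m k x
  proof -
    have "continuous_on {- real m<..<real m} (g k)"
      by (rule continuous_on_subset[OF gc[of k]]) (use that in auto)
    then have c: "continuous_on {- real m<..<real m} (\<lambda>x. g m x - g k x)" by (intro continuous_intros gc)
    have "\<forall>x\<in>?D m. g m x - g k x = 0"
      using g(2)[of _ m] g(2)[of _ k] that(2) by (metis Int_iff cancel_comm_monoid_add_class.diff_cancel greaterThanLessThan_iff le_less_trans less_le_trans minus_le_iff neg_less_iff_less of_nat_le_iff order.strict_trans2 neg_le_iff_le)
    show ?thesis
    proof (rule ccontr)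
      assume ne: "g m x \<noteq> g k x"
      have "open ({- real m<..<real m} \<inter> (\<lambda>x. g m x - g k x) -` (- {0}))"
        by (rule continuous_open_preimage[OF c]) auto
      moreover have "x \<in> {- real m<..<real m} \<inter> (\<lambda>x. g m x - g k x) -` (- {0})" using that ne by auto
      moreover have "x \<in> closure D" using dense by simp
      ultimately obtain z where "z \<in> D" "z \<in> {- real m<..<real m} \<inter> (\<lambda>x. g m x - g k x) -` (- {0})"
        using open_Int_closure_eq_empty by blast
      then show False using \<open>\<forall>x\<in>?D m. g m x - g k x = 0\<close> by auto
    qed
  qed
  define M where "M x = nat \<lceil>\<bar>x\<bar>\<rceil> + 1" for x :: real
  define G where "G x = g (M x) x" for x
  have Mx: "x \<in> {- real (M x)<..<real (M x)}" for x
  proof -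
    have "\<bar>x\<bar> < real (M x)" unfolding M_def using real_nat_ceiling_ge[of "\<bar>x\<bar>"] by linarith
    then show ?thesis by auto
  qed
  have Geq: "G x = g m x" if "x \<in> {- real m<..<real m}" for x m
  proof (cases "m \<le> M x")
    case True
    from eq[OF that this] show ?thesis unfolding G_def by (rule sym)
  next
    case False
    then show ?thesis unfolding G_def by (intro eq[OF Mx]) simp
  qed
  have "isCont G x" for x
  proof -
    have "isCont (g (M x)) x" using gc[of "M x"] Mx[of x] by (simp add: continuous_on_eq_continuous_at)
    moreover have "\<forall>\<^sub>F z in nhds x. G z = g (M x) z"
      using eventually_nhds_in_open[of "{- real (M x)<..<real (M x)}" x] Mx[of x]
      by (auto elim!: eventually_mono simp: Geq)
    ultimately show ?thesis by (simp add: isCont_cong)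
  qed
  moreover have "G x = f x" if "x \<in> D" for x using g(2)[of x "M x"] Mx[of x] that by (simp add: G_def)
  ultimately show ?thesis using that continuous_at_imp_continuous_on by blast
qed

section \<open>The sheets of a homogeneous map\<close>

lemma Omega_open: "open Omega"
  unfolding Omega_def D_half_def U_disk_def by (intro open_Int open_ball open_Collect_less continuous_intros)

lemma Omega_convex: "convex Omega"
proof -
  have "D_half = {x. (axis 2 1 :: real^2) \<bullet> x > 0}" by (simp add: D_half_def inner_axis')
  then have "convex D_half" using convex_halfspace_gt[of 0 "axis 2 1 :: real^2"] by simp
  then show ?thesis unfolding Omega_def U_disk_def by (intro convex_Int convex_ball)
qed

lemma Omega_sets [measurable]: "Omega \<in> sets borel" using Omega_open by simp

lemma Omega_sets_lebesgue: "Omega \<in> sets lebesgue" using Omega_open by simp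

lemma Omega_iff: "x \<in> Omega \<longleftrightarrow> x $ 2 > 0 \<and> (x $ 1)\<^sup>2 + (x $ 2)\<^sup>2 < 1"
  by (auto simp: Omega_def D_half_def U_disk_def dist_norm norm_vec_def L2_set_def UNIV_2 real_sqrt_lt_1_iff)

lemma pt_1_Omega: "pt 1 t y \<in> Omega \<longleftrightarrow> y > 0 \<and> t\<^sup>2 + y\<^sup>2 < 1"
  by (simp add: Omega_iff pt_def)

lemma Omega_finite: "emeasure lborel Omega < \<infinity>"
  by (rule emeasure_bounded_finite) (auto simp: Omega_def U_disk_def intro!: bounded_Int)

lemma integrable_Omega_indicator: "integrable lborel (indicator Omega :: real^2 \<Rightarrow> real)"
  using Omega_finite by (simp add: integrable_indicator_iff)

lemma AE_lebesgue_on_Omega: "(AE x in lebesgue_on Omega. R x) \<longleftrightarrow> (AE x in lborel. x \<in> Omega \<longrightarrow> R x)"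
  using Omega_sets_lebesgue by (simp add: AE_restrict_space_iff AE_completion_iff)

section \<open>Admissible bounds on lines\<close>

lemma L2_Omega_borel_rep:
  assumes "L2 Omega f"
  obtains f' where "f' \<in> borel_measurable borel" "\<And>x. x \<notin> Omega \<Longrightarrow> f' x = 0" "AE x in lborel. x \<in> Omega \<longrightarrow> f' x = f x"
    "integrable lborel (\<lambda>x. (f' x)\<^sup>2)" "integrable lborel f'"
    "set_lebesgue_integral lebesgue Omega (\<lambda>x. (f x)\<^sup>2) = (LINT x|lborel. (f' x)\<^sup>2)"
proof -
  have m: "(\<lambda>x. indicator Omega x * f x) \<in> borel_measurable lebesgue"
    using assms Omega_sets_lebesgue by (simp add: L2_def borel_measurable_restrict_space_iff)
  then obtain f0 where f0: "f0 \<in> borel_measurable lborel" "AE x in lborel. indicator Omega x * f x = f0 x"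
    using completion_ex_borel_measurable_real by blast
  define f' where "f' x = indicator Omega x * f0 x" for x
  have fm[measurable]: "f' \<in> borel_measurable borel" unfolding f'_def using f0(1) by measurable
  have ae: "AE x in lborel. x \<in> Omega \<longrightarrow> f' x = f x"
    using f0(2) by eventually_elim (auto simp: f'_def)
  have i: "integrable lebesgue (\<lambda>x. indicator Omega x * (f x)\<^sup>2)"
    using assms Omega_sets_lebesgue by (simp add: L2_def integrable_restrict_space)
  have ae2: "AE x in lebesgue. indicator Omega x * (f x)\<^sup>2 = (f' x)\<^sup>2"
    unfolding AE_completion_iff using ae by eventually_elim (auto simp: f'_def indicator_def)
  have fm': "(\<lambda>x. (f' x)\<^sup>2) \<in> borel_measurable lborel" by measurable
  have fm2: "(\<lambda>x. (f' x)\<^sup>2) \<in> borel_measurable lebesgue" using measurable_completion[OF fm'] .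
  have "integrable lebesgue (\<lambda>x. (f' x)\<^sup>2)"
    using i integrable_cong_AE[OF borel_measurable_integrable[OF i] fm2 ae2] by blast
  then have i2: "integrable lborel (\<lambda>x. (f' x)\<^sup>2)" using integrable_completion[OF fm'] by simp
  \<comment> \<open>\<open>Omega\<close> has finite measure, so square integrable functions on it
    are integrable.\<close>
  have "integrable lborel f'"
  proof (rule Bochner_Integration.integrable_bound[of lborel "\<lambda>x. indicator Omega x + (f' x)\<^sup>2"])
    show "integrable lborel (\<lambda>x. indicator Omega x + (f' x)\<^sup>2)" using i2 integrable_Omega_indicator by simp
    show "AE x in lborel. norm (f' x) \<le> norm (indicator Omega x + (f' x)\<^sup>2)"
    proof (rule AE_I2)
      fix x
      have "\<bar>a\<bar> \<le> 1 + a\<^sup>2" for a :: real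
        using zero_le_power2[of "\<bar>a\<bar> - 1/2"] by (simp add: power2_eq_square algebra_simps)
      then show "norm (f' x) \<le> norm (indicator Omega x + (f' x)\<^sup>2)" by (cases "x \<in> Omega") (auto simp: f'_def)
    qed
  qed simp
  moreover have "set_lebesgue_integral lebesgue Omega (\<lambda>x. (f x)\<^sup>2) = (LINT x|lborel. (f' x)\<^sup>2)"
  proof -
    have "set_lebesgue_integral lebesgue Omega (\<lambda>x. (f x)\<^sup>2) = (LINT x|lebesgue. (f' x)\<^sup>2)"
      unfolding set_lebesgue_integral_def
      using integral_cong_AE[OF borel_measurable_integrable[OF i] fm2 ae2] by simp
    then show ?thesis using integral_completion[OF fm'] by simp
  qed
  ultimately show ?thesis using that[of f'] fm ae i2 by (auto simp: f'_def)
qed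

lemma L2_Omega_borelI:
  assumes "f \<in> borel_measurable borel" "integrable lborel (\<lambda>x. indicator Omega x * (f x)\<^sup>2)"
  shows "L2 Omega f"
proof -
  have "(\<lambda>x. indicator Omega x * f x) \<in> borel_measurable lborel" using assms(1) by measurable
  from measurable_completion[OF this] have "f \<in> borel_measurable (lebesgue_on Omega)"
    using Omega_sets_lebesgue by (simp add: borel_measurable_restrict_space_iff)
  moreover have "integrable (lebesgue_on Omega) (\<lambda>x. (f x)\<^sup>2)"
    using set_lebesgue_borel(1)[OF assms(2)] Omega_sets_lebesgue by (simp add: integrable_restrict_space set_integrable_def)
  ultimately show ?thesis by (simp add: L2_def)
qed

lemma L2_Omega_set_integrable: assumes "L2 Omega f" shows "set_integrable lebesgue Omega f"
proof -
  obtain f' where f': "f' \<in> borel_measurable borel" "\<And>x. x \<notin> Omega \<Longrightarrow> f' x = 0" "AE x in lborel. x \<in> Omega \<longrightarrow> f' x = f x"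
    "integrable lborel f'" by (rule L2_Omega_borel_rep[OF assms]) blast
  have i: "integrable lebesgue f'" using f'(4) integrable_completion[of f' lborel] f'(1) by simp
  have m: "(\<lambda>x. indicator Omega x * f x) \<in> borel_measurable lebesgue"
    using assms Omega_sets_lebesgue by (simp add: L2_def borel_measurable_restrict_space_iff)
  have "AE x in lebesgue. f' x = indicator Omega x * f x"
    unfolding AE_completion_iff using f'(3) by eventually_elim (use f'(2) in \<open>auto simp: indicator_def\<close>)
  then have "integrable lebesgue (\<lambda>x. indicator Omega x * f x)"
    using integrable_cong_AE[OF borel_measurable_integrable[OF i] m] i by blast
  then show ?thesis by (simp add: set_integrable_def)
qed

text \<open>The admissible bounds of \<open>AQ_adm\<close>, made Borel and read off on almost every line in direction \<open>j\<close>.\<close>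

definition badm :: "nat \<Rightarrow> (real^2 \<Rightarrow> (real^'n) multiset) \<Rightarrow> 2 \<Rightarrow> (real^2 \<Rightarrow> real) \<Rightarrow> bool" where
  "badm Q u j \<psi> \<longleftrightarrow> \<psi> \<in> borel_measurable borel \<and> (\<forall>x. 0 \<le> \<psi> x) \<and> integrable lborel \<psi> \<and> integrable lborel (\<lambda>x. (\<psi> x)\<^sup>2) \<and>
     (AE y in lborel. \<exists>N\<in>null_sets lborel. \<forall>s t. s < t \<longrightarrow> s \<notin> N \<longrightarrow> t \<notin> N \<longrightarrow> pt j s y \<in> Omega \<longrightarrow> pt j t y \<in> Omega \<longrightarrow>
       Gdist (u (pt j t y)) (u (pt j s y)) \<le> integral {s..t} (\<lambda>\<tau>. \<psi> (pt j \<tau> y)))"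

text \<open>For each \<open>T\<close> in a countable dense set the weak derivative controls the
  increments of the distance to \<open>T\<close> on almost every line. A common null set and
  \<open>Gdist_le_if_dense\<close> transfer the control to \<open>u\<close>. The integral of the
  square is preserved, so the infimum in \<open>Dir\<close> can be estimated through
  \<open>badm\<close>.\<close>

lemma AQ_adm_badm:
  fixes u :: "real^2 \<Rightarrow> (real^'n) multiset"
  assumes u: "AQ_W12 Q Omega u" and adm: "AQ_adm Q Omega u j \<psi>"
  obtains \<psi>' where "badm Q u j \<psi>'" "set_lebesgue_integral lebesgue Omega (\<lambda>x. (\<psi> x)\<^sup>2) = (LINT x|lborel. (\<psi>' x)\<^sup>2)"
proof -
  have L: "L2 Omega \<psi>" using adm by (simp add: AQ_adm_def)
  obtain f where f: "f \<in> borel_measurable borel" "\<And>x. x \<notin> Omega \<Longrightarrow> f x = 0" "AE x in lborel. x \<in> Omega \<longrightarrow> f x = \<psi> x"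
    "integrable lborel (\<lambda>x. (f x)\<^sup>2)" "integrable lborel f"
    "set_lebesgue_integral lebesgue Omega (\<lambda>x. (\<psi> x)\<^sup>2) = (LINT x|lborel. (f x)\<^sup>2)"
    by (rule L2_Omega_borel_rep[OF L]) blast
  define \<psi>' where "\<psi>' x = \<bar>f x\<bar>" for x
  have \<psi>': "\<psi>' \<in> borel_measurable borel" "\<And>x. 0 \<le> \<psi>' x" "integrable lborel \<psi>'" "integrable lborel (\<lambda>x. (\<psi>' x)\<^sup>2)"
    using f unfolding \<psi>'_def by auto
  obtain D :: "(real^'n) multiset set" where D: "countable D" "D \<subseteq> AQ Q"
    "\<And>V e. 0 < e \<Longrightarrow> \<exists>W. ms Q W \<in> D \<and> Gdist (ms Q V) (ms Q W) < e"
    by (rule countable_dense_AQ[of Q]) blast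
  have "AE y in lborel. \<forall>T\<in>D. \<exists>N\<in>null_sets lborel. \<forall>s t. s < t \<longrightarrow> s \<notin> N \<longrightarrow> t \<notin> N \<longrightarrow> (\<forall>\<tau>\<in>{s..t}. pt j \<tau> y \<in> Omega) \<longrightarrow>
     \<bar>Gdist (u (pt j t y)) T - Gdist (u (pt j s y)) T\<bar> \<le> integral {s..t} (\<lambda>\<tau>. \<psi>' (pt j \<tau> y))"
    unfolding AE_ball_countable[OF D(1)]
  proof
    fix T assume "T \<in> D"
    then have T: "T \<in> AQ Q" using D(2) by auto
    obtain g where g: "weak_deriv Omega j (\<lambda>x. Gdist (u x) T) g" "AE x in lebesgue_on Omega. \<bar>g x\<bar> \<le> \<psi> x"
      using adm T by (auto simp: AQ_adm_def)
    have L: "L2 Omega (\<lambda>x. Gdist (u x) T)" using u T by (auto simp: AQ_W12_def W12_def)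
    have gb: "AE x in lborel. x \<in> Omega \<longrightarrow> \<bar>g x\<bar> \<le> \<psi>' x"
      using g(2) f(3) unfolding AE_lebesgue_on_Omega by eventually_elim (auto simp: \<psi>'_def)
    show "AE y in lborel. \<exists>N\<in>null_sets lborel. \<forall>s t. s < t \<longrightarrow> s \<notin> N \<longrightarrow> t \<notin> N \<longrightarrow> (\<forall>\<tau>\<in>{s..t}. pt j \<tau> y \<in> Omega) \<longrightarrow>
     \<bar>Gdist (u (pt j t y)) T - Gdist (u (pt j s y)) T\<bar> \<le> integral {s..t} (\<lambda>\<tau>. \<psi>' (pt j \<tau> y))"
      by (rule weak_deriv_lines[OF Omega_open g(1) L2_Omega_set_integrable[OF L] gb \<psi>'(3,2)])
  qed
  then have "AE y in lborel. \<exists>N\<in>null_sets lborel. \<forall>s t. s < t \<longrightarrow> s \<notin> N \<longrightarrow> t \<notin> N \<longrightarrow> pt j s y \<in> Omega \<longrightarrow> pt j t y \<in> Omega \<longrightarrow>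
       Gdist (u (pt j t y)) (u (pt j s y)) \<le> integral {s..t} (\<lambda>\<tau>. \<psi>' (pt j \<tau> y))"
  proof eventually_elim
    case (elim y)
    then obtain NN where NN: "\<And>T. T \<in> D \<Longrightarrow> NN T \<in> null_sets lborel"
      "\<And>T s t. T \<in> D \<Longrightarrow> s < t \<Longrightarrow> s \<notin> NN T \<Longrightarrow> t \<notin> NN T \<Longrightarrow> (\<forall>\<tau>\<in>{s..t}. pt j \<tau> y \<in> Omega) \<Longrightarrow>
        \<bar>Gdist (u (pt j t y)) T - Gdist (u (pt j s y)) T\<bar> \<le> integral {s..t} (\<lambda>\<tau>. \<psi>' (pt j \<tau> y))"
      unfolding bchoice_iff by metis
    show ?case
    proof (intro bexI[of _ "\<Union>T\<in>D. NN T"] allI impI)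
      show "(\<Union>T\<in>D. NN T) \<in> null_sets lborel" by (rule null_sets_UN'[OF D(1)]) (use NN in auto)
      fix s t assume st: "s < t" "s \<notin> (\<Union>T\<in>D. NN T)" "t \<notin> (\<Union>T\<in>D. NN T)" "pt j s y \<in> Omega" "pt j t y \<in> Omega"
      have inS: "\<forall>\<tau>\<in>{s..t}. pt j \<tau> y \<in> Omega" using convex_pt[OF Omega_convex st(4,5)] by auto
      obtain V W where VW: "u (pt j t y) = ms Q V" "u (pt j s y) = ms Q W"
        using u st(4,5) AQ_imp_ms unfolding AQ_W12_def by metis
      show "Gdist (u (pt j t y)) (u (pt j s y)) \<le> integral {s..t} (\<lambda>\<tau>. \<psi>' (pt j \<tau> y))"
        unfolding VW
      proof (rule Gdist_le_if_dense[OF D(3)])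
        fix T assume "T \<in> D"
        from NN(2)[OF this st(1) _ _ inS] st(2,3) this
        show "\<bar>Gdist (ms Q V) T - Gdist (ms Q W) T\<bar> \<le> integral {s..t} (\<lambda>\<tau>. \<psi>' (pt j \<tau> y))"
          unfolding VW by auto
      qed
    qed
  qed
  then have "badm Q u j \<psi>'" unfolding badm_def using \<psi>' by blast
  moreover have "set_lebesgue_integral lebesgue Omega (\<lambda>x. (\<psi> x)\<^sup>2) = (LINT x|lborel. (\<psi>' x)\<^sup>2)"
    using f(6) by (simp add: \<psi>'_def)
  ultimately show ?thesis using that by blast
qed

text \<open>Slope and height take the place of polar coordinates: at fixed height the slope is a
  rescaling of the first coordinate, so bounds on horizontal lines are bounds for the
  profile.\<close>

definition sheet :: "real \<Rightarrow> (nat \<Rightarrow> real \<Rightarrow> real^'n) \<Rightarrow> real^2 \<Rightarrow> nat \<Rightarrow> real^'n" where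
  "sheet I H x i = (x $ 2 powr I) *\<^sub>R H i (x $ 1 / x $ 2)"

text \<open>Agreement with \<open>u\<close> is almost everywhere, since the Sobolev bounds do not
  see null sets. Continuity is the only regularity, a condition that survives exchanging two sheets
  where they meet.\<close>

definition csel :: "nat \<Rightarrow> real \<Rightarrow> (real^2 \<Rightarrow> (real^'n) multiset) \<Rightarrow> (nat \<Rightarrow> real \<Rightarrow> real^'n) \<Rightarrow> bool" where
  "csel Q I u H \<longleftrightarrow> (\<forall>i<Q. continuous_on UNIV (H i)) \<and> (AE x in lborel. x \<in> Omega \<longrightarrow> u x = ms Q (sheet I H x))"

section \<open>Existence of a continuous splitting\<close>

lemma AE_lborel_ex_interval:
  assumes "AE y in lborel. R y" "a < (b::real)"
  obtains y where "a < y" "y < b" "R y"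
proof -
  obtain N where N: "N \<in> null_sets lborel" "\<And>y. y \<notin> N \<Longrightarrow> R y" using AE_E3[OF assms(1)] by (auto simp: space_lborel)
  have "\<not> {a<..<b} \<subseteq> N"
  proof
    assume "{a<..<b} \<subseteq> N"
    then have "{a<..<b} \<in> null_sets lborel" using null_sets_subset[OF N(1)] by simp
    then show False using assms(2) by (simp add: null_sets_def)
  qed
  then show ?thesis using that N by (auto simp: subset_iff)
qed

lemma closure_compl_null:
  assumes "N \<in> null_sets (lborel :: real measure)" shows "closure (- N) = UNIV"
proof -
  have "interior N = {}"
  proof (rule ccontr)
    assume "interior N \<noteq> {}"
    moreover have "negligible (interior N)"
    proof -
      have "N \<in> null_sets lebesgue" using assms null_sets_completionI by blast
      then show ?thesis using negligible_subset[OF _ interior_subset] by (auto simp: negligible_iff_null_sets)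
    qed
    ultimately show False using open_not_negligible[of "interior N"] by auto
  qed
  then show ?thesis by (simp add: closure_complement)
qed

lemma null_sets_scale:
  assumes "N \<in> null_sets (lborel :: real measure)" "c \<noteq> 0" shows "{s. s * c \<in> N} \<in> null_sets lborel"
proof -
  have N: "N \<in> sets borel" "emeasure lborel N = 0" using assms(1) by (auto simp: null_sets_def)
  have [measurable]: "N \<in> sets borel" by fact
  have s: "{s. s * c \<in> N} \<in> sets borel" by measurable
  have "0 = emeasure lborel N" using N by simp
  also have "\<dots> = emeasure (density (distr lborel borel (\<lambda>x. 0 + c * x)) (\<lambda>_. ennreal \<bar>c\<bar>)) N"
    using lborel_real_affine[OF assms(2), of 0] by simp
  also have "\<dots> = ennreal \<bar>c\<bar> * emeasure (distr lborel borel (\<lambda>x. 0 + c * x)) N"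
    by (subst emeasure_density_const) simp_all
  also have "emeasure (distr lborel borel (\<lambda>x. 0 + c * x)) N = emeasure lborel {s. s * c \<in> N}"
    by (subst emeasure_distr) (auto simp: vimage_def mult.commute)
  finally have "emeasure lborel {s. s * c \<in> N} = 0" using assms(2) by auto
  then show ?thesis using s by (simp add: null_sets_def)
qed

text \<open>On each horizontal line in the upper half plane the bad points are a rescaled copy of
  the null set of slopes.\<close>

lemma AE_slope:
  assumes N: "N \<in> null_sets (lborel :: real measure)"
  shows "AE x in lborel. (x::real^2) $ 2 > 0 \<longrightarrow> x $ 1 / x $ 2 \<notin> N"
proof (rule AE_lborel_ptI[where j=1])
  have [measurable]: "N \<in> sets borel" using N by (auto simp: null_sets_def)
  show "Measurable.pred borel (\<lambda>x::real^2. x $ 2 > 0 \<longrightarrow> x $ 1 / x $ 2 \<notin> N)" by measurable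
  show "AE y in lborel. AE t in lborel. pt 1 t y $ 2 > 0 \<longrightarrow> pt 1 t y $ 1 / pt 1 t y $ 2 \<notin> N"
  proof (rule AE_I2)
    fix y :: real
    show "AE t in lborel. pt 1 t y $ 2 > 0 \<longrightarrow> pt 1 t y $ 1 / pt 1 t y $ 2 \<notin> N"
    proof (cases "y > 0")
      case True
      have "{t. t * (1/y) \<in> N} \<in> null_sets lborel" by (rule null_sets_scale[OF N]) (use True in simp)
      from AE_not_in[OF this] show ?thesis by eventually_elim (simp add: pt_def)
    qed (simp add: pt_def)
  qed
qed

text \<open>A point of slope s at height y has norm y (1 + s^2)^(1/2), which is less than y (m +
  1).\<close>

lemma pt_slope_Omega:
  assumes "0 < y" "y * (m + 1) \<le> 1" "\<bar>s\<bar> < m" shows "pt 1 (s * y) y \<in> Omega"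
proof -
  have "s\<^sup>2 < m\<^sup>2" using assms(3) by (metis abs_ge_zero order_le_less_trans power2_abs power_strict_mono zero_less_numeral)
  have "m > 0" using assms(3) by linarith
  have "(s * y)\<^sup>2 + y\<^sup>2 = y\<^sup>2 * (s\<^sup>2 + 1)" by (simp add: power_mult_distrib algebra_simps)
  also have "\<dots> < y\<^sup>2 * (m + 1)\<^sup>2"
    using assms(1) \<open>s\<^sup>2 < m\<^sup>2\<close> \<open>m > 0\<close> by (intro mult_strict_left_mono) (auto simp: power2_sum)
  also have "\<dots> = (y * (m + 1))\<^sup>2" by (simp add: power_mult_distrib)
  also have "\<dots> \<le> 1\<^sup>2" using assms \<open>m > 0\<close> by (intro power_mono) auto
  finally show ?thesis using assms(1) by (simp add: pt_1_Omega)
qed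

text \<open>The height 1/(2 + |s|) puts the point of slope \<open>s\<close> into
  \<open>Omega\<close> for every \<open>s\<close>; homogeneity transports the value to the other
  heights, as in \<open>homogeneous_profile\<close>.\<close>

definition profile :: "real \<Rightarrow> (real^2 \<Rightarrow> (real^'n) multiset) \<Rightarrow> real \<Rightarrow> (real^'n) multiset" where
  "profile I u s = (let y = 1 / (2 + \<bar>s\<bar>) in image_mset (\<lambda>P. (y powr (- I)) *\<^sub>R P) (u (pt 1 (s * y) y)))"

lemma homogeneous_profile:
  assumes hom: "homogeneous I u" and y: "0 < y" "pt 1 (s * y) y \<in> Omega"
  shows "u (pt 1 (s * y) y) = image_mset (\<lambda>P. (y powr I) *\<^sub>R P) (profile I u s)"
    "profile I u s = image_mset (\<lambda>P. (y powr (- I)) *\<^sub>R P) (u (pt 1 (s * y) y))"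
proof -
  define y0 where "y0 = 1 / (2 + \<bar>s\<bar>)"
  have y0: "y0 > 0" by (simp add: y0_def)
  have in0: "pt 1 (s * y0) y0 \<in> Omega"
    by (rule pt_slope_Omega[of y0 "\<bar>s\<bar> + 1"]) (auto simp: y0_def)
  have e: "(y / y0) *\<^sub>R pt 1 (s * y0) y0 = pt 1 (s * y) y" using y0 by (auto simp: vec_eq_iff pt_def)
  have pr: "profile I u s = image_mset (\<lambda>P. (y0 powr (- I)) *\<^sub>R P) (u (pt 1 (s * y0) y0))"
    by (simp add: profile_def y0_def Let_def)
  have "u ((y / y0) *\<^sub>R pt 1 (s * y0) y0) = image_mset (\<lambda>P. ((y / y0) powr I) *\<^sub>R P) (u (pt 1 (s * y0) y0))"
    using hom[unfolded homogeneous_def, rule_format, of "y / y0" "pt 1 (s * y0) y0"] y y0 in0 by (simp add: e)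
  moreover have "(y / y0) powr I = y powr I * y0 powr (- I)"
    using y y0 by (simp add: powr_divide powr_minus_divide)
  ultimately show 1: "u (pt 1 (s * y) y) = image_mset (\<lambda>P. (y powr I) *\<^sub>R P) (profile I u s)"
    unfolding pr e by (simp add: image_mset.compositionality o_def)
  have "y powr (- I) * y powr I = 1" using y by (simp flip: powr_add)
  then show "profile I u s = image_mset (\<lambda>P. (y powr (- I)) *\<^sub>R P) (u (pt 1 (s * y) y))"
    unfolding 1 by (simp add: image_mset.compositionality o_def)
qed

lemma profile_AQ: assumes "\<forall>x\<in>Omega. u x \<in> AQ Q" shows "profile I u s \<in> AQ Q"
proof -
  have "pt 1 (s * (1 / (2 + \<bar>s\<bar>))) (1 / (2 + \<bar>s\<bar>)) \<in> Omega"
    by (rule pt_slope_Omega[of _ "\<bar>s\<bar> + 1"]) auto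
  then show ?thesis using assms by (auto simp: profile_def Let_def AQ_def)
qed

text \<open>A horizontal line in \<open>Omega\<close> sees only a bounded range of slopes, so a
  sequence of good lines with growing range is used. Each line controls the increments of the
  profile additively. The infimum of these controls is still superadditive, and the selection that
  it governs is uniformly continuous on every bounded window.\<close>

lemma exists_csel:
  fixes u :: "real^2 \<Rightarrow> (real^'n) multiset"
  assumes u: "AQ_W12 Q Omega u" and hom: "homogeneous I u" and b: "badm Q u 1 \<psi>"
  obtains H where "csel Q I u H"
proof -
  have \<psi>: "\<And>x. 0 \<le> \<psi> x" "integrable lborel \<psi>"
    and ae: "AE y in lborel. \<exists>N\<in>null_sets lborel. \<forall>s t. s < t \<longrightarrow> s \<notin> N \<longrightarrow> t \<notin> N \<longrightarrow> pt 1 s y \<in> Omega \<longrightarrow> pt 1 t y \<in> Omega \<longrightarrow>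
       Gdist (u (pt 1 t y)) (u (pt 1 s y)) \<le> integral {s..t} (\<lambda>\<tau>. \<psi> (pt 1 \<tau> y))"
    using b by (auto simp: badm_def)
  have uAQ: "\<forall>x\<in>Omega. u x \<in> AQ Q" using u by (simp add: AQ_W12_def)
  have "\<forall>m::nat. \<exists>y N. 0 < y \<and> y * (real m + 1) \<le> 1 \<and> integrable lborel (\<lambda>t. \<psi> (pt 1 t y)) \<and> N \<in> null_sets lborel \<and>
     (\<forall>s t. s < t \<longrightarrow> s \<notin> N \<longrightarrow> t \<notin> N \<longrightarrow> pt 1 s y \<in> Omega \<longrightarrow> pt 1 t y \<in> Omega \<longrightarrow>
       Gdist (u (pt 1 t y)) (u (pt 1 s y)) \<le> integral {s..t} (\<lambda>\<tau>. \<psi> (pt 1 \<tau> y)))"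
  proof
    fix m :: nat
    have ae2: "AE y in lborel. integrable lborel (\<lambda>t. \<psi> (pt 1 t y)) \<and> (\<exists>N\<in>null_sets lborel. \<forall>s t. s < t \<longrightarrow> s \<notin> N \<longrightarrow> t \<notin> N \<longrightarrow> pt 1 s y \<in> Omega \<longrightarrow> pt 1 t y \<in> Omega \<longrightarrow>
       Gdist (u (pt 1 t y)) (u (pt 1 s y)) \<le> integral {s..t} (\<lambda>\<tau>. \<psi> (pt 1 \<tau> y)))"
      using ae integrable_lborel_pt(1)[OF \<psi>(2), of 1] by eventually_elim blast
    obtain y where "0 < y" "y < 1 / (real m + 1)" "integrable lborel (\<lambda>t. \<psi> (pt 1 t y)) \<and> (\<exists>N\<in>null_sets lborel. \<forall>s t. s < t \<longrightarrow> s \<notin> N \<longrightarrow> t \<notin> N \<longrightarrow> pt 1 s y \<in> Omega \<longrightarrow> pt 1 t y \<in> Omega \<longrightarrow>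
       Gdist (u (pt 1 t y)) (u (pt 1 s y)) \<le> integral {s..t} (\<lambda>\<tau>. \<psi> (pt 1 \<tau> y)))"
      by (rule AE_lborel_ex_interval[OF ae2, of 0 "1 / (real m + 1)"]) auto
    moreover have "y * (real m + 1) \<le> 1" using \<open>y < 1 / (real m + 1)\<close> by (simp add: field_simps)
    ultimately show "\<exists>y N. 0 < y \<and> y * (real m + 1) \<le> 1 \<and> integrable lborel (\<lambda>t. \<psi> (pt 1 t y)) \<and> N \<in> null_sets lborel \<and>
     (\<forall>s t. s < t \<longrightarrow> s \<notin> N \<longrightarrow> t \<notin> N \<longrightarrow> pt 1 s y \<in> Omega \<longrightarrow> pt 1 t y \<in> Omega \<longrightarrow>
       Gdist (u (pt 1 t y)) (u (pt 1 s y)) \<le> integral {s..t} (\<lambda>\<tau>. \<psi> (pt 1 \<tau> y)))" by blast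
  qed
  from choice[OF this] obtain y where "\<forall>m::nat. \<exists>N. 0 < y m \<and> y m * (real m + 1) \<le> 1 \<and> integrable lborel (\<lambda>t. \<psi> (pt 1 t (y m))) \<and> N \<in> null_sets lborel \<and>
     (\<forall>s t. s < t \<longrightarrow> s \<notin> N \<longrightarrow> t \<notin> N \<longrightarrow> pt 1 s (y m) \<in> Omega \<longrightarrow> pt 1 t (y m) \<in> Omega \<longrightarrow>
       Gdist (u (pt 1 t (y m))) (u (pt 1 s (y m))) \<le> integral {s..t} (\<lambda>\<tau>. \<psi> (pt 1 \<tau> (y m))))" by blast
  from choice[OF this] obtain N where yN: "\<And>m. 0 < y m" "\<And>m. y m * (real m + 1) \<le> 1" "\<And>m. integrable lborel (\<lambda>t. \<psi> (pt 1 t (y m)))" "\<And>m. N m \<in> null_sets lborel"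
     "\<And>m s t. s < t \<Longrightarrow> s \<notin> N m \<Longrightarrow> t \<notin> N m \<Longrightarrow> pt 1 s (y m) \<in> Omega \<Longrightarrow> pt 1 t (y m) \<in> Omega \<Longrightarrow>
       Gdist (u (pt 1 t (y m))) (u (pt 1 s (y m))) \<le> integral {s..t} (\<lambda>\<tau>. \<psi> (pt 1 \<tau> (y m)))" by blast
  \<comment> \<open>The slopes that fall on an exceptional point of one of the lines.\<close>
  define NN where "NN = (\<Union>m. {s. s * y m \<in> N m})"
  have NN: "NN \<in> null_sets lborel" unfolding NN_def
  proof (rule null_sets_UN)
    show "{s. s * y m \<in> N m} \<in> null_sets lborel" for m by (rule null_sets_scale[OF yN(4)]) (use yN(1)[of m] in simp)
  qed
  let ?h = "profile I u"
  define cm where "cm m s t = y m powr (- I) * integral {s * y m..t * y m} (\<lambda>\<tau>. \<psi> (pt 1 \<tau> (y m)))" for m s t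
  define A where "A s t = {m. \<bar>s\<bar> < real m \<and> \<bar>t\<bar> < real m}" for s t :: real
  \<comment> \<open>The infimum runs over lines whose range contains both slopes. For s < r < t
    these lines also see r, whence superadditivity.\<close>
  define c where "c s t = (INF m\<in>A s t. cm m s t)" for s t
  have io: "(\<lambda>\<tau>. \<psi> (pt 1 \<tau> (y m))) integrable_on {a..b}" for m a b
    by (rule integrable_lborel_imp_integrable_on[OF yN(3)]) simp
  have cm0: "0 \<le> cm m s t" for m s t
    unfolding cm_def by (intro mult_nonneg_nonneg integral_nonneg io) (use \<psi> in auto)
  have Ane: "A s t \<noteq> {}" for s t
  proof -
    obtain m where "max \<bar>s\<bar> \<bar>t\<bar> < real m" using reals_Archimedean2 by blast
    then show ?thesis by (auto simp: A_def)
  qed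
  have bdd: "bdd_below ((\<lambda>m. cm m s t) ` A s t)" for s t using cm0 by (intro bdd_belowI[of _ 0]) auto
  have c_le: "c s t \<le> cm m s t" if "m \<in> A s t" for m s t
    unfolding c_def by (rule cINF_lower[OF bdd that])
  have cm_add: "cm m s r + cm m r t = cm m s t" if "s < r" "r < t" for m s r t
    unfolding cm_def using Henstock_Kurzweil_Integration.integral_combine[OF _ _ io, of "s * y m" "r * y m" "t * y m"] that yN(1)[of m]
    by (simp flip: distrib_left)
  have sup: "c s r + c r t \<le> c s t" if "s < r" "r < t" for s r t
    unfolding c_def[of s t]
  proof (rule cINF_greatest[OF Ane])
    fix m assume m: "m \<in> A s t"
    then have "m \<in> A s r" "m \<in> A r t" using that by (auto simp: A_def)
    then show "c s r + c r t \<le> cm m s t" using c_le cm_add[OF that, of m] by (metis add_mono)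
  qed
  have inO: "pt 1 (s * y m) (y m) \<in> Omega" if "\<bar>s\<bar> < real m" for s m
    by (rule pt_slope_Omega[OF yN(1,2) that])
  have G: "Gdist (?h s) (?h t) \<le> c s t" if st: "s \<in> - NN" "t \<in> - NN" "s < t" for s t
    unfolding c_def
  proof (rule cINF_greatest[OF Ane])
    fix m assume m: "m \<in> A s t"
    then have os: "pt 1 (s * y m) (y m) \<in> Omega" "pt 1 (t * y m) (y m) \<in> Omega" using inO by (auto simp: A_def)
    obtain V W where VW: "u (pt 1 (s * y m) (y m)) = ms Q V" "u (pt 1 (t * y m) (y m)) = ms Q W"
      using uAQ os AQ_imp_ms by metis
    have e: "?h s = ms Q (\<lambda>i. (y m powr (- I)) *\<^sub>R V i)" "?h t = ms Q (\<lambda>i. (y m powr (- I)) *\<^sub>R W i)"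
      using homogeneous_profile(2)[OF hom yN(1) os(1)] homogeneous_profile(2)[OF hom yN(1) os(2)]
      by (simp_all add: VW image_mset_ms)
    have "Gdist (?h s) (?h t) \<le> y m powr (- I) * Gdist (ms Q V) (ms Q W)"
      unfolding e by (rule Gdist_scaleR) simp
    also have "Gdist (ms Q V) (ms Q W) = Gdist (u (pt 1 (t * y m) (y m))) (u (pt 1 (s * y m) (y m)))"
      using Gdist_sym VW by metis
    also have "y m powr (- I) * \<dots> \<le> cm m s t"
      unfolding cm_def using st yN(1)[of m] os by (intro mult_left_mono yN(5)) (auto simp: NN_def)
    finally show "Gdist (?h s) (?h t) \<le> cm m s t" by simp
  qed
  have "\<exists>X. (\<forall>s\<in>- NN. ms Q (X s) = ?h s) \<and> (\<forall>s\<in>- NN. \<forall>t\<in>- NN. s < t \<longrightarrow> l2d Q (X s) (X t) \<le> c s t)"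
  proof (rule controlled_selection[of "- NN" ?h Q c], goal_cases)
    case (1 s)
    show ?case by (rule profile_AQ[OF uAQ])
  next
    case (2 s t)
    then show ?case by (rule G)
  next
    case (3 s r t)
    from 3(4,5) show ?case by (rule sup)
  next
    case (4 X)
    then show ?case by blast
  qed
  then obtain X where X: "\<And>s. s \<in> - NN \<Longrightarrow> ms Q (X s) = ?h s"
    "\<And>s t. s \<in> - NN \<Longrightarrow> t \<in> - NN \<Longrightarrow> s < t \<Longrightarrow> l2d Q (X s) (X t) \<le> c s t" by blast
  have cl: "closure (- NN) = UNIV" by (rule closure_compl_null[OF NN])
  have "\<exists>g. continuous_on UNIV g \<and> (\<forall>x\<in>- NN. g x = X x i)" if i: "i < Q" for i
  proof -
    have "uniformly_continuous_on (- NN \<inter> {- real m<..<real m}) (\<lambda>s. X s i)" for m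
    proof -
      \<comment> \<open>On the window of line \<open>m\<close> the control is an increment of this
        continuous function.\<close>
      define \<Phi> where "\<Phi> s = y m powr (- I) * integral {- real m * y m..s * y m} (\<lambda>\<tau>. \<psi> (pt 1 \<tau> (y m)))" for s
      have c0: "continuous_on {- real m * y m..real m * y m} (\<lambda>t. integral {- real m * y m..t} (\<lambda>\<tau>. \<psi> (pt 1 \<tau> (y m))))"
        by (rule indefinite_integral_continuous_1[OF io])
      have im: "(\<lambda>s. s * y m) ` {- real m..real m} \<subseteq> {- real m * y m..real m * y m}"
      proof clarify
        fix s assume "s \<in> {- real m..real m}"
        then show "s * y m \<in> {- real m * y m..real m * y m}"
          using mult_right_mono[of "- real m" s "y m"] mult_right_mono[of s "real m" "y m"] yN(1)[of m] by auto
      qed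
      have "continuous_on {- real m..real m} (\<lambda>s. integral {- real m * y m..s * y m} (\<lambda>\<tau>. \<psi> (pt 1 \<tau> (y m))))"
        by (rule continuous_on_compose2[OF c0 _ im]) (intro continuous_intros)
      then have "continuous_on {- real m..real m} \<Phi>" unfolding \<Phi>_def by (rule continuous_on_mult_left)
      then have uc: "uniformly_continuous_on {- real m..real m} \<Phi>" by (intro compact_uniformly_continuous) auto
      have le: "dist (X s i) (X t i) \<le> \<bar>\<Phi> t - \<Phi> s\<bar>"
        if "s \<in> - NN \<inter> {- real m<..<real m}" "t \<in> - NN \<inter> {- real m<..<real m}" "s < t" for s t
      proof -
        have "dist (X s i) (X t i) \<le> l2d Q (X s) (X t)" using norm_le_l2d[OF i] by (simp add: dist_norm)
        also have "\<dots> \<le> c s t" using X(2) that by auto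
        also have "\<dots> \<le> cm m s t" by (rule c_le) (use that in \<open>auto simp: A_def\<close>)
        also have "\<dots> = \<Phi> t - \<Phi> s"
        proof -
          have "integral {- real m * y m..s * y m} (\<lambda>\<tau>. \<psi> (pt 1 \<tau> (y m))) + integral {s * y m..t * y m} (\<lambda>\<tau>. \<psi> (pt 1 \<tau> (y m)))
            = integral {- real m * y m..t * y m} (\<lambda>\<tau>. \<psi> (pt 1 \<tau> (y m)))"
            by (rule Henstock_Kurzweil_Integration.integral_combine[OF _ _ io]) (use that yN(1)[of m] mult_right_mono[of "- real m" s "y m"] in auto)
          then show ?thesis unfolding cm_def \<Phi>_def by (metis add_diff_cancel_left' right_diff_distrib)
        qed
        finally show ?thesis by simp
      qed
      show ?thesis unfolding uniformly_continuous_on_def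
      proof (intro allI impI)
        fix e :: real assume "0 < e"
        then obtain d where d: "d > 0" "\<And>s t. s \<in> {- real m..real m} \<Longrightarrow> t \<in> {- real m..real m} \<Longrightarrow> dist t s < d \<Longrightarrow> dist (\<Phi> t) (\<Phi> s) < e"
          using uc unfolding uniformly_continuous_on_def by blast
        show "\<exists>d>0. \<forall>x\<in>- NN \<inter> {- real m<..<real m}. \<forall>x'\<in>- NN \<inter> {- real m<..<real m}. dist x' x < d \<longrightarrow> dist (X x' i) (X x i) < e"
        proof (intro exI[of _ d] conjI ballI impI d(1))
          fix s t assume st: "s \<in> - NN \<inter> {- real m<..<real m}" "t \<in> - NN \<inter> {- real m<..<real m}" "dist t s < d"
          have "dist (\<Phi> t) (\<Phi> s) < e" using d(2)[of s t] st by auto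
          moreover have "dist (X t i) (X s i) \<le> dist (\<Phi> t) (\<Phi> s)"
            using le[OF st(1,2)] le[OF st(2,1)] by (cases s t rule: linorder_cases) (auto simp: dist_real_def dist_commute abs_minus_commute)
          ultimately show "dist (X t i) (X s i) < e" by simp
        qed
      qed
    qed
    then show ?thesis by (rule continuous_extension_real[OF cl]) blast
  qed
  then have "\<forall>i. \<exists>g. i < Q \<longrightarrow> continuous_on UNIV g \<and> (\<forall>x\<in>- NN. g x = X x i)" by blast
  from choice[OF this] obtain H where H: "\<And>i. i < Q \<Longrightarrow> continuous_on UNIV (H i)" "\<And>i x. i < Q \<Longrightarrow> x \<in> - NN \<Longrightarrow> H i x = X x i" by blast
  have "AE x in lborel. x \<in> Omega \<longrightarrow> u x = ms Q (sheet I H x)"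
    using AE_slope[OF NN]
  proof eventually_elim
    case (elim x)
    show ?case
    proof
      assume x: "x \<in> Omega"
      define s where "s = x $ 1 / x $ 2"
      have x2: "x $ 2 > 0" using x by (simp add: Omega_iff)
      have s: "s \<in> - NN" using elim x2 by (simp add: s_def)
      have xe: "x = pt 1 (s * x $ 2) (x $ 2)" using x2 by (auto simp: vec_eq_iff pt_def s_def forall_2)
      have "u x = image_mset (\<lambda>P. (x $ 2 powr I) *\<^sub>R P) (?h s)"
        using homogeneous_profile(1)[OF hom x2, of s] x xe by metis
      also have "\<dots> = ms Q (\<lambda>i. (x $ 2 powr I) *\<^sub>R X s i)" using X(1)[OF s] by (metis image_mset_ms)
      also have "\<dots> = ms Q (sheet I H x)" by (rule ms_cong) (use H(2) s in \<open>simp add: sheet_def s_def\<close>)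
      finally show "u x = ms Q (sheet I H x)" .
    qed
  qed
  then have "csel Q I u H" using H(1) by (simp add: csel_def)
  then show ?thesis by (rule that)
qed

section \<open>The energy carried by the sheets\<close>

lemma sheet_continuous: assumes "continuous_on UNIV (H i)" shows "continuous_on Omega (\<lambda>x. sheet I H x i)"
  unfolding sheet_def
  by (intro continuous_intros continuous_on_compose2[OF assms]) (auto simp: Omega_iff)

text \<open>Near a given tuple labelled distance from it and \<open>Gdist\<close> coincide, so the
  bound that \<open>u\<close> obeys in \<open>Gdist\<close> holds for the sheets on short intervals,
  with the same \<psi>. The right side is additive, so the bound propagates to long intervals. This
  applies to every continuous splitting.\<close>

lemma csel_line:
  fixes u :: "real^2 \<Rightarrow> (real^'n) multiset"
  assumes cs: "csel Q I u H" and b: "badm Q u j \<psi>"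
  shows "AE y in lborel. \<forall>s t. s < t \<longrightarrow> pt j s y \<in> Omega \<longrightarrow> pt j t y \<in> Omega \<longrightarrow>
     l2d Q (sheet I H (pt j t y)) (sheet I H (pt j s y)) \<le> integral {s..t} (\<lambda>\<tau>. \<psi> (pt j \<tau> y))"
proof -
  have \<psi>: "\<And>x. 0 \<le> \<psi> x" "integrable lborel \<psi>"
    and ae: "AE y in lborel. \<exists>N\<in>null_sets lborel. \<forall>s t. s < t \<longrightarrow> s \<notin> N \<longrightarrow> t \<notin> N \<longrightarrow> pt j s y \<in> Omega \<longrightarrow> pt j t y \<in> Omega \<longrightarrow>
       Gdist (u (pt j t y)) (u (pt j s y)) \<le> integral {s..t} (\<lambda>\<tau>. \<psi> (pt j \<tau> y))"
    using b by (auto simp: badm_def)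
  have cH: "\<And>i. i < Q \<Longrightarrow> continuous_on UNIV (H i)" and ae2: "AE x in lborel. x \<in> Omega \<longrightarrow> u x = ms Q (sheet I H x)"
    using cs by (auto simp: csel_def)
  show ?thesis using ae AE_lborel_pt[OF ae2, of j] integrable_lborel_pt(1)[OF \<psi>(2), of j]
  proof eventually_elim
    case (elim y)
    obtain N1 where N1: "N1 \<in> null_sets lborel" "\<And>s t. s < t \<Longrightarrow> s \<notin> N1 \<Longrightarrow> t \<notin> N1 \<Longrightarrow> pt j s y \<in> Omega \<Longrightarrow> pt j t y \<in> Omega \<Longrightarrow>
       Gdist (u (pt j t y)) (u (pt j s y)) \<le> integral {s..t} (\<lambda>\<tau>. \<psi> (pt j \<tau> y))" using elim(1) by blast
    obtain N2 where N2: "N2 \<in> null_sets lborel" "\<And>t. t \<notin> N2 \<Longrightarrow> pt j t y \<in> Omega \<Longrightarrow> u (pt j t y) = ms Q (sheet I H (pt j t y))"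
      using AE_E3[OF elim(2)] by (auto simp: space_lborel)
    have N12: "N1 \<union> N2 \<in> null_sets lborel" using N1(1) N2(1) by auto
    have io: "(\<lambda>\<tau>. \<psi> (pt j \<tau> y)) integrable_on {a..b}" for a b
      by (rule integrable_lborel_imp_integrable_on[OF elim(3)]) simp
    define W where "W \<tau> = sheet I H (pt j \<tau> y)" for \<tau>
    show ?case
    proof (intro allI impI)
      fix s t assume st: "s < t" "pt j s y \<in> Omega" "pt j t y \<in> Omega"
      have inO: "pt j \<tau> y \<in> Omega" if "\<tau> \<in> {s..t}" for \<tau> using convex_pt[OF Omega_convex st(2,3)] that by auto
      have cW: "continuous_on {s..t} (\<lambda>\<tau>. W \<tau> i)" if "i < Q" for i
        unfolding W_def by (rule continuous_on_compose2[OF sheet_continuous[where I=I and H=H and i=i, OF cH[OF that]]])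
          (use inO in \<open>auto intro!: continuous_intros\<close>)
      have cl: "continuous_on {s..t} (\<lambda>\<tau>. l2d Q (W r) (W \<tau>))" for r
        unfolding l2d_def L2_set_def by (intro continuous_intros cW) simp
      have near: "\<exists>d>0. \<forall>\<tau>\<in>{s..t}. \<bar>\<tau> - r\<bar> < d \<longrightarrow> l2d Q (W r) (W \<tau>) < e" if "r \<in> {s..t}" "e > 0" for r e
        using cl[of r] that unfolding continuous_on_iff by (force simp: dist_real_def)
      \<comment> \<open>Exceptional end points are avoided by moving both ends inwards to good ones,
        at a cost of e by continuity of the sheets.\<close>
      have G: "Gdist (ms Q (W b)) (ms Q (W a)) \<le> integral {a..b} (\<lambda>\<tau>. \<psi> (pt j \<tau> y))" if ab: "s \<le> a" "a < b" "b \<le> t" for a b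
      proof (rule field_le_epsilon)
        fix e :: real assume e: "e > 0"
        obtain d1 where d1: "d1 > 0" "\<And>\<tau>. \<tau> \<in> {s..t} \<Longrightarrow> \<bar>\<tau> - a\<bar> < d1 \<Longrightarrow> l2d Q (W a) (W \<tau>) < e/2"
          using near[of a "e/2"] ab e by auto
        obtain d2 where d2: "d2 > 0" "\<And>\<tau>. \<tau> \<in> {s..t} \<Longrightarrow> \<bar>\<tau> - b\<bar> < d2 \<Longrightarrow> l2d Q (W b) (W \<tau>) < e/2"
          using near[of b "e/2"] ab e by auto
        have aeN: "AE \<tau> in lborel. \<tau> \<notin> N1 \<union> N2" by (rule AE_not_in[OF N12])
        obtain a' where a': "a < a'" "a' < min (a + d1) ((a + b) / 2)" "a' \<notin> N1 \<union> N2"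
          by (rule AE_lborel_ex_interval[OF aeN, of a "min (a + d1) ((a + b) / 2)"]) (use ab d1 in auto)
        obtain b' where b': "max (b - d2) ((a + b) / 2) < b'" "b' < b" "b' \<notin> N1 \<union> N2"
          by (rule AE_lborel_ex_interval[OF aeN, of "max (b - d2) ((a + b) / 2)" b]) (use ab d2 in auto)
        have lt: "a' < b'" using a' b' by auto
        have O': "pt j a' y \<in> Omega" "pt j b' y \<in> Omega" using a' b' ab lt by (auto intro!: inO)
        have "Gdist (ms Q (W b')) (ms Q (W a')) \<le> integral {a'..b'} (\<lambda>\<tau>. \<psi> (pt j \<tau> y))"
          using N1(2)[OF lt _ _ O'] N2(2)[OF _ O'(1)] N2(2)[OF _ O'(2)] a'(3) b'(3) unfolding W_def by auto
        also have "\<dots> \<le> integral {a..b} (\<lambda>\<tau>. \<psi> (pt j \<tau> y))"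
          by (rule integral_subset_le[OF _ io io]) (use a' b' lt \<psi> in auto)
        finally have 1: "Gdist (ms Q (W b')) (ms Q (W a')) \<le> integral {a..b} (\<lambda>\<tau>. \<psi> (pt j \<tau> y))" .
        have 2: "l2d Q (W a) (W a') < e/2" by (rule d1(2)) (use a' b' ab lt in auto)
        have 3: "l2d Q (W b) (W b') < e/2" by (rule d2(2)) (use a' b' ab lt in auto)
        have "Gdist (ms Q (W b)) (ms Q (W a)) \<le> Gdist (ms Q (W b)) (ms Q (W b')) + (Gdist (ms Q (W b')) (ms Q (W a')) + Gdist (ms Q (W a')) (ms Q (W a)))"
          using Gdist_triangle[of Q "W b" "W a" "W b'"] Gdist_triangle[of Q "W b'" "W a" "W a'"] by linarith
        then show "Gdist (ms Q (W b)) (ms Q (W a)) \<le> integral {a..b} (\<lambda>\<tau>. \<psi> (pt j \<tau> y)) + e"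
          using 1 2 3 Gdist_le_l2d[of Q "W b" "W b'"] Gdist_le_l2d[of Q "W a'" "W a"] l2d_sym[of Q "W a'" "W a"] by linarith
      qed
      \<comment> \<open>An induction by bisection. \<open>Gdist_eq_l2d_local\<close> is anchored at
        a point x, so a short interval around x is split at x and the two halves are added.\<close>
      define R where "R a b \<longleftrightarrow> (s \<le> a \<longrightarrow> b \<le> t \<longrightarrow> l2d Q (W b) (W a) \<le> integral {a..b} (\<lambda>\<tau>. \<psi> (pt j \<tau> y)))" for a b
      have "R s t" using less_imp_le[OF st(1)]
      proof (induction rule: Bolzano)
        case (trans a b c)
        show ?case unfolding R_def
        proof (intro impI)
          assume "s \<le> a" "c \<le> t"
          then have "l2d Q (W b) (W a) \<le> integral {a..b} (\<lambda>\<tau>. \<psi> (pt j \<tau> y))" "l2d Q (W c) (W b) \<le> integral {b..c} (\<lambda>\<tau>. \<psi> (pt j \<tau> y))"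
            using trans unfolding R_def by auto
          then show "l2d Q (W c) (W a) \<le> integral {a..c} (\<lambda>\<tau>. \<psi> (pt j \<tau> y))"
            using l2d_triangle[of Q "W c" "W a" "W b"] Henstock_Kurzweil_Integration.integral_combine[OF trans(3,4) io] by linarith
        qed
      next
        case (local x)
        obtain e where e: "e > 0" "\<And>V. l2d Q (W x) V < e \<Longrightarrow> Gdist (ms Q (W x)) (ms Q V) = l2d Q (W x) V"
          by (rule Gdist_eq_l2d_local[of Q "W x"]) blast
        obtain d where d: "d > 0" "\<And>\<tau>. \<tau> \<in> {s..t} \<Longrightarrow> \<bar>\<tau> - x\<bar> < d \<Longrightarrow> l2d Q (W x) (W \<tau>) < e"
          using near[of x e] local e(1) by auto
        show ?case unfolding R_def
        proof (intro exI[of _ d] conjI allI impI d(1))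
          fix a b assume ab: "a \<le> x \<and> x \<le> b \<and> b - a < d" "s \<le> a" "b \<le> t"
          have ga: "Gdist (ms Q (W x)) (ms Q (W a)) = l2d Q (W x) (W a)" by (intro e(2) d(2)) (use ab in auto)
          have gb: "Gdist (ms Q (W x)) (ms Q (W b)) = l2d Q (W x) (W b)" by (intro e(2) d(2)) (use ab in auto)
          have 1: "l2d Q (W x) (W a) \<le> integral {a..x} (\<lambda>\<tau>. \<psi> (pt j \<tau> y))"
          proof (cases "a = x")
            case False
            then show ?thesis using G[of a x] ga ab by auto
          qed simp
          have 2: "l2d Q (W x) (W b) \<le> integral {x..b} (\<lambda>\<tau>. \<psi> (pt j \<tau> y))"
          proof (cases "b = x")
            case False
            then show ?thesis using G[of x b] gb ab Gdist_sym[of Q "W x" "W b"] by auto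
          qed simp
          have "integral {a..x} (\<lambda>\<tau>. \<psi> (pt j \<tau> y)) + integral {x..b} (\<lambda>\<tau>. \<psi> (pt j \<tau> y)) = integral {a..b} (\<lambda>\<tau>. \<psi> (pt j \<tau> y))"
            by (rule Henstock_Kurzweil_Integration.integral_combine[OF _ _ io]) (use ab in auto)
          then show "l2d Q (W b) (W a) \<le> integral {a..b} (\<lambda>\<tau>. \<psi> (pt j \<tau> y))"
            using 1 2 l2d_triangle[of Q "W b" "W a" "W x"] l2d_sym[of Q "W b" "W x"] by linarith
        qed
      qed
      then show "l2d Q (sheet I H (pt j t y)) (sheet I H (pt j s y)) \<le> integral {s..t} (\<lambda>\<tau>. \<psi> (pt j \<tau> y))"
        unfolding W_def R_def by simp
    qed
  qed
qed

definition shc :: "real \<Rightarrow> (nat \<Rightarrow> real \<Rightarrow> real^'n) \<Rightarrow> nat \<Rightarrow> 'n \<Rightarrow> real^2 \<Rightarrow> real" where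
  "shc I H i c x = sheet I H x i $ c"

definition dsh :: "2 \<Rightarrow> real \<Rightarrow> (nat \<Rightarrow> real \<Rightarrow> real^'n) \<Rightarrow> nat \<Rightarrow> 'n \<Rightarrow> real^2 \<Rightarrow> real" where
  "dsh j I H i c = ldiff j (\<lambda>x. indicator Omega x * shc I H i c x)"

lemma l2d_power2:
  fixes V W :: "nat \<Rightarrow> real^'n"
  shows "(l2d Q V W)\<^sup>2 = (\<Sum>i<Q. \<Sum>c\<in>UNIV. (V i $ c - W i $ c)\<^sup>2)"
proof -
  have n: "(norm (x::real^'n))\<^sup>2 = (\<Sum>c\<in>UNIV. (x $ c)\<^sup>2)" for x
    by (simp add: norm_vec_def L2_set_def sum_nonneg)
  have "(l2d Q V W)\<^sup>2 = (\<Sum>i<Q. (norm (V i - W i))\<^sup>2)" by (simp add: l2d_def L2_set_def sum_nonneg)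
  then show ?thesis unfolding n by simp
qed

lemma csel_continuous: "csel Q I u H \<Longrightarrow> i < Q \<Longrightarrow> continuous_on Omega (\<lambda>x. sheet I H x i)"
  by (intro sheet_continuous) (simp add: csel_def)

lemma csel_continuous_c: "csel Q I u H \<Longrightarrow> i < Q \<Longrightarrow> continuous_on Omega (shc I H i c)"
  unfolding shc_def[abs_def] using csel_continuous[of Q I u H i] by (intro continuous_intros)

lemma csel_line_bounded:
  assumes cs: "csel Q I u H" and b: "badm Q u j \<psi>" and i: "i < Q"
  shows "line_bounded j Omega (shc I H i c) \<psi>"
  unfolding line_bounded_def
proof (intro conjI)
  show "integrable lborel \<psi>" "\<forall>x. 0 \<le> \<psi> x" using b by (auto simp: badm_def)
  show "AE y in lborel. \<forall>s t. s < t \<longrightarrow> pt j s y \<in> Omega \<longrightarrow> pt j t y \<in> Omega \<longrightarrow>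
       \<bar>shc I H i c (pt j t y) - shc I H i c (pt j s y)\<bar> \<le> integral {s..t} (\<lambda>\<tau>. \<psi> (pt j \<tau> y))"
    using csel_line[OF cs b]
  proof eventually_elim
    case (elim y)
    show ?case
    proof (intro allI impI)
      fix s t assume st: "s < t" "pt j s y \<in> Omega" "pt j t y \<in> Omega"
      have "\<bar>shc I H i c (pt j t y) - shc I H i c (pt j s y)\<bar> \<le> norm (sheet I H (pt j t y) i - sheet I H (pt j s y) i)"
        unfolding shc_def using component_le_norm_cart[of "sheet I H (pt j t y) i - sheet I H (pt j s y) i" c] by simp
      also have "\<dots> \<le> l2d Q (sheet I H (pt j t y)) (sheet I H (pt j s y))" by (rule norm_le_l2d[OF i])
      finally show "\<bar>shc I H i c (pt j t y) - shc I H i c (pt j s y)\<bar> \<le> integral {s..t} (\<lambda>\<tau>. \<psi> (pt j \<tau> y))"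
        using elim st by fastforce
    qed
  qed
qed

lemma dsh_measurable:
  assumes "csel Q I u H" "i < Q" shows "dsh j I H i c \<in> borel_measurable borel"
  unfolding dsh_def by (intro ldiff_measurable continuous_on_open_borel_indicator Omega_open csel_continuous_c[OF assms])

lemma dsh_AE_tendsto:
  assumes cs: "csel Q I u H" and b: "badm Q u j \<psi>" and i: "i < Q"
  shows "AE x in lborel. x \<in> Omega \<longrightarrow> (\<lambda>n. ldq j (\<lambda>x. indicator Omega x * shc I H i c x) n x) \<longlonglongrightarrow> dsh j I H i c x"
  unfolding dsh_def by (rule line_bounded_AE(1)[OF Omega_open Omega_convex csel_continuous_c[OF cs i] csel_line_bounded[OF cs b i]])

lemma filterlim_inverse_Suc: "filterlim (\<lambda>n. 1 / real (Suc n)) (at_right 0) sequentially"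
  using LIMSEQ_Suc[OF lim_const_over_n[of "1::real"]] by (auto simp: filterlim_at intro!: always_eventually)

lemma Omega_shift_eventually:
  assumes "x \<in> Omega" shows "\<forall>\<^sub>F n in sequentially. x + (1 / real (Suc n)) *\<^sub>R axis j 1 \<in> Omega"
proof -
  have "(\<lambda>n. x + (1 / real (Suc n)) *\<^sub>R axis j 1) \<longlonglongrightarrow> x + 0 *\<^sub>R axis j 1"
    using LIMSEQ_Suc[OF lim_const_over_n[of "1::real"]] by (intro tendsto_intros)
  then show ?thesis using topological_tendstoD[OF _ Omega_open] assms by simp
qed

text \<open>Difference quotients of the whole labelled tuple are bounded by averages of \<psi>,
  which tend to \<psi> at almost every point of almost every line. All sheets and components are
  treated together, which keeps the constant 1.\<close>

lemma dsh_le: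
  fixes u :: "real^2 \<Rightarrow> (real^'n) multiset"
  assumes cs: "csel Q I u H" and b: "badm Q u j \<psi>"
  shows "AE x in lborel. x \<in> Omega \<longrightarrow> (\<Sum>i<Q. \<Sum>c\<in>UNIV. (dsh j I H i c x)\<^sup>2) \<le> (\<psi> x)\<^sup>2"
proof (rule AE_lborel_ptI[where j=j])
  have \<psi>: "\<psi> \<in> borel_measurable borel" "\<And>x. 0 \<le> \<psi> x" "integrable lborel \<psi>" using b by (auto simp: badm_def)
  have m: "(\<lambda>x. \<Sum>i<Q. \<Sum>c\<in>UNIV. (dsh j I H i c x)\<^sup>2) \<in> borel_measurable borel"
    by (intro borel_measurable_sum borel_measurable_power dsh_measurable[OF cs]) simp
  show "Measurable.pred borel (\<lambda>x. x \<in> Omega \<longrightarrow> (\<Sum>i<Q. \<Sum>c\<in>UNIV. (dsh j I H i c x)\<^sup>2) \<le> (\<psi> x)\<^sup>2)"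
    using m \<psi>(1) by measurable
  have "AE x in lborel. \<forall>i\<in>{..<Q}. \<forall>c\<in>UNIV. x \<in> Omega \<longrightarrow> (\<lambda>n. ldq j (\<lambda>x. indicator Omega x * shc I H i c x) n x) \<longlonglongrightarrow> dsh j I H i c x"
    by (intro AE_finite_allI finite_lessThan finite dsh_AE_tendsto[OF cs b]) simp
  from AE_lborel_pt[OF this, of j] csel_line[OF cs b] integrable_lborel_pt(1)[OF \<psi>(3), of j]
  show "AE y in lborel. AE t in lborel. pt j t y \<in> Omega \<longrightarrow> (\<Sum>i<Q. \<Sum>c\<in>UNIV. (dsh j I H i c (pt j t y))\<^sup>2) \<le> (\<psi> (pt j t y))\<^sup>2"
  proof eventually_elim
    case (elim y)
    note ln = elim(2)
    show ?case using elim(1) AE_lborel_averages[OF elim(3)]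
    proof eventually_elim
      case (elim t)
      show ?case
      proof
        assume O: "pt j t y \<in> Omega"
        let ?q = "\<lambda>n i c. ldq j (\<lambda>x. indicator Omega x * shc I H i c x) n (pt j t y)"
        have 1: "(\<lambda>n. \<Sum>i<Q. \<Sum>c\<in>UNIV. (?q n i c)\<^sup>2) \<longlonglongrightarrow> (\<Sum>i<Q. \<Sum>c\<in>UNIV. (dsh j I H i c (pt j t y))\<^sup>2)"
          using elim(1) O by (intro tendsto_sum tendsto_power) auto
        have 2: "(\<lambda>n. (integral {t..t + 1 / real (Suc n)} (\<lambda>\<tau>. \<psi> (pt j \<tau> y)) / (1 / real (Suc n)))\<^sup>2) \<longlonglongrightarrow> (\<psi> (pt j t y))\<^sup>2"
          by (intro tendsto_power filterlim_compose[OF elim(2) filterlim_inverse_Suc])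
        have ev: "\<forall>\<^sub>F n in sequentially. (\<Sum>i<Q. \<Sum>c\<in>UNIV. (?q n i c)\<^sup>2) \<le> (integral {t..t + 1 / real (Suc n)} (\<lambda>\<tau>. \<psi> (pt j \<tau> y)) / (1 / real (Suc n)))\<^sup>2"
          using Omega_shift_eventually[OF O, of j]
        proof eventually_elim
          case (elim n)
          let ?d = "1 / real (Suc n)"
          have O': "pt j (t + ?d) y \<in> Omega" using elim by (simp add: pt_add)
          have "(\<Sum>i<Q. \<Sum>c\<in>UNIV. (?q n i c)\<^sup>2) = (l2d Q (sheet I H (pt j (t + ?d) y)) (sheet I H (pt j t y)))\<^sup>2 * (real (Suc n))\<^sup>2"
            unfolding l2d_power2 ldq_def sum_distrib_right using O O'
            by (intro sum.cong refl) (simp add: shc_def pt_add power_mult_distrib del: of_nat_Suc)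
          also have "\<dots> = (l2d Q (sheet I H (pt j (t + ?d) y)) (sheet I H (pt j t y)) / ?d)\<^sup>2"
            by (simp add: power_mult_distrib del: of_nat_Suc)
          also have "\<dots> \<le> (integral {t..t + ?d} (\<lambda>\<tau>. \<psi> (pt j \<tau> y)) / ?d)\<^sup>2"
          proof (rule power_mono)
            show "l2d Q (sheet I H (pt j (t + ?d) y)) (sheet I H (pt j t y)) / ?d \<le> integral {t..t + ?d} (\<lambda>\<tau>. \<psi> (pt j \<tau> y)) / ?d"
              by (rule divide_right_mono) (use ln[rule_format, OF _ O O'] in \<open>auto simp del: of_nat_Suc\<close>)
          qed (simp add: l2d_nonneg)
          finally show ?case .
        qed
        show "(\<Sum>i<Q. \<Sum>c\<in>UNIV. (dsh j I H i c (pt j t y))\<^sup>2) \<le> (\<psi> (pt j t y))\<^sup>2"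
          by (rule tendsto_le[OF sequentially_bot 2 1 ev])
      qed
    qed
  qed
qed

lemma dsh_sq_integrable:
  fixes u :: "real^2 \<Rightarrow> (real^'n) multiset"
  assumes cs: "csel Q I u H" and b: "badm Q u j \<psi>"
  shows "integrable lborel (\<lambda>x. indicator Omega x * (\<Sum>i<Q. \<Sum>c\<in>UNIV. (dsh j I H i c x)\<^sup>2))"
    "(LINT x|lborel. indicator Omega x * (\<Sum>i<Q. \<Sum>c\<in>UNIV. (dsh j I H i c x)\<^sup>2)) \<le> (LINT x|lborel. (\<psi> x)\<^sup>2)"
proof -
  have \<psi>: "integrable lborel (\<lambda>x. (\<psi> x)\<^sup>2)" using b by (auto simp: badm_def)
  have m[measurable]: "(\<lambda>x. \<Sum>i<Q. \<Sum>c\<in>UNIV. (dsh j I H i c x)\<^sup>2) \<in> borel_measurable borel"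
    by (intro borel_measurable_sum borel_measurable_power dsh_measurable[OF cs]) simp
  have nn: "0 \<le> (\<Sum>i<Q. \<Sum>c\<in>UNIV. (dsh j I H i c x)\<^sup>2)" for x by (intro sum_nonneg) simp
  have ae: "AE x in lborel. indicator Omega x * (\<Sum>i<Q. \<Sum>c\<in>UNIV. (dsh j I H i c x)\<^sup>2) \<le> (\<psi> x)\<^sup>2"
    using dsh_le[OF cs b] by eventually_elim (auto simp: indicator_def)
  show i: "integrable lborel (\<lambda>x. indicator Omega x * (\<Sum>i<Q. \<Sum>c\<in>UNIV. (dsh j I H i c x)\<^sup>2))"
  proof (rule Bochner_Integration.integrable_bound[OF \<psi>])
    show "AE x in lborel. norm (indicator Omega x * (\<Sum>i<Q. \<Sum>c\<in>UNIV. (dsh j I H i c x)\<^sup>2)) \<le> norm ((\<psi> x)\<^sup>2)"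
      using ae by eventually_elim (use nn in \<open>auto simp: abs_mult\<close>)
  qed measurable
  show "(LINT x|lborel. indicator Omega x * (\<Sum>i<Q. \<Sum>c\<in>UNIV. (dsh j I H i c x)\<^sup>2)) \<le> (LINT x|lborel. (\<psi> x)\<^sup>2)"
    by (rule integral_mono_AE[OF i \<psi> ae])
qed

text \<open>Every admissible bound dominates the derivatives of the sheets by \<open>dsh_le\<close>.
  Admissible bounds exist by \<open>AQ_W12\<close>, so each infimum is taken over a nonempty
  set.\<close>

lemma Dir_lower:
  fixes u :: "real^2 \<Rightarrow> (real^'n) multiset"
  assumes u: "AQ_W12 Q Omega u" and cs: "csel Q I u H"
  shows "(\<Sum>j\<in>UNIV. LINT x|lborel. indicator Omega x * (\<Sum>i<Q. \<Sum>c\<in>UNIV. (dsh j I H i c x)\<^sup>2)) \<le> Dir Q Omega u"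
  unfolding Dir_def
proof (rule sum_mono)
  fix j :: 2
  let ?S = "{set_lebesgue_integral lebesgue Omega (\<lambda>x. (\<psi> x)\<^sup>2) | \<psi>. AQ_adm Q Omega u j \<psi>}"
  have "?S \<noteq> {}" using u by (auto simp: AQ_W12_def)
  then show "(LINT x|lborel. indicator Omega x * (\<Sum>i<Q. \<Sum>c\<in>UNIV. (dsh j I H i c x)\<^sup>2)) \<le> Inf ?S"
  proof (rule cInf_greatest)
    fix r assume "r \<in> ?S"
    then obtain \<psi> where r: "r = set_lebesgue_integral lebesgue Omega (\<lambda>x. (\<psi> x)\<^sup>2)" "AQ_adm Q Omega u j \<psi>" by blast
    obtain \<psi>' where p: "badm Q u j \<psi>'" "set_lebesgue_integral lebesgue Omega (\<lambda>x. (\<psi> x)\<^sup>2) = (LINT x|lborel. (\<psi>' x)\<^sup>2)"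
      by (rule AQ_adm_badm[OF u r(2)])
    show "(LINT x|lborel. indicator Omega x * (\<Sum>i<Q. \<Sum>c\<in>UNIV. (dsh j I H i c x)\<^sup>2)) \<le> r"
      using dsh_sq_integrable(2)[OF cs p(1)] unfolding r(1) p(2) .
  qed
qed

lemma L2_cong: "(\<And>x. x \<in> S \<Longrightarrow> f x = g x) \<Longrightarrow> L2 S f \<Longrightarrow> L2 S g"
  unfolding L2_def using measurable_cong[of "lebesgue_on S" f g borel]
    Bochner_Integration.integrable_cong[of "lebesgue_on S" "lebesgue_on S" "\<lambda>x. (f x)\<^sup>2" "\<lambda>x. (g x)\<^sup>2"]
  by (simp add: space_restrict_space)

section \<open>Variation of a single sheet\<close>

text \<open>The competitor adds \<tau> \<phi> to component \<open>c0\<close> of sheet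
  \<open>i0\<close>. It is in general not homogeneous, so it is described by functions
  \<open>V\<close> of the point, and its Sobolev properties are derived from the line bounds of the
  original sheets.\<close>

locale sheet_variation =
  fixes Q :: nat and I :: real and u :: "real^2 \<Rightarrow> (real^'n) multiset" and H :: "nat \<Rightarrow> real \<Rightarrow> real^'n"
    and i0 :: nat and c0 :: 'n and \<phi> :: "real^2 \<Rightarrow> real"
  assumes W12: "AQ_W12 Q Omega u" and cs: "csel Q I u H" and i0: "i0 < Q" and phi: "\<phi> \<in> C1c Omega"
begin

definition E :: "real \<Rightarrow> real^2 \<Rightarrow> nat \<Rightarrow> real^'n" where
  "E \<tau> x i = (if i = i0 then (\<tau> * \<phi> x) *\<^sub>R axis c0 1 else 0)"

definition V :: "real \<Rightarrow> real^2 \<Rightarrow> nat \<Rightarrow> real^'n" where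
  "V \<tau> x i = sheet I H x i + E \<tau> x i"

definition v :: "real \<Rightarrow> real^2 \<Rightarrow> (real^'n) multiset" where
  "v \<tau> x = ms Q (V \<tau> x)"

definition dV :: "2 \<Rightarrow> real \<Rightarrow> nat \<Rightarrow> 'n \<Rightarrow> real^2 \<Rightarrow> real" where
  "dV j \<tau> i c x = dsh j I H i c x + (if i = i0 \<and> c = c0 then \<tau> * pd j \<phi> x else 0)"

definition S2 :: "2 \<Rightarrow> real \<Rightarrow> real^2 \<Rightarrow> real" where
  "S2 j \<tau> x = (\<Sum>i<Q. \<Sum>c\<in>UNIV. (dV j \<tau> i c x)\<^sup>2)"

lemma dV_0: "dV j 0 i c x = dsh j I H i c x" by (simp add: dV_def)

lemma E_0: "E 0 x i = 0" by (simp add: E_def)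

lemma E_nth: "E \<tau> x i $ c = (if i = i0 \<and> c = c0 then \<tau> * \<phi> x else 0)"
  by (auto simp: E_def axis_def)

lemma l2d_E: "l2d Q (E \<tau> x) (E \<tau> x') \<le> \<bar>\<tau>\<bar> * \<bar>\<phi> x - \<phi> x'\<bar>"
proof -
  have "l2d Q (E \<tau> x) (E \<tau> x') \<le> (\<Sum>i<Q. norm (E \<tau> x i - E \<tau> x' i))"
    unfolding l2d_def by (rule L2_set_le_sum) simp
  also have "\<dots> = (\<Sum>i<Q. if i = i0 then norm (((\<tau> * \<phi> x) - (\<tau> * \<phi> x')) *\<^sub>R (axis c0 1 :: real^'n)) else 0)"
    by (rule sum.cong) (auto simp: E_def scaleR_left_diff_distrib)
  also have "\<dots> = \<bar>\<tau>\<bar> * \<bar>\<phi> x - \<phi> x'\<bar>" using i0 by (simp flip: right_diff_distrib add: abs_mult)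
  finally show ?thesis .
qed

lemma l2d_V: "l2d Q (V \<tau> x) (V \<tau> x') \<le> l2d Q (sheet I H x) (sheet I H x') + \<bar>\<tau>\<bar> * \<bar>\<phi> x - \<phi> x'\<bar>"
proof -
  let ?X = "\<lambda>i. sheet I H x' i + E \<tau> x i"
  have "l2d Q (V \<tau> x) (V \<tau> x') \<le> l2d Q (V \<tau> x) ?X + l2d Q ?X (V \<tau> x')" by (rule l2d_triangle)
  also have "l2d Q (V \<tau> x) ?X = l2d Q (sheet I H x) (sheet I H x')" by (simp add: l2d_def V_def)
  also have "l2d Q ?X (V \<tau> x') = l2d Q (E \<tau> x) (E \<tau> x')" by (simp add: l2d_def V_def)
  finally show ?thesis using l2d_E[of \<tau> x x'] by linarith
qed

lemma V_continuous: "i < Q \<Longrightarrow> continuous_on Omega (\<lambda>x. V \<tau> x i)"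
  unfolding V_def E_def
  using csel_continuous[OF cs, of i] continuous_on_subset[OF C1cD(3)[OF phi], of Omega]
  by (cases "i = i0") (auto intro!: continuous_intros)

lemma v_dist_continuous: "continuous_on Omega (\<lambda>x. Gdist (v \<tau> x) (ms Q W))"
  unfolding continuous_on_iff
proof (intro ballI allI impI)
  fix x e assume x: "x \<in> Omega" and e: "0 < (e::real)"
  have "continuous_on Omega (\<lambda>x'. l2d Q (V \<tau> x) (V \<tau> x'))"
    unfolding l2d_def L2_set_def by (intro continuous_intros V_continuous) simp
  then obtain d where d: "d > 0" "\<And>x'. x' \<in> Omega \<Longrightarrow> dist x' x < d \<Longrightarrow> dist (l2d Q (V \<tau> x) (V \<tau> x')) (l2d Q (V \<tau> x) (V \<tau> x)) < e"
    using x e unfolding continuous_on_iff by blast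
  show "\<exists>d>0. \<forall>x'\<in>Omega. dist x' x < d \<longrightarrow> dist (Gdist (v \<tau> x') (ms Q W)) (Gdist (v \<tau> x) (ms Q W)) < e"
  proof (intro exI[of _ d] conjI ballI impI d(1))
    fix x' assume "x' \<in> Omega" "dist x' x < d"
    from d(2)[OF this] have "l2d Q (V \<tau> x) (V \<tau> x') < e" by (simp add: dist_real_def)
    then show "dist (Gdist (v \<tau> x') (ms Q W)) (Gdist (v \<tau> x) (ms Q W)) < e"
      unfolding dist_real_def v_def using Gdist_diff_le[of Q "V \<tau> x'" W "V \<tau> x"] l2d_sym[of Q "V \<tau> x'" "V \<tau> x"] by linarith
  qed
qed

lemma obtain_badm: obtains \<psi> where "badm Q u j \<psi>"
proof -
  obtain \<psi> where "AQ_adm Q Omega u j \<psi>" using W12 unfolding AQ_W12_def by blast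
  from AQ_adm_badm[OF W12 this] show ?thesis using that by blast
qed

lemma v_dist_line_bounded:
  obtains w where "line_bounded j Omega (\<lambda>x. Gdist (v \<tau> x) (ms Q W)) w"
proof -
  obtain \<psi> where b: "badm Q u j \<psi>" by (rule obtain_badm)
  obtain C where C: "\<And>x. \<bar>\<phi> x\<bar> \<le> C" "\<And>x j. \<bar>pd j \<phi> x\<bar> \<le> C" "C \<ge> 0" by (rule C1c_bounded[OF phi]) blast
  have \<psi>: "integrable lborel \<psi>" "\<And>x. 0 \<le> \<psi> x" using b by (auto simp: badm_def)
  \<comment> \<open>\<psi> accounts for the sheets and |\<tau>| C for the Lipschitz function \<tau>
    \<phi>; the indicator makes the constant integrable.\<close>
  define w where "w x = \<psi> x + \<bar>\<tau>\<bar> * C * indicator Omega x" for x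
  have "line_bounded j Omega (\<lambda>x. Gdist (v \<tau> x) (ms Q W)) w"
    unfolding line_bounded_def
  proof (intro conjI allI)
    show "integrable lborel w" unfolding w_def[abs_def] using \<psi> integrable_Omega_indicator by simp
    show "0 \<le> w x" for x unfolding w_def using \<psi> C(3) by simp
    show "AE y in lborel. \<forall>s t. s < t \<longrightarrow> pt j s y \<in> Omega \<longrightarrow> pt j t y \<in> Omega \<longrightarrow>
       \<bar>Gdist (v \<tau> (pt j t y)) (ms Q W) - Gdist (v \<tau> (pt j s y)) (ms Q W)\<bar> \<le> integral {s..t} (\<lambda>\<tau>. w (pt j \<tau> y))"
      using csel_line[OF cs b] integrable_lborel_pt(1)[OF \<psi>(1), of j]
    proof eventually_elim
      case (elim y)
      show ?case
      proof (intro allI impI)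
        fix s t assume st: "s < t" "pt j s y \<in> Omega" "pt j t y \<in> Omega"
        have io: "(\<lambda>\<tau>. \<psi> (pt j \<tau> y)) integrable_on {s..t}"
          by (rule integrable_lborel_imp_integrable_on[OF elim(2)]) simp
        obtain z where z: "\<phi> (pt j t y) - \<phi> (pt j s y) = (t - s) * pd j \<phi> (pt j z y)"
          using MVT2[OF st(1), of "\<lambda>t. \<phi> (pt j t y)" "\<lambda>r. pd j \<phi> (pt j r y)"] C1c_line_derivative[OF phi] by blast
        have dp: "\<bar>\<phi> (pt j t y) - \<phi> (pt j s y)\<bar> \<le> C * (t - s)"
          unfolding z abs_mult using C(2)[of j "pt j z y"] st by (simp add: mult.commute mult_right_mono)
        have "\<bar>Gdist (v \<tau> (pt j t y)) (ms Q W) - Gdist (v \<tau> (pt j s y)) (ms Q W)\<bar> \<le> l2d Q (V \<tau> (pt j t y)) (V \<tau> (pt j s y))"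
          unfolding v_def by (rule Gdist_diff_le)
        also have "\<dots> \<le> l2d Q (sheet I H (pt j t y)) (sheet I H (pt j s y)) + \<bar>\<tau>\<bar> * \<bar>\<phi> (pt j t y) - \<phi> (pt j s y)\<bar>"
          by (rule l2d_V)
        also have "\<dots> \<le> integral {s..t} (\<lambda>\<tau>. \<psi> (pt j \<tau> y)) + \<bar>\<tau>\<bar> * (C * (t - s))"
          using elim(1) st dp by (intro add_mono mult_left_mono) auto
        also have "\<dots> = integral {s..t} (\<lambda>r. \<psi> (pt j r y) + \<bar>\<tau>\<bar> * C)"
          using st io by (subst Henstock_Kurzweil_Integration.integral_add) (auto simp: mult_ac)
        also have "\<dots> = integral {s..t} (\<lambda>\<tau>. w (pt j \<tau> y))"
        proof (rule Henstock_Kurzweil_Integration.integral_cong)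
          fix r assume "r \<in> {s..t}"
          then have "pt j r y \<in> Omega" using convex_pt[OF Omega_convex st(2,3)] by auto
          then show "\<psi> (pt j r y) + \<bar>\<tau>\<bar> * C = w (pt j r y)" by (simp add: w_def)
        qed
        finally show "\<bar>Gdist (v \<tau> (pt j t y)) (ms Q W) - Gdist (v \<tau> (pt j s y)) (ms Q W)\<bar> \<le> integral {s..t} (\<lambda>\<tau>. w (pt j \<tau> y))" .
      qed
    qed
  qed
  then show ?thesis by (rule that)
qed

definition gv :: "2 \<Rightarrow> real \<Rightarrow> (nat \<Rightarrow> real^'n) \<Rightarrow> real^2 \<Rightarrow> real" where
  "gv j \<tau> W = ldiff j (\<lambda>x. indicator Omega x * Gdist (v \<tau> x) (ms Q W))"

lemma gv_weak_deriv: "weak_deriv Omega j (\<lambda>x. Gdist (v \<tau> x) (ms Q W)) (gv j \<tau> W)"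
proof -
  obtain w where "line_bounded j Omega (\<lambda>x. Gdist (v \<tau> x) (ms Q W)) w" by (rule v_dist_line_bounded)
  then show ?thesis unfolding gv_def by (rule line_bounded_weak_deriv[OF Omega_open Omega_convex v_dist_continuous])
qed

lemma gv_measurable [measurable]: "gv j \<tau> W \<in> borel_measurable borel"
  unfolding gv_def by (intro ldiff_measurable continuous_on_open_borel_indicator Omega_open v_dist_continuous)

lemma dV_measurable: "i < Q \<Longrightarrow> dV j \<tau> i c \<in> borel_measurable borel"
proof -
  assume i: "i < Q"
  have [measurable]: "dsh j I H i c \<in> borel_measurable borel" by (rule dsh_measurable[OF cs i])
  have [measurable]: "pd j \<phi> \<in> borel_measurable borel" by (rule borel_measurable_continuous_onI[OF C1cD(2)[OF phi]])
  show ?thesis unfolding dV_def[abs_def] by measurable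
qed

lemma S2_measurable [measurable]: "S2 j \<tau> \<in> borel_measurable borel"
  unfolding S2_def[abs_def] by (intro borel_measurable_sum borel_measurable_power dV_measurable) simp

lemma S2_nonneg: "0 \<le> S2 j \<tau> x" unfolding S2_def by (intro sum_nonneg) simp

text \<open>The distance to a fixed Q-point is 1-Lipschitz in labelled distance, so its difference
  quotients lie below those of the labelled tuple, whose limit is the root of \<open>S2\<close>. The
  bound is the same for all \<open>W\<close>, as admissibility demands.\<close>

lemma gv_le: "AE x in lborel. x \<in> Omega \<longrightarrow> \<bar>gv j \<tau> W x\<bar> \<le> sqrt (S2 j \<tau> x)"
proof -
  obtain \<psi> where b: "badm Q u j \<psi>" by (rule obtain_badm)
  obtain w where lb: "line_bounded j Omega (\<lambda>x. Gdist (v \<tau> x) (ms Q W)) w" by (rule v_dist_line_bounded)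
  have ae: "AE x in lborel. \<forall>i\<in>{..<Q}. \<forall>c\<in>UNIV. x \<in> Omega \<longrightarrow> (\<lambda>n. ldq j (\<lambda>x. indicator Omega x * shc I H i c x) n x) \<longlonglongrightarrow> dsh j I H i c x"
    by (intro AE_finite_allI finite_lessThan finite dsh_AE_tendsto[OF cs b]) simp
  show ?thesis
    using ae line_bounded_AE(1)[OF Omega_open Omega_convex v_dist_continuous lb]
  proof eventually_elim
    case (elim x)
    show ?case
    proof
      assume O: "x \<in> Omega"
      let ?d = "\<lambda>n. 1 / real (Suc n)" and ?x = "\<lambda>n. x + (1 / real (Suc n)) *\<^sub>R axis j 1"
      let ?qV = "\<lambda>n i c. (V \<tau> (?x n) i $ c - V \<tau> x i $ c) * real (Suc n)"
      have xp: "x = pt j (x $ j) (x $ oth j)" by simp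
      have qphi: "(\<lambda>n. (\<phi> (?x n) - \<phi> x) * real (Suc n)) \<longlonglongrightarrow> pd j \<phi> x"
        using ldq_tendsto(1)[OF C1c_line_derivative[OF phi, of j "x $ oth j" "x $ j"]] by (simp add: ldq_def)
      have qV: "(\<lambda>n. ?qV n i c) \<longlonglongrightarrow> dV j \<tau> i c x" if i: "i < Q" for i c
      proof -
        have 1: "(\<lambda>n. ldq j (\<lambda>x. indicator Omega x * shc I H i c x) n x + (if i = i0 \<and> c = c0 then \<tau> * ((\<phi> (?x n) - \<phi> x) * real (Suc n)) else 0)) \<longlonglongrightarrow> dV j \<tau> i c x"
          unfolding dV_def using elim(1) O i qphi by (auto intro!: tendsto_add tendsto_mult_left)
        have ev: "\<forall>\<^sub>F n in sequentially. ldq j (\<lambda>x. indicator Omega x * shc I H i c x) n x + (if i = i0 \<and> c = c0 then \<tau> * ((\<phi> (?x n) - \<phi> x) * real (Suc n)) else 0) = ?qV n i c"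
          using Omega_shift_eventually[OF O, of j]
          by eventually_elim (use O in \<open>simp add: ldq_def shc_def V_def E_nth algebra_simps del: of_nat_Suc\<close>)
        show ?thesis by (rule Lim_transform_eventually[OF 1 ev])
      qed
      have 2: "(\<lambda>n. sqrt (\<Sum>i<Q. \<Sum>c\<in>UNIV. (?qV n i c)\<^sup>2)) \<longlonglongrightarrow> sqrt (S2 j \<tau> x)"
        unfolding S2_def by (intro tendsto_real_sqrt tendsto_sum tendsto_power qV) simp
      have 3: "(\<lambda>n. \<bar>ldq j (\<lambda>x. indicator Omega x * Gdist (v \<tau> x) (ms Q W)) n x\<bar>) \<longlonglongrightarrow> \<bar>gv j \<tau> W x\<bar>"
        unfolding gv_def using elim(2) O by (intro tendsto_rabs) auto
      have ev: "\<forall>\<^sub>F n in sequentially. \<bar>ldq j (\<lambda>x. indicator Omega x * Gdist (v \<tau> x) (ms Q W)) n x\<bar> \<le> sqrt (\<Sum>i<Q. \<Sum>c\<in>UNIV. (?qV n i c)\<^sup>2)"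
        using Omega_shift_eventually[OF O, of j]
      proof eventually_elim
        case (elim n)
        have "\<bar>ldq j (\<lambda>x. indicator Omega x * Gdist (v \<tau> x) (ms Q W)) n x\<bar> = \<bar>Gdist (v \<tau> (?x n)) (ms Q W) - Gdist (v \<tau> x) (ms Q W)\<bar> * real (Suc n)"
          using elim O by (simp add: ldq_def abs_mult del: of_nat_Suc)
        also have "\<dots> \<le> l2d Q (V \<tau> (?x n)) (V \<tau> x) * real (Suc n)"
          unfolding v_def by (intro mult_right_mono Gdist_diff_le) simp
        also have "\<dots> = sqrt ((l2d Q (V \<tau> (?x n)) (V \<tau> x))\<^sup>2 * (real (Suc n))\<^sup>2)"
          by (simp add: real_sqrt_mult l2d_nonneg del: of_nat_Suc)
        also have "(l2d Q (V \<tau> (?x n)) (V \<tau> x))\<^sup>2 * (real (Suc n))\<^sup>2 = (\<Sum>i<Q. \<Sum>c\<in>UNIV. (?qV n i c)\<^sup>2)"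
          unfolding l2d_power2 sum_distrib_right by (simp add: power_mult_distrib del: of_nat_Suc)
        finally show ?case .
      qed
      show "\<bar>gv j \<tau> W x\<bar> \<le> sqrt (S2 j \<tau> x)"
        by (rule tendsto_le[OF sequentially_bot 2 3 ev])
    qed
  qed
qed

lemma dsh_pd_integrable:
  "integrable lborel (\<lambda>x. indicator Omega x * (dsh j I H i0 c0 x * pd j \<phi> x))"
  "integrable lborel (\<lambda>x. indicator Omega x * (pd j \<phi> x)\<^sup>2)"
  "integrable lborel (\<lambda>x. indicator Omega x * S2 j 0 x)"
proof -
  obtain \<psi> where b: "badm Q u j \<psi>" by (rule obtain_badm)
  obtain C where C: "\<And>x. \<bar>\<phi> x\<bar> \<le> C" "\<And>x j. \<bar>pd j \<phi> x\<bar> \<le> C" "C \<ge> 0" by (rule C1c_bounded[OF phi]) blast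
  have [measurable]: "dsh j I H i0 c0 \<in> borel_measurable borel" by (rule dsh_measurable[OF cs i0])
  have [measurable]: "pd j \<phi> \<in> borel_measurable borel" by (rule borel_measurable_continuous_onI[OF C1cD(2)[OF phi]])
  have S20: "S2 j 0 x = (\<Sum>i<Q. \<Sum>c\<in>UNIV. (dsh j I H i c x)\<^sup>2)" for x by (simp add: S2_def dV_0)
  show i0S: "integrable lborel (\<lambda>x. indicator Omega x * S2 j 0 x)"
    unfolding S20 by (rule dsh_sq_integrable(1)[OF cs b])
  show i1: "integrable lborel (\<lambda>x. indicator Omega x * (pd j \<phi> x)\<^sup>2)"
    by (rule integrable_mult_bounded[OF integrable_Omega_indicator, of _ "C\<^sup>2"])
      (use C in \<open>auto simp: power2_le_iff_abs_le\<close>)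
  show "integrable lborel (\<lambda>x. indicator Omega x * (dsh j I H i0 c0 x * pd j \<phi> x))"
  proof (rule Bochner_Integration.integrable_bound[OF Bochner_Integration.integrable_add[OF i0S i1]])
    show "AE x in lborel. norm (indicator Omega x * (dsh j I H i0 c0 x * pd j \<phi> x)) \<le> norm (indicator Omega x * S2 j 0 x + indicator Omega x * (pd j \<phi> x)\<^sup>2)"
    proof (rule AE_I2)
      fix x
      have "(dsh j I H i0 c0 x)\<^sup>2 \<le> (\<Sum>c\<in>UNIV. (dsh j I H i0 c x)\<^sup>2)" by (rule member_le_sum) auto
      also have "\<dots> \<le> S2 j 0 x" unfolding S20
        by (rule member_le_sum[of i0 "{..<Q}" "\<lambda>i. \<Sum>c\<in>UNIV. (dsh j I H i c x)\<^sup>2"]) (use i0 in \<open>auto intro!: sum_nonneg\<close>)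
      finally have 1: "(dsh j I H i0 c0 x)\<^sup>2 \<le> S2 j 0 x" .
      have "\<bar>a * b\<bar> \<le> a\<^sup>2 + b\<^sup>2" for a b :: real
      proof -
        have "2 * (\<bar>a\<bar> * \<bar>b\<bar>) \<le> a\<^sup>2 + b\<^sup>2" using zero_le_power2[of "\<bar>a\<bar> - \<bar>b\<bar>"] by (simp add: power2_diff)
        moreover have "0 \<le> \<bar>a\<bar> * \<bar>b\<bar>" by simp
        ultimately show ?thesis unfolding abs_mult by linarith
      qed
      from this[of "dsh j I H i0 c0 x" "pd j \<phi> x"] 1
      show "norm (indicator Omega x * (dsh j I H i0 c0 x * pd j \<phi> x)) \<le> norm (indicator Omega x * S2 j 0 x + indicator Omega x * (pd j \<phi> x)\<^sup>2)"
        by (cases "x \<in> Omega") auto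
    qed
  qed measurable
qed

lemma S2_expand: "S2 j \<tau> x = S2 j 0 x + 2 * \<tau> * (dsh j I H i0 c0 x * pd j \<phi> x) + \<tau>\<^sup>2 * (pd j \<phi> x)\<^sup>2"
proof -
  have "S2 j \<tau> x = (\<Sum>i<Q. \<Sum>c\<in>UNIV. (dsh j I H i c x)\<^sup>2 + (if i = i0 then if c = c0 then 2 * \<tau> * (dsh j I H i0 c0 x * pd j \<phi> x) + \<tau>\<^sup>2 * (pd j \<phi> x)\<^sup>2 else 0 else 0))"
    unfolding S2_def dV_def by (intro sum.cong refl) (auto simp: power2_eq_square algebra_simps)
  also have "\<dots> = S2 j 0 x + (\<Sum>i<Q. \<Sum>c\<in>(UNIV::'n set). if i = i0 then if c = c0 then 2 * \<tau> * (dsh j I H i0 c0 x * pd j \<phi> x) + \<tau>\<^sup>2 * (pd j \<phi> x)\<^sup>2 else 0 else 0)"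
    by (simp add: S2_def dV_0 sum.distrib)
  also have "(\<Sum>i<Q. \<Sum>c\<in>(UNIV::'n set). if i = i0 then if c = c0 then 2 * \<tau> * (dsh j I H i0 c0 x * pd j \<phi> x) + \<tau>\<^sup>2 * (pd j \<phi> x)\<^sup>2 else 0 else 0)
    = (\<Sum>i<Q. if i = i0 then 2 * \<tau> * (dsh j I H i0 c0 x * pd j \<phi> x) + \<tau>\<^sup>2 * (pd j \<phi> x)\<^sup>2 else 0)"
    by (intro sum.cong refl) (auto simp: sum.delta)
  also have "\<dots> = 2 * \<tau> * (dsh j I H i0 c0 x * pd j \<phi> x) + \<tau>\<^sup>2 * (pd j \<phi> x)\<^sup>2" using i0 by (simp add: sum.delta)
  finally show ?thesis by simp
qed

lemma S2_integrable: "integrable lborel (\<lambda>x. indicator Omega x * S2 j \<tau> x)"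
  and S2_integral: "(LINT x|lborel. indicator Omega x * S2 j \<tau> x) = (LINT x|lborel. indicator Omega x * S2 j 0 x)
     + 2 * \<tau> * (LINT x|lborel. indicator Omega x * (dsh j I H i0 c0 x * pd j \<phi> x)) + \<tau>\<^sup>2 * (LINT x|lborel. indicator Omega x * (pd j \<phi> x)\<^sup>2)"
proof -
  note i = dsh_pd_integrable[of j]
  have e: "indicator Omega x * S2 j \<tau> x = indicator Omega x * S2 j 0 x + 2 * \<tau> * (indicator Omega x * (dsh j I H i0 c0 x * pd j \<phi> x)) + \<tau>\<^sup>2 * (indicator Omega x * (pd j \<phi> x)\<^sup>2)" for x
    by (subst S2_expand) (simp add: algebra_simps)
  show "integrable lborel (\<lambda>x. indicator Omega x * S2 j \<tau> x)"
    unfolding e by (intro Bochner_Integration.integrable_add Bochner_Integration.integrable_mult_right i)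
  show "(LINT x|lborel. indicator Omega x * S2 j \<tau> x) = (LINT x|lborel. indicator Omega x * S2 j 0 x)
     + 2 * \<tau> * (LINT x|lborel. indicator Omega x * (dsh j I H i0 c0 x * pd j \<phi> x)) + \<tau>\<^sup>2 * (LINT x|lborel. indicator Omega x * (pd j \<phi> x)\<^sup>2)"
    unfolding e using i by (simp add: Bochner_Integration.integral_add)
qed

lemma sqrt_S2_L2: "L2 Omega (\<lambda>x. sqrt (S2 j \<tau> x))"
  by (rule L2_Omega_borelI) (use S2_integrable S2_nonneg in \<open>auto\<close>)

lemma gv_L2: "L2 Omega (gv j \<tau> W)"
proof (rule L2_Omega_borelI)
  show "integrable lborel (\<lambda>x. indicator Omega x * (gv j \<tau> W x)\<^sup>2)"
  proof (rule Bochner_Integration.integrable_bound[OF S2_integrable[of j \<tau>]])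
    show "AE x in lborel. norm (indicator Omega x * (gv j \<tau> W x)\<^sup>2) \<le> norm (indicator Omega x * S2 j \<tau> x)"
      using gv_le[of j \<tau> W]
    proof eventually_elim
      case (elim x)
      then have "x \<in> Omega \<Longrightarrow> (gv j \<tau> W x)\<^sup>2 \<le> S2 j \<tau> x"
        using S2_nonneg[of j \<tau> x] by (metis abs_ge_zero power2_abs power_mono real_sqrt_pow2)
      then show ?case by (cases "x \<in> Omega") auto
    qed
  qed measurable
qed measurable

lemma AE_u: "AE x in lborel. x \<in> Omega \<longrightarrow> u x = ms Q (sheet I H x)"
  using cs by (simp add: csel_def)

lemma v_dist_L2: "L2 Omega (\<lambda>x. Gdist (v \<tau> x) (ms Q W))"
proof -
  obtain C where C: "\<And>x. \<bar>\<phi> x\<bar> \<le> C" "\<And>x j. \<bar>pd j \<phi> x\<bar> \<le> C" "C \<ge> 0" by (rule C1c_bounded[OF phi]) blast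
  have "L2 Omega (\<lambda>x. Gdist (u x) (ms Q W))" using W12 ms_in_AQ by (auto simp: AQ_W12_def W12_def)
  then obtain f where f: "f \<in> borel_measurable borel" "\<And>x. x \<notin> Omega \<Longrightarrow> f x = 0" "AE x in lborel. x \<in> Omega \<longrightarrow> f x = Gdist (u x) (ms Q W)"
    "integrable lborel (\<lambda>x. (f x)\<^sup>2)" "integrable lborel f"
    "set_lebesgue_integral lebesgue Omega (\<lambda>x. (Gdist (u x) (ms Q W))\<^sup>2) = (LINT x|lborel. (f x)\<^sup>2)"
    by (rule L2_Omega_borel_rep) blast
  let ?F = "\<lambda>x. indicator Omega x * Gdist (v \<tau> x) (ms Q W)"
  have Fm[measurable]: "?F \<in> borel_measurable borel"
    by (rule continuous_on_open_borel_indicator[OF Omega_open v_dist_continuous])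
  have "L2 Omega ?F"
  proof (rule L2_Omega_borelI[OF Fm])
    show "integrable lborel (\<lambda>x. indicator Omega x * (?F x)\<^sup>2)"
    proof (rule Bochner_Integration.integrable_bound[of lborel "\<lambda>x. 2 * (f x)\<^sup>2 + 2 * (\<bar>\<tau>\<bar> * C)\<^sup>2 * indicator Omega x"])
      show "integrable lborel (\<lambda>x. 2 * (f x)\<^sup>2 + 2 * (\<bar>\<tau>\<bar> * C)\<^sup>2 * indicator Omega x)"
        using f(4) integrable_Omega_indicator by simp
      show "AE x in lborel. norm (indicator Omega x * (?F x)\<^sup>2) \<le> norm (2 * (f x)\<^sup>2 + 2 * (\<bar>\<tau>\<bar> * C)\<^sup>2 * indicator Omega x)"
        using f(3) AE_u
      proof eventually_elim
        case (elim x)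
        show ?case
        proof (cases "x \<in> Omega")
          case True
          have l0: "l2d Q (V \<tau> x) (sheet I H x) \<le> \<bar>\<tau>\<bar> * C"
          proof -
            have "l2d Q (V \<tau> x) (sheet I H x) = l2d Q (E \<tau> x) (E 0 x)" by (simp add: l2d_def V_def E_0)
            also have "\<dots> \<le> (\<Sum>i<Q. norm (E \<tau> x i - E 0 x i))" unfolding l2d_def by (rule L2_set_le_sum) simp
            also have "\<dots> = (\<Sum>i<Q. if i = i0 then \<bar>\<tau>\<bar> * \<bar>\<phi> x\<bar> else 0)" by (intro sum.cong) (auto simp: E_0 E_def abs_mult)
            also have "\<dots> = \<bar>\<tau>\<bar> * \<bar>\<phi> x\<bar>" using i0 by simp
            also have "\<dots> \<le> \<bar>\<tau>\<bar> * C" using C(1) by (intro mult_left_mono) auto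
            finally show ?thesis .
          qed
          have "Gdist (v \<tau> x) (ms Q W) \<le> f x + \<bar>\<tau>\<bar> * C"
            using Gdist_diff_le[of Q "V \<tau> x" W "sheet I H x"] l0 elim True unfolding v_def by (simp add: abs_le_iff)
          moreover have "0 \<le> Gdist (v \<tau> x) (ms Q W)" unfolding v_def by (rule Gdist_nonneg)
          ultimately have "(Gdist (v \<tau> x) (ms Q W))\<^sup>2 \<le> (f x + \<bar>\<tau>\<bar> * C)\<^sup>2" by (rule power_mono)
          also have "\<dots> \<le> 2 * (f x)\<^sup>2 + 2 * (\<bar>\<tau>\<bar> * C)\<^sup>2"
            using zero_le_power2[of "f x - \<bar>\<tau>\<bar> * C"] unfolding power2_sum power2_diff by linarith
          finally show ?thesis using True by simp
        qed simp
      qed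
    qed measurable
  qed
  then show ?thesis by (rule L2_cong[rotated]) simp
qed

lemma v_adm: "AQ_adm Q Omega (v \<tau>) j (\<lambda>x. sqrt (S2 j \<tau> x))"
  unfolding AQ_adm_def
proof (intro conjI ballI sqrt_S2_L2)
  fix T :: "(real^'n) multiset" assume "T \<in> AQ Q"
  then obtain W where W: "T = ms Q W" by (rule AQ_imp_ms)
  show "\<exists>g. weak_deriv Omega j (\<lambda>x. Gdist (v \<tau> x) T) g \<and> (AE x in lebesgue_on Omega. \<bar>g x\<bar> \<le> sqrt (S2 j \<tau> x))"
    unfolding W AE_lebesgue_on_Omega using gv_weak_deriv gv_le by blast
qed

lemma v_W12: "AQ_W12 Q Omega (v \<tau>)"
  unfolding AQ_W12_def
proof (intro conjI ballI allI)
  show "v \<tau> x \<in> AQ Q" for x unfolding v_def by (rule ms_in_AQ)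
  show "\<exists>\<psi>. AQ_adm Q Omega (v \<tau>) j \<psi>" for j using v_adm by blast
  fix T :: "(real^'n) multiset" assume "T \<in> AQ Q"
  then obtain W where W: "T = ms Q W" by (rule AQ_imp_ms)
  show "W12 Omega (\<lambda>x. Gdist (v \<tau> x) T)"
    unfolding W W12_def using v_dist_L2 gv_L2 gv_weak_deriv by blast
qed

lemma Dir_v_le: "Dir Q Omega (v \<tau>) \<le> (\<Sum>j\<in>UNIV. LINT x|lborel. indicator Omega x * S2 j \<tau> x)"
  unfolding Dir_def
proof (rule sum_mono)
  fix j :: 2
  let ?S = "{set_lebesgue_integral lebesgue Omega (\<lambda>x. (\<psi> x)\<^sup>2) | \<psi>. AQ_adm Q Omega (v \<tau>) j \<psi>}"
  have "bdd_below ?S"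
    by (rule bdd_belowI[of _ 0]) (auto simp: set_lebesgue_integral_def intro!: integral_nonneg_AE)
  moreover have "set_lebesgue_integral lebesgue Omega (\<lambda>x. (sqrt (S2 j \<tau> x))\<^sup>2) \<in> ?S" by (rule CollectI, rule exI, rule conjI[OF refl v_adm])
  ultimately have "Inf ?S \<le> set_lebesgue_integral lebesgue Omega (\<lambda>x. (sqrt (S2 j \<tau> x))\<^sup>2)" by (rule cInf_lower[rotated])
  also have "\<dots> = (LINT x|lborel. indicator Omega x * S2 j \<tau> x)"
    using set_lebesgue_borel(2)[OF S2_integrable[of j \<tau>]] S2_nonneg by simp
  finally show "Inf ?S \<le> (LINT x|lborel. indicator Omega x * S2 j \<tau> x)" .
qed

end

section \<open>Traces under changes away from the flat boundary\<close>

lemma L2_Omega_AE_cong: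
  assumes f: "L2 Omega f" and ae: "AE x in lborel. x \<in> Omega \<longrightarrow> f x = g x"
  shows "L2 Omega g"
proof -
  have m: "(\<lambda>x. indicator Omega x * f x) \<in> borel_measurable lebesgue"
    using f Omega_sets_lebesgue by (simp add: L2_def borel_measurable_restrict_space_iff)
  have "AE x in lebesgue. indicator Omega x * f x = indicator Omega x * g x"
    unfolding AE_completion_iff using ae by eventually_elim (auto simp: indicator_def)
  then have m2: "(\<lambda>x. indicator Omega x * g x) \<in> borel_measurable lebesgue"
    by (rule borel_measurable_AE[OF m])
  then have gm: "g \<in> borel_measurable (lebesgue_on Omega)"
    using Omega_sets_lebesgue by (simp add: borel_measurable_restrict_space_iff)
  have fm: "f \<in> borel_measurable (lebesgue_on Omega)" using f by (simp add: L2_def)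
  have "AE x in lebesgue_on Omega. (f x)\<^sup>2 = (g x)\<^sup>2"
    unfolding AE_lebesgue_on_Omega using ae by eventually_elim auto
  then have "integrable (lebesgue_on Omega) (\<lambda>x. (g x)\<^sup>2)"
    using f integrable_cong_AE[of "\<lambda>x. (f x)\<^sup>2" "lebesgue_on Omega" "\<lambda>x. (g x)\<^sup>2"] fm gm
    by (simp add: L2_def borel_measurable_power)
  with gm show ?thesis by (simp add: L2_def)
qed

lemma L2_times_bounded:
  assumes "L2 Omega g" "continuous_on UNIV h" "\<And>x. \<bar>h x\<bar> \<le> C"
  shows "set_integrable lebesgue Omega (\<lambda>x. g x * h x)"
proof -
  have "integrable lebesgue (\<lambda>x. indicator Omega x * g x)"
    using L2_Omega_set_integrable[OF assms(1)] by (simp add: set_integrable_def)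
  moreover have "h \<in> borel_measurable lebesgue"
    using measurable_completion[of h lborel borel] borel_measurable_continuous_onI[OF assms(2)] by simp
  ultimately have "integrable lebesgue (\<lambda>x. indicator Omega x * g x * h x)"
    using assms(3) by (rule integrable_mult_bounded)
  then show ?thesis by (simp add: set_integrable_def mult.assoc)
qed

text \<open>\<open>flat_trace\<close> only provides some weak derivative; uniqueness identifies it
  with a square integrable one.\<close>

lemma W12_weak_deriv_L2:
  assumes "W12 Omega F" "weak_deriv Omega j F g" shows "L2 Omega g"
proof -
  obtain g' where g': "L2 Omega g'" "weak_deriv Omega j F g'" using assms(1) by (auto simp: W12_def)
  show ?thesis by (rule L2_Omega_AE_cong[OF g'(1) weak_deriv_unique[OF Omega_open g'(2) assms(2)]])
qed

lemma Omega_subset_U: "Omega \<subseteq> U_disk" by (auto simp: Omega_def)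

lemma cutoff_has_derivative:
  fixes c :: real assumes "c > 0"
  shows "((\<lambda>x::real^2. sstep (x $ 2 / c - 1)) has_derivative (\<lambda>v. \<Sum>j\<in>UNIV. v $ j * (if j = 2 then shat (x $ 2 / c - 1) / c else 0))) (at x)"
proof -
  have pr: "((\<lambda>x::real^2. x $ 2 / c - 1) has_derivative (\<lambda>v. v $ 2 / c)) (at x)"
    using assms by (auto intro!: derivative_eq_intros bounded_linear.has_derivative[OF bounded_linear_vec_nth])
  have "((\<lambda>x::real^2. sstep (x $ 2 / c - 1)) has_derivative (\<lambda>v. shat (x $ 2 / c - 1) * (v $ 2 / c))) (at x)"
    using diff_chain_at[OF pr sstep_has_real_derivative[THEN has_field_derivative_imp_has_derivative]] by (simp add: o_def)
  then show ?thesis by (rule has_derivative_eq_rhs) (auto simp: sum_2_oth[of _ 2])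
qed

text \<open>The factor \<open>sstep (x $ 2 / c - 1)\<close> is 0 up to height c and 1 from height 2c
  on. It pushes a test function on the disk into \<open>Omega\<close>; the complementary factor
  retains what happens near the flat boundary.\<close>

lemma cutoff_C1c:
  assumes c: "c > 0" and \<phi>: "\<phi> \<in> C1c S" and S: "S = Omega \<or> S = U_disk"
  shows "(\<lambda>x. sstep (x $ 2 / c - 1) * \<phi> x) \<in> C1c Omega"
    "pd 2 (\<lambda>x. sstep (x $ 2 / c - 1) * \<phi> x) x = shat (x $ 2 / c - 1) / c * \<phi> x + sstep (x $ 2 / c - 1) * pd 2 \<phi> x"
    "(\<lambda>x. (1 - sstep (x $ 2 / c - 1)) * \<phi> x) \<in> C1c S"
    "pd 2 (\<lambda>x. (1 - sstep (x $ 2 / c - 1)) * \<phi> x) x = - shat (x $ 2 / c - 1) / c * \<phi> x + (1 - sstep (x $ 2 / c - 1)) * pd 2 \<phi> x"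
proof -
  let ?A = "\<lambda>j (x::real^2). if j = (2::2) then shat (x $ 2 / c - 1) / c else 0"
  have cA: "continuous_on UNIV (?A j)" for j
    by (cases "j = 2") (auto intro!: continuous_intros simp: c[THEN less_imp_neq, symmetric])
  note M = C1c_mult[OF \<phi> cutoff_has_derivative[OF c] cA]
  show "pd 2 (\<lambda>x. sstep (x $ 2 / c - 1) * \<phi> x) x = shat (x $ 2 / c - 1) / c * \<phi> x + sstep (x $ 2 / c - 1) * pd 2 \<phi> x"
    using M(2)[of 2 x] by simp
  have "closure {x. sstep (x $ 2 / c - 1) * \<phi> x \<noteq> 0} \<subseteq> closure {x. \<phi> x \<noteq> 0} \<inter> {x. x $ 2 \<ge> c}"
  proof (rule closure_minimal)
    show "{x. sstep (x $ 2 / c - 1) * \<phi> x \<noteq> 0} \<subseteq> closure {x. \<phi> x \<noteq> 0} \<inter> {x. x $ 2 \<ge> c}"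
    proof
      fix x assume "x \<in> {x. sstep (x $ 2 / c - 1) * \<phi> x \<noteq> 0}"
      then have n0: "sstep (x $ 2 / c - 1) \<noteq> 0" "\<phi> x \<noteq> 0" by auto
      have n: "\<phi> x \<noteq> 0" "\<not> x $ 2 / c - 1 \<le> 0" using n0 sstep_le0[of "x $ 2 / c - 1"] by blast+
      have "x \<in> closure {x. \<phi> x \<noteq> 0}" by (rule subsetD[OF closure_subset]) (simp add: n(1))
      moreover have "x $ 2 \<ge> c" using n(2) c by (simp add: field_simps)
      ultimately show "x \<in> closure {x. \<phi> x \<noteq> 0} \<inter> {x. x $ 2 \<ge> c}" by simp
    qed
    show "closed (closure {x. \<phi> x \<noteq> 0} \<inter> {x. x $ 2 \<ge> c})"
      by (intro closed_Int closed_closure closed_Collect_le continuous_intros)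
  qed
  moreover have "closure {x. \<phi> x \<noteq> 0} \<inter> {x. x $ 2 \<ge> c} \<subseteq> Omega"
    using C1cD(5)[OF \<phi>] S c by (auto simp: Omega_def D_half_def)
  ultimately show "(\<lambda>x. sstep (x $ 2 / c - 1) * \<phi> x) \<in> C1c Omega"
    using M(1) unfolding C1c_def by blast
  let ?B = "\<lambda>j (x::real^2). if j = (2::2) then - shat (x $ 2 / c - 1) / c else 0"
  have D2: "((\<lambda>x::real^2. 1 - sstep (x $ 2 / c - 1)) has_derivative (\<lambda>v. \<Sum>j\<in>UNIV. v $ j * ?B j x)) (at x)" for x
    by (rule has_derivative_eq_rhs[OF has_derivative_diff[OF has_derivative_const cutoff_has_derivative[OF c]]])
      (auto simp: sum_2_oth[of _ 2])
  have cB: "continuous_on UNIV (?B j)" for j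
    by (cases "j = 2") (auto intro!: continuous_intros simp: c[THEN less_imp_neq, symmetric])
  note M2 = C1c_mult[OF \<phi> D2 cB]
  show "(\<lambda>x. (1 - sstep (x $ 2 / c - 1)) * \<phi> x) \<in> C1c S" by (rule M2(1))
  show "pd 2 (\<lambda>x. (1 - sstep (x $ 2 / c - 1)) * \<phi> x) x = - shat (x $ 2 / c - 1) / c * \<phi> x + (1 - sstep (x $ 2 / c - 1)) * pd 2 \<phi> x"
    using M2(2)[of 2 x] by simp
qed

lemma L2_pd_integrable:
  assumes "L2 Omega f" "\<phi> \<in> C1c S"
  shows "set_integrable lebesgue Omega (\<lambda>x. f x * pd j \<phi> x)" "set_integrable lebesgue Omega (\<lambda>x. f x * \<phi> x)"
proof -
  obtain C where C: "\<And>x. \<bar>\<phi> x\<bar> \<le> C" "\<And>x j. \<bar>pd j \<phi> x\<bar> \<le> C" "C \<ge> 0" by (rule C1c_bounded[OF assms(2)]) blast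
  show "set_integrable lebesgue Omega (\<lambda>x. f x * pd j \<phi> x)" by (rule L2_times_bounded[OF assms(1) C1cD(2)[OF assms(2)] C(2)])
  show "set_integrable lebesgue Omega (\<lambda>x. f x * \<phi> x)" by (rule L2_times_bounded[OF assms(1) C1cD(3)[OF assms(2)] C(1)])
qed

text \<open>Test functions are split between the heights c and 2c. The upper part has compact
  support in \<open>Omega\<close> and is governed by the weak derivative of \<open>f'\<close>. The
  lower part lives where \<open>f'\<close> and \<open>f\<close> agree and is governed by the trace
  identity of \<open>f\<close>.\<close>

lemma flat_trace_local:
  assumes tr: "flat_trace f h" and f: "W12 Omega f" and f': "L2 Omega f'" "weak_deriv Omega 2 f' g'" "L2 Omega g'"
    and c: "c > 0" and eq: "AE x in lborel. x \<in> Omega \<longrightarrow> x $ 2 < 2 * c \<longrightarrow> f' x = f x"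
  shows "flat_trace f' h"
proof -
  obtain g where g: "weak_deriv Omega 2 f g" and trg: "\<And>\<phi>. \<phi> \<in> C1c U_disk \<Longrightarrow>
        set_lebesgue_integral lebesgue Omega (\<lambda>x. f x * pd 2 \<phi> x) + set_lebesgue_integral lebesgue Omega (\<lambda>x. g x * \<phi> x)
        = - set_lebesgue_integral lborel {-1<..<1::real} (\<lambda>t. h (vector [t, 0]) * \<phi> (vector [t, 0]))"
    using tr unfolding flat_trace_def by blast
  have gL: "L2 Omega g" by (rule W12_weak_deriv_L2[OF f g])
  have fL: "L2 Omega f" using f by (simp add: W12_def)
  define \<kappa> where "\<kappa> x = sstep (x $ 2 / c - 1)" for x :: "real^2"
  \<comment> \<open>\<open>flat_trace\<close> asks for one weak derivative that also satisfies the
    boundary identity. This blend is the trace-carrying \<open>g\<close> near the boundary and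
    \<open>g'\<close> above.\<close>
  define G where "G x = \<kappa> x * g' x + (1 - \<kappa> x) * g x" for x
  have split: "set_integrable lebesgue Omega (\<lambda>x. f' x * pd 2 \<phi> x) \<and> set_integrable lebesgue Omega (\<lambda>x. G x * \<phi> x) \<and>
      (LINT x:Omega|lebesgue. f' x * pd 2 \<phi> x) + (LINT x:Omega|lebesgue. G x * \<phi> x)
      = (LINT x:Omega|lebesgue. f x * pd 2 (\<lambda>x. (1 - \<kappa> x) * \<phi> x) x) + (LINT x:Omega|lebesgue. g x * ((1 - \<kappa> x) * \<phi> x))"
    if \<phi>: "\<phi> \<in> C1c S" and S: "S = Omega \<or> S = U_disk" for \<phi> S
  proof -
    let ?A = "\<lambda>x. \<kappa> x * \<phi> x" and ?B = "\<lambda>x. (1 - \<kappa> x) * \<phi> x"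
    have A: "?A \<in> C1c Omega" and pA: "pd 2 ?A x = shat (x $ 2 / c - 1) / c * \<phi> x + \<kappa> x * pd 2 \<phi> x"
      and B: "?B \<in> C1c S" and pB: "pd 2 ?B x = - shat (x $ 2 / c - 1) / c * \<phi> x + (1 - \<kappa> x) * pd 2 \<phi> x" for x
      unfolding \<kappa>_def using cutoff_C1c[OF c \<phi> S] by auto
    have p: "pd 2 \<phi> x = pd 2 ?A x + pd 2 ?B x" for x unfolding pA pB by (simp add: algebra_simps)
    note i1 = L2_pd_integrable(1)[OF f'(1) A, of 2] and i2 = L2_pd_integrable(1)[OF f'(1) B, of 2]
    note i3 = L2_pd_integrable(2)[OF f'(3) A] and i4 = L2_pd_integrable(2)[OF gL B]
    have I1: "set_integrable lebesgue Omega (\<lambda>x. f' x * pd 2 \<phi> x)" by (rule L2_pd_integrable(1)[OF f'(1) \<phi>])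
    have e1: "(LINT x:Omega|lebesgue. f' x * pd 2 \<phi> x) = (LINT x:Omega|lebesgue. f' x * pd 2 ?A x) + (LINT x:Omega|lebesgue. f' x * pd 2 ?B x)"
      unfolding p distrib_left by (rule set_integral_add(2)[OF i1 i2])
    have Ge: "G x * \<phi> x = g' x * ?A x + g x * ?B x" for x unfolding G_def by (simp add: algebra_simps)
    have I2: "set_integrable lebesgue Omega (\<lambda>x. G x * \<phi> x)" unfolding Ge by (rule set_integral_add(1)[OF i3 i4])
    have e2: "(LINT x:Omega|lebesgue. G x * \<phi> x) = (LINT x:Omega|lebesgue. g' x * ?A x) + (LINT x:Omega|lebesgue. g x * ?B x)"
      unfolding Ge by (rule set_integral_add(2)[OF i3 i4])
    have e3: "(LINT x:Omega|lebesgue. f' x * pd 2 ?A x) = - (LINT x:Omega|lebesgue. g' x * ?A x)"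
      using f'(2) A by (simp add: weak_deriv_def)
    have e4: "(LINT x:Omega|lebesgue. f' x * pd 2 ?B x) = (LINT x:Omega|lebesgue. f x * pd 2 ?B x)"
      unfolding set_lebesgue_integral_def
    proof (rule integral_cong_AE)
      show "(\<lambda>x. indicator Omega x *\<^sub>R (f' x * pd 2 ?B x)) \<in> borel_measurable lebesgue"
        using i2 by (simp add: set_integrable_def borel_measurable_integrable)
      show "(\<lambda>x. indicator Omega x *\<^sub>R (f x * pd 2 ?B x)) \<in> borel_measurable lebesgue"
        using L2_pd_integrable(1)[OF fL B, of 2] by (simp add: set_integrable_def borel_measurable_integrable)
      show "AE x in lebesgue. indicator Omega x *\<^sub>R (f' x * pd 2 ?B x) = indicator Omega x *\<^sub>R (f x * pd 2 ?B x)"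
        unfolding AE_completion_iff using eq
      proof eventually_elim
        case (elim x)
        show ?case
        proof (cases "x $ 2 < 2 * c")
          case False
          then have "x $ 2 / c - 1 \<ge> 1" using c by (simp add: field_simps)
          then have "pd 2 ?B x = 0" unfolding pB by (simp add: \<kappa>_def shat_ge1 sstep_ge1)
          then show ?thesis by simp
        qed (use elim in \<open>auto simp: indicator_def\<close>)
      qed
    qed
    show ?thesis using I1 I2 e1 e2 e3 e4 by simp
  qed
  have "weak_deriv Omega 2 f' G"
    unfolding weak_deriv_def
  proof
    fix \<phi> assume \<phi>: "\<phi> \<in> C1c Omega"
    have B: "(\<lambda>x. (1 - \<kappa> x) * \<phi> x) \<in> C1c Omega" unfolding \<kappa>_def using cutoff_C1c(3)[OF c \<phi>] by auto
    have "(LINT x:Omega|lebesgue. f x * pd 2 (\<lambda>x. (1 - \<kappa> x) * \<phi> x) x) = - (LINT x:Omega|lebesgue. g x * ((1 - \<kappa> x) * \<phi> x))"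
      using g B by (simp add: weak_deriv_def)
    then show "set_integrable lebesgue Omega (\<lambda>x. f' x * pd 2 \<phi> x) \<and> set_integrable lebesgue Omega (\<lambda>x. G x * \<phi> x) \<and>
      (LINT x:Omega|lebesgue. f' x * pd 2 \<phi> x) = - (LINT x:Omega|lebesgue. G x * \<phi> x)"
      using split[OF \<phi>] by simp
  qed
  moreover have "set_lebesgue_integral lebesgue Omega (\<lambda>x. f' x * pd 2 \<phi> x) + set_lebesgue_integral lebesgue Omega (\<lambda>x. G x * \<phi> x)
        = - set_lebesgue_integral lborel {-1<..<1::real} (\<lambda>t. h (vector [t, 0]) * \<phi> (vector [t, 0]))"
    if \<phi>: "\<phi> \<in> C1c U_disk" for \<phi>
  proof -
    have B: "(\<lambda>x. (1 - \<kappa> x) * \<phi> x) \<in> C1c U_disk" unfolding \<kappa>_def using cutoff_C1c(3)[OF c \<phi>] by auto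
    have "\<kappa> (vector [t, 0]) = 0" for t unfolding \<kappa>_def by (simp add: sstep_le0)
    then show ?thesis using split[OF \<phi>] trg[OF B] by simp
  qed
  ultimately show ?thesis unfolding flat_trace_def by blast
qed

context sheet_variation
begin

text \<open>A compact subset of \<open>Omega\<close> has positive height. The competitor therefore
  equals \<open>u\<close> near the flat boundary, which is the situation of
  \<open>flat_trace_local\<close>.\<close>

lemma support_height: obtains c where "c > 0" "\<And>x. \<phi> x \<noteq> 0 \<Longrightarrow> 2 * c \<le> x $ 2"
proof (cases "closure {x. \<phi> x \<noteq> 0} = {}")
  case True
  then have "\<phi> x = 0" for x using C1cD(6)[OF phi] by blast
  then show ?thesis using that[of 1] by simp
next
  case False
  obtain x0 where x0: "x0 \<in> closure {x. \<phi> x \<noteq> 0}" "\<And>x. x \<in> closure {x. \<phi> x \<noteq> 0} \<Longrightarrow> x0 $ 2 \<le> x $ 2"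
    using continuous_attains_inf[OF C1cD(4)[OF phi] False continuous_on_component[OF continuous_on_id], of 2] by blast
  have "x0 $ 2 > 0" using C1cD(5)[OF phi] x0(1) by (auto simp: Omega_iff)
  then show ?thesis using that[of "x0 $ 2 / 2"] x0(2) closure_subset[of "{x. \<phi> x \<noteq> 0}"] by (auto simp: subset_iff)
qed

lemma v_eq_u: "AE x in lborel. x \<in> Omega \<longrightarrow> \<phi> x = 0 \<longrightarrow> v \<tau> x = u x"
  using AE_u
proof eventually_elim
  case (elim x)
  show ?case
  proof (intro impI)
    assume x: "x \<in> Omega" "\<phi> x = 0"
    have "v \<tau> x = ms Q (sheet I H x)" unfolding v_def by (rule ms_cong) (simp add: V_def E_def x)
    then show "v \<tau> x = u x" using elim x by simp
  qed
qed

lemma v_trace: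
  assumes "AQ_trace_zero Q u" shows "AQ_trace_zero Q (v \<tau>)"
  unfolding AQ_trace_zero_def
proof
  fix T :: "(real^'n) multiset" assume T: "T \<in> AQ Q"
  then obtain W where W: "T = ms Q W" by (rule AQ_imp_ms)
  obtain c where c: "c > 0" "\<And>x. \<phi> x \<noteq> 0 \<Longrightarrow> 2 * c \<le> x $ 2" by (rule support_height) blast
  show "flat_trace (\<lambda>x. Gdist (v \<tau> x) T) (\<lambda>x. Gdist (replicate_mset Q 0) T)"
  proof (rule flat_trace_local[OF _ _ _ _ _ c(1)])
    show "flat_trace (\<lambda>x. Gdist (u x) T) (\<lambda>x. Gdist (replicate_mset Q 0) T)" using assms T by (simp add: AQ_trace_zero_def)
    show "W12 Omega (\<lambda>x. Gdist (u x) T)" using W12 T by (simp add: AQ_W12_def)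
    show "L2 Omega (\<lambda>x. Gdist (v \<tau> x) T)" unfolding W by (rule v_dist_L2)
    show "weak_deriv Omega 2 (\<lambda>x. Gdist (v \<tau> x) T) (gv 2 \<tau> W)" unfolding W by (rule gv_weak_deriv)
    show "L2 Omega (gv 2 \<tau> W)" by (rule gv_L2)
    show "AE x in lborel. x \<in> Omega \<longrightarrow> x $ 2 < 2 * c \<longrightarrow> Gdist (v \<tau> x) T = Gdist (u x) T"
      using v_eq_u[of \<tau>]
    proof eventually_elim
      case (elim x)
      then show ?case using c(2)[of x] by fastforce
    qed
  qed
qed

lemma quadratic_nonneg_imp_zero:
  fixes A B :: real assumes "\<And>\<tau>. 0 \<le> 2 * \<tau> * A + \<tau>\<^sup>2 * B" "0 \<le> B" shows "A = 0"
proof (rule ccontr)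
  assume "A \<noteq> 0"
  \<comment> \<open>The parabola has its minimum at - A / B; the summand 1 covers B = 0.\<close>
  define \<tau> where "\<tau> = - A / (B + 1)"
  have t: "\<tau> * (B + 1) = - A" using assms(2) by (simp add: \<tau>_def)
  have "(2 * \<tau> * A + \<tau>\<^sup>2 * B) * (B + 1)\<^sup>2 = 2 * A * (\<tau> * (B + 1)) * (B + 1) + B * (\<tau> * (B + 1))\<^sup>2"
    by (simp add: power2_eq_square algebra_simps)
  also have "\<dots> = - (A\<^sup>2 * (B + 2))" unfolding t by (simp add: power2_eq_square algebra_simps)
  also have "\<dots> < 0" using \<open>A \<noteq> 0\<close> assms(2) by simp
  finally show False using assms(1)[of \<tau>] by (simp add: mult_less_0_iff)
qed

text \<open>The chain is: sheet energy at 0 \<le> \<open>Dir\<close> of \<open>u\<close> \<le>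
  \<open>Dir\<close> of the competitor \<le> sheet energy at \<tau>. Both ends are values of one
  quadratic polynomial in \<tau>, so its linear coefficient vanishes.\<close>

lemma Euler_Lagrange:
  assumes min: "Dir_minimizing Q u" and tr: "AQ_trace_zero Q u"
  shows "(\<Sum>j\<in>UNIV. LINT x|lborel. indicator Omega x * (dsh j I H i0 c0 x * pd j \<phi> x)) = 0"
proof (rule quadratic_nonneg_imp_zero)
  fix \<tau> :: real
  have S20: "S2 j 0 x = (\<Sum>i<Q. \<Sum>c\<in>UNIV. (dsh j I H i c x)\<^sup>2)" for j x by (simp add: S2_def dV_0)
  have "(\<Sum>j\<in>UNIV. LINT x|lborel. indicator Omega x * S2 j 0 x) \<le> Dir Q Omega u"
    using Dir_lower[OF W12 cs] unfolding S20 .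
  also have "\<dots> \<le> Dir Q Omega (v \<tau>)"
  proof -
    have "compact (closure {x. \<phi> x \<noteq> 0})" "closure {x. \<phi> x \<noteq> 0} \<subseteq> U_disk"
      using C1cD(4,5)[OF phi] Omega_subset_U by auto
    moreover have "AE x in lebesgue_on Omega. x \<notin> closure {x. \<phi> x \<noteq> 0} \<longrightarrow> v \<tau> x = u x"
      unfolding AE_lebesgue_on_Omega using v_eq_u[of \<tau>]
    proof eventually_elim
      case (elim x)
      then show ?case using C1cD(6)[OF phi, of x] by blast
    qed
    ultimately show ?thesis using min v_W12[of \<tau>] v_trace[OF tr, of \<tau>] unfolding Dir_minimizing_def by blast
  qed
  also have "\<dots> \<le> (\<Sum>j\<in>UNIV. LINT x|lborel. indicator Omega x * S2 j \<tau> x)" by (rule Dir_v_le)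
  also have "\<dots> = (\<Sum>j\<in>UNIV. LINT x|lborel. indicator Omega x * S2 j 0 x)
    + 2 * \<tau> * (\<Sum>j\<in>UNIV. LINT x|lborel. indicator Omega x * (dsh j I H i0 c0 x * pd j \<phi> x)) + \<tau>\<^sup>2 * (\<Sum>j\<in>UNIV. LINT x|lborel. indicator Omega x * (pd j \<phi> x)\<^sup>2)"
    unfolding S2_integral[of _ \<tau>] by (simp add: sum.distrib sum_distrib_left)
  finally show "0 \<le> 2 * \<tau> * (\<Sum>j\<in>UNIV. LINT x|lborel. indicator Omega x * (dsh j I H i0 c0 x * pd j \<phi> x)) + \<tau>\<^sup>2 * (\<Sum>j\<in>UNIV. LINT x|lborel. indicator Omega x * (pd j \<phi> x)\<^sup>2)"
    by simp
qed (auto intro!: sum_nonneg integral_nonneg_AE)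

end

section \<open>The equation for the profile\<close>

lemma integrable_indicator_times_continuous:
  fixes k :: "real \<Rightarrow> real"
  assumes "continuous_on {a..b} k" shows "integrable lborel (\<lambda>s. indicator {a<..<b} s * k s)"
proof -
  have "integrable lborel (\<lambda>s. indicator {a..b} s *\<^sub>R k s)"
    using borel_integrable_atLeastAtMost'[OF assms] by (simp add: set_integrable_def)
  then have "integrable lborel (\<lambda>s. indicator {a<..<b} s *\<^sub>R (indicator {a..b} s *\<^sub>R k s))"
    by (rule integrable_mult_indicator[rotated]) simp
  then show ?thesis by (rule Bochner_Integration.integrable_cong[THEN iffD1, rotated -1]) (auto simp: indicator_def)
qed

lemma integral_cong_AE_Icc:
  fixes f g :: "real \<Rightarrow> real"
  assumes f: "f integrable_on {a..b}" and ae: "AE x in lborel. a < x \<longrightarrow> x < b \<longrightarrow> f x = g x"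
  shows "integral {a..b} f = integral {a..b} g" "g integrable_on {a..b}"
proof -
  obtain N where N: "N \<in> null_sets lborel" "\<And>x. x \<notin> N \<Longrightarrow> a < x \<Longrightarrow> x < b \<Longrightarrow> f x = g x"
    using AE_E3[OF ae] by (auto simp: space_lborel)
  have "negligible N" using null_sets_completionI[OF N(1)] by (simp add: negligible_iff_null_sets)
  then have n: "negligible (N \<union> {a, b})" by (intro negligible_Un) auto
  show "integral {a..b} f = integral {a..b} g"
    by (rule integral_spike[OF n]) (use N in force)
  show "g integrable_on {a..b}"
    by (rule integrable_spike[OF f n]) (use N in force)
qed

text \<open>The polar angle of a point of slope s = x_1 / x_2, decreasing from \<pi> to 0 as s runs
  over the real line. The factor (1 + s^2)^(1/2) that accompanies it is r / x_2.\<close>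

definition angle :: "real \<Rightarrow> real" where "angle s = pi / 2 - arctan s"

lemma angle_has_derivative: "(angle has_real_derivative - (1 / (1 + s\<^sup>2))) (at s)"
  unfolding angle_def[abs_def]
  by (rule DERIV_cong[OF DERIV_diff[OF DERIV_const DERIV_arctan]]) (simp add: inverse_eq_divide)

lemma one_plus_sq_pos: "0 < 1 + (s::real)\<^sup>2" by (simp add: add_pos_nonneg)

lemma radial_weight_derivative:
  "((\<lambda>s. (1 + s\<^sup>2) powr (- I / 2)) has_real_derivative - (I * s * (1 + s\<^sup>2) powr (- I / 2) / (1 + s\<^sup>2))) (at s)"
proof -
  have "((\<lambda>s. (1 + s\<^sup>2) powr (- I / 2)) has_real_derivative (- I / 2) * (1 + s\<^sup>2) powr (- I / 2 - 1) * (2 * s)) (at s)"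
    using one_plus_sq_pos[of s]
    by (intro DERIV_powr[THEN DERIV_cong] | auto intro!: derivative_eq_intros simp: powr_diff)+
  moreover have "(1 + s\<^sup>2) powr (- I / 2 - 1) = (1 + s\<^sup>2) powr (- I / 2) / (1 + s\<^sup>2)"
    using one_plus_sq_pos[of s] by (simp add: powr_diff)
  moreover have "(- I / 2) * (X / q) * (2 * s) = - (I * s * X / q)" for X q :: real by simp
  ultimately show ?thesis by (simp only:)
qed

text \<open>Let w be (1 + s^2)^(-I/2) h, regarded as a function of the angle \<theta>. Then w' is -
  (1 + s^2)^(-I/2) m, and the system says w'' + I^2 w = 0. \<open>A\<close> and \<open>B\<close> are
  the first integrals w cos (I \<theta>) - (w'/I) sin (I \<theta>) and w sin (I \<theta>) + (w'/I)
  cos (I \<theta>).\<close>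

lemma linear_ode_constants:
  fixes h m :: "real \<Rightarrow> real"
  assumes I: "I > 0" and M: "M > 0"
    and h: "\<And>t. t \<in> {-M<..<M} \<Longrightarrow> (h has_real_derivative (m t + I * t * h t) / (1 + t\<^sup>2)) (at t)"
    and m: "\<And>t. t \<in> {-M<..<M} \<Longrightarrow> (m has_real_derivative - (I * (I * h t - t * ((m t + I * t * h t) / (1 + t\<^sup>2))))) (at t)"
    and s: "s \<in> {-M<..<M}"
  shows "(1 + s\<^sup>2) powr (- I / 2) * h s
     = (h 0 * cos (I * angle 0) + m 0 / I * sin (I * angle 0)) * cos (I * angle s)
      + (h 0 * sin (I * angle 0) - m 0 / I * cos (I * angle 0)) * sin (I * angle s)"
proof -
  define \<rho> where "\<rho> s = (1 + s\<^sup>2) powr (- I / 2)" for s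
  define A where "A t = \<rho> t * (h t * cos (I * angle t) + m t / I * sin (I * angle t))" for t
  define B where "B t = \<rho> t * (h t * sin (I * angle t) - m t / I * cos (I * angle t))" for t
  have d\<rho>: "(\<rho> has_real_derivative - (I * t * \<rho> t / (1 + t\<^sup>2))) (at t)" for t
    unfolding \<rho>_def[abs_def] by (rule radial_weight_derivative)
  have dc: "((\<lambda>t. cos (I * angle t)) has_real_derivative I * sin (I * angle t) / (1 + t\<^sup>2)) (at t)" for t
    by (rule derivative_eq_intros angle_has_derivative refl | simp)+
  have ds: "((\<lambda>t. sin (I * angle t)) has_real_derivative - (I * cos (I * angle t) / (1 + t\<^sup>2))) (at t)" for t
    by (rule derivative_eq_intros angle_has_derivative refl | simp)+
  have AB: "(A has_real_derivative 0) (at t)" "(B has_real_derivative 0) (at t)" if t: "t \<in> {-M<..<M}" for t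
  proof -
    define c sn q where "c = cos (I * angle t)" and "sn = sin (I * angle t)" and "q = 1 + t\<^sup>2"
    have q: "q > 0" using one_plus_sq_pos[of t] by (simp add: q_def)
    define hp where "hp = (m t + I * t * h t) / q"
    have hq: "hp * q = m t + I * t * h t" using q by (simp add: hp_def)
    have dm: "((\<lambda>t. m t / I) has_real_derivative - (I * h t - t * hp)) (at t)"
      using DERIV_cdivide[OF m[OF t], of I] I by (simp add: hp_def q_def)
    have dh: "(h has_real_derivative hp) (at t)" using h[OF t] by (simp add: hp_def q_def)
    have e: "q = 1 + t * t" by (simp add: q_def power2_eq_square)
    have zA: "(- (I * t / q)) * (h t * c + m t / I * sn) + (hp * c + h t * (I * sn / q) + (- (I * h t - t * hp)) * sn + m t / I * (- (I * c / q))) = 0"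
    proof -
      have "((- (I * t / q)) * (h t * c + m t / I * sn) + (hp * c + h t * (I * sn / q) + (- (I * h t - t * hp)) * sn + m t / I * (- (I * c / q)))) * q
        = (- I * t) * (h t * c) - t * m t * sn + (hp * q) * c + h t * I * sn - I * h t * q * sn + t * (hp * q) * sn - m t * c"
        using q I by (simp add: field_simps)
      also have "\<dots> = 0" unfolding hq unfolding e by (simp add: algebra_simps)
      finally show ?thesis using q by simp
    qed
    have zB: "(- (I * t / q)) * (h t * sn - m t / I * c) + (hp * sn + h t * (- (I * c / q)) - ((- (I * h t - t * hp)) * c + m t / I * (I * sn / q))) = 0"
    proof -
      have "((- (I * t / q)) * (h t * sn - m t / I * c) + (hp * sn + h t * (- (I * c / q)) - ((- (I * h t - t * hp)) * c + m t / I * (I * sn / q)))) * q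
        = (- I * t) * (h t * sn) + t * m t * c + (hp * q) * sn - h t * I * c + I * h t * q * c - t * (hp * q) * c - m t * sn"
        using q I by (simp add: field_simps)
      also have "\<dots> = 0" unfolding hq unfolding e by (simp add: algebra_simps)
      finally show ?thesis using q by simp
    qed
    have "(A has_real_derivative (- (I * t * \<rho> t / q)) * (h t * c + m t / I * sn) + ((hp * c + I * sn / q * h t) + ((- (I * h t - t * hp)) * sn + (- (I * c / q)) * (m t / I))) * \<rho> t) (at t)"
      unfolding A_def[abs_def] c_def sn_def q_def
      by (intro DERIV_mult DERIV_add d\<rho> dh dm dc ds)
    moreover have "(- (I * t * \<rho> t / q)) * (h t * c + m t / I * sn) + ((hp * c + I * sn / q * h t) + ((- (I * h t - t * hp)) * sn + (- (I * c / q)) * (m t / I))) * \<rho> t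
       = \<rho> t * ((- (I * t / q)) * (h t * c + m t / I * sn) + (hp * c + h t * (I * sn / q) + (- (I * h t - t * hp)) * sn + m t / I * (- (I * c / q))))"
      by (simp add: algebra_simps)
    ultimately show "(A has_real_derivative 0) (at t)" unfolding zA by simp
    have "(B has_real_derivative (- (I * t * \<rho> t / q)) * (h t * sn - m t / I * c) + ((hp * sn + (- (I * c / q)) * h t) - ((- (I * h t - t * hp)) * c + I * sn / q * (m t / I))) * \<rho> t) (at t)"
      unfolding B_def[abs_def] c_def sn_def q_def
      by (intro DERIV_mult DERIV_diff d\<rho> dh dm dc ds)
    moreover have "(- (I * t * \<rho> t / q)) * (h t * sn - m t / I * c) + ((hp * sn + (- (I * c / q)) * h t) - ((- (I * h t - t * hp)) * c + I * sn / q * (m t / I))) * \<rho> t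
       = \<rho> t * ((- (I * t / q)) * (h t * sn - m t / I * c) + (hp * sn + h t * (- (I * c / q)) - ((- (I * h t - t * hp)) * c + m t / I * (I * sn / q))))"
      by (simp add: algebra_simps)
    ultimately show "(B has_real_derivative 0) (at t)" unfolding zB by simp
  qed
  have const: "F s = F 0" if "\<And>t. t \<in> {-M<..<M} \<Longrightarrow> (F has_real_derivative 0) (at t)" for F
  proof -
    have "\<exists>c. \<forall>x\<in>{-M<..<M}. F x = c"
      by (rule has_field_derivative_zero_constant) (auto intro!: has_field_derivative_at_within that)
    then obtain c where c: "\<forall>x\<in>{-M<..<M}. F x = c" ..
    have "0 \<in> {-M<..<M}" using M by simp
    with c s show ?thesis by metis
  qed
  have "\<rho> s * h s = A s * cos (I * angle s) + B s * sin (I * angle s)"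
  proof -
    have "A s * cos (I * angle s) + B s * sin (I * angle s) = \<rho> s * h s * ((cos (I * angle s))\<^sup>2 + (sin (I * angle s))\<^sup>2)"
    proof -
      have "r * (x * c + k * sn) * c + r * (x * sn - k * c) * sn = r * x * (c\<^sup>2 + sn\<^sup>2)" for r x k c sn :: real
        by algebra
      then show ?thesis unfolding A_def B_def .
    qed
    then show ?thesis by simp
  qed
  moreover have "A s = h 0 * cos (I * angle 0) + m 0 / I * sin (I * angle 0)"
    using const[of A] AB(1) by (simp add: A_def \<rho>_def)
  moreover have "B s = h 0 * sin (I * angle 0) - m 0 / I * cos (I * angle 0)"
    using const[of B] AB(2) by (simp add: B_def \<rho>_def)
  ultimately show ?thesis by (simp add: \<rho>_def)
qed

text \<open>The flux (1 + s^2) p - I s h has a weak derivative, so by the du Bois-Reymond lemma it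
  agrees almost everywhere with a continuous \<open>m\<close>. Then \<open>p\<close> has a
  continuous representative, \<open>h\<close> is C^1, hence so is \<open>m\<close>, and the
  classical system holds on each window.\<close>

lemma weak_ode_solution:
  fixes h p :: "real \<Rightarrow> real"
  assumes I: "I > 0" and hc: "continuous_on UNIV h"
    and pi: "\<And>M::nat. integrable lborel (\<lambda>s. indicator {- real M<..<real M} s * p s)"
    and hp: "\<And>a b. a \<le> b \<Longrightarrow> h b - h a = integral {a..b} p"
    and weak: "\<And>(M::nat) n a b d. 0 < d \<Longrightarrow> - real M < a \<Longrightarrow> a < b \<Longrightarrow> b + d + 1 / real (Suc n) < real M \<Longrightarrow>
      (LINT s|lborel. ((1 + s\<^sup>2) * p s - I * s * h s) * trap' (real (Suc n)) a b d s)
       = (LINT s|lborel. I * (I * h s - s * p s) * trap (real (Suc n)) a b d s)"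
  shows "\<exists>\<alpha> \<beta>. \<forall>s. (1 + s\<^sup>2) powr (- I / 2) * h s = \<alpha> * cos (I * angle s) + \<beta> * sin (I * angle s)"
proof -
  have main: "\<exists>m. (\<forall>t\<in>{- real M<..<real M}. (h has_real_derivative (m t + I * t * h t) / (1 + t\<^sup>2)) (at t)
      \<and> (m has_real_derivative - (I * (I * h t - t * ((m t + I * t * h t) / (1 + t\<^sup>2))))) (at t))" if M: "M > 0" for M :: nat
  proof -
    let ?J = "{- real M<..<real M}" and ?K = "{- real M..real M}"
    define f where "f s = indicator ?J s * ((1 + s\<^sup>2) * p s - I * s * h s)" for s
    define g where "g s = - (indicator ?J s * (I * (I * h s - s * p s)))" for s
    have hcK: "continuous_on ?K h" by (rule continuous_on_subset[OF hc]) simp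
    have bp: "integrable lborel (\<lambda>s. (indicator ?J s * p s) * (indicator ?K s * k s))" if k: "continuous_on ?K k" for k
    proof -
      have "bounded (k ` ?K)" by (intro compact_imp_bounded compact_continuous_image k) simp
      then obtain C where "\<forall>x\<in>?K. \<bar>k x\<bar> \<le> C" by (auto simp: bounded_iff)
      then have C: "\<And>x. x \<in> ?K \<Longrightarrow> \<bar>k x\<bar> \<le> C" by blast
      show ?thesis
      proof (rule integrable_mult_bounded[OF pi])
        show "(\<lambda>s. indicator ?K s * k s) \<in> borel_measurable lborel"
          using borel_measurable_continuous_on_indicator[OF _ k] by simp
        show "\<bar>indicator ?K s * k s\<bar> \<le> \<bar>C\<bar>" for s using C[of s] by (auto simp: indicator_def)
      qed
    qed
    have fi: "integrable lborel f"
    proof -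
      have "f = (\<lambda>s. (indicator ?J s * p s) * (indicator ?K s * (1 + s\<^sup>2)) - indicator ?J s * (I * s * h s))"
        unfolding f_def by (auto simp: indicator_def fun_eq_iff)
      then show ?thesis
        by (simp only:) (intro Bochner_Integration.integrable_diff bp integrable_indicator_times_continuous continuous_intros hcK)
    qed
    have gi: "integrable lborel g"
    proof -
      have "g = (\<lambda>s. (indicator ?J s * p s) * (indicator ?K s * (I * s)) - indicator ?J s * (I * (I * h s)))"
        unfolding g_def by (auto simp: indicator_def fun_eq_iff algebra_simps)
      then show ?thesis
        by (simp only:) (intro Bochner_Integration.integrable_diff bp integrable_indicator_times_continuous continuous_intros hcK)
    qed
    have "\<exists>N\<in>null_sets lborel. \<forall>s t. s < t \<longrightarrow> s \<notin> N \<longrightarrow> t \<notin> N \<longrightarrow> - real M < s \<longrightarrow> t < real M \<longrightarrow> f t - f s = integral {s..t} g"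
    proof (rule du_Bois_Reymond[where l="- real M" and r="real M", OF fi gi], goal_cases)
      case (1 a b d n)
      have out: "trap (real (Suc n)) a b d s = 0" "trap' (real (Suc n)) a b d s = 0" if "s \<notin> ?J" for s
        using trap_outside[of "real (Suc n)" d a b s] that 1 by auto
      have "(LINT s|lborel. f s * trap' (real (Suc n)) a b d s) = (LINT s|lborel. ((1 + s\<^sup>2) * p s - I * s * h s) * trap' (real (Suc n)) a b d s)"
        by (rule Bochner_Integration.integral_cong[OF refl]) (use out(2) in \<open>auto simp: f_def indicator_def\<close>)
      also have "\<dots> = (LINT s|lborel. I * (I * h s - s * p s) * trap (real (Suc n)) a b d s)"
        by (rule weak[of d M a b n]) (use 1 in auto)
      also have "\<dots> = (LINT s|lborel. - (g s * trap (real (Suc n)) a b d s))"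
        by (rule Bochner_Integration.integral_cong[OF refl]) (use out(1) in \<open>auto simp: g_def indicator_def\<close>)
      finally show ?case by simp
    next
      case (2 N)
      then show ?case by (intro bexI[of _ N] allI impI) auto
    qed
    then obtain N where N: "N \<in> null_sets lborel"
      "\<And>s t. s < t \<Longrightarrow> s \<notin> N \<Longrightarrow> t \<notin> N \<Longrightarrow> - real M < s \<Longrightarrow> t < real M \<Longrightarrow> f t - f s = integral {s..t} g" by blast
    have go: "g integrable_on {a..b}" for a b by (rule integrable_lborel_imp_integrable_on[OF gi]) simp
    have "\<not> ?J \<subseteq> N"
    proof
      assume "?J \<subseteq> N"
      then have "?J \<in> null_sets lborel" using null_sets_subset[OF N(1)] by simp
      then show False using M by (simp add: null_sets_def)
    qed
    then obtain s0 where s0: "s0 \<in> ?J" "s0 \<notin> N" by blast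
    \<comment> \<open>Off the null set the flux is a constant plus an integral; the base point s0,
      chosen off that set, fixes the constant.\<close>
    define m where "m t = (f s0 - integral {- real M..s0} g) + integral {- real M..t} g" for t
    have fm: "f t = m t" if t: "t \<in> ?J" "t \<notin> N" for t
    proof -
      have cmb: "integral {- real M..a} g + integral {a..b} g = integral {- real M..b} g" if "a \<in> ?J" "a \<le> b" for a b
        by (rule Henstock_Kurzweil_Integration.integral_combine[OF _ _ go]) (use that in auto)
      consider "t < s0" | "t = s0" | "t > s0" by linarith
      then show ?thesis
      proof cases
        case 1
        then show ?thesis using N(2)[of t s0] cmb[of t s0] t s0 by (auto simp: m_def)
      next
        case 3
        then show ?thesis using N(2)[of s0 t] cmb[of s0 t] t s0 by (auto simp: m_def)
      qed (simp add: m_def)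
    qed
    have mc: "continuous_on ?K m" unfolding m_def by (intro continuous_intros indefinite_integral_continuous_1 go)
    \<comment> \<open>The definition of the flux, solved for the derivative of \<open>h\<close>; it
      is continuous because \<open>m\<close> and \<open>h\<close> are.\<close>
    define p' where "p' t = (m t + I * t * h t) / (1 + t\<^sup>2)" for t
    have p'c: "continuous_on ?K p'" unfolding p'_def
      by (intro continuous_intros mc hcK) (use one_plus_sq_pos in \<open>auto simp: less_imp_neq[symmetric]\<close>)
    have aeN: "AE t in lborel. t \<notin> N" by (rule AE_not_in[OF N(1)])
    have pp: "AE t in lborel. - real M < t \<longrightarrow> t < real M \<longrightarrow> p' t = p t"
      using aeN
    proof eventually_elim
      case (elim t)
      show ?case
      proof (intro impI)
        assume "- real M < t" "t < real M"
        then have "(1 + t\<^sup>2) * p t - I * t * h t = m t" using fm[of t] elim by (simp add: f_def)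
        then show "p' t = p t" using one_plus_sq_pos[of t] by (simp add: p'_def field_simps)
      qed
    qed
    have p'io: "p' integrable_on {a..b}" if "- real M \<le> a" "b \<le> real M" for a b
      by (rule integrable_continuous_interval) (rule continuous_on_subset[OF p'c], use that in auto)
    have hp': "h b - h a = integral {a..b} p'" if ab: "- real M \<le> a" "a \<le> b" "b \<le> real M" for a b
    proof -
      have "AE t in lborel. a < t \<longrightarrow> t < b \<longrightarrow> p' t = p t" using pp by eventually_elim (use ab in auto)
      from integral_cong_AE_Icc(1)[OF p'io[OF ab(1,3)] this] show ?thesis using hp[OF ab(2)] by simp
    qed
    define g' where "g' t = - (I * (I * h t - t * p' t))" for t
    have g'c: "continuous_on ?K g'" unfolding g'_def by (intro continuous_intros hcK p'c)
    have g'io: "g' integrable_on {a..b}" if "- real M \<le> a" "b \<le> real M" for a b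
      by (rule integrable_continuous_interval) (rule continuous_on_subset[OF g'c], use that in auto)
    have mg: "m t = (f s0 - integral {- real M..s0} g) + integral {- real M..t} g'" if "t \<in> ?K" for t
    proof -
      have "AE x in lborel. - real M < x \<longrightarrow> x < t \<longrightarrow> g' x = g x"
        using pp by eventually_elim (use that in \<open>auto simp: g'_def g_def\<close>)
      from integral_cong_AE_Icc(1)[OF g'io this] show ?thesis using that by (simp add: m_def)
    qed
    have der: "(F has_real_derivative k t) (at t)"
      if F: "\<And>t. t \<in> ?K \<Longrightarrow> F t = C + integral {- real M..t} k" and k: "continuous_on ?K k" and t: "t \<in> ?J" for F k C t
    proof -
      have "((\<lambda>x. integral {- real M..x} k) has_real_derivative k t) (at t within ?K)"
        by (rule integral_has_real_derivative[OF k]) (use t in auto)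
      then have "((\<lambda>x. C + integral {- real M..x} k) has_real_derivative k t) (at t within ?K)"
        by (auto intro!: derivative_eq_intros)
      then have "((\<lambda>x. C + integral {- real M..x} k) has_real_derivative k t) (at t within ?J)"
        by (rule DERIV_subset) auto
      then have "((\<lambda>x. C + integral {- real M..x} k) has_real_derivative k t) (at t)"
        by (simp only: at_within_open[OF t open_greaterThanLessThan])
      then show ?thesis
        by (rule has_field_derivative_transform_within_open[OF _ open_greaterThanLessThan t]) (rule F[symmetric], simp)
    qed
    show ?thesis
    proof (intro exI[of _ m] ballI conjI)
      fix t assume t: "t \<in> ?J"
      have hF: "h r = h (- real M) + integral {- real M..r} p'" if "r \<in> ?K" for r
      proof -
        have "h r - h (- real M) = integral {- real M..r} p'" by (rule hp') (use that in auto)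
        then show ?thesis by linarith
      qed
      have "(h has_real_derivative p' t) (at t)" by (rule der[OF hF p'c t])
      then show "(h has_real_derivative (m t + I * t * h t) / (1 + t\<^sup>2)) (at t)" by (simp add: p'_def)
      have "(m has_real_derivative g' t) (at t)" by (rule der[OF mg g'c t])
      then show "(m has_real_derivative - (I * (I * h t - t * ((m t + I * t * h t) / (1 + t\<^sup>2))))) (at t)" by (simp add: g'_def p'_def)
    qed
  qed
  \<comment> \<open>The constants must be the same for all windows. On each of them m 0 equals the
    derivative of \<open>h\<close> at 0, which is intrinsic.\<close>
  define D where "D = deriv h 0"
  define \<alpha> where "\<alpha> = h 0 * cos (I * angle 0) + D / I * sin (I * angle 0)"
  define \<beta> where "\<beta> = h 0 * sin (I * angle 0) - D / I * cos (I * angle 0)"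
  have "(1 + s\<^sup>2) powr (- I / 2) * h s = \<alpha> * cos (I * angle s) + \<beta> * sin (I * angle s)" for s
  proof -
    obtain M :: nat where M: "\<bar>s\<bar> < real M" using reals_Archimedean2 by blast
    have M0': "real M > 0" using M by linarith
    then have M0: "M > 0" "real M > 0" by auto
    obtain m where m: "\<And>t. t \<in> {- real M<..<real M} \<Longrightarrow> (h has_real_derivative (m t + I * t * h t) / (1 + t\<^sup>2)) (at t)"
      "\<And>t. t \<in> {- real M<..<real M} \<Longrightarrow> (m has_real_derivative - (I * (I * h t - t * ((m t + I * t * h t) / (1 + t\<^sup>2))))) (at t)"
      using main[OF M0(1)] by blast
    have "m 0 = D" unfolding D_def using DERIV_imp_deriv[OF m(1)[of 0]] M0 by simp
    with linear_ode_constants[OF I M0(2) m, of s] M show ?thesis by (simp add: \<alpha>_def \<beta>_def abs_less_iff)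
  qed
  then show ?thesis by blast
qed

section \<open>From the plane to the slope variable\<close>

lemma integral_scale:
  fixes f :: "real \<Rightarrow> real"
  assumes f: "integrable lborel f" and y: "y > 0"
  shows "integrable lborel (\<lambda>s. f (s * y))" "integral {a * y..b * y} f = y * integral {a..b} (\<lambda>s. f (s * y))"
proof -
  show i: "integrable lborel (\<lambda>s. f (s * y))"
    using lborel_integrable_real_affine[OF f, of y 0] y by (simp add: mult.commute)
  have "integral {a * y..b * y} f = (LINT x|lborel. indicator {a * y<..b * y} x * f x)"
    by (rule lborel_integral_Ioc_eq_integral[OF f, symmetric])
  also have "\<dots> = \<bar>y\<bar> *\<^sub>R (LINT x|lborel. indicator {a * y<..b * y} (0 + y * x) * f (0 + y * x))"
    by (rule lborel_integral_real_affine) (use y in simp)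
  also have "(LINT x|lborel. indicator {a * y<..b * y} (0 + y * x) * f (0 + y * x)) = (LINT x|lborel. indicator {a<..b} x * f (x * y))"
    by (rule Bochner_Integration.integral_cong[OF refl]) (use y in \<open>auto simp: indicator_def mult.commute\<close>)
  also have "\<dots> = integral {a..b} (\<lambda>s. f (s * y))" by (rule lborel_integral_Ioc_eq_integral[OF i])
  finally show "integral {a * y..b * y} f = y * integral {a..b} (\<lambda>s. f (s * y))" using y by simp
qed

text \<open>A good line at height below 1 / (M + 2) shows all slopes in [-M, M]. \<open>p\<close> is
  defined once, as a limit of difference quotients, so that the densities found on different windows
  agree with it almost everywhere.\<close>

lemma profile_absolutely_continuous:
  fixes u :: "real^2 \<Rightarrow> (real^'n) multiset"
  assumes cs: "csel Q I u H" and b: "badm Q u 1 \<psi>" and i: "i < Q"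
  obtains p where "p \<in> borel_measurable borel" "\<And>M::nat. integrable lborel (\<lambda>s. indicator {- real M<..<real M} s * p s)"
    "AE s in lborel. ((\<lambda>s. H i s $ c) has_real_derivative p s) (at s)"
    "\<And>a b. a \<le> b \<Longrightarrow> H i b $ c - H i a $ c = integral {a..b} p"
proof -
  define h where "h s = H i s $ c" for s
  have hc: "continuous_on UNIV h" unfolding h_def using cs i by (intro continuous_intros) (auto simp: csel_def)
  have [measurable]: "h \<in> borel_measurable borel" by (rule borel_measurable_continuous_onI[OF hc])
  define p where "p s = lim (\<lambda>n. (h (s + 1 / real (Suc n)) - h s) * real (Suc n))" for s
  have pm[measurable]: "p \<in> borel_measurable borel" unfolding p_def by (rule borel_measurable_lim_metric) measurable
  have plim: "p s = D" if "(h has_real_derivative D) (at s)" for s D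
  proof -
    have "((\<lambda>k. (h (s + k) - h s) / k) \<longlongrightarrow> D) (at 0)" using that by (simp add: DERIV_def)
    moreover have "filterlim (\<lambda>n. 1 / real (Suc n)) (at 0) sequentially"
      using LIMSEQ_Suc[OF lim_const_over_n[of "1::real"]] by (auto simp: filterlim_at)
    ultimately have "(\<lambda>n. (h (s + 1 / real (Suc n)) - h s) / (1 / real (Suc n))) \<longlonglongrightarrow> D" by (rule filterlim_compose)
    then show ?thesis unfolding p_def by (intro limI) simp
  qed
  have \<psi>: "\<And>x. 0 \<le> \<psi> x" "integrable lborel \<psi>" using b by (auto simp: badm_def)
  have loc: "\<exists>q. integrable lborel q \<and> (\<forall>s t. - real M \<le> s \<longrightarrow> s \<le> t \<longrightarrow> t \<le> real M \<longrightarrow> h t - h s = integral {s..t} q) \<and>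
     (AE s in lborel. - real M < s \<longrightarrow> s < real M \<longrightarrow> (h has_real_derivative q s) (at s))" for M :: nat
  proof -
    have lb: "AE y in lborel. \<forall>s t. s < t \<longrightarrow> pt 1 s y \<in> Omega \<longrightarrow> pt 1 t y \<in> Omega \<longrightarrow>
       \<bar>shc I H i c (pt 1 t y) - shc I H i c (pt 1 s y)\<bar> \<le> integral {s..t} (\<lambda>\<tau>. \<psi> (pt 1 \<tau> y))"
      using csel_line_bounded[OF cs b i, of c] by (simp add: line_bounded_def)
    have ae: "AE y in lborel. integrable lborel (\<lambda>t. \<psi> (pt 1 t y)) \<and> (\<forall>s t. s < t \<longrightarrow> pt 1 s y \<in> Omega \<longrightarrow> pt 1 t y \<in> Omega \<longrightarrow>
       \<bar>shc I H i c (pt 1 t y) - shc I H i c (pt 1 s y)\<bar> \<le> integral {s..t} (\<lambda>\<tau>. \<psi> (pt 1 \<tau> y)))"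
      using lb integrable_lborel_pt(1)[OF \<psi>(2), of 1] by eventually_elim blast
    obtain y where y: "0 < y" "y < 1 / (real M + 2)" and yi: "integrable lborel (\<lambda>t. \<psi> (pt 1 t y))"
      and yl: "\<And>s t. s < t \<Longrightarrow> pt 1 s y \<in> Omega \<Longrightarrow> pt 1 t y \<in> Omega \<Longrightarrow>
       \<bar>shc I H i c (pt 1 t y) - shc I H i c (pt 1 s y)\<bar> \<le> integral {s..t} (\<lambda>\<tau>. \<psi> (pt 1 \<tau> y))"
      by (rule AE_lborel_ex_interval[OF ae, of 0 "1 / (real M + 2)"]) auto
    have y2: "y * ((real M + 1) + 1) \<le> 1" using y by (simp add: field_simps)
    define w where "w s = y powr (- I) * (y * \<psi> (pt 1 (s * y) y))" for s
    have wi: "integrable lborel w" unfolding w_def[abs_def] using integral_scale(1)[OF yi y(1)] by simp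
    have w0: "0 \<le> w s" for s unfolding w_def using y \<psi> by simp
    have sh: "shc I H i c (pt 1 (s * y) y) = y powr I * h s" for s
      using y by (simp add: shc_def sheet_def h_def pt_def)
    have "\<exists>q. integrable lborel q \<and> (\<forall>s t. - real M \<le> s \<longrightarrow> s \<le> t \<longrightarrow> t \<le> real M \<longrightarrow> h t - h s = integral {s..t} q) \<and>
      (AE s in lborel. - real M < s \<longrightarrow> s < real M \<longrightarrow> (h has_real_derivative q s) (at s) \<and> \<bar>q s\<bar> \<le> w s)"
    proof (rule absolutely_continuous_interval[OF _ wi w0])
      fix s t assume st: "- real M \<le> s" "s < t" "t \<le> real M"
      have O: "pt 1 (s * y) y \<in> Omega" "pt 1 (t * y) y \<in> Omega"
        by (rule pt_slope_Omega[OF y(1) y2]; use st in auto)+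
      have "y powr I * \<bar>h t - h s\<bar> = \<bar>shc I H i c (pt 1 (t * y) y) - shc I H i c (pt 1 (s * y) y)\<bar>"
        unfolding sh by (simp flip: right_diff_distrib add: abs_mult)
      also have "\<dots> \<le> integral {s * y..t * y} (\<lambda>\<tau>. \<psi> (pt 1 \<tau> y))" using yl[OF _ O] st y by simp
      also have "\<dots> = y * integral {s..t} (\<lambda>r. \<psi> (pt 1 (r * y) y))" by (rule integral_scale(2)[OF yi y(1)])
      finally have "y powr (- I) * (y powr I * \<bar>h t - h s\<bar>) \<le> y powr (- I) * (y * integral {s..t} (\<lambda>r. \<psi> (pt 1 (r * y) y)))"
        by (intro mult_left_mono) auto
      moreover have "y powr (- I) * (y powr I * \<bar>h t - h s\<bar>) = \<bar>h t - h s\<bar>" using y by (simp flip: powr_add mult.assoc)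
      moreover have "integral {s..t} w = y powr (- I) * (y * integral {s..t} (\<lambda>r. \<psi> (pt 1 (r * y) y)))" unfolding w_def by simp
      ultimately show "\<bar>h t - h s\<bar> \<le> integral {s..t} w" by simp
    qed simp
    then obtain q where q: "integrable lborel q" "\<forall>s t. - real M \<le> s \<longrightarrow> s \<le> t \<longrightarrow> t \<le> real M \<longrightarrow> h t - h s = integral {s..t} q"
      "AE s in lborel. - real M < s \<longrightarrow> s < real M \<longrightarrow> (h has_real_derivative q s) (at s) \<and> \<bar>q s\<bar> \<le> w s" by blast
    moreover have "AE s in lborel. - real M < s \<longrightarrow> s < real M \<longrightarrow> (h has_real_derivative q s) (at s)"
      using q(3) by eventually_elim blast
    ultimately show ?thesis by blast
  qed
  have pq: "AE s in lborel. - real M < s \<longrightarrow> s < real M \<longrightarrow> q s = p s"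
    if "AE s in lborel. - real M < s \<longrightarrow> s < real M \<longrightarrow> (h has_real_derivative q s) (at s)" for q and M :: nat
    using that by eventually_elim (use plim in auto)
  have 1: "integrable lborel (\<lambda>s. indicator {- real M<..<real M} s * p s)" for M :: nat
  proof -
    obtain q where q: "integrable lborel q" "AE s in lborel. - real M < s \<longrightarrow> s < real M \<longrightarrow> (h has_real_derivative q s) (at s)"
      using loc[of M] by blast
    have [measurable]: "q \<in> borel_measurable borel" using q(1) borel_measurable_integrable by force
    have qi: "integrable lborel (\<lambda>s. indicator {- real M<..<real M} s * q s)"
      using integrable_mult_indicator[OF _ q(1), of "{- real M<..<real M}"] by simp
    have "AE s in lborel. indicator {- real M<..<real M} s * q s = indicator {- real M<..<real M} s * p s"
      using pq[OF q(2)] by eventually_elim (auto simp: indicator_def)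
    then show ?thesis using integrable_cong_AE[of "\<lambda>s. indicator {- real M<..<real M} s * q s" lborel "\<lambda>s. indicator {- real M<..<real M} s * p s"] qi by simp
  qed
  have 2: "AE s in lborel. (h has_real_derivative p s) (at s)"
  proof -
    have "AE s in lborel. - real M < s \<longrightarrow> s < real M \<longrightarrow> (h has_real_derivative p s) (at s)" for M :: nat
    proof -
      obtain q where q: "AE s in lborel. - real M < s \<longrightarrow> s < real M \<longrightarrow> (h has_real_derivative q s) (at s)" using loc[of M] by blast
      then show ?thesis by eventually_elim (use plim in auto)
    qed
    then have "AE s in lborel. \<forall>M::nat. - real M < s \<longrightarrow> s < real M \<longrightarrow> (h has_real_derivative p s) (at s)"
      unfolding AE_all_countable by blast
    then show ?thesis
    proof eventually_elim
      case (elim s)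
      obtain M :: nat where "\<bar>s\<bar> < real M" using reals_Archimedean2 by blast
      then show ?case using elim[rule_format, of M] by auto
    qed
  qed
  have 3: "h b - h a = integral {a..b} p" if ab: "a \<le> b" for a b
  proof -
    obtain M :: nat where M: "max \<bar>a\<bar> \<bar>b\<bar> < real M" using reals_Archimedean2 by blast
    obtain q where q: "integrable lborel q" "\<forall>s t. - real M \<le> s \<longrightarrow> s \<le> t \<longrightarrow> t \<le> real M \<longrightarrow> h t - h s = integral {s..t} q"
      "AE s in lborel. - real M < s \<longrightarrow> s < real M \<longrightarrow> (h has_real_derivative q s) (at s)" using loc[of M] by blast
    have "AE s in lborel. a < s \<longrightarrow> s < b \<longrightarrow> q s = p s" using pq[OF q(3)] by eventually_elim (use M in auto)
    from integral_cong_AE_Icc(1)[OF integrable_lborel_imp_integrable_on[OF q(1)] this]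
    show ?thesis using q(2)[rule_format, of a b] M ab by auto
  qed
  show ?thesis by (rule that[OF pm 1]) (use 2 3 in \<open>simp_all add: h_def[abs_def]\<close>)
qed

lemma derivative_zero_outside:
  assumes "\<And>x. (\<eta> has_real_derivative \<eta>' x) (at x)" "\<And>x. x \<notin> {l..r} \<Longrightarrow> \<eta> x = 0" "x \<notin> {l..r}"
  shows "\<eta>' x = (0::real)"
proof -
  have "((\<lambda>x. 0) has_real_derivative 0) (at x)" by simp
  then have "(\<eta> has_real_derivative 0) (at x)"
    by (rule has_field_derivative_transform_within_open[of _ _ _ "- {l..r}"]) (use assms in auto)
  then show ?thesis using assms(1) DERIV_unique by blast
qed

text \<open>Test functions adapted to slope and height. The condition r (M + 2) \<le> 1 keeps the
  truncated cone in \<open>Omega\<close>, and l > 0 keeps it off the line x_2 = 0, where the slope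
  degenerates and the function is 0.\<close>

lemma slope_C1c:
  fixes \<zeta> \<eta> :: "real \<Rightarrow> real"
  assumes z: "\<And>x. (\<zeta> has_real_derivative \<zeta>' x) (at x)" "continuous_on UNIV \<zeta>'" "\<And>x. x \<notin> {-M..M} \<Longrightarrow> \<zeta> x = 0"
    and e: "\<And>x. (\<eta> has_real_derivative \<eta>' x) (at x)" "continuous_on UNIV \<eta>'" "\<And>x. x \<notin> {l..r} \<Longrightarrow> \<eta> x = 0"
    and lr: "0 < l" "r * (M + 2) \<le> 1" and M: "M \<ge> 0"
  shows "(\<lambda>x. \<zeta> (x $ 1 / x $ 2) * \<eta> (x $ 2)) \<in> C1c Omega"
    "pd 1 (\<lambda>x. \<zeta> (x $ 1 / x $ 2) * \<eta> (x $ 2)) x = \<zeta>' (x $ 1 / x $ 2) * \<eta> (x $ 2) / x $ 2"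
    "pd 2 (\<lambda>x. \<zeta> (x $ 1 / x $ 2) * \<eta> (x $ 2)) x = \<zeta> (x $ 1 / x $ 2) * \<eta>' (x $ 2) - x $ 1 / x $ 2 * \<zeta>' (x $ 1 / x $ 2) * \<eta> (x $ 2) / x $ 2"
proof -
  let ?\<phi> = "\<lambda>x::real^2. \<zeta> (x $ 1 / x $ 2) * \<eta> (x $ 2)"
  define A where "A j x = (if j = 1 then \<zeta>' (x $ 1 / x $ 2) * \<eta> (x $ 2) / x $ 2
     else \<zeta> (x $ 1 / x $ 2) * \<eta>' (x $ 2) - x $ 1 / x $ 2 * \<zeta>' (x $ 1 / x $ 2) * \<eta> (x $ 2) / x $ 2)" for j :: 2 and x :: "real^2"
  have cz: "continuous_on UNIV \<zeta>" and ce: "continuous_on UNIV \<eta>"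
    using DERIV_isCont[OF z(1)] DERIV_isCont[OF e(1)] by (auto simp: continuous_on_eq_continuous_at)
  have e0: "\<eta> y = 0" "\<eta>' y = 0" if "y < l" for y
    using that by (auto intro!: e(3) derivative_zero_outside[where l=l and r=r, OF e(1)])
  have A0: "A j x = 0" "?\<phi> x = 0" if "x $ 2 < l" for j x using e0[OF that] by (auto simp: A_def)
  have D: "(?\<phi> has_derivative (\<lambda>v. \<Sum>j\<in>UNIV. v $ j * A j x)) (at x)" for x
  proof (cases "x $ 2 > 0")
    case True
    have pr: "((\<lambda>x::real^2. x $ k) has_derivative (\<lambda>v. v $ k)) (at x)" for k
      by (rule bounded_linear.has_derivative[OF bounded_linear_vec_nth]) simp
    have q: "((\<lambda>x::real^2. x $ 1 / x $ 2) has_derivative (\<lambda>v. (v $ 1 * x $ 2 - x $ 1 * v $ 2) / (x $ 2 * x $ 2))) (at x)"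
      using has_derivative_divide'[OF pr[of 1] pr[of 2]] True by simp
    have 1: "((\<lambda>x. \<zeta> (x $ 1 / x $ 2)) has_derivative (\<lambda>v. \<zeta>' (x $ 1 / x $ 2) * ((v $ 1 * x $ 2 - x $ 1 * v $ 2) / (x $ 2 * x $ 2)))) (at x)"
      using diff_chain_at[OF q z(1)[THEN has_field_derivative_imp_has_derivative]] by (simp add: o_def)
    have 2: "((\<lambda>x. \<eta> (x $ 2)) has_derivative (\<lambda>v. \<eta>' (x $ 2) * v $ 2)) (at x)"
      using diff_chain_at[OF pr e(1)[THEN has_field_derivative_imp_has_derivative]] by (simp add: o_def)
    show ?thesis
    proof (rule has_derivative_eq_rhs[OF has_derivative_mult[OF 1 2]], rule ext)
      fix v :: "real^2"
      have "z * (e' * v2) + z' * ((v1 * y - x1 * v2) / (y * y)) * n = v1 * (z' * n / y) + v2 * (z * e' - x1 / y * z' * n / y)"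
        if "y > 0" for z z' e' n v1 v2 x1 y :: real using that by (simp add: field_simps)
      from this[OF True] show "\<zeta> (x $ 1 / x $ 2) * (\<eta>' (x $ 2) * v $ 2) + \<zeta>' (x $ 1 / x $ 2) * ((v $ 1 * x $ 2 - x $ 1 * v $ 2) / (x $ 2 * x $ 2)) * \<eta> (x $ 2) = (\<Sum>j\<in>UNIV. v $ j * A j x)"
        by (simp add: UNIV_2 A_def)
    qed
  next
    case False
    have "((\<lambda>x::real^2. 0) has_derivative (\<lambda>v. 0)) (at x)" by simp
    then have "(?\<phi> has_derivative (\<lambda>v. 0)) (at x)"
      by (rule has_derivative_transform_within_open[of _ _ _ _ "{x. x $ 2 < l}"])
        (use False lr A0 in \<open>auto intro!: open_Collect_less continuous_intros\<close>)
    then show ?thesis using A0(1)[of x] False lr by simp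
  qed
  have c: "continuous_on UNIV (A j)" for j
  proof -
    have "continuous_on ({x. x $ 2 > 0} \<union> {x. x $ 2 < l}) (A j)"
    proof (rule continuous_on_open_Un)
      show "open {x::real^2. x $ 2 > 0}" "open {x::real^2. x $ 2 < l}" by (auto intro!: open_Collect_less continuous_intros)
      have cq: "continuous_on {x. x $ 2 > 0} (\<lambda>x::real^2. f (x $ 1 / x $ 2))" "continuous_on {x. x $ 2 > 0} (\<lambda>x::real^2. f (x $ 2))"
        if "continuous_on UNIV f" for f :: "real \<Rightarrow> real"
        by (auto intro!: continuous_on_compose2[OF that] continuous_intros)
      show "continuous_on {x. x $ 2 > 0} (A j)"
        unfolding A_def by (cases "j = 1") (auto intro!: continuous_intros cq z e cz ce)
      have "continuous_on {x::real^2. x $ 2 < l} (\<lambda>x. 0::real)" by simp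
      then show "continuous_on {x. x $ 2 < l} (A j)" by (rule continuous_on_eq) (use A0 in auto)
    qed
    moreover have "{x::real^2. x $ 2 > 0} \<union> {x. x $ 2 < l} = UNIV" using lr(1) by auto
    ultimately show ?thesis by simp
  qed
  define K where "K = (\<lambda>(s,y). pt 1 (s * y) y) ` ({-M..M} \<times> {l..r})"
  have K: "compact K" unfolding K_def case_prod_unfold
    by (intro compact_continuous_image compact_Times continuous_intros) auto
  have KO: "K \<subseteq> Omega"
  proof -
    have "pt 1 (s * y) y \<in> Omega" if "s \<in> {-M..M}" "y \<in> {l..r}" for s y
    proof (rule pt_slope_Omega[of y "M + 1"])
      show "0 < y" using that lr by auto
      have "y * (M + 2) \<le> r * (M + 2)" using that M by (intro mult_right_mono) auto
      then show "y * ((M + 1) + 1) \<le> 1" using lr by (simp add: algebra_simps)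
      show "\<bar>s\<bar> < M + 1" using that by auto
    qed
    then show ?thesis by (auto simp: K_def)
  qed
  have zK: "?\<phi> x = 0" if "x \<notin> K" for x
  proof (rule ccontr)
    assume n: "?\<phi> x \<noteq> 0"
    then have "x $ 2 \<in> {l..r}" "x $ 1 / x $ 2 \<in> {-M..M}" using e(3) z(3) by force+
    then have "(\<lambda>(s,y). pt 1 (s * y) y) (x $ 1 / x $ 2, x $ 2) \<in> K" unfolding K_def by blast
    moreover have "x $ 2 > 0" using \<open>x $ 2 \<in> {l..r}\<close> lr by auto
    ultimately have "pt 1 (x $ 1) (x $ 2) \<in> K" by simp
    moreover have "pt 1 (x $ 1) (x $ 2) = x" by (auto simp: vec_eq_iff pt_def forall_2)
    ultimately show False using that by simp
  qed
  show "?\<phi> \<in> C1c Omega" by (rule C1cI(1)[OF D c K KO zK])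
  show "pd 1 ?\<phi> x = \<zeta>' (x $ 1 / x $ 2) * \<eta> (x $ 2) / x $ 2"
    "pd 2 ?\<phi> x = \<zeta> (x $ 1 / x $ 2) * \<eta>' (x $ 2) - x $ 1 / x $ 2 * \<zeta>' (x $ 1 / x $ 2) * \<eta> (x $ 2) / x $ 2"
    using C1cI(2)[OF D c K KO zK, of 1 x] C1cI(2)[OF D c K KO zK, of 2 x] by (simp_all add: A_def)
qed

text \<open>The chain rule at points whose slope is a point of differentiability of the profile; by
  \<open>AE_slope\<close> this covers almost every point.\<close>

lemma dsh_sheet:
  fixes H :: "nat \<Rightarrow> real \<Rightarrow> real^'n"
  assumes der: "((\<lambda>s. H i s $ c) has_real_derivative D) (at (x $ 1 / x $ 2))" and x: "x \<in> Omega"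
  shows "dsh 1 I H i c x = x $ 2 powr (I - 1) * D"
    "dsh 2 I H i c x = x $ 2 powr (I - 1) * (I * H i (x $ 1 / x $ 2) $ c - x $ 1 / x $ 2 * D)"
proof -
  let ?F = "\<lambda>x. indicator Omega x * shc I H i c x"
  have y: "x $ 2 > 0" using x by (simp add: Omega_iff)
  have op: "open {\<tau>. pt j \<tau> z \<in> Omega}" for j z
    using open_vimage[OF Omega_open, of "\<lambda>\<tau>. pt j \<tau> z"] by (simp add: vimage_def continuous_on_pt continuous_on_const continuous_on_id)
  have line: "((\<lambda>\<tau>. ?F (pt j \<tau> z)) has_real_derivative E) (at t)"
    if "((\<lambda>\<tau>. shc I H i c (pt j \<tau> z)) has_real_derivative E) (at t)" "pt j t z \<in> Omega" for j z t E
    by (rule has_field_derivative_transform_within_open[OF that(1) op[of j z]]) (use that(2) in auto)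
  show "dsh 1 I H i c x = x $ 2 powr (I - 1) * D"
  proof -
    have e: "pt 1 (x $ 1) (x $ 2) = x" by (auto simp: vec_eq_iff pt_def forall_2)
    have "((\<lambda>\<tau>. H i (\<tau> / x $ 2) $ c) has_real_derivative D * (1 / x $ 2)) (at (x $ 1))"
      by (rule DERIV_chain2[where f="\<lambda>s. H i s $ c" and g="\<lambda>\<tau>. \<tau> / x $ 2" and x="x $ 1", OF der])
        (use y in \<open>auto intro!: derivative_eq_intros\<close>)
    then have "((\<lambda>\<tau>. x $ 2 powr I * H i (\<tau> / x $ 2) $ c) has_real_derivative x $ 2 powr I * (D * (1 / x $ 2))) (at (x $ 1))"
      by (rule DERIV_cmult)
    then have "((\<lambda>\<tau>. shc I H i c (pt 1 \<tau> (x $ 2))) has_real_derivative x $ 2 powr (I - 1) * D) (at (x $ 1))"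
      using y by (simp add: shc_def sheet_def pt_def powr_diff)
    from ldq_tendsto(2)[OF line[OF this]] show ?thesis using x unfolding dsh_def e by simp
  qed
  show "dsh 2 I H i c x = x $ 2 powr (I - 1) * (I * H i (x $ 1 / x $ 2) $ c - x $ 1 / x $ 2 * D)"
  proof -
    have e: "pt 2 (x $ 2) (x $ 1) = x" by (auto simp: vec_eq_iff pt_def forall_2)
    have 1: "((\<lambda>\<tau>. H i (x $ 1 / \<tau>) $ c) has_real_derivative D * (- (x $ 1 / (x $ 2)\<^sup>2))) (at (x $ 2))"
      by (rule DERIV_chain2[where f="\<lambda>s. H i s $ c" and g="\<lambda>\<tau>. x $ 1 / \<tau>" and x="x $ 2", OF der])
        (use y in \<open>auto intro!: derivative_eq_intros simp: power2_eq_square\<close>)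
    have 2: "((\<lambda>\<tau>. \<tau> powr I) has_real_derivative I * x $ 2 powr (I - 1)) (at (x $ 2))"
      by (rule has_real_derivative_powr[OF y])
    have "((\<lambda>\<tau>. \<tau> powr I * H i (x $ 1 / \<tau>) $ c) has_real_derivative
       (I * x $ 2 powr (I - 1)) * H i (x $ 1 / x $ 2) $ c + (D * (- (x $ 1 / (x $ 2)\<^sup>2))) * x $ 2 powr I) (at (x $ 2))"
      by (rule DERIV_mult[OF 2 1])
    moreover have "(I * x $ 2 powr (I - 1)) * H i (x $ 1 / x $ 2) $ c + (D * (- (x $ 1 / (x $ 2)\<^sup>2))) * x $ 2 powr I
      = x $ 2 powr (I - 1) * (I * H i (x $ 1 / x $ 2) $ c - x $ 1 / x $ 2 * D)"
    proof -
      have p: "x $ 2 powr I = x $ 2 powr (I - 1) * x $ 2" using y by (simp add: powr_diff)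
      have "(I * k) * h + (D * (- (a / y\<^sup>2))) * (k * y) = k * (I * h - a / y * D)" if "y > 0" for k h a y :: real
        using that by (simp add: field_simps power2_eq_square)
      from this[OF y] show ?thesis unfolding p .
    qed
    ultimately have "((\<lambda>\<tau>. shc I H i c (pt 2 \<tau> (x $ 1))) has_real_derivative x $ 2 powr (I - 1) * (I * H i (x $ 1 / x $ 2) $ c - x $ 1 / x $ 2 * D)) (at (x $ 2))"
      by (simp add: shc_def sheet_def pt_def)
    from ldq_tendsto(2)[OF line[OF this]] show ?thesis using x unfolding dsh_def e by simp
  qed
qed

lemma lborel_integral_slope:
  fixes G :: "real \<Rightarrow> real" assumes "y > 0"
  shows "(LINT t|lborel. G (t / y)) = y * (LINT s|lborel. G s)"
proof -
  have "(LINT s|lborel. G s) = \<bar>1 / y\<bar> *\<^sub>R (LINT t|lborel. G (0 + (1 / y) * t))"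
    by (rule lborel_integral_real_affine) (use assms in simp)
  then show ?thesis using assms by simp
qed

text \<open>Integration by parts in the height makes the integral with \<eta>' equal to - I times
  the one with \<eta>. The latter is positive, so it can be divided out of the first
  variation.\<close>

lemma radial_test_integrals:
  fixes \<eta> :: "real \<Rightarrow> real"
  assumes e: "\<And>x. (\<eta> has_real_derivative \<eta>' x) (at x)" "continuous_on UNIV \<eta>'" "\<And>x. x \<notin> {l<..<r} \<Longrightarrow> \<eta> x = 0"
    and lr: "0 < l" "l < m" "m < r" and nn: "\<And>x. 0 \<le> \<eta> x" "\<eta> m > 0"
  shows "integrable lborel (\<lambda>y. y powr (I - 1) * \<eta> y)" "integrable lborel (\<lambda>y. y powr I * \<eta>' y)"
    "(LINT y|lborel. y powr I * \<eta>' y) = - I * (LINT y|lborel. y powr (I - 1) * \<eta> y)"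
    "(LINT y|lborel. y powr (I - 1) * \<eta> y) > 0"
proof -
  have ec: "continuous_on UNIV \<eta>" using DERIV_isCont[OF e(1)] by (auto simp: continuous_on_eq_continuous_at)
  have e0: "\<eta> x = 0" "\<eta>' x = 0" if "x \<notin> {l..r}" for x
  proof -
    have o: "\<eta> x = 0" if "x \<notin> {l..r}" for x using that by (intro e(3)) auto
    show "\<eta> x = 0" by (rule o[OF that])
    show "\<eta>' x = 0" by (rule derivative_zero_outside[OF e(1) o that])
  qed
  have gen: "integrable lborel k \<and> (LINT y|lborel. k y) = integral {l..r} k"
    if k: "continuous_on {l..r} k" "\<And>y. y \<notin> {l..r} \<Longrightarrow> k y = 0" for k :: "real \<Rightarrow> real"
  proof -
    have s: "set_integrable lborel {l..r} k" by (rule borel_integrable_atLeastAtMost'[OF k(1)])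
    have "(\<lambda>y. indicator {l..r} y *\<^sub>R k y) = k" using k(2) by (auto simp: indicator_def fun_eq_iff)
    then show ?thesis using s set_borel_integral_eq_integral(2)[OF s] unfolding set_integrable_def set_lebesgue_integral_def by simp
  qed
  have c1: "continuous_on {l..r} (\<lambda>y. y powr (I - 1) * \<eta> y)" and c2: "continuous_on {l..r} (\<lambda>y. y powr I * \<eta>' y)"
    using lr by (auto intro!: continuous_intros continuous_on_subset[OF ec] continuous_on_subset[OF e(2)])
  have g1: "integrable lborel (\<lambda>y. y powr (I - 1) * \<eta> y) \<and> (LINT y|lborel. y powr (I - 1) * \<eta> y) = integral {l..r} (\<lambda>y. y powr (I - 1) * \<eta> y)"
    by (rule gen[OF c1]) (simp add: e0)
  have g2: "integrable lborel (\<lambda>y. y powr I * \<eta>' y) \<and> (LINT y|lborel. y powr I * \<eta>' y) = integral {l..r} (\<lambda>y. y powr I * \<eta>' y)"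
    by (rule gen[OF c2]) (simp add: e0)
  show "integrable lborel (\<lambda>y. y powr (I - 1) * \<eta> y)" "integrable lborel (\<lambda>y. y powr I * \<eta>' y)" using g1 g2 by auto
  have "((\<lambda>y. I * y powr (I - 1) * \<eta> y + \<eta>' y * y powr I) has_integral (r powr I * \<eta> r - l powr I * \<eta> l)) {l..r}"
  proof (rule fundamental_theorem_of_calculus)
    fix y assume "y \<in> {l..r}"
    then have y: "y > 0" using lr by auto
    have "((\<lambda>y. y powr I * \<eta> y) has_real_derivative I * y powr (I - 1) * \<eta> y + \<eta>' y * y powr I) (at y)"
      by (rule DERIV_mult[OF has_real_derivative_powr[OF y] e(1)])
    then show "((\<lambda>y. y powr I * \<eta> y) has_vector_derivative I * y powr (I - 1) * \<eta> y + \<eta>' y * y powr I) (at y within {l..r})"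
      by (simp add: has_real_derivative_iff_has_vector_derivative has_vector_derivative_at_within)
  qed (use lr in simp)
  moreover have "\<eta> r = 0" "\<eta> l = 0" by (auto intro: e(3))
  ultimately have "integral {l..r} (\<lambda>y. I * y powr (I - 1) * \<eta> y + \<eta>' y * y powr I) = 0" by (simp add: integral_unique)
  moreover have "integral {l..r} (\<lambda>y. I * y powr (I - 1) * \<eta> y + \<eta>' y * y powr I)
     = I * integral {l..r} (\<lambda>y. y powr (I - 1) * \<eta> y) + integral {l..r} (\<lambda>y. y powr I * \<eta>' y)"
  proof -
    have "integral {l..r} (\<lambda>y. I * (y powr (I - 1) * \<eta> y) + y powr I * \<eta>' y) = integral {l..r} (\<lambda>y. I * (y powr (I - 1) * \<eta> y)) + integral {l..r} (\<lambda>y. y powr I * \<eta>' y)"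
      by (rule Henstock_Kurzweil_Integration.integral_add) (intro integrable_continuous_interval continuous_intros c1 c2)+
    then show ?thesis by (simp add: mult_ac)
  qed
  ultimately show "(LINT y|lborel. y powr I * \<eta>' y) = - I * (LINT y|lborel. y powr (I - 1) * \<eta> y)" using g1 g2 by simp
  have "integral {l..r} (\<lambda>y. y powr (I - 1) * \<eta> y) \<noteq> 0"
  proof
    assume "integral {l..r} (\<lambda>y. y powr (I - 1) * \<eta> y) = 0"
    then have "\<forall>y\<in>{l..r}. y powr (I - 1) * \<eta> y = 0"
      using integral_eq_0_iff[OF c1] lr nn by auto
    then have "m powr (I - 1) * \<eta> m = 0" using lr by auto
    then show False using nn(2) lr by auto
  qed
  moreover have "0 \<le> integral {l..r} (\<lambda>y. y powr (I - 1) * \<eta> y)"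
    by (intro integral_nonneg integrable_continuous_interval c1) (use nn in auto)
  ultimately show "(LINT y|lborel. y powr (I - 1) * \<eta> y) > 0" using g1 by simp
qed

lemma plat_nonneg: "0 \<le> plat e a b x" unfolding plat_def using sstep_nonneg by simp

text \<open>For a test function \<zeta>(slope) \<eta>(height) the first variation factorises by
  homogeneity into slope integrals and height integrals. The two height integrals have ratio - I,
  and what remains is the equation in the slope.\<close>

lemma minimizer_weak_ode:
  fixes u :: "real^2 \<Rightarrow> (real^'n) multiset"
  assumes W12: "AQ_W12 Q Omega u" and min: "Dir_minimizing Q u" and tr: "AQ_trace_zero Q u"
    and cs: "csel Q I u H" and i: "i < Q"
    and pm: "p \<in> borel_measurable borel" and pi: "\<And>M::nat. integrable lborel (\<lambda>s. indicator {- real M<..<real M} s * p s)"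
    and pd: "AE s in lborel. ((\<lambda>s. H i s $ c) has_real_derivative p s) (at s)"
    and z: "\<And>x. (\<zeta> has_real_derivative \<zeta>' x) (at x)" "continuous_on UNIV \<zeta>'" "\<And>x. x \<notin> {- real M..real M} \<Longrightarrow> \<zeta> x = 0"
  shows "(LINT s|lborel. ((1 + s\<^sup>2) * p s - I * s * H i s $ c) * \<zeta>' s) = (LINT s|lborel. I * (I * H i s $ c - s * p s) * \<zeta> s)"
proof -
  note [measurable] = pm
  define h where "h s = H i s $ c" for s
  have hc: "continuous_on UNIV h" unfolding h_def using cs i by (intro continuous_intros) (auto simp: csel_def)
  have cz: "continuous_on UNIV \<zeta>" using DERIV_isCont[OF z(1)] by (auto simp: continuous_on_eq_continuous_at)
  have [measurable]: "h \<in> borel_measurable borel" "\<zeta> \<in> borel_measurable borel" "\<zeta>' \<in> borel_measurable borel"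
    using hc cz z(2) by (auto intro!: borel_measurable_continuous_onI)
  have z0: "\<zeta> x = 0" "\<zeta>' x = 0" if "x \<notin> {- real M..real M}" for x
    using z(3)[OF that] derivative_zero_outside[OF z(1) z(3) that] by auto
  \<comment> \<open>\<eta> will be a bump at height 4e that vanishes outside (2e, 6e); 6e (M + 2) =
    1 meets the condition of \<open>slope_C1c\<close>.\<close>
  define e where "e = 1 / (6 * (real M + 2))"
  have e: "e > 0" "6 * e * (real M + 2) \<le> 1" by (auto simp: e_def field_simps)
  define \<eta> where "\<eta> = plat e (4 * e) (4 * e)"
  define \<eta>' where "\<eta>' = plat' e (4 * e) (4 * e)"
  have \<eta>: "\<And>x. (\<eta> has_real_derivative \<eta>' x) (at x)" "continuous_on UNIV \<eta>'"
    unfolding \<eta>_def \<eta>'_def by (rule plat_has_real_derivative[OF e(1)], rule continuous_on_plat)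
  have \<eta>0: "\<eta> x = 0" if "x \<notin> {2 * e<..<6 * e}" for x unfolding \<eta>_def by (rule plat_eq0[OF e(1)]) (use that e in auto)
  then have \<eta>0': "\<eta> x = 0" if "x \<notin> {2 * e..6 * e}" for x using that by auto
  have [measurable]: "\<eta> \<in> borel_measurable borel" "\<eta>' \<in> borel_measurable borel"
    unfolding \<eta>_def \<eta>'_def using continuous_on_plat by (auto intro!: borel_measurable_continuous_onI)
  have e0: "\<eta> x = 0" "\<eta>' x = 0" if "x \<notin> {2 * e..6 * e}" for x
    using \<eta>0'[OF that] derivative_zero_outside[OF \<eta>(1) \<eta>0' that] by auto
  have \<eta>p: "\<eta> (4 * e) > 0" unfolding \<eta>_def using plat_eq1[OF e(1), of "4 * e" "4 * e" "4 * e"] by simp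
  have l: "0 < 2 * e" "2 * e < 4 * e" "4 * e < 6 * e" using e by auto
  note R = radial_test_integrals[OF \<eta> \<eta>0 l plat_nonneg[of e "4 * e" "4 * e", folded \<eta>_def] \<eta>p, of I]
  define \<phi> where "\<phi> x = \<zeta> (x $ 1 / x $ 2) * \<eta> (x $ 2)" for x :: "real^2"
  have \<phi>: "\<phi> \<in> C1c Omega"
    and p1: "\<And>x. pd 1 \<phi> x = \<zeta>' (x $ 1 / x $ 2) * \<eta> (x $ 2) / x $ 2"
    and p2: "\<And>x. pd 2 \<phi> x = \<zeta> (x $ 1 / x $ 2) * \<eta>' (x $ 2) - x $ 1 / x $ 2 * \<zeta>' (x $ 1 / x $ 2) * \<eta> (x $ 2) / x $ 2"
    unfolding \<phi>_def[abs_def] by (rule slope_C1c[OF z \<eta> \<eta>0' l(1) e(2)]; (assumption | rule of_nat_0_le_iff))+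
  interpret sheet_variation Q I u H i c \<phi> by unfold_locales (use W12 cs i \<phi> in auto)
  define T where "T x = indicator Omega x * (dsh 1 I H i c x * pd 1 \<phi> x) + indicator Omega x * (dsh 2 I H i c x * pd 2 \<phi> x)" for x
  have Ti: "integrable lborel T" unfolding T_def[abs_def] by (intro Bochner_Integration.integrable_add dsh_pd_integrable(1))
  have T0: "(LINT x|lborel. T x) = 0"
    using Euler_Lagrange[OF min tr] dsh_pd_integrable(1)
    unfolding T_def UNIV_2 by (subst Bochner_Integration.integral_add) auto
  define G1 where "G1 s = ((1 + s\<^sup>2) * p s - I * s * h s) * \<zeta>' s" for s
  define G2 where "G2 s = (I * h s - s * p s) * \<zeta> s" for s
  have bp: "integrable lborel (\<lambda>s. p s * k s)" if k: "continuous_on UNIV k" "\<And>s. s \<notin> {- real M..real M} \<Longrightarrow> k s = 0" for k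
  proof -
    have "bounded (k ` {- real M..real M})" by (intro compact_imp_bounded compact_continuous_image continuous_on_subset[OF k(1)]) auto
    then obtain C where "\<forall>x\<in>{- real M..real M}. \<bar>k x\<bar> \<le> C" by (auto simp: bounded_iff)
    then have C: "\<bar>k x\<bar> \<le> \<bar>C\<bar>" for x using k(2)[of x] by (cases "x \<in> {- real M..real M}") force+
    have "integrable lborel (\<lambda>s. (indicator {- real (Suc M)<..<real (Suc M)} s * p s) * k s)"
      by (rule integrable_mult_bounded[OF pi _ C]) (use borel_measurable_continuous_onI[OF k(1)] in simp)
    moreover have "(indicator {- real (Suc M)<..<real (Suc M)} s * p s) * k s = p s * k s" for s
      by (cases "s \<in> {- real M..real M}") (auto simp: k(2))
    ultimately show ?thesis by (simp only:)
  qed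
  have bc: "integrable lborel k" if k: "continuous_on UNIV k" "\<And>s. s \<notin> {- real M..real M} \<Longrightarrow> k s = 0" for k :: "real \<Rightarrow> real"
  proof -
    have "integrable lborel (\<lambda>s. indicator {- real (Suc M)<..<real (Suc M)} s * k s)"
      by (rule integrable_indicator_times_continuous) (rule continuous_on_subset[OF k(1)], simp)
    moreover have "indicator {- real (Suc M)<..<real (Suc M)} s * k s = k s" for s
      by (cases "s \<in> {- real M..real M}") (auto simp: k(2))
    ultimately show ?thesis by (simp only:)
  qed
  have G1i: "integrable lborel G1"
  proof -
    have "G1 = (\<lambda>s. p s * ((1 + s\<^sup>2) * \<zeta>' s) - I * s * h s * \<zeta>' s)" by (auto simp: G1_def fun_eq_iff algebra_simps)
    then show ?thesis
      by (simp only:) (intro Bochner_Integration.integrable_diff bp bc continuous_intros hc z(2); simp add: z0)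
  qed
  have G2i: "integrable lborel G2"
  proof -
    have "G2 = (\<lambda>s. I * h s * \<zeta> s - p s * (s * \<zeta> s))" by (auto simp: G2_def fun_eq_iff algebra_simps)
    then show ?thesis
      by (simp only:) (intro Bochner_Integration.integrable_diff bp bc continuous_intros hc cz; simp add: z0)
  qed
  \<comment> \<open>The integrand of the first variation is \<open>K1 * G1 + K2 * G2\<close>, height
    factors times slope factors. The \<zeta>' terms of both directions combine to the coefficient 1
    + s^2.\<close>
  define K1 where "K1 y = y powr (I - 2) * \<eta> y" for y
  define K2 where "K2 y = y powr (I - 1) * \<eta>' y" for y
  obtain N where N: "N \<in> null_sets lborel" "\<And>s. s \<notin> N \<Longrightarrow> ((\<lambda>s. H i s $ c) has_real_derivative p s) (at s)"
    using AE_E3[OF pd] by (auto simp: space_lborel)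
  have Tf: "AE x in lborel. x $ 2 > 0 \<longrightarrow> T x = K1 (x $ 2) * G1 (x $ 1 / x $ 2) + K2 (x $ 2) * G2 (x $ 1 / x $ 2)"
    using AE_slope[OF N(1)]
  proof eventually_elim
    case (elim x)
    show ?case
    proof
      assume y: "x $ 2 > 0"
      define s where "s = x $ 1 / x $ 2"
      show "T x = K1 (x $ 2) * G1 (x $ 1 / x $ 2) + K2 (x $ 2) * G2 (x $ 1 / x $ 2)"
      proof (cases "x \<in> Omega")
        case True
        have d: "((\<lambda>s. H i s $ c) has_real_derivative p s) (at (x $ 1 / x $ 2))" using N(2) elim y by (simp add: s_def)
        have "T x = x $ 2 powr (I - 1) * p s * (\<zeta>' s * \<eta> (x $ 2) / x $ 2)
           + x $ 2 powr (I - 1) * (I * h s - s * p s) * (\<zeta> s * \<eta>' (x $ 2) - s * \<zeta>' s * \<eta> (x $ 2) / x $ 2)"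
          unfolding T_def p1 p2 dsh_sheet[where I=I and H=H and i=i and c=c, OF d True] using True by (simp add: s_def h_def)
        also have "\<dots> = (x $ 2 powr (I - 1) / x $ 2) * \<eta> (x $ 2) * (((1 + s\<^sup>2) * p s - I * s * h s) * \<zeta>' s)
           + x $ 2 powr (I - 1) * \<eta>' (x $ 2) * ((I * h s - s * p s) * \<zeta> s)"
          using y by (simp add: field_simps power2_eq_square)
        also have "x $ 2 powr (I - 1) / x $ 2 = x $ 2 powr (I - 2)" using y by (simp add: powr_diff power2_eq_square)
        finally show ?thesis by (simp add: K1_def K2_def G1_def G2_def s_def)
      next
        \<comment> \<open>Outside \<open>Omega\<close> the left side is 0. So is the right side: a
          slope and a height within both supports would put the point into
          \<open>Omega\<close>.\<close>
        case False
        have "x = pt 1 (s * x $ 2) (x $ 2)" using y by (auto simp: vec_eq_iff pt_def s_def forall_2)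
        then have "\<not> (s \<in> {- real M..real M} \<and> x $ 2 \<in> {2 * e..6 * e})"
        proof (rule contrapos_pn, elim conjE)
          assume a: "s \<in> {- real M..real M}" "x $ 2 \<in> {2 * e..6 * e}"
          have "pt 1 (s * x $ 2) (x $ 2) \<in> Omega"
          proof (rule pt_slope_Omega[of _ "real M + 1"])
            have "x $ 2 * (real M + 2) \<le> 6 * e * (real M + 2)" using a by (intro mult_right_mono) auto
            then show "x $ 2 * ((real M + 1) + 1) \<le> 1" using e(2) by (simp add: algebra_simps)
          qed (use a y in auto)
          then show "x \<noteq> pt 1 (s * x $ 2) (x $ 2)" using False by auto
        qed
        then have "(\<zeta> s = 0 \<and> \<zeta>' s = 0) \<or> (\<eta> (x $ 2) = 0 \<and> \<eta>' (x $ 2) = 0)" using z0 e0 by blast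
        then show ?thesis using False by (auto simp: T_def K1_def K2_def G1_def G2_def s_def)
      qed
    qed
  qed
  have [measurable]: "T \<in> borel_measurable borel" using Ti borel_measurable_integrable by force
  have [measurable]: "G1 \<in> borel_measurable borel" "G2 \<in> borel_measurable borel"
    unfolding G1_def[abs_def] G2_def[abs_def] by measurable
  \<comment> \<open>At height y the substitution t = s y contributes a factor y, which raises both
    powers of y by one.\<close>
  have inner: "AE y in lborel. (LINT t|lborel. T (pt 1 t y)) = y powr (I - 1) * \<eta> y * (LINT s|lborel. G1 s) + y powr I * \<eta>' y * (LINT s|lborel. G2 s)"
    using AE_lborel_pt[OF Tf, of 1]
  proof eventually_elim
    case (elim y)
    show ?case
    proof (cases "y > 0")
      case True
      have "(LINT t|lborel. T (pt 1 t y)) = (LINT t|lborel. K1 y * G1 (t / y) + K2 y * G2 (t / y))"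
      proof (rule integral_cong_AE)
        show "(\<lambda>t. T (pt 1 t y)) \<in> borel_measurable lborel" by measurable
        show "(\<lambda>t. K1 y * G1 (t / y) + K2 y * G2 (t / y)) \<in> borel_measurable lborel" by measurable
        show "AE t in lborel. T (pt 1 t y) = K1 y * G1 (t / y) + K2 y * G2 (t / y)"
          using elim by eventually_elim (use True in \<open>simp add: pt_def\<close>)
      qed
      also have "\<dots> = K1 y * (LINT t|lborel. G1 (t / y)) + K2 y * (LINT t|lborel. G2 (t / y))"
      proof -
        have s: "integrable lborel (\<lambda>t. G (t / y))" if "integrable lborel G" for G :: "real \<Rightarrow> real"
          using integral_scale(1)[OF that, of "1 / y"] True by simp
        show ?thesis using s[OF G1i] s[OF G2i] by simp
      qed
      also have "\<dots> = (y * K1 y) * (LINT s|lborel. G1 s) + (y * K2 y) * (LINT s|lborel. G2 s)"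
        unfolding lborel_integral_slope[OF True] by simp
      also have "y * K1 y = y powr (I - 1) * \<eta> y" using True by (simp add: K1_def powr_diff power2_eq_square field_simps)
      also have "y * K2 y = y powr I * \<eta>' y" using True by (simp add: K2_def powr_diff field_simps)
      finally show ?thesis .
    next
      case False
      then have "y \<notin> {2 * e..6 * e}" using e by auto
      moreover have "T (pt 1 t y) = 0" for t using False by (simp add: T_def pt_1_Omega)
      ultimately show ?thesis by (simp add: e0)
    qed
  qed
  have "0 = (LINT y|lborel. LINT t|lborel. T (pt 1 t y))" using integrable_lborel_pt(3)[OF Ti, of 1] T0 by simp
  also have "\<dots> = (LINT y|lborel. y powr (I - 1) * \<eta> y * (LINT s|lborel. G1 s) + y powr I * \<eta>' y * (LINT s|lborel. G2 s))"
    using integrable_lborel_pt(2)[OF Ti, of 1] by (intro integral_cong_AE inner) auto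
  also have "\<dots> = (LINT y|lborel. y powr (I - 1) * \<eta> y) * (LINT s|lborel. G1 s) + (LINT y|lborel. y powr I * \<eta>' y) * (LINT s|lborel. G2 s)"
    using R(1,2) by simp
  also have "\<dots> = (LINT y|lborel. y powr (I - 1) * \<eta> y) * ((LINT s|lborel. G1 s) - I * (LINT s|lborel. G2 s))"
  proof -
    have "A * x + (- I * A) * z = A * (x - I * z)" for A x z :: real by (simp add: algebra_simps)
    moreover have "(LINT y|lborel. y powr I * \<eta>' y) = - I * (LINT y|lborel. y powr (I - 1) * \<eta> y)" using R(3) by (simp add: mult.commute)
    ultimately show ?thesis by metis
  qed
  finally have "(LINT s|lborel. G1 s) = I * (LINT s|lborel. G2 s)" using R(4) by simp
  then show ?thesis by (simp add: G1_def G2_def h_def mult.assoc)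
qed

lemma csel_profile_form:
  fixes u :: "real^2 \<Rightarrow> (real^'n) multiset"
  assumes W12: "AQ_W12 Q Omega u" and min: "Dir_minimizing Q u" and tr: "AQ_trace_zero Q u"
    and cs: "csel Q I u H" and i: "i < Q" and I: "I > 0"
  shows "\<exists>\<alpha> \<beta>. \<forall>s. (1 + s\<^sup>2) powr (- I / 2) * H i s $ c = \<alpha> * cos (I * angle s) + \<beta> * sin (I * angle s)"
proof -
  obtain \<psi>0 where "AQ_adm Q Omega u 1 \<psi>0" using W12 unfolding AQ_W12_def by blast
  from AQ_adm_badm[OF W12 this] obtain \<psi> where b: "badm Q u 1 \<psi>" by blast
  obtain p where p: "p \<in> borel_measurable borel" "\<And>M::nat. integrable lborel (\<lambda>s. indicator {- real M<..<real M} s * p s)"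
    "AE s in lborel. ((\<lambda>s. H i s $ c) has_real_derivative p s) (at s)"
    "\<And>a b. a \<le> b \<Longrightarrow> H i b $ c - H i a $ c = integral {a..b} p"
    by (rule profile_absolutely_continuous[OF cs b i, of c]) blast
  have hc: "continuous_on UNIV (\<lambda>s. H i s $ c)" using cs i by (intro continuous_intros) (auto simp: csel_def)
  show ?thesis
  proof (rule weak_ode_solution[OF I hc p(2,4)], assumption)
    fix M n :: nat and a b d :: real
    assume h: "0 < d" "- real M < a" "a < b" "b + d + 1 / real (Suc n) < real M"
    have m0: "real (Suc n) > 0" by simp
    have out: "trap (real (Suc n)) a b d x = 0" if "x \<notin> {- real M..real M}" for x
      using trap_outside(1)[OF m0, of d a b x] h that by auto
    show "(LINT s|lborel. ((1 + s\<^sup>2) * p s - I * s * H i s $ c) * trap' (real (Suc n)) a b d s)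
       = (LINT s|lborel. I * (I * H i s $ c - s * p s) * trap (real (Suc n)) a b d s)"
      by (rule minimizer_weak_ode[OF W12 min tr cs i p(1,2,3) trap_has_real_derivative[OF m0] continuous_on_trap(2) out])
  qed
qed

section \<open>Boundary values and exchange of sheets\<close>

lemma sstep_shift_tendsto: "(\<lambda>n. sstep (y / (1 / real (Suc n)) - 1)) \<longlonglongrightarrow> (if y > 0 then 1 else 0)"
proof (cases "y > 0")
  case True
  obtain N where N: "real N > 2 / y" using reals_Archimedean2 by blast
  have "sstep (y / (1 / real (Suc n)) - 1) = 1" if "n \<ge> N" for n
  proof (rule sstep_ge1)
    have "2 / y < real (Suc n)" using N that by linarith
    then show "1 \<le> y / (1 / real (Suc n)) - 1" using True by (simp add: field_simps del: of_nat_Suc)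
  qed
  then show ?thesis using True by (auto intro!: tendsto_eventually eventually_sequentiallyI[of N] simp del: of_nat_Suc)
next
  case False
  have "sstep (y / (1 / real (Suc n)) - 1) = 0" for n
  proof (rule sstep_le0)
    have "y * real (Suc n) \<le> 0" using False by (intro mult_nonpos_nonneg) auto
    then show "y / (1 / real (Suc n)) - 1 \<le> 0" by (simp del: of_nat_Suc)
  qed
  then show ?thesis using False by (simp del: of_nat_Suc)
qed

text \<open>The height derivative of the cutoff is a kernel of mass 1 on [c, 2c]; as c tends to 0 it
  concentrates on the boundary.\<close>

lemma shat_scaled_integral:
  assumes c: "c > 0"
  shows "integrable lborel (\<lambda>y. shat (y / c - 1) / c)" "(LINT y|lborel. shat (y / c - 1) / c) = 1"
proof -
  let ?k = "\<lambda>y. shat (y / c - 1) / c"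
  have cont: "continuous_on {c..2*c} ?k" using c by (intro continuous_intros) auto
  have z: "?k y = 0" if "y \<notin> {c..2*c}" for y
  proof -
    have "y / c - 1 \<le> 0 \<or> y / c - 1 \<ge> 1" using that c by (auto simp: field_simps)
    then show ?thesis by (auto simp: shat_le0 shat_ge1)
  qed
  have s: "set_integrable lborel {c..2*c} ?k" by (rule borel_integrable_atLeastAtMost'[OF cont])
  have e: "(\<lambda>y. indicator {c..2*c} y *\<^sub>R ?k y) = ?k" using z by (auto simp: indicator_def fun_eq_iff)
  show "integrable lborel ?k" using s unfolding set_integrable_def e .
  have d: "((\<lambda>y. sstep (y / c - 1)) has_real_derivative ?k y) (at y)" for y
  proof -
    have "((\<lambda>y. y / c - 1) has_real_derivative 1 / c) (at y)" using c by (auto intro!: derivative_eq_intros)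
    from DERIV_chain2[OF sstep_has_real_derivative this] show ?thesis by simp
  qed
  have "(?k has_integral (sstep (2 * c / c - 1) - sstep (c / c - 1))) {c..2*c}"
    by (rule fundamental_theorem_of_calculus)
      (use c d in \<open>auto simp: has_real_derivative_iff_has_vector_derivative has_vector_derivative_at_within\<close>)
  then have "(?k has_integral 1) {c..2*c}" using c by (simp add: sstep_le0 sstep_ge1)
  then have "integral {c..2*c} ?k = 1" by (rule integral_unique)
  then show "(LINT y|lborel. ?k y) = 1"
    using set_borel_integral_eq_integral(2)[OF s] unfolding set_lebesgue_integral_def e by simp
qed

text \<open>For zero trace the Gauss-Green identity has no boundary term even if \<phi> does not
  vanish at x_2 = 0. Inserting the cutoff at height c leaves a weighted integral \<open>L c\<close>
  of \<open>F\<close> over the strip c \<le> x_2 \<le> 2c, which must tend to 0. A lower bound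
  \<delta> near a boundary interval keeps it away from 0.\<close>

lemma trace_zero_not_bounded_below:
  fixes F :: "real^2 \<Rightarrow> real"
  assumes tr: "flat_trace F (\<lambda>x. 0)" and W: "W12 Omega F" and \<sigma>: "\<sigma> = 1 / 2 \<or> \<sigma> = - (1 / 2)"
    and \<delta>: "\<delta> > 0" and y0: "y0 > 0"
    and lower: "AE x in lborel. x \<in> Omega \<longrightarrow> x $ 1 \<in> {\<sigma> - 1/8..\<sigma> + 1/8} \<longrightarrow> x $ 2 < y0 \<longrightarrow> \<delta> \<le> F x"
  shows False
proof -
  obtain g where g: "weak_deriv Omega 2 F g" and trg: "\<And>\<phi>. \<phi> \<in> C1c U_disk \<Longrightarrow>
        set_lebesgue_integral lebesgue Omega (\<lambda>x. F x * pd 2 \<phi> x) + set_lebesgue_integral lebesgue Omega (\<lambda>x. g x * \<phi> x) = 0"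
    using tr unfolding flat_trace_def by auto
  have FL: "L2 Omega F" using W by (simp add: W12_def)
  have gL: "L2 Omega g" by (rule W12_weak_deriv_L2[OF W g])
  \<comment> \<open>Bumps of radius 1/8 about \<sigma> and of radius 1/4 about height 0. The support
    lies in the disk because 5/8 + 1/4 < 1, and \<beta> is 1 up to height 1/8.\<close>
  define \<alpha> where "\<alpha> = plat (1/8) \<sigma> \<sigma>"
  define \<beta> where "\<beta> = plat (1/8) (- (1/8)) (1/8)"
  have e8: "(1/8::real) > 0" by simp
  define \<phi> where "\<phi> x = \<alpha> (x $ 1) * \<beta> (x $ 2)" for x :: "real^2"
  have o1: "oth 1 = 2" by (simp add: oth_def)
  have \<alpha>0: "\<alpha> t = 0" if "t \<notin> {\<sigma> - 1/8..\<sigma> + 1/8}" for t unfolding \<alpha>_def by (rule plat_eq0[OF e8 that])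
  have \<alpha>nn: "0 \<le> \<alpha> t" for t unfolding \<alpha>_def by (rule plat_nonneg)
  have \<alpha>c: "continuous_on UNIV \<alpha>" unfolding \<alpha>_def by (rule continuous_on_plat)
  have \<phi>U: "\<phi> \<in> C1c U_disk"
  proof -
    have "(\<lambda>x. \<alpha> (x $ 1) * \<beta> (x $ oth 1)) \<in> C1c U_disk" unfolding \<alpha>_def \<beta>_def
    proof (rule C1c_tensor(1)[OF plat_has_real_derivative[OF e8] continuous_on_plat(2) plat_eq0[OF e8]
          plat_has_real_derivative[OF e8] continuous_on_plat(2) plat_eq0[OF e8]])
      fix t y :: real assume t: "t \<in> {\<sigma> - 1/8..\<sigma> + 1/8}" and y: "y \<in> {- (1/8) - 1/8..1/8 + 1/8}"
      have pt0: "pt 1 0 0 = 0" by (simp add: pt_def vec_eq_iff)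
      have "\<bar>t\<bar> \<le> 5/8" "\<bar>y\<bar> \<le> 1/4" using t y \<sigma> by auto
      then have "norm (pt 1 t y) \<le> 5/8 + 1/4" using dist_pt[of 1 t y 0 0] pt0 by (simp add: dist_norm)
      then show "pt 1 t y \<in> U_disk" by (simp add: U_disk_def)
    qed auto
    then show ?thesis unfolding \<phi>_def[abs_def] o1 .
  qed
  obtain C where C: "\<And>x. \<bar>\<phi> x\<bar> \<le> C" "\<And>x j. \<bar>pd j \<phi> x\<bar> \<le> C" "C \<ge> 0" by (rule C1c_bounded[OF \<phi>U]) blast
  define k where "k c y = shat (y / c - 1) / c" for c y :: real
  define L where "L c = (LINT x:Omega|lebesgue. F x * (k c (x $ 2) * \<phi> x))" for c
  note iF = L2_pd_integrable(1)[OF FL \<phi>U, of 2] and ig = L2_pd_integrable(2)[OF gL \<phi>U]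
  define f where "f x = indicator Omega x * (F x * pd 2 \<phi> x + g x * \<phi> x)" for x
  have fi: "integrable lebesgue f"
    using set_integral_add(1)[OF iF ig] unfolding f_def set_integrable_def by simp
  have f0: "(LINT x|lebesgue. f x) = 0"
    using trg[OF \<phi>U] set_integral_add(2)[OF iF ig] unfolding f_def set_lebesgue_integral_def by simp
  have kc: "continuous_on UNIV (\<lambda>x::real^2. k c (x $ 2))" if "c > 0" for c
    unfolding k_def using that by (intro continuous_intros) auto
  have kb: "\<bar>k c y\<bar> \<le> 2 / c" if "c > 0" for c y
    unfolding k_def using that shat_nonneg[of "y / c - 1"] shat_le2[of "y / c - 1"] by (simp add: divide_right_mono)
  have iL: "set_integrable lebesgue Omega (\<lambda>x. F x * (k c (x $ 2) * \<phi> x))" if c: "c > 0" for c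
  proof (rule L2_times_bounded[OF FL])
    show "continuous_on UNIV (\<lambda>x. k c (x $ 2) * \<phi> x)" by (intro continuous_intros kc[OF c] C1cD(3)[OF \<phi>U])
    show "\<bar>k c (x $ 2) * \<phi> x\<bar> \<le> 2 / c * C" for x
      unfolding abs_mult using kb[OF c] C c by (intro mult_mono) auto
  qed
  \<comment> \<open>Testing with the cutoff times \<phi>: the kernel term is minus the truncated
    Gauss-Green integral, which tends to the full one, that is, to 0.\<close>
  have Leq: "L c = - (LINT x|lebesgue. f x * sstep (x $ 2 / c - 1))" if c: "c > 0" for c
  proof -
    let ?s = "\<lambda>x::real^2. sstep (x $ 2 / c - 1)"
    let ?A = "\<lambda>x. ?s x * \<phi> x"
    have A: "?A \<in> C1c Omega" and pA: "\<And>x. pd 2 ?A x = shat (x $ 2 / c - 1) / c * \<phi> x + ?s x * pd 2 \<phi> x"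
      using cutoff_C1c(1,2)[OF c \<phi>U] by auto
    have sc: "continuous_on UNIV ?s" using c by (intro continuous_intros) auto
    have sb: "\<bar>?s x\<bar> \<le> 1" for x using sstep_nonneg[of "x $ 2 / c - 1"] sstep_le1[of "x $ 2 / c - 1"] by simp
    have i1: "set_integrable lebesgue Omega (\<lambda>x. F x * (?s x * pd 2 \<phi> x))"
    proof (rule L2_times_bounded[OF FL])
      show "continuous_on UNIV (\<lambda>x. ?s x * pd 2 \<phi> x)" by (intro continuous_on_mult sc C1cD(2)[OF \<phi>U])
      show "\<bar>?s x * pd 2 \<phi> x\<bar> \<le> 1 * C" for x unfolding abs_mult using sb C by (intro mult_mono) auto
    qed
    have i2: "set_integrable lebesgue Omega (\<lambda>x. g x * ?A x)" by (rule L2_pd_integrable(2)[OF gL A])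
    have "(LINT x:Omega|lebesgue. F x * pd 2 ?A x) = - (LINT x:Omega|lebesgue. g x * ?A x)"
      using g A by (simp add: weak_deriv_def)
    moreover have "(LINT x:Omega|lebesgue. F x * pd 2 ?A x) = L c + (LINT x:Omega|lebesgue. F x * (?s x * pd 2 \<phi> x))"
      unfolding pA L_def distrib_left using set_integral_add(2)[OF iL[OF c] i1] unfolding k_def .
    ultimately have "L c = - ((LINT x:Omega|lebesgue. F x * (?s x * pd 2 \<phi> x)) + (LINT x:Omega|lebesgue. g x * ?A x))" by simp
    also have "(LINT x:Omega|lebesgue. F x * (?s x * pd 2 \<phi> x)) + (LINT x:Omega|lebesgue. g x * ?A x)
      = (LINT x:Omega|lebesgue. F x * (?s x * pd 2 \<phi> x) + g x * ?A x)" by (rule set_integral_add(2)[OF i1 i2, symmetric])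
    also have "\<dots> = (LINT x|lebesgue. f x * ?s x)"
      unfolding set_lebesgue_integral_def f_def by (intro Bochner_Integration.integral_cong) (auto simp: algebra_simps)
    finally show ?thesis .
  qed
  have lim: "(\<lambda>n. LINT x|lebesgue. f x * sstep (x $ 2 / (1 / real (Suc n)) - 1)) \<longlonglongrightarrow> (LINT x|lebesgue. f x * (if x $ 2 > 0 then 1 else 0))"
  proof (rule integral_mult_bounded_tendsto[OF fi, where C=1])
    show "(\<lambda>x::real^2. sstep (x $ 2 / (1 / real (Suc n)) - 1)) \<in> borel_measurable lebesgue" for n
    proof -
      have "continuous_on UNIV (\<lambda>x::real^2. sstep (x $ 2 / (1 / real (Suc n)) - 1))" by (intro continuous_intros) auto
      from borel_measurable_continuous_onI[OF this] show ?thesis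
        using measurable_completion[of "\<lambda>x::real^2. sstep (x $ 2 / (1 / real (Suc n)) - 1)" lborel borel] by simp
    qed
    have "(\<lambda>x::real^2. if x $ 2 > 0 then 1 else 0 :: real) \<in> borel_measurable lborel" by measurable
    then show "(\<lambda>x::real^2. if x $ 2 > 0 then 1 else 0 :: real) \<in> borel_measurable lebesgue" by (rule measurable_completion)
    show "\<bar>sstep (x $ 2 / (1 / real (Suc n)) - 1)\<bar> \<le> 1" for n and x :: "real^2"
      using sstep_nonneg[of "x $ 2 / (1 / real (Suc n)) - 1"] sstep_le1[of "x $ 2 / (1 / real (Suc n)) - 1"] by simp
    show "AE x::real^2 in lebesgue. (\<lambda>n. sstep (x $ 2 / (1 / real (Suc n)) - 1)) \<longlonglongrightarrow> (if x $ 2 > 0 then 1 else 0)"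
      by (intro AE_I2 sstep_shift_tendsto)
  qed
  have fx: "f x * (if x $ 2 > 0 then 1 else 0) = f x" for x by (auto simp: f_def Omega_iff)
  have lim0: "(\<lambda>n. LINT x|lebesgue. f x * sstep (x $ 2 / (1 / real (Suc n)) - 1)) \<longlonglongrightarrow> 0" using lim unfolding fx f0 .
  have Llim: "(\<lambda>n. L (1 / real (Suc n))) \<longlonglongrightarrow> 0"
    using tendsto_minus[OF lim0] by (simp add: Leq del: of_nat_Suc)
  have \<alpha>i: "integrable lborel \<alpha>"
  proof -
    have "integrable lborel (\<lambda>t. indicator {\<sigma> - 1/8..\<sigma> + 1/8} t *\<^sub>R \<alpha> t)"
      using borel_integrable_atLeastAtMost'[OF continuous_on_subset[OF \<alpha>c], of "\<sigma> - 1/8" "\<sigma> + 1/8"] by (simp add: set_integrable_def)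
    moreover have "(\<lambda>t. indicator {\<sigma> - 1/8..\<sigma> + 1/8} t *\<^sub>R \<alpha> t) = \<alpha>" using \<alpha>0 by (fastforce simp: indicator_def fun_eq_iff)
    ultimately show ?thesis by simp
  qed
  have \<alpha>pos: "(LINT t|lborel. \<alpha> t) > 0"
  proof -
    have "(LINT t|lborel. \<alpha> t) \<noteq> 0"
    proof
      assume "(LINT t|lborel. \<alpha> t) = 0"
      then have "AE t in lborel. \<alpha> t = 0" using integral_nonneg_eq_0_iff_AE[OF \<alpha>i] \<alpha>nn by auto
      obtain d where d: "d > 0" "\<And>t. dist t \<sigma> < d \<Longrightarrow> dist (\<alpha> t) (\<alpha> \<sigma>) < 1"
        using \<alpha>c[unfolded continuous_on_iff, rule_format, of \<sigma> 1] by auto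
      obtain t where t: "\<sigma> - d < t" "t < \<sigma> + d" "\<alpha> t = 0"
        by (rule AE_lborel_ex_interval[OF \<open>AE t in lborel. \<alpha> t = 0\<close>, of "\<sigma> - d" "\<sigma> + d"]) (use d in auto)
      have "\<alpha> \<sigma> = 1" unfolding \<alpha>_def by (rule plat_eq1) auto
      moreover have "dist t \<sigma> < d" using t by (auto simp: dist_real_def abs_less_iff)
      ultimately show False using d(2)[of t] t by (auto simp: dist_real_def)
    qed
    moreover have "(LINT t|lborel. \<alpha> t) \<ge> 0" using \<alpha>nn by (intro integral_nonneg_AE) auto
    ultimately show ?thesis by simp
  qed
  \<comment> \<open>Where the kernel and \<alpha> live, \<beta> is 1 and the point is in
    \<open>Omega\<close>, so \<delta> bounds \<open>F\<close> from below. The kernel has mass 1 in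
    the height, which leaves the mass of \<alpha>.\<close>
  have Lge: "\<delta> * (LINT t|lborel. \<alpha> t) \<le> L c" if c: "c > 0" "2 * c < y0" "2 * c \<le> 1/8" for c
  proof -
    let ?q = "\<lambda>x::real^2. \<alpha> (x $ 1) * k c (x $ 2)"
    have k0: "k c y = 0" if "y \<notin> {c..2*c}" for y
    proof -
      have "y / c - 1 \<le> 0 \<or> y / c - 1 \<ge> 1" using that c by (auto simp: field_simps)
      then show ?thesis by (auto simp: shat_le0 shat_ge1 k_def)
    qed
    have qi: "integrable lborel ?q"
    proof -
      have "continuous_on UNIV ?q"
        by (intro continuous_on_mult kc[OF c(1)] continuous_on_compose2[OF \<alpha>c]) (auto intro!: continuous_intros)
      moreover have "compact ((\<lambda>(t,y). pt 1 t y) ` ({\<sigma> - 1/8..\<sigma> + 1/8} \<times> {c..2*c}))"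
        unfolding case_prod_unfold by (intro compact_continuous_image compact_Times continuous_intros) auto
      moreover have "?q x = 0" if "x \<notin> (\<lambda>(t,y). pt 1 t y) ` ({\<sigma> - 1/8..\<sigma> + 1/8} \<times> {c..2*c})" for x
      proof (rule ccontr)
        assume "?q x \<noteq> 0"
        then have "x $ 1 \<in> {\<sigma> - 1/8..\<sigma> + 1/8}" "x $ 2 \<in> {c..2*c}" using \<alpha>0 k0 by force+
        then have "(\<lambda>(t,y). pt 1 t y) (x $ 1, x $ 2) \<in> (\<lambda>(t,y). pt 1 t y) ` ({\<sigma> - 1/8..\<sigma> + 1/8} \<times> {c..2*c})" by blast
        moreover have "pt 1 (x $ 1) (x $ 2) = x" by (auto simp: vec_eq_iff pt_def forall_2)
        ultimately show False using that by simp
      qed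
      ultimately have "integrable lborel (\<lambda>x. indicator UNIV x * (1 * ?q x))"
        by (intro integrable_continuous_times_C1c[OF open_UNIV continuous_on_const]) auto
      then show ?thesis by simp
    qed
    have "(LINT x|lborel. ?q x) = (LINT y|lborel. LINT t|lborel. \<alpha> t * k c y)"
      using integrable_lborel_pt(3)[OF qi, of 1] by (simp add: pt_def)
    also have "\<dots> = (LINT t|lborel. \<alpha> t) * (LINT y|lborel. k c y)" by simp
    also have "(LINT y|lborel. k c y) = 1" unfolding k_def by (rule shat_scaled_integral(2)[OF c(1)])
    finally have q1: "(LINT x|lborel. ?q x) = (LINT t|lborel. \<alpha> t)" by simp
    have qm: "?q \<in> borel_measurable lborel" using qi by auto
    have "\<delta> * (LINT t|lborel. \<alpha> t) = (LINT x|lebesgue. \<delta> * ?q x)" using q1 integral_completion[OF qm] by simp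
    also have "\<dots> \<le> (LINT x|lebesgue. indicator Omega x * (F x * (k c (x $ 2) * \<phi> x)))"
    proof (rule integral_mono_AE)
      show "integrable lebesgue (\<lambda>x. \<delta> * ?q x)" using integrable_completion[OF qm] qi by simp
      show "integrable lebesgue (\<lambda>x. indicator Omega x * (F x * (k c (x $ 2) * \<phi> x)))" using iL[OF c(1)] by (simp add: set_integrable_def)
      show "AE x in lebesgue. \<delta> * ?q x \<le> indicator Omega x * (F x * (k c (x $ 2) * \<phi> x))"
        unfolding AE_completion_iff using lower
      proof eventually_elim
        case (elim x)
        show ?case
        proof (cases "x $ 1 \<in> {\<sigma> - 1/8..\<sigma> + 1/8} \<and> x $ 2 \<in> {c..2*c}")
          case True
          have "\<bar>x $ 1\<bar> \<le> 5/8" "\<bar>x $ 2\<bar> \<le> 1/8" using True \<sigma> c by auto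
          then have "(x $ 1)\<^sup>2 \<le> (5/8)\<^sup>2" "(x $ 2)\<^sup>2 \<le> (1/8)\<^sup>2" by (metis abs_ge_zero power2_abs power_mono)+
          then have "(x $ 1)\<^sup>2 + (x $ 2)\<^sup>2 < 1" by (simp add: power2_eq_square)
          then have O: "x \<in> Omega" using True c by (auto simp: Omega_iff)
          have F: "\<delta> \<le> F x" using elim O True c by auto
          have "\<beta> (x $ 2) = 1" unfolding \<beta>_def by (rule plat_eq1) (use True c in auto)
          then have "F x * (k c (x $ 2) * \<phi> x) = F x * ?q x" by (simp add: \<phi>_def mult_ac)
          moreover have "0 \<le> ?q x" using \<alpha>nn shat_nonneg c by (simp add: k_def)
          ultimately show ?thesis using mult_right_mono[OF F, of "?q x"] O by (simp only: indicator_simps) simp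
        next
          case False
          then have q: "?q x = 0" and f: "k c (x $ 2) * \<phi> x = 0" using \<alpha>0 k0 by (auto simp: \<phi>_def)
          show ?thesis unfolding q f by simp
        qed
      qed
    qed
    also have "\<dots> = L c" by (simp add: L_def set_lebesgue_integral_def)
    finally show ?thesis .
  qed
  have ev: "\<forall>\<^sub>F n in sequentially. \<delta> * (LINT t|lborel. \<alpha> t) \<le> L (1 / real (Suc n))"
  proof -
    have "(\<lambda>n. 2 * (1 / real (Suc n))) \<longlonglongrightarrow> 2 * 0"
      using LIMSEQ_Suc[OF lim_const_over_n[of "1::real"]] by (intro tendsto_mult_left)
    then have "\<forall>\<^sub>F n in sequentially. 2 * (1 / real (Suc n)) < min y0 (1/8)"
      using y0 by (intro order_tendstoD(2)) auto
    then show ?thesis by eventually_elim (intro Lge, auto simp del: of_nat_Suc)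
  qed
  have "\<delta> * (LINT t|lborel. \<alpha> t) \<le> 0" by (rule tendsto_lowerbound[OF Llim ev]) simp
  then show False using \<delta> \<alpha>pos by (simp add: mult_le_0_iff)
qed

section \<open>The explicit sheets at the boundary\<close>

lemma csel_form:
  fixes u :: "real^2 \<Rightarrow> (real^'n) multiset"
  assumes W12: "AQ_W12 Q Omega u" and min: "Dir_minimizing Q u" and tr: "AQ_trace_zero Q u"
    and cs: "csel Q I u H" and I: "I > 0"
  obtains a b :: "nat \<Rightarrow> real^'n" where
    "\<And>i s. i < Q \<Longrightarrow> H i s = ((1 + s\<^sup>2) powr (I / 2)) *\<^sub>R (cos (I * angle s) *\<^sub>R a i + sin (I * angle s) *\<^sub>R b i)"
proof -
  have "\<forall>i c. \<exists>\<alpha> \<beta>. i < Q \<longrightarrow> (\<forall>s. (1 + s\<^sup>2) powr (- I / 2) * H i s $ c = \<alpha> * cos (I * angle s) + \<beta> * sin (I * angle s))"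
    using csel_profile_form[OF W12 min tr cs _ I] by blast
  then obtain A B where AB: "\<And>i c s. i < Q \<Longrightarrow> (1 + s\<^sup>2) powr (- I / 2) * H i s $ c = A i c * cos (I * angle s) + B i c * sin (I * angle s)"
    by metis
  show ?thesis
  proof (rule that[of "\<lambda>i. \<chi> c. A i c" "\<lambda>i. \<chi> c. B i c"])
    fix i s assume i: "i < Q"
    have p: "(1 + s\<^sup>2) powr (I / 2) * (1 + s\<^sup>2) powr (- I / 2) = 1"
      using powr_add[of "1 + s\<^sup>2" "I / 2" "- I / 2"] by (simp add: add_pos_nonneg add_nonneg_eq_0_iff)
    show "H i s = ((1 + s\<^sup>2) powr (I / 2)) *\<^sub>R (cos (I * angle s) *\<^sub>R (\<chi> c. A i c) + sin (I * angle s) *\<^sub>R (\<chi> c. B i c))"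
    proof (rule vec_eq_iff[THEN iffD2, rule_format])
      fix c
      have "H i s $ c = ((1 + s\<^sup>2) powr (I / 2) * (1 + s\<^sup>2) powr (- I / 2)) * H i s $ c" unfolding p by simp
      also have "\<dots> = (1 + s\<^sup>2) powr (I / 2) * (A i c * cos (I * angle s) + B i c * sin (I * angle s))"
        unfolding mult.assoc AB[OF i] ..
      finally show "H i s $ c = (((1 + s\<^sup>2) powr (I / 2)) *\<^sub>R (cos (I * angle s) *\<^sub>R (\<chi> c. A i c) + sin (I * angle s) *\<^sub>R (\<chi> c. B i c))) $ c"
        by (simp add: mult.commute)
    qed
  qed
qed

lemma replicate_mset_ms: "replicate_mset Q P = ms Q (\<lambda>_. P)"
  by (simp add: ms_eq_mset map_replicate_const)

lemma sum_mset_replicate_scaleR: "sum_mset (replicate_mset n P) = real n *\<^sub>R (P :: real^'n)"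
  by (induction n) (simp_all add: scaleR_left_distrib del: sum_mset_replicate_mset)

text \<open>All labellings of Q copies of 0 are equal, so the distance is attained without any
  rearrangement.\<close>

lemma norm_le_Gdist_zero: assumes "i < Q" shows "norm (V i) \<le> Gdist (ms Q V) (replicate_mset Q 0)"
proof -
  obtain p where "p permutes {..<Q}" "Gdist (ms Q V) (ms Q (\<lambda>_. 0)) = l2d Q V ((\<lambda>_. 0) \<circ> p)" by (rule Gdist_attained)
  then have "Gdist (ms Q V) (replicate_mset Q 0) = L2_set (\<lambda>i. norm (V i)) {..<Q}" by (simp add: replicate_mset_ms l2d_def o_def)
  then show ?thesis using member_le_L2_set[of "{..<Q}" i "\<lambda>i. norm (V i)"] assms by simp
qed

lemma powr_slope: fixes y t I :: real assumes "y > 0" shows "y powr I * (1 + (t / y)\<^sup>2) powr (I / 2) = (t\<^sup>2 + y\<^sup>2) powr (I / 2)"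
proof -
  have "y powr I = (y\<^sup>2) powr (I / 2)" using assms by (simp add: powr_powr flip: powr_numeral)
  then have "y powr I * (1 + (t / y)\<^sup>2) powr (I / 2) = (y\<^sup>2 * (1 + (t / y)\<^sup>2)) powr (I / 2)" using assms by (simp add: powr_mult)
  also have "y\<^sup>2 * (1 + (t / y)\<^sup>2) = t\<^sup>2 + y\<^sup>2" using assms by (simp add: field_simps)
  finally show ?thesis .
qed

text \<open>Near the boundary point (\<sigma>, 0) the angle is close to \<theta> while r stays
  bounded below. A nonzero value of \<open>v\<close> there would bound the norm of the sheet, and
  with it the distance of \<open>u\<close> to Q copies of 0, from below.\<close>

lemma profile_vanishes_at_boundary:
  fixes u :: "real^2 \<Rightarrow> (real^'n) multiset" and v :: "real \<Rightarrow> real^'n" and \<sigma> :: real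
  assumes W12: "AQ_W12 Q Omega u" and tr: "AQ_trace_zero Q u" and cs: "csel Q I u H" and i: "i < Q" and I: "I > 0"
    and H: "\<And>s. H i s = ((1 + s\<^sup>2) powr (I / 2)) *\<^sub>R v (angle s)" and v: "isCont v \<theta>"
    and \<theta>: "\<theta> = 0 \<and> \<sigma> = 1 / 2 \<or> \<theta> = pi \<and> \<sigma> = - (1 / 2)"
  shows "v \<theta> = 0"
proof (rule ccontr)
  assume nz: "v \<theta> \<noteq> 0"
  let ?Q0 = "replicate_mset Q 0 :: (real^'n) multiset"
  let ?F = "\<lambda>x. Gdist (u x) ?Q0"
  have Q0: "?Q0 \<in> AQ Q" by (simp add: AQ_def)
  have W: "W12 Omega ?F" using W12 Q0 by (simp add: AQ_W12_def)
  have "Gdist ?Q0 ?Q0 = 0" by (simp add: replicate_mset_ms Gdist_self)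
  then have tr0: "flat_trace ?F (\<lambda>x. 0)" using tr Q0 unfolding AQ_trace_zero_def by metis
  have "(\<lambda>\<theta>. norm (v \<theta>)) \<midarrow>\<theta>\<rightarrow> norm (v \<theta>)" using v by (auto simp: isCont_def intro: tendsto_norm)
  moreover have "norm (v \<theta>) / 2 < norm (v \<theta>)" using nz by simp
  ultimately have "\<forall>\<^sub>F t in at \<theta>. norm (v \<theta>) / 2 < norm (v t)" by (rule order_tendstoD(1))
  then obtain d where d: "d > 0" "\<And>t. t \<noteq> \<theta> \<Longrightarrow> dist t \<theta> < d \<Longrightarrow> norm (v \<theta>) / 2 < norm (v t)"
    unfolding eventually_at by auto
  have "\<forall>\<^sub>F s in at_top. arctan s > pi / 2 - d" by (rule order_tendstoD(1)[OF tendsto_arctan_at_top]) (use d in simp)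
  then obtain S where S: "\<And>s. s \<ge> S \<Longrightarrow> arctan s > pi / 2 - d" unfolding eventually_at_top_linorder by auto
  \<comment> \<open>3/8 = 1/2 - 1/8 is the least |x_1| in the strip, so a height below
    \<open>y0\<close> forces |slope| \<ge> S; the summand 1 avoids a zero denominator.\<close>
  define y0 where "y0 = 3 / 8 / (\<bar>S\<bar> + 1)"
  \<comment> \<open>In the strip r^2 \<ge> (3/8)^2 = 9/64 \<ge> 1/8.\<close>
  define \<delta> where "\<delta> = (1 / 8) powr (I / 2) * (norm (v \<theta>) / 2)"
  show False
  proof (rule trace_zero_not_bounded_below[OF tr0 W, of \<sigma> \<delta> y0])
    show "\<sigma> = 1 / 2 \<or> \<sigma> = - (1 / 2)" using \<theta> by auto
    show "\<delta> > 0" using nz by (simp add: \<delta>_def)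
    show "y0 > 0" by (simp add: y0_def)
    have "AE x in lborel. x \<in> Omega \<longrightarrow> u x = ms Q (sheet I H x)" using cs by (simp add: csel_def)
    then show "AE x in lborel. x \<in> Omega \<longrightarrow> x $ 1 \<in> {\<sigma> - 1/8..\<sigma> + 1/8} \<longrightarrow> x $ 2 < y0 \<longrightarrow> \<delta> \<le> ?F x"
    proof eventually_elim
      case (elim x)
      show ?case
      proof (intro impI)
        assume x: "x \<in> Omega" "x $ 1 \<in> {\<sigma> - 1/8..\<sigma> + 1/8}" "x $ 2 < y0"
        define t y s where "t = x $ 1" and "y = x $ 2" and "s = t / y"
        have y: "y > 0" using x(1) by (simp add: Omega_iff y_def)
        have t: "\<bar>t\<bar> \<ge> 3 / 8" using x(2) \<theta> by (auto simp: t_def)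
        have "S * y \<le> \<bar>t\<bar>"
        proof -
          have "S * y \<le> (\<bar>S\<bar> + 1) * y" using y by (intro mult_right_mono) auto
          also have "\<dots> \<le> (\<bar>S\<bar> + 1) * y0" using x(3) by (intro mult_left_mono) (auto simp: y_def)
          also have "\<dots> = 3 / 8" unfolding y0_def using nonzero_mult_div_cancel_left[of "\<bar>S\<bar> + 1" "3 / 8"] by (simp only: times_divide_eq_right)
          finally show ?thesis using t by simp
        qed
        then have sS: "arctan \<bar>s\<bar> > pi / 2 - d" using y by (intro S) (simp add: s_def field_simps)
        have ang: "\<bar>angle s - \<theta>\<bar> = pi / 2 - arctan \<bar>s\<bar>"
        proof (cases "\<theta> = 0")
          case True
          then have "s \<ge> 0" using x(2) \<theta> y by (auto simp: s_def t_def)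
          then show ?thesis using True arctan_ubound[of s] by (simp add: angle_def)
        next
          case False
          then have "s \<le> 0" "\<theta> = pi" using x(2) \<theta> y by (auto simp: s_def t_def divide_nonpos_pos)
          then show ?thesis using arctan_lbound[of s] by (simp add: angle_def arctan_minus)
        qed
        have "norm (v \<theta>) / 2 < norm (v (angle s))"
        proof (rule d(2))
          show "angle s \<noteq> \<theta>" using ang arctan_ubound[of "\<bar>s\<bar>"] by auto
          show "dist (angle s) \<theta> < d" using ang sS by (simp add: dist_real_def)
        qed
        moreover have "(1 / 8) powr (I / 2) \<le> (t\<^sup>2 + y\<^sup>2) powr (I / 2)"
        proof (rule powr_mono2)
          have "(3 / 8)\<^sup>2 \<le> \<bar>t\<bar>\<^sup>2" using t by (intro power_mono) auto
          then have "9 / 64 \<le> t\<^sup>2" by (simp add: power_divide)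
          then show "1 / 8 \<le> t\<^sup>2 + y\<^sup>2" using zero_le_power2[of y] by linarith
        qed (use I in auto)
        ultimately have "\<delta> \<le> (t\<^sup>2 + y\<^sup>2) powr (I / 2) * norm (v (angle s))"
          unfolding \<delta>_def by (intro mult_mono) auto
        also have "\<dots> = norm (sheet I H x i)"
          unfolding sheet_def H using powr_slope[OF y, of I t] by (simp add: t_def y_def s_def)
        also have "\<dots> \<le> ?F x" using norm_le_Gdist_zero[OF i, of "sheet I H x"] elim x(1) by simp
        finally show "\<delta> \<le> ?F x" .
      qed
    qed
  qed
qed

section \<open>Exchange of two sheets\<close>

lemma tan_slope_angle: assumes "0 < \<theta>" "\<theta> < pi" shows "angle (tan (pi / 2 - \<theta>)) = \<theta>"
  using assms by (simp add: angle_def arctan_tan)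

lemma angle_less: "angle s < angle t \<longleftrightarrow> t < s"
  by (simp add: angle_def arctan_less_iff)

text \<open>The two pieces meet at \<open>s0\<close>, so continuity is preserved, and at every slope
  the values are those of \<open>H\<close> up to a transposition of labels. The exchange may create
  a kink, which \<open>csel\<close> permits.\<close>

lemma csel_swap:
  fixes u :: "real^2 \<Rightarrow> (real^'n) multiset"
  assumes cs: "csel Q I u H" and ik: "i < Q" "k < Q" and eq: "H i s0 = H k s0"
  defines "H' \<equiv> \<lambda>j s. if s \<le> s0 then H j s else H (Transposition.transpose i k j) s"
  shows "csel Q I u H'"
  unfolding csel_def
proof (intro conjI allI impI)
  have p: "Transposition.transpose i k permutes {..<Q}" using ik by (intro permutes_swap_id) auto
  have c: "continuous_on UNIV (H j)" if "j < Q" for j using cs that by (simp add: csel_def)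
  fix j assume j: "j < Q"
  then have j': "Transposition.transpose i k j < Q" using permutes_in_image[OF p, of j] by simp
  have e: "H j s0 = H (Transposition.transpose i k j) s0" using eq by (auto simp: Transposition.transpose_def)
  have "continuous_on ({..s0} \<union> {s0..}) (\<lambda>s. if s \<le> s0 then H j s else H (Transposition.transpose i k j) s)"
    by (rule continuous_on_If) (use e in \<open>auto intro: continuous_on_subset[OF c[OF j]] continuous_on_subset[OF c[OF j']]\<close>)
  moreover have "{..s0} \<union> {s0..} = (UNIV :: real set)" by auto
  ultimately show "continuous_on UNIV (H' j)" unfolding H'_def by simp
next
  have p: "Transposition.transpose i k permutes {..<Q}" using ik by (intro permutes_swap_id) auto
  have "AE x in lborel. x \<in> Omega \<longrightarrow> u x = ms Q (sheet I H x)" using cs by (simp add: csel_def)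
  then show "AE x in lborel. x \<in> Omega \<longrightarrow> u x = ms Q (sheet I H' x)"
  proof eventually_elim
    case (elim x)
    have "ms Q (sheet I H' x) = ms Q (sheet I H x)"
    proof (cases "x $ 1 / x $ 2 \<le> s0")
      case True
      then show ?thesis by (intro ms_cong) (simp add: sheet_def H'_def)
    next
      case False
      then have "sheet I H' x = sheet I H x \<circ> Transposition.transpose i k" by (simp add: sheet_def H'_def fun_eq_iff)
      then show ?thesis by (simp add: ms_permute[OF p])
    qed
    then show ?case using elim by simp
  qed
qed

theorem theorem6p3:
  fixes Q :: nat and I :: real and u :: "real^2 \<Rightarrow> (real^'n) multiset"
  assumes "AQ_W12 Q Omega u"
    and "Dir_minimizing Q u"
    and "AQ_trace_zero Q u"
    and "I > 0"
    and "homogeneous I u"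
  shows "(AE x in lebesgue_on Omega. u x = replicate_mset Q (AQ_eta Q (u x))) \<or> I = 1"
proof -
  note W12 = assms(1) and min = assms(2) and tr = assms(3) and I = assms(4)
  obtain \<psi>0 where "AQ_adm Q Omega u 1 \<psi>0" using W12 unfolding AQ_W12_def by blast
  from AQ_adm_badm[OF W12 this] obtain \<psi> where "badm Q u 1 \<psi>" by blast
  from exists_csel[OF W12 assms(5) this] obtain H where cs: "csel Q I u H" by blast
  obtain a b where H: "\<And>i s. i < Q \<Longrightarrow> H i s = ((1 + s\<^sup>2) powr (I / 2)) *\<^sub>R (cos (I * angle s) *\<^sub>R a i + sin (I * angle s) *\<^sub>R b i)"
    by (rule csel_form[OF W12 min tr cs I]) blast
  have bd: "cos (I * \<theta>) *\<^sub>R a i + sin (I * \<theta>) *\<^sub>R b i = 0"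
    if "i < Q" "\<theta> = 0 \<and> \<sigma> = 1 / 2 \<or> \<theta> = pi \<and> \<sigma> = - (1 / 2)" for i and \<theta> \<sigma> :: real
  proof (rule profile_vanishes_at_boundary[OF W12 tr cs that(1) I, where v = "\<lambda>\<theta>. cos (I * \<theta>) *\<^sub>R a i + sin (I * \<theta>) *\<^sub>R b i"])
    show "isCont (\<lambda>\<theta>. cos (I * \<theta>) *\<^sub>R a i + sin (I * \<theta>) *\<^sub>R b i) \<theta>" by (intro continuous_intros)
  qed (use H that in auto)
  have a0: "a i = 0" if "i < Q" for i using bd[OF that, of 0 "1 / 2"] by simp
  have bpi: "sin (I * pi) *\<^sub>R b i = 0" if "i < Q" for i using bd[OF that, of pi "- (1 / 2)"] a0[OF that] by simp
  have H0: "H i s = ((1 + s\<^sup>2) powr (I / 2) * sin (I * angle s)) *\<^sub>R b i" if "i < Q" for i s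
    using H[OF that] a0[OF that] by simp
  show ?thesis
  proof (cases "\<forall>i<Q. \<forall>k<Q. b i = b k")
    case True
    have "AE x in lborel. x \<in> Omega \<longrightarrow> u x = ms Q (sheet I H x)" using cs by (simp add: csel_def)
    then have "AE x in lborel. x \<in> Omega \<longrightarrow> u x = replicate_mset Q (AQ_eta Q (u x))"
    proof eventually_elim
      case (elim x)
      show ?case
      proof (rule impI)
        assume "x \<in> Omega"
        then have "u x = ms Q (sheet I H x)" using elim by blast
        also have "\<dots> = ms Q (\<lambda>_. sheet I H x 0)"
        proof (rule ms_cong)
          fix i assume i: "i < Q"
          then have "0 < Q" by simp
          then have "b i = b 0" using True i by blast
          then show "sheet I H x i = sheet I H x 0" using H0[OF i] H0[OF \<open>0 < Q\<close>] by (simp add: sheet_def)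
        qed
        finally have ux: "u x = replicate_mset Q (sheet I H x 0)" by (simp add: replicate_mset_ms)
        \<comment> \<open>\<open>AQ_eta\<close> divides by Q; for Q = 0 both sides are the empty
          multiset.\<close>
        show "u x = replicate_mset Q (AQ_eta Q (u x))"
        proof (cases "Q = 0")
          case False
          then have "AQ_eta Q (u x) = sheet I H x 0" unfolding ux AQ_eta_def
            by (simp add: sum_mset_replicate_scaleR del: sum_mset_replicate_mset)
          then show ?thesis using ux by simp
        qed (simp add: ux)
      qed
    qed
    then show ?thesis by (simp add: AE_lebesgue_on_Omega)
  next
    case False
    then obtain i k where ik: "i < Q" "k < Q" "b i \<noteq> b k" by blast
    then obtain c where c: "b i $ c \<noteq> b k $ c" by (auto simp: vec_eq_iff)
    \<comment> \<open>Of two different vectors at least one is nonzero.\<close>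
    have "sin (I * pi) = 0" using bpi[OF ik(1)] bpi[OF ik(2)] ik(3) by (metis scaleR_eq_0_iff)
    then obtain m :: int where "I * pi = of_int m * pi" by (auto simp: sin_zero_iff_int2)
    then have m: "I = of_int m" by simp
    show ?thesis
    proof (cases "I = 1")
      case False
      then have "m \<ge> 2" using m I by simp
      then have I2: "I \<ge> 2" using m by simp
      \<comment> \<open>The slopes of the angles \<pi>/I, 3\<pi>/(2I) and \<pi>/(2I). At the first
        sin (I \<theta>) vanishes, so the sheets meet. The others lie on its two sides, where cos (I
        \<theta>) is 0 and sin (I \<theta>) is -1 and 1. I \<ge> 2 keeps all three angles below
        \<pi>.\<close>
      define s0 s1 s2 where "s0 = tan (pi / 2 - pi / I)" and "s1 = tan (pi / 2 - 3 * pi / (2 * I))" and "s2 = tan (pi / 2 - pi / (2 * I))"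
      have ang: "angle s0 = pi / I" "angle s1 = 3 * pi / (2 * I)" "angle s2 = pi / (2 * I)"
        unfolding s0_def s1_def s2_def
      proof (safe intro!: tan_slope_angle)
        show "pi / I < pi" "3 * pi / (2 * I) < pi" "pi / (2 * I) < pi" using I2 by (simp_all add: pos_divide_less_eq)
      qed (use I in auto)
      have lt: "s1 < s0" "s0 < s2"
      proof -
        have "angle s0 < angle s1" "angle s2 < angle s0" using I by (simp_all add: ang field_simps)
        then show "s1 < s0" "s0 < s2" by (simp_all add: angle_less)
      qed
      have Ia: "I * angle s0 = pi" "I * angle s1 = 3 / 2 * pi" "I * angle s2 = pi / 2" using I by (simp_all add: ang)
      have "H i s0 = H k s0" using H0[OF ik(1)] H0[OF ik(2)] Ia by simp
      note cs' = csel_swap[OF cs ik(1,2) this]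
      from csel_profile_form[OF W12 min tr cs' ik(1) I, of c] obtain \<alpha> \<beta> where
        ab: "\<And>s. (1 + s\<^sup>2) powr (- I / 2) * (if s \<le> s0 then H i s else H (Transposition.transpose i k i) s) $ c
           = \<alpha> * cos (I * angle s) + \<beta> * sin (I * angle s)" by blast
      have p: "(1 + s\<^sup>2) powr (- I / 2) * (1 + s\<^sup>2) powr (I / 2) = 1" for s :: real
        using powr_add[of "1 + s\<^sup>2" "- I / 2" "I / 2"] by (simp add: add_pos_nonneg add_nonneg_eq_0_iff)
      have val: "(1 + s\<^sup>2) powr (- I / 2) * H j s $ c = sin (I * angle s) * b j $ c" if "j < Q" for j s
      proof -
        have "(1 + s\<^sup>2) powr (- I / 2) * H j s $ c = ((1 + s\<^sup>2) powr (- I / 2) * (1 + s\<^sup>2) powr (I / 2)) * (sin (I * angle s) * b j $ c)"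
          unfolding H0[OF that] vector_scaleR_component by (simp only: real_scaleR_def mult.assoc)
        then show ?thesis unfolding p by simp
      qed
      have s3: "sin (3 / 2 * pi) = - 1" "cos (3 / 2 * pi) = 0" using sin_3over2_pi cos_3over2_pi by simp_all
      \<comment> \<open>The exchanged sheet has a single coefficient \<beta>. It is read off on
        either side of the exchange ray, where the sheet is still the old sheet i at s1 and already
        the old sheet k at s2.\<close>
      have "b i $ c = \<beta>" using ab[of s1] val[OF ik(1), of s1] lt unfolding Ia s3 by simp
      moreover have "b k $ c = \<beta>" using ab[of s2] val[OF ik(2), of s2] lt by (simp add: Ia)
      ultimately show ?thesis using c by simp
    qed simp
  qed
qed

end
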